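(* Let $N\ge 2$, $0<\alpha<1$, $\mu_1,\mu_2>0$, $\beta>0$, $r_1,r_2>1$, $2<p_1,p_2<2+\frac{4\alpha}{N}$ and $r_1+r_2<2+\frac{4\alpha}{N}$. For any $\tau\in\mathbb R^+\times\mathbb R^+$ the set $V(\tau)$ of minimizers of $E$ over $\mathcal S_\tau$ is stable, i.e., for every $\varepsilon>0$ there exists $\delta>0$ such that if $\Psi_0=(\Psi_{1,0},\Psi_{2,0})\in H^\alpha(\mathbb R^N)\times H^\alpha(\mathbb R^N)$ satisfies $$\inf_{\mathbf u\in V(\tau)}\|\Psi_0-\mathbf u\|_\alpha<\delta,$$ then any solution $\Psi(t)=(\Psi_1(t),\Psi_2(t))$ (in the sense specified in the context) of the system $$i\partial_t\Psi_j+(-\Delta)^\alpha\Psi_j=\mu_j|\Psi_j|^{p_j-2}\Psi_j+\partial_jF(\Psi_1,\Psi_2),\quad j=1,2,\ x\in\mathbb R^N,\ t>0,$$ emanating from $\Psi_0$ satisfies $$\sup_{t\ge0}\ \inf_{\mathbf u\in V(\tau)}\|\Psi(t)-\mathbf u\|_\alpha<\varepsilon.$$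
   Context: Here $\mathbb R^+=(0,\infty)$ and all functions are complex-valued. The fractional Laplacian is defined by the Fourier transform: $\widehat{(-\Delta)^\alpha u}(\xi)=|\xi|^{2\alpha}\widehat u(\xi)$; similarly $(-\Delta)^{\alpha/2}$ has symbol $|\xi|^\alpha$. $H^\alpha(\mathbb R^N)$ is the space of $u\in L^2(\mathbb R^N)$ with $\|u\|_{H^\alpha(\mathbb R^N)}=\|(1+|\xi|^2)^{\alpha/2}\widehat u\|_{L^2(\mathbb R^N)}<\infty$, and $\|\cdot\|_\alpha$ is the product norm on $H^\alpha(\mathbb R^N)\times H^\alpha(\mathbb R^N)$, e.g. $\|(u_1,u_2)\|_\alpha=(\|u_1\|_{H^\alpha}^2+\|u_2\|_{H^\alpha}^2)^{1/2}$. $F(s,t)=\beta|s|^{r_1}|t|^{r_2}$ for $s,t\in\mathbb C$, with $\partial_1F(s,t)=\beta r_1|s|^{r_1-2}s|t|^{r_2}$ and $\partial_2F(s,t)=\beta r_2|s|^{r_1}|t|^{r_2-2}t$ (with $|z|^{r-2}z:=0$ at $z=0$). The energy is $$E(u_1,u_2)=\frac12\int_{\mathbb R^N}\left(|(-\Delta)^{\alpha/2}u_1|^2+|(-\Delta)^{\alpha/2}u_2|^2\right)dx-\int_{\mathbb R^N}\left(\frac{\mu_1}{p_1}|u_1|^{p_1}+\frac{\mu_2}{p_2}|u_2|^{p_2}+F(u_1,u_2)\right)dx.$$ For $r>0$, $S_r=\{u\in H^\alpha(\mathbb R^N):\|u\|_{L^2(\mathbb R^N)}=\sqrt r\}$;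 for $\tau=(\tau_1,\tau_2)$, $\mathcal S_\tau=S_{\tau_1}\times S_{\tau_2}$, $E_\tau=\inf\{E(u_1,u_2):(u_1,u_2)\in\mathcal S_\tau\}$, and $V(\tau)=\{(u_1,u_2)\in\mathcal S_\tau:E(u_1,u_2)=E_\tau\}$. Solutions: the theorem concerns solutions that exist for all $t\ge 0$ (no global well-posedness is claimed), i.e. $\Psi\in C([0,\infty);H^\alpha(\mathbb R^N)\times H^\alpha(\mathbb R^N))$ with $\Psi(0)=\Psi_0$, satisfying the system in the distributional sense, and for which the energy and the masses are conserved: $E(\Psi(t))=E(\Psi_0)$ and $\|\Psi_j(t)\|_{L^2(\mathbb R^N)}=\|\Psi_{j,0}\|_{L^2(\mathbb R^N)}$ for all $t\ge0$, $j=1,2$. *)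

theory Defs
  imports "HOL-Analysis.Analysis"
begin

section \<open>Square-integrable functions and the Fourier transform\<close>

text \<open>
  Elements of \<open>L\<^sup>2\<close> are represented by Borel functions; two functions that agree almost
  everywhere represent the same element.
\<close>

definition L2 :: "('a::euclidean_space \<Rightarrow> complex) set" where
  "L2 = {f. f \<in> borel_measurable lborel \<and> integrable lborel (\<lambda>x. (norm (f x))\<^sup>2)}"

definition L2_norm :: "('a::euclidean_space \<Rightarrow> complex) \<Rightarrow> real" where
  "L2_norm f = sqrt (LINT x|lborel. (norm (f x))\<^sup>2)"

text \<open>
  Unitary normalisation with kernel \<open>exp (- i x \<xi>)\<close>, so that \<open>-\<Delta>\<close> has symbol \<open>|\<xi>|\<^sup>2\<close>.
\<close>

definition fourier_integral :: "('a::euclidean_space \<Rightarrow> complex) \<Rightarrow> 'a \<Rightarrow> complex" where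
  "fourier_integral f \<xi> =
     ((2 * pi) powr (- real DIM('a) / 2)) *\<^sub>R (LINT x|lborel. cis (- (x \<bullet> \<xi>)) * f x)"

definition inverse_fourier_integral :: "('a::euclidean_space \<Rightarrow> complex) \<Rightarrow> 'a \<Rightarrow> complex" where
  "inverse_fourier_integral f x =
     ((2 * pi) powr (- real DIM('a) / 2)) *\<^sub>R (LINT \<xi>|lborel. cis (x \<bullet> \<xi>) * f \<xi>)"

text \<open>
  The Fourier transform of \<open>f \<in> L\<^sup>2\<close> is the \<open>L\<^sup>2\<close>-limit, as \<open>R \<rightarrow> \<infinity>\<close>, of the Fourier integrals
  of \<open>f\<close> restricted to the ball of radius \<open>R\<close>. The convergence is stated with the nonnegative
  integral, so that it cannot hold merely because a Bochner integral is undefined.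
\<close>

definition is_fourier_transform ::
    "('a::euclidean_space \<Rightarrow> complex) \<Rightarrow> ('a \<Rightarrow> complex) \<Rightarrow> bool" where
  "is_fourier_transform f g \<longleftrightarrow> g \<in> L2 \<and>
     ((\<lambda>R. \<integral>\<^sup>+ \<xi>. ennreal ((norm (fourier_integral
              (\<lambda>x. indicator (cball 0 R) x *\<^sub>R f x) \<xi> - g \<xi>))\<^sup>2) \<partial>lborel) \<longlongrightarrow> 0) at_top"

text \<open>For \<open>f \<in> L\<^sup>2\<close> the choice is unique up to null sets.\<close>

definition fourier :: "('a::euclidean_space \<Rightarrow> complex) \<Rightarrow> 'a \<Rightarrow> complex" where
  "fourier f = (SOME g. is_fourier_transform f g)"


section \<open>Fractional Sobolev spaces and the fractional Laplacian\<close>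

definition bessel_weighted ::
    "real \<Rightarrow> ('a::euclidean_space \<Rightarrow> complex) \<Rightarrow> 'a \<Rightarrow> complex" where
  "bessel_weighted \<alpha> u \<xi> = ((1 + (norm \<xi>)\<^sup>2) powr (\<alpha> / 2)) *\<^sub>R fourier u \<xi>"

definition H_space :: "real \<Rightarrow> ('a::euclidean_space \<Rightarrow> complex) set" where
  "H_space \<alpha> = {u \<in> L2. bessel_weighted \<alpha> u \<in> L2}"

definition H_norm :: "real \<Rightarrow> ('a::euclidean_space \<Rightarrow> complex) \<Rightarrow> real" where
  "H_norm \<alpha> u = L2_norm (bessel_weighted \<alpha> u)"

type_synonym 'a fpair = "('a \<Rightarrow> complex) \<times> ('a \<Rightarrow> complex)"

definition HH_space :: "real \<Rightarrow> ('a::euclidean_space) fpair set" where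
  "HH_space \<alpha> = H_space \<alpha> \<times> H_space \<alpha>"

definition HH_norm :: "real \<Rightarrow> ('a::euclidean_space) fpair \<Rightarrow> real" where
  "HH_norm \<alpha> u = sqrt ((H_norm \<alpha> (fst u))\<^sup>2 + (H_norm \<alpha> (snd u))\<^sup>2)"

definition HH_dist ::
    "real \<Rightarrow> ('a::euclidean_space) fpair \<Rightarrow> 'a fpair \<Rightarrow> real" where
  "HH_dist \<alpha> u v = HH_norm \<alpha> (\<lambda>x. fst u x - fst v x, \<lambda>x. snd u x - snd v x)"

text \<open>
  \<open>(-\<Delta>)\<^sup>s u\<close> as an \<open>L\<^sup>2\<close> function, for those \<open>u \<in> L\<^sup>2\<close> for which \<open>|\<xi>|\<^sup>2\<^sup>s\<close> times the Fourier transform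
  of \<open>u\<close> is in \<open>L\<^sup>2\<close>.
\<close>

definition frac_laplacian ::
    "real \<Rightarrow> ('a::euclidean_space \<Rightarrow> complex) \<Rightarrow> 'a \<Rightarrow> complex" where
  "frac_laplacian s u = (SOME w. w \<in> L2 \<and>
     (AE \<xi> in lborel. fourier w \<xi> = (norm \<xi> powr (2 * s)) *\<^sub>R fourier u \<xi>))"

text \<open>
  \<open>(-\<Delta>)\<^sup>s u\<close> as a (tempered) distribution applied to a test function \<open>\<phi>\<close>: it is the distribution
  whose Fourier transform is the function \<open>g \<xi> = |\<xi>|\<^sup>2\<^sup>s (fourier u \<xi>)\<close>, and the inverse Fourier
  transform of \<open>g\<close> maps \<open>\<phi>\<close> to the integral of \<open>g\<close> times the inverse Fourier transform of \<open>\<phi>\<close>.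
  This is needed because for \<open>u\<close> in \<open>H_space \<alpha>\<close> the distribution \<open>(-\<Delta>)\<^sup>\<alpha> u\<close> is in general
  not a function.
\<close>

definition frac_laplacian_distr ::
    "real \<Rightarrow> ('a::euclidean_space \<Rightarrow> complex) \<Rightarrow> ('a \<Rightarrow> complex) \<Rightarrow> complex" where
  "frac_laplacian_distr s u \<phi> =
     (LINT \<xi>|lborel. ((norm \<xi> powr (2 * s)) *\<^sub>R fourier u \<xi>) * inverse_fourier_integral \<phi> \<xi>)"


section \<open>Energy and constrained minimizers\<close>

text \<open>\<open>|z|\<^sup>r\<^sup>-\<^sup>2 z\<close>; it is \<open>0\<close> at \<open>z = 0\<close> for every \<open>r\<close>.\<close>

definition pow_nl :: "real \<Rightarrow> complex \<Rightarrow> complex" where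
  "pow_nl r z = (norm z powr (r - 2)) *\<^sub>R z"

definition F :: "real \<Rightarrow> real \<Rightarrow> real \<Rightarrow> complex \<Rightarrow> complex \<Rightarrow> real" where
  "F \<beta> r\<^sub>1 r\<^sub>2 s t = \<beta> * norm s powr r\<^sub>1 * norm t powr r\<^sub>2"

definition d1F :: "real \<Rightarrow> real \<Rightarrow> real \<Rightarrow> complex \<Rightarrow> complex \<Rightarrow> complex" where
  "d1F \<beta> r\<^sub>1 r\<^sub>2 s t = (\<beta> * r\<^sub>1 * norm t powr r\<^sub>2) *\<^sub>R pow_nl r\<^sub>1 s"

definition d2F :: "real \<Rightarrow> real \<Rightarrow> real \<Rightarrow> complex \<Rightarrow> complex \<Rightarrow> complex" where
  "d2F \<beta> r\<^sub>1 r\<^sub>2 s t = (\<beta> * r\<^sub>2 * norm s powr r\<^sub>1) *\<^sub>R pow_nl r\<^sub>2 t"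

definition energy ::
    "real \<Rightarrow> real \<Rightarrow> real \<Rightarrow> real \<Rightarrow> real \<Rightarrow> real \<Rightarrow> real \<Rightarrow> real \<Rightarrow> ('a::euclidean_space) fpair \<Rightarrow> real"
  where
  "energy \<alpha> \<mu>\<^sub>1 \<mu>\<^sub>2 p\<^sub>1 p\<^sub>2 \<beta> r\<^sub>1 r\<^sub>2 u =
     1 / 2 * (LINT x|lborel. (norm (frac_laplacian (\<alpha> / 2) (fst u) x))\<^sup>2
                           + (norm (frac_laplacian (\<alpha> / 2) (snd u) x))\<^sup>2)
     - (LINT x|lborel. \<mu>\<^sub>1 / p\<^sub>1 * norm (fst u x) powr p\<^sub>1
                     + \<mu>\<^sub>2 / p\<^sub>2 * norm (snd u x) powr p\<^sub>2
                     + F \<beta> r\<^sub>1 r\<^sub>2 (fst u x) (snd u x))"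

definition mass_sphere :: "real \<Rightarrow> real \<Rightarrow> ('a::euclidean_space \<Rightarrow> complex) set" where
  "mass_sphere \<alpha> r = {u \<in> H_space \<alpha>. L2_norm u = sqrt r}"

definition mass_set :: "real \<Rightarrow> real \<times> real \<Rightarrow> ('a::euclidean_space) fpair set" where
  "mass_set \<alpha> \<tau> = mass_sphere \<alpha> (fst \<tau>) \<times> mass_sphere \<alpha> (snd \<tau>)"

text \<open>
  The infimum is taken in the extended reals, so no boundedness from below is presupposed. The type
  argument fixes the underlying space.
\<close>

definition min_energy ::
    "'a::euclidean_space itself \<Rightarrow>
     real \<Rightarrow> real \<Rightarrow> real \<Rightarrow> real \<Rightarrow> real \<Rightarrow> real \<Rightarrow> real \<Rightarrow> real \<Rightarrow> real \<times> real \<Rightarrow> ereal" where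
  "min_energy _ \<alpha> \<mu>\<^sub>1 \<mu>\<^sub>2 p\<^sub>1 p\<^sub>2 \<beta> r\<^sub>1 r\<^sub>2 \<tau> =
     (INF u\<in>(mass_set \<alpha> \<tau> :: 'a fpair set). ereal (energy \<alpha> \<mu>\<^sub>1 \<mu>\<^sub>2 p\<^sub>1 p\<^sub>2 \<beta> r\<^sub>1 r\<^sub>2 u))"

definition minimizers ::
    "real \<Rightarrow> real \<Rightarrow> real \<Rightarrow> real \<Rightarrow> real \<Rightarrow> real \<Rightarrow> real \<Rightarrow> real \<Rightarrow> real \<times> real \<Rightarrow>
     ('a::euclidean_space) fpair set" where
  "minimizers \<alpha> \<mu>\<^sub>1 \<mu>\<^sub>2 p\<^sub>1 p\<^sub>2 \<beta> r\<^sub>1 r\<^sub>2 \<tau> =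
     {u \<in> mass_set \<alpha> \<tau>. ereal (energy \<alpha> \<mu>\<^sub>1 \<mu>\<^sub>2 p\<^sub>1 p\<^sub>2 \<beta> r\<^sub>1 r\<^sub>2 u)
        = min_energy TYPE('a) \<alpha> \<mu>\<^sub>1 \<mu>\<^sub>2 p\<^sub>1 p\<^sub>2 \<beta> r\<^sub>1 r\<^sub>2 \<tau>}"

text \<open>Extended-valued, so that the distance to the empty set is \<open>\<infinity>\<close>.\<close>

definition HH_infdist ::
    "real \<Rightarrow> ('a::euclidean_space) fpair \<Rightarrow> 'a fpair set \<Rightarrow> ennreal" where
  "HH_infdist \<alpha> u V = (INF v\<in>V. ennreal (HH_dist \<alpha> u v))"


section \<open>Distributional solutions\<close>

primrec C_k :: "nat \<Rightarrow> ('a::euclidean_space \<Rightarrow> complex) \<Rightarrow> bool" where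
  "C_k 0 f \<longleftrightarrow> continuous_on UNIV f"
| "C_k (Suc k) f \<longleftrightarrow>
     (\<forall>x. f differentiable (at x)) \<and> (\<forall>v. C_k k (\<lambda>x. frechet_derivative f (at x) v))"

text \<open>Space-time test functions: smooth with compact support in \<open>(0,\<infinity>) \<times> \<real>\<^sup>N\<close>.\<close>

definition test_function :: "(real \<times> 'a::euclidean_space \<Rightarrow> complex) \<Rightarrow> bool" where
  "test_function \<phi> \<longleftrightarrow> (\<forall>k. C_k k \<phi>) \<and> compact (closure {z. \<phi> z \<noteq> 0}) \<and>
     closure {z. \<phi> z \<noteq> 0} \<subseteq> {0<..} \<times> UNIV"

text \<open>
  \<open>i \<partial>\<^sub>t \<psi> + (-\<Delta>)\<^sup>\<alpha> \<psi> = g\<close> in the sense of distributions on \<open>(0,\<infinity>) \<times> \<real>\<^sup>N\<close>. Since \<open>\<psi> t\<close> is a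
  representative chosen separately for each time, the space-time pairings are iterated integrals.
\<close>

definition schrodinger_distr ::
    "real \<Rightarrow> (real \<Rightarrow> 'a::euclidean_space \<Rightarrow> complex) \<Rightarrow> (real \<Rightarrow> 'a \<Rightarrow> complex) \<Rightarrow> bool" where
  "schrodinger_distr \<alpha> \<psi> g \<longleftrightarrow> (\<forall>\<phi>. test_function \<phi> \<longrightarrow>
     (LINT t:{0<..}|lborel.
         - \<i> * (LINT x|lborel. \<psi> t x * vector_derivative (\<lambda>s. \<phi> (s, x)) (at t))
         + frac_laplacian_distr \<alpha> (\<psi> t) (\<lambda>x. \<phi> (t, x)))
     = (LINT t:{0<..}|lborel. (LINT x|lborel. g t x * \<phi> (t, x))))"

text \<open>
  Global solutions with initial datum \<open>\<Psi>0\<close>, along which energy and masses are conserved. The values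
  of \<open>\<Psi>\<close> at negative times are irrelevant.
\<close>

definition solution ::
    "real \<Rightarrow> real \<Rightarrow> real \<Rightarrow> real \<Rightarrow> real \<Rightarrow> real \<Rightarrow> real \<Rightarrow> real \<Rightarrow>
     ('a::euclidean_space) fpair \<Rightarrow> (real \<Rightarrow> 'a fpair) \<Rightarrow> bool" where
  "solution \<alpha> \<mu>\<^sub>1 \<mu>\<^sub>2 p\<^sub>1 p\<^sub>2 \<beta> r\<^sub>1 r\<^sub>2 \<Psi>0 \<Psi> \<longleftrightarrow>
     (\<forall>t\<ge>0. \<Psi> t \<in> HH_space \<alpha>) \<and>
     (\<forall>t\<ge>0. ((\<lambda>s. HH_dist \<alpha> (\<Psi> s) (\<Psi> t)) \<longlongrightarrow> 0) (at t within {0..})) \<and>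
     (AE x in lborel. fst (\<Psi> 0) x = fst \<Psi>0 x \<and> snd (\<Psi> 0) x = snd \<Psi>0 x) \<and>
     schrodinger_distr \<alpha> (\<lambda>t. fst (\<Psi> t))
       (\<lambda>t x. \<mu>\<^sub>1 *\<^sub>R pow_nl p\<^sub>1 (fst (\<Psi> t) x) + d1F \<beta> r\<^sub>1 r\<^sub>2 (fst (\<Psi> t) x) (snd (\<Psi> t) x)) \<and>
     schrodinger_distr \<alpha> (\<lambda>t. snd (\<Psi> t))
       (\<lambda>t x. \<mu>\<^sub>2 *\<^sub>R pow_nl p\<^sub>2 (snd (\<Psi> t) x) + d2F \<beta> r\<^sub>1 r\<^sub>2 (fst (\<Psi> t) x) (snd (\<Psi> t) x)) \<and>
     (\<forall>t\<ge>0. energy \<alpha> \<mu>\<^sub>1 \<mu>\<^sub>2 p\<^sub>1 p\<^sub>2 \<beta> r\<^sub>1 r\<^sub>2 (\<Psi> t) = energy \<alpha> \<mu>\<^sub>1 \<mu>\<^sub>2 p\<^sub>1 p\<^sub>2 \<beta> r\<^sub>1 r\<^sub>2 \<Psi>0) \<and>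
     (\<forall>t\<ge>0. L2_norm (fst (\<Psi> t)) = L2_norm (fst \<Psi>0) \<and> L2_norm (snd (\<Psi> t)) = L2_norm (snd \<Psi>0))"

end

theory Submission
  imports Defs "HOL-Probability.Probability" "HOL-Complex_Analysis.Great_Picard"
begin

text \<open>
  Orbital stability follows from the compactness of minimizing sequences up to translation
  (\<open>minimizing_sequences_compact\<close>). If stability failed, there would be data approaching the set of ground states
  whose solutions leave it at some times; the energies and masses at these times are those of the
  data, so the solutions at these times form a minimizing sequence, which must
  approach the set of ground states along a subsequence.

  Compactness rests on three facts about the energy. It is bounded from below and coercive on bounded masses
  (\<open>energy_coercive\<close>), because the powers are mass-subcritical. Any prescribed masses can be realised with negative energy
  (\<open>negative_energy\<close>), by spreading a function out. Finally, two pairs \<open>U\<close> and \<open>V\<close> can be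
  superposed (\<open>oplus\<close>) to the pair with components \<open>(|U\<^sub>j|\<^sup>2 + |V\<^sub>j|\<^sup>2)\<^sup>1\<^sup>/\<^sup>2\<close>. The masses add, and the
  energy is at most the sum of the energies, strictly less if \<open>U\<close> and \<open>V\<close> overlap (\<open>energy_oplus\<close>);
  overlap can be arranged by a translation. A minimizing sequence cannot vanish because the
  infimum is negative, so after translations it has a nonzero local limit that splits off
  (\<open>extraction\<close>). If the limit does not carry all the mass, then the rest either loses its
  potential energy, and it is better to replace it by a function of negative energy, or it has a nonzero
  limit of its own, and it is better to superpose this limit on the first. Both contradict minimality.

  Everything is expressed through the Gagliardo seminorm, the integral of squared
  increments \<open>|u (x + h) - u x|\<^sup>2\<close> against a multiple of \<open>|h|\<^sup>-\<^sup>(\<^sup>N\<^sup>+\<^sup>2\<^sup>\<alpha>\<^sup>)\<close>. Its identification with the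
  Fourier definition (\<open>gagliardo_fourier\<close>) comes from one identity for the heat semigroup
  (\<open>heat_identity\<close>), which also yields Plancherel's theorem, by integration in time against
  \<open>t\<^sup>-\<^sup>1\<^sup>-\<^sup>\<alpha>\<close>. In this form, the squared seminorm is subadditive under superposition by the reverse
  triangle inequality, the Brezis--Lieb lemma applies to it directly, and elementary averaging over balls gives
  local compactness as well as one dyadic level set estimate (\<open>concentration_estimate\<close>)
  that contains both the Gagliardo--Nirenberg inequality and Lions' vanishing lemma.
\<close>

section \<open>Square-integrable functions over an arbitrary measure\<close>

text \<open>The measure is arbitrary because the same facts are needed for Lebesgue measure, for a Gaussian
  weight, for weights in frequency space and for a measure on pairs of points. With extended values
  membership in \<open>L\<^sup>2\<close> is a finiteness statement.\<close>

definition sqn :: "'x measure \<Rightarrow> ('x \<Rightarrow> 'v::real_normed_vector) \<Rightarrow> ennreal" where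
  "sqn M f = (\<integral>\<^sup>+x. ennreal ((norm (f x))\<^sup>2) \<partial>M)"

lemma norm_sq_split:
  fixes a b :: "'v::real_normed_vector"
  assumes "0 < s"
  shows "(norm (a + b))\<^sup>2 \<le> (1 + s) * (norm a)\<^sup>2 + (1 + 1 / s) * (norm b)\<^sup>2"
proof -
  have "(norm (a + b))\<^sup>2 \<le> (norm a + norm b)\<^sup>2"
    by (simp add: norm_triangle_ineq power_mono)
  also have "\<dots> = (norm a)\<^sup>2 + (norm b)\<^sup>2 + 2 * norm a * norm b"
    by (simp add: power2_sum)
  also have "2 * norm a * norm b \<le> s * (norm a)\<^sup>2 + (1 / s) * (norm b)\<^sup>2"
  proof -
    have "0 \<le> (s * norm a - norm b)\<^sup>2 / s" using assms by simp
    also have "\<dots> = s * (norm a)\<^sup>2 + (1 / s) * (norm b)\<^sup>2 - 2 * norm a * norm b"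
      using assms by (simp add: power2_eq_square field_simps)
    finally show ?thesis by simp
  qed
  finally show ?thesis by (simp add: algebra_simps)
qed

lemma sqn_add_le_weighted:
  fixes f g :: "'x \<Rightarrow> 'v::{real_normed_vector,second_countable_topology}"
  assumes [measurable]: "f \<in> borel_measurable M" "g \<in> borel_measurable M" and "0 < s"
  shows "sqn M (\<lambda>x. f x + g x) \<le> ennreal (1 + s) * sqn M f + ennreal (1 + 1 / s) * sqn M g"
proof -
  have "sqn M (\<lambda>x. f x + g x) \<le>
      (\<integral>\<^sup>+x. ennreal (1 + s) * ennreal ((norm (f x))\<^sup>2) + ennreal (1 + 1 / s) * ennreal ((norm (g x))\<^sup>2) \<partial>M)"
    unfolding sqn_def using \<open>0 < s\<close> norm_sq_split[OF \<open>0 < s\<close>]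
    by (intro nn_integral_mono) (simp flip: ennreal_mult ennreal_plus)
  also have "\<dots> = ennreal (1 + s) * sqn M f + ennreal (1 + 1 / s) * sqn M g"
    unfolding sqn_def by (simp add: nn_integral_add nn_integral_cmult)
  finally show ?thesis .
qed

lemma sqn_add_le:
  fixes f g :: "'x \<Rightarrow> 'v::{real_normed_vector,second_countable_topology}"
  assumes "f \<in> borel_measurable M" "g \<in> borel_measurable M"
  shows "sqn M (\<lambda>x. f x + g x) \<le> 2 * sqn M f + 2 * sqn M g"
  using sqn_add_le_weighted[OF assms, of 1] by simp

lemma sqn_minus: "sqn M (\<lambda>x. - f x) = sqn M f"
  by (simp add: sqn_def)

lemma sqn_diff_commute: "sqn M (\<lambda>x. f x - g x) = sqn M (\<lambda>x. g x - f x)"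
  by (simp add: sqn_def norm_minus_commute)

lemma sqn_diff_le:
  fixes f g :: "'x \<Rightarrow> 'v::{real_normed_vector,second_countable_topology}"
  assumes "f \<in> borel_measurable M" "g \<in> borel_measurable M"
  shows "sqn M (\<lambda>x. f x - g x) \<le> 2 * sqn M f + 2 * sqn M g"
  using sqn_add_le[OF assms(1), of "\<lambda>x. - g x"] assms by (simp add: sqn_minus)

lemma sqn_scaleR: "f \<in> borel_measurable M \<Longrightarrow> sqn M (\<lambda>x. c *\<^sub>R f x) = ennreal (c\<^sup>2) * sqn M f"
  for f :: "'x \<Rightarrow> 'v::{real_normed_vector,second_countable_topology}"
  unfolding sqn_def by (subst nn_integral_cmult[symmetric])
    (auto simp: power_mult_distrib ennreal_mult intro!: nn_integral_cong)

lemma sqn_cong_AE: "AE x in M. f x = g x \<Longrightarrow> sqn M f = sqn M g"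
  unfolding sqn_def by (rule nn_integral_cong_AE) (auto elim: eventually_mono)

lemma sqn_eq_0_iff:
  fixes f :: "'x \<Rightarrow> 'v::{real_normed_vector,second_countable_topology}"
  assumes [measurable]: "f \<in> borel_measurable M"
  shows "sqn M f = 0 \<longleftrightarrow> (AE x in M. f x = 0)"
  unfolding sqn_def by (subst nn_integral_0_iff_AE) auto

text \<open>Weighted Cauchy--Schwarz with the optimal weight \<open>B / A\<close> gives Minkowski's inequality
  without a duality argument.\<close>

lemma sqn_minkowski:
  fixes f g :: "'x \<Rightarrow> 'v::{real_normed_vector,second_countable_topology}"
  assumes [measurable]: "f \<in> borel_measurable M" "g \<in> borel_measurable M"
    and fA: "sqn M f \<le> ennreal (A\<^sup>2)" and gB: "sqn M g \<le> ennreal (B\<^sup>2)" and "0 \<le> A" "0 \<le> B"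
  shows "sqn M (\<lambda>x. f x + g x) \<le> ennreal ((A + B)\<^sup>2)"
proof (cases "A = 0 \<or> B = 0")
  case True
  then show ?thesis
  proof
    assume "A = 0"
    then have "AE x in M. f x = 0" using fA sqn_eq_0_iff[of f M] by auto
    then have "AE x in M. f x + g x = g x" by (auto elim: eventually_mono)
    then show ?thesis using sqn_cong_AE[where f="\<lambda>x. f x + g x" and g=g] gB \<open>A = 0\<close> by simp
  next
    assume "B = 0"
    then have "AE x in M. g x = 0" using gB sqn_eq_0_iff[of g M] by auto
    then have "AE x in M. f x + g x = f x" by (auto elim: eventually_mono)
    then show ?thesis using sqn_cong_AE[where f="\<lambda>x. f x + g x" and g=f] fA \<open>B = 0\<close> by simp
  qed
next
  case False
  then have AB: "0 < A" "0 < B" using assms by auto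
  have "sqn M (\<lambda>x. f x + g x) \<le> ennreal (1 + B / A) * sqn M f + ennreal (1 + 1 / (B / A)) * sqn M g"
    using AB by (intro sqn_add_le_weighted) auto
  also have "\<dots> \<le> ennreal (1 + B / A) * ennreal (A\<^sup>2) + ennreal (1 + 1 / (B / A)) * ennreal (B\<^sup>2)"
    by (intro add_mono mult_left_mono fA gB) auto
  also have "\<dots> = ennreal ((1 + B / A) * A\<^sup>2 + (1 + 1 / (B / A)) * B\<^sup>2)"
    using AB by (simp add: ennreal_mult ennreal_plus)
  also have "(1 + B / A) * A\<^sup>2 + (1 + 1 / (B / A)) * B\<^sup>2 = (A + B)\<^sup>2"
    using AB by (simp add: power2_eq_square field_simps)
  finally show ?thesis .
qed

lemma sqn_diff_norms:
  fixes f g :: "'x \<Rightarrow> 'v::{real_normed_vector,second_countable_topology}"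
  assumes [measurable]: "f \<in> borel_measurable M" "g \<in> borel_measurable M"
    and f: "sqn M f < \<infinity>" and g: "sqn M g < \<infinity>"
  shows "\<bar>sqrt (enn2real (sqn M f)) - sqrt (enn2real (sqn M g))\<bar>
    \<le> sqrt (enn2real (sqn M (\<lambda>x. f x - g x)))"
proof -
  have d: "sqn M (\<lambda>x. f x - g x) < \<infinity>"
    using sqn_diff_le[of f M g] f g
    by (auto intro: le_less_trans simp: ennreal_mult_less_top ennreal_add_less_top)
  have *: "sqrt (enn2real (sqn M a)) \<le> sqrt (enn2real (sqn M (\<lambda>x. a x - b x))) + sqrt (enn2real (sqn M b))"
    if [measurable]: "a \<in> borel_measurable M" "b \<in> borel_measurable M" and "sqn M b < \<infinity>"
      "sqn M (\<lambda>x. a x - b x) < \<infinity>" for a b :: "'x \<Rightarrow> 'v"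
  proof -
    have "sqn M (\<lambda>x. (a x - b x) + b x) \<le>
      ennreal ((sqrt (enn2real (sqn M (\<lambda>x. a x - b x))) + sqrt (enn2real (sqn M b)))\<^sup>2)"
      using that by (intro sqn_minkowski) (auto simp: ennreal_enn2real_if)
    then have "enn2real (sqn M a) \<le>
        (sqrt (enn2real (sqn M (\<lambda>x. a x - b x))) + sqrt (enn2real (sqn M b)))\<^sup>2"
      by (intro enn2real_leI) auto
    then show ?thesis by (intro real_le_lsqrt) auto
  qed
  show ?thesis
    using *[of f g] *[of g f] f g d by (auto simp: sqn_diff_commute[of M g f])
qed

lemma sqn_tendsto:
  fixes f :: "'i \<Rightarrow> 'x \<Rightarrow> 'v::{real_normed_vector,second_countable_topology}"
  assumes [measurable]: "\<And>i. f i \<in> borel_measurable M" "g \<in> borel_measurable M"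
    and g: "sqn M g < \<infinity>" and lim: "((\<lambda>i. sqn M (\<lambda>x. f i x - g x)) \<longlongrightarrow> 0) \<F>"
  shows "((\<lambda>i. sqn M (f i)) \<longlongrightarrow> sqn M g) \<F>"
proof -
  have ev: "\<forall>\<^sub>F i in \<F>. sqn M (\<lambda>x. f i x - g x) < \<infinity>"
    using lim by (rule order_tendstoD) simp
  have fin: "sqn M (f i) < \<infinity>" if "sqn M (\<lambda>x. f i x - g x) < \<infinity>" for i
    using sqn_add_le[of "\<lambda>x. f i x - g x" M g] that g
    by (auto intro: le_less_trans simp: ennreal_mult_less_top ennreal_add_less_top)
  have "((\<lambda>i. enn2real (sqn M (\<lambda>x. f i x - g x))) \<longlongrightarrow> enn2real 0) \<F>"
    by (rule tendsto_enn2real) (use lim in simp_all)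
  then have lim': "((\<lambda>i. sqrt (enn2real (sqn M (\<lambda>x. f i x - g x)))) \<longlongrightarrow> 0) \<F>"
    using tendsto_real_sqrt by fastforce
  have "((\<lambda>i. sqrt (enn2real (sqn M (f i))) - sqrt (enn2real (sqn M g))) \<longlongrightarrow> 0) \<F>"
  proof (rule Lim_null_comparison[OF _ lim'])
    show "\<forall>\<^sub>F i in \<F>. norm (sqrt (enn2real (sqn M (f i))) - sqrt (enn2real (sqn M g)))
       \<le> sqrt (enn2real (sqn M (\<lambda>x. f i x - g x)))"
      using ev by (rule eventually_mono) (simp only: real_norm_def, intro sqn_diff_norms fin g assms)
  qed
  then have "((\<lambda>i. (sqrt (enn2real (sqn M (f i))))\<^sup>2) \<longlongrightarrow> (sqrt (enn2real (sqn M g)))\<^sup>2) \<F>"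
    by (intro tendsto_power) (simp add: LIM_zero_iff)
  then have "((\<lambda>i. ennreal (enn2real (sqn M (f i)))) \<longlongrightarrow> ennreal (enn2real (sqn M g))) \<F>"
    by simp
  moreover have "\<forall>\<^sub>F i in \<F>. ennreal (enn2real (sqn M (f i))) = sqn M (f i)"
    using ev by (rule eventually_mono) (use fin in \<open>auto simp: ennreal_enn2real_if less_top\<close>)
  ultimately have "((\<lambda>i. sqn M (f i)) \<longlongrightarrow> ennreal (enn2real (sqn M g))) \<F>"
    by (rule Lim_transform_eventually)
  moreover have "sqn M g \<noteq> \<top>" using g by auto
  ultimately show ?thesis by (simp add: ennreal_enn2real_if)
qed

text \<open>Riesz--Fischer. Along a subsequence whose increments \<open>d\<^sub>k\<close> have squared norm at most \<open>8\<^sup>-\<^sup>k\<close>, the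
  series \<open>\<Sum> 2\<^sup>k |d\<^sub>k|\<^sup>2\<close> has finite integral, so the increments decay geometrically almost
  everywhere; the pointwise limit is the \<open>L\<^sup>2\<close> limit by Fatou's lemma.\<close>

lemma sqn_complete:
  fixes f :: "nat \<Rightarrow> 'x \<Rightarrow> 'v::euclidean_space"
  assumes [measurable]: "\<And>n. f n \<in> borel_measurable M"
    and cauchy: "\<And>e::real. 0 < e \<Longrightarrow> \<exists>N. \<forall>m\<ge>N. \<forall>n\<ge>N. sqn M (\<lambda>x. f m x - f n x) \<le> ennreal e"
  obtains g r where "g \<in> borel_measurable M" "strict_mono (r :: nat \<Rightarrow> nat)"
    "AE x in M. (\<lambda>n. f (r n) x) \<longlonglongrightarrow> g x" "(\<lambda>n. sqn M (\<lambda>x. f n x - g x)) \<longlonglongrightarrow> 0"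
proof -
  have "\<forall>k. \<exists>N. \<forall>m\<ge>N. \<forall>n\<ge>N. sqn M (\<lambda>x. f m x - f n x) \<le> ennreal ((1/8) ^ k)"
    using cauchy by simp
  then obtain N0 where N0: "\<And>k m n. m \<ge> N0 k \<Longrightarrow> n \<ge> N0 k \<Longrightarrow> sqn M (\<lambda>x. f m x - f n x) \<le> ennreal ((1/8) ^ k)"
    by metis
  define r where "r k = (\<Sum>j\<le>k. Suc (N0 j))" for k
  have sm: "strict_mono r" by (rule strict_monoI_Suc) (simp add: r_def)
  have rN: "r k \<ge> N0 k" for k
    by (cases k) (simp_all add: r_def)
  define d where "d k x = f (r (Suc k)) x - f (r k) x" for k x
  have [measurable]: "d k \<in> borel_measurable M" for k unfolding d_def by measurable
  have "sqn M (d k) \<le> ennreal ((1/8) ^ k)" for k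
    unfolding d_def using rN[of k] strict_monoD[OF sm, of k "Suc k"] by (intro N0) auto
  then have le: "(\<integral>\<^sup>+x. ennreal (2 ^ k * (norm (d k x))\<^sup>2) \<partial>M) \<le> ennreal ((1/4)^k)" for k
  proof -
    have "(\<integral>\<^sup>+x. ennreal (2 ^ k * (norm (d k x))\<^sup>2) \<partial>M) = ennreal (2^k) * sqn M (d k)"
      unfolding sqn_def by (subst nn_integral_cmult[symmetric]) (auto simp: ennreal_mult)
    also have "\<dots> \<le> ennreal (2^k) * ennreal ((1/8) ^ k)"
      by (intro mult_left_mono \<open>sqn M (d k) \<le> _\<close>) auto
    also have "\<dots> = ennreal ((1/4)^k)"
      by (simp flip: ennreal_mult power_mult_distrib)
    finally show ?thesis .
  qed
  have "(\<integral>\<^sup>+x. (\<Sum>k. ennreal (2 ^ k * (norm (d k x))\<^sup>2)) \<partial>M) = (\<Sum>k. \<integral>\<^sup>+x. ennreal (2 ^ k * (norm (d k x))\<^sup>2) \<partial>M)"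
    by (intro nn_integral_suminf) auto
  also have "\<dots> \<le> (\<Sum>k. ennreal ((1/4)^k))" by (intro suminf_le le) auto
  also have "\<dots> = ennreal (\<Sum>k. (1/4)^k)" by (intro suminf_ennreal2) (auto intro: summable_geometric)
  also have "\<dots> < \<infinity>" by simp
  finally have "AE x in M. (\<Sum>k. ennreal (2 ^ k * (norm (d k x))\<^sup>2)) \<noteq> \<infinity>"
    by (intro nn_integral_PInf_AE) auto
  then have conv: "AE x in M. convergent (\<lambda>n. f (r n) x)"
  proof eventually_elim
    fix x assume "(\<Sum>k. ennreal (2 ^ k * (norm (d k x))\<^sup>2)) \<noteq> \<infinity>"
    then have "summable (\<lambda>k. 2 ^ k * (norm (d k x))\<^sup>2)"
      by (intro summable_suminf_not_top) auto
    then have "(\<lambda>k. 2 ^ k * (norm (d k x))\<^sup>2) \<longlonglongrightarrow> 0" by (rule summable_LIMSEQ_zero)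
    then have "Bseq (\<lambda>k. 2 ^ k * (norm (d k x))\<^sup>2)" by (rule convergent_imp_Bseq[OF convergentI])
    then obtain C where C: "0 < C" "\<And>k. 2 ^ k * (norm (d k x))\<^sup>2 \<le> C"
      by (auto simp: Bseq_def)
    have "norm (d k x) \<le> sqrt C * (1 / sqrt 2) ^ k" for k
    proof -
      have "(norm (d k x))\<^sup>2 \<le> C / 2 ^ k" using C(2)[of k] by (simp add: field_simps)
      then have "norm (d k x) \<le> sqrt (C / 2 ^ k)" by (intro real_le_rsqrt)
      also have "\<dots> = sqrt C * (1 / sqrt 2) ^ k" by (simp add: real_sqrt_divide real_sqrt_power power_divide)
      finally show ?thesis .
    qed
    then have nle: "\<And>k. norm (d k x) \<le> sqrt C * (1 / sqrt 2) ^ k" .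
    have sm': "summable (\<lambda>k. sqrt C * (1 / sqrt 2) ^ k)"
      by (intro summable_mult summable_geometric) auto
    have "summable (\<lambda>k. d k x)"
      by (rule summable_comparison_test'[OF sm' nle])
    then have "convergent (\<lambda>n. \<Sum>k<n. d k x)" by (simp add: summable_iff_convergent)
    moreover have "(\<Sum>k<n. d k x) = f (r n) x - f (r 0) x" for n
      unfolding d_def by (rule sum_lessThan_telescope)
    ultimately show "convergent (\<lambda>n. f (r n) x)"
      by (simp add: convergent_diff_const_right_iff)
  qed
  define g where "g x = lim (\<lambda>n. f (r n) x)" for x
  have gm[measurable]: "g \<in> borel_measurable M"
    unfolding g_def by measurable
  have AEl: "AE x in M. (\<lambda>n. f (r n) x) \<longlonglongrightarrow> g x"
    using conv by eventually_elim (simp add: g_def convergent_LIMSEQ_iff)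
  have L: "sqn M (\<lambda>x. f n x - g x) \<le> ennreal e"
    if H: "\<And>m. m \<ge> K \<Longrightarrow> sqn M (\<lambda>x. f n x - f m x) \<le> ennreal e" for n K e
  proof -
    have "AE x in M. liminf (\<lambda>k. ennreal ((norm (f n x - f (r k) x))\<^sup>2)) = ennreal ((norm (f n x - g x))\<^sup>2)"
      using AEl by eventually_elim
        (intro lim_imp_Liminf trivial_limit_sequentially tendsto_ennrealI tendsto_power tendsto_norm tendsto_diff tendsto_const)
    then have "sqn M (\<lambda>x. f n x - g x) = (\<integral>\<^sup>+x. liminf (\<lambda>k. ennreal ((norm (f n x - f (r k) x))\<^sup>2)) \<partial>M)"
      unfolding sqn_def by (intro nn_integral_cong_AE) (auto elim: eventually_mono)
    also have "\<dots> \<le> liminf (\<lambda>k. sqn M (\<lambda>x. f n x - f (r k) x))"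
      unfolding sqn_def by (intro nn_integral_liminf) auto
    also have "\<dots> \<le> ennreal e"
    proof (intro Liminf_le)
      show "\<forall>\<^sub>F k in sequentially. sqn M (\<lambda>x. f n x - f (r k) x) \<le> ennreal e"
        using eventually_ge_at_top[of K]
        by eventually_elim (use seq_suble[OF sm] H order_trans in blast)
    qed simp
    finally show ?thesis .
  qed
  have "(\<lambda>n. sqn M (\<lambda>x. f n x - g x)) \<longlonglongrightarrow> 0"
  proof (rule order_tendstoI)
    fix a :: ennreal assume "0 < a"
    then obtain b where b: "0 < b" "b < a" using dense by blast
    then obtain e where "b = ennreal e" "0 \<le> e" by (cases b) auto
    with b have e: "0 < e" "ennreal e < a" by auto
    from cauchy[OF e(1)] obtain K where "\<And>m n. m \<ge> K \<Longrightarrow> n \<ge> K \<Longrightarrow> sqn M (\<lambda>x. f m x - f n x) \<le> ennreal e"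
      by blast
    then show "\<forall>\<^sub>F n in sequentially. sqn M (\<lambda>x. f n x - g x) < a"
      using e by (intro eventually_sequentiallyI[of K]) (blast intro: le_less_trans L)
  qed auto
  with gm sm AEl show ?thesis by (rule that)
qed

section \<open>Translations and dilations\<close>

lemma nn_integral_lborel_affine:
  fixes f :: "'a::euclidean_space \<Rightarrow> ennreal"
  assumes [measurable]: "f \<in> borel_measurable borel" and c: "c \<noteq> 0"
  shows "(\<integral>\<^sup>+x. f x \<partial>lborel) = ennreal (\<bar>c\<bar> ^ DIM('a)) * (\<integral>\<^sup>+x. f (t + c *\<^sub>R x) \<partial>lborel)"
proof -
  have "(\<integral>\<^sup>+x. f x \<partial>lborel) = integral\<^sup>N (density (distr lborel borel (\<lambda>x. t + c *\<^sub>R x)) (\<lambda>_. \<bar>c\<bar> ^ DIM('a))) f"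
    using lborel_affine[OF c, of t] by simp
  also have "\<dots> = (\<integral>\<^sup>+x. ennreal (\<bar>c\<bar> ^ DIM('a)) * f x \<partial>distr lborel borel (\<lambda>x. t + c *\<^sub>R x))"
    by (subst nn_integral_density) auto
  also have "\<dots> = (\<integral>\<^sup>+x. ennreal (\<bar>c\<bar> ^ DIM('a)) * f (t + c *\<^sub>R x) \<partial>lborel)"
    by (rule nn_integral_distr) auto
  also have "\<dots> = ennreal (\<bar>c\<bar> ^ DIM('a)) * (\<integral>\<^sup>+x. f (t + c *\<^sub>R x) \<partial>lborel)"
    by (rule nn_integral_cmult) auto
  finally show ?thesis .
qed

lemma nn_integral_lborel_shift:
  fixes f :: "'a::euclidean_space \<Rightarrow> ennreal"
  assumes "f \<in> borel_measurable borel"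
  shows "(\<integral>\<^sup>+x. f (x + h) \<partial>lborel) = (\<integral>\<^sup>+x. f x \<partial>lborel)"
  using nn_integral_lborel_affine[OF assms, of 1 h] by (simp add: add.commute)

lemma sqn_shift:
  fixes f :: "'a::euclidean_space \<Rightarrow> 'v::{real_normed_vector,second_countable_topology}"
  assumes [measurable]: "f \<in> borel_measurable borel"
  shows "sqn lborel (\<lambda>x. f (x + h)) = sqn lborel f"
  unfolding sqn_def using nn_integral_lborel_shift[of "\<lambda>x. ennreal ((norm (f x))\<^sup>2)" h] by simp

lemma integral_lborel_shift:
  fixes f :: "'a::euclidean_space \<Rightarrow> 'v::{banach,second_countable_topology}"
  assumes [measurable]: "f \<in> borel_measurable borel"
  shows "(LINT x|lborel. f (x + h)) = (LINT x|lborel. f x)"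
    and "integrable lborel (\<lambda>x. f (x + h)) \<longleftrightarrow> integrable lborel f"
proof -
  have "integral\<^sup>L (distr lborel borel ((+) h)) f = (LINT x|lborel. f (h + x))"
    by (rule integral_distr) measurable
  then show "(LINT x|lborel. f (x + h)) = (LINT x|lborel. f x)"
    unfolding lborel_distr_plus by (simp add: add.commute)
  have "integrable (distr lborel borel ((+) h)) f \<longleftrightarrow> integrable lborel (\<lambda>x. f (h + x))"
    by (rule integrable_distr_eq) measurable
  then show "integrable lborel (\<lambda>x. f (x + h)) \<longleftrightarrow> integrable lborel f"
    unfolding lborel_distr_plus by (simp add: add.commute)
qed

definition shift_dist :: "('a::euclidean_space \<Rightarrow> 'v::real_normed_vector) \<Rightarrow> 'a \<Rightarrow> ennreal" where
  "shift_dist f h = sqn lborel (\<lambda>x. f (x + h) - f x)"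

lemma measurable_shift_dist [measurable]:
  fixes f :: "'a::euclidean_space \<Rightarrow> 'v::{real_normed_vector,second_countable_topology}"
  assumes [measurable]: "f \<in> borel_measurable borel"
  shows "shift_dist f \<in> borel_measurable borel"
  unfolding shift_dist_def sqn_def by measurable

lemma shift_dist_le:
  fixes f :: "'a::euclidean_space \<Rightarrow> 'v::{real_normed_vector,second_countable_topology}"
  assumes [measurable]: "f \<in> borel_measurable borel"
  shows "shift_dist f h \<le> 4 * sqn lborel f"
proof -
  have "shift_dist f h \<le> 2 * sqn lborel (\<lambda>x. f (x + h)) + 2 * sqn lborel f"
    unfolding shift_dist_def by (rule sqn_diff_le) auto
  also have "\<dots> = (2 + 2) * sqn lborel f"
    unfolding sqn_shift[OF assms] by (simp only: distrib_right)
  finally show ?thesis by simp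
qed

lemma shift_dist_add_le:
  fixes f g :: "'a::euclidean_space \<Rightarrow> 'v::{real_normed_vector,second_countable_topology}"
  assumes [measurable]: "f \<in> borel_measurable borel" "g \<in> borel_measurable borel"
  shows "shift_dist (\<lambda>x. f x + g x) h \<le> 2 * shift_dist f h + 2 * shift_dist g h"
proof -
  have "(\<lambda>x. (f (x + h) + g (x + h)) - (f x + g x)) = (\<lambda>x. (f (x + h) - f x) + (g (x + h) - g x))"
    by (auto simp: algebra_simps)
  then show ?thesis
    unfolding shift_dist_def using sqn_add_le[of "\<lambda>x. f (x + h) - f x" lborel "\<lambda>x. g (x + h) - g x"] by simp
qed

section \<open>Continuity of translations in the mean\<close>

definition shift_continuous :: "('a::euclidean_space \<Rightarrow> 'v::real_normed_vector) \<Rightarrow> bool" where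
  "shift_continuous f \<longleftrightarrow> (\<forall>h. h \<longlonglongrightarrow> 0 \<longrightarrow> (\<lambda>n. shift_dist f (h n)) \<longlonglongrightarrow> 0)"

lemma ennreal_tendsto_0I:
  assumes "\<And>e::real. 0 < e \<Longrightarrow> \<forall>\<^sub>F n in \<F>. f n \<le> ennreal e"
  shows "(f \<longlongrightarrow> (0::ennreal)) \<F>"
proof (rule order_tendstoI)
  fix a :: ennreal assume "0 < a"
  then obtain b where b: "0 < b" "b < a" using dense by blast
  then obtain e where "b = ennreal e" "0 \<le> e" by (cases b) auto
  with b have e: "0 < e" "ennreal e < a" by auto
  show "\<forall>\<^sub>F n in \<F>. f n < a"
    using assms[OF e(1)] by (rule eventually_mono) (use e in \<open>auto intro: le_less_trans\<close>)
qed auto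

lemma ennreal_tendsto_0D:
  assumes "(f \<longlongrightarrow> (0::ennreal)) \<F>" "0 < (e::real)"
  shows "\<forall>\<^sub>F n in \<F>. f n \<le> ennreal e"
  using order_tendstoD(2)[OF assms(1), of "ennreal e"] assms(2) by (auto elim!: eventually_mono)

lemma ennreal_squeeze_0:
  assumes "(g \<longlongrightarrow> (0::ennreal)) \<F>" "\<forall>\<^sub>F n in \<F>. f n \<le> g n"
  shows "(f \<longlongrightarrow> 0) \<F>"
  by (rule tendsto_sandwich[OF _ assms(2) tendsto_const assms(1)]) auto

text \<open>The translation distance of \<open>f - g\<close> is at most four times its squared norm, uniformly in the
  translation.\<close>

lemma shift_continuous_limit:
  fixes f :: "'a::euclidean_space \<Rightarrow> 'v::{real_normed_vector,second_countable_topology}"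
  assumes [measurable]: "f \<in> borel_measurable borel"
    and appr: "\<And>e::real. 0 < e \<Longrightarrow> \<exists>g \<in> borel_measurable borel. shift_continuous g \<and> sqn lborel (\<lambda>x. f x - g x) \<le> ennreal e"
  shows "shift_continuous f"
  unfolding shift_continuous_def
proof (intro allI impI ennreal_tendsto_0I)
  fix h :: "nat \<Rightarrow> 'a" and e :: real assume h: "h \<longlonglongrightarrow> 0" and e: "0 < e"
  obtain g where [measurable]: "g \<in> borel_measurable borel" and g: "shift_continuous g"
      "sqn lborel (\<lambda>x. f x - g x) \<le> ennreal (e / 16)"
    using appr[of "e / 16"] e by auto
  have "shift_dist f k \<le> 2 * shift_dist g k + ennreal (e / 2)" for k
  proof -
    have "shift_dist f k \<le> 2 * shift_dist g k + 2 * shift_dist (\<lambda>x. f x - g x) k"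
      using shift_dist_add_le[of g "\<lambda>x. f x - g x" k] by simp
    also have "\<dots> \<le> 2 * shift_dist g k + 2 * (4 * ennreal (e / 16))"
      by (intro add_mono mult_left_mono order_trans[OF shift_dist_le] g order_refl) auto
    also have "2 * (4 * ennreal (e / 16)) = ennreal (2 * (4 * (e / 16)))"
      using e by (simp only: numeral_mult_ennreal)
    finally show ?thesis using e by simp
  qed
  moreover have "\<forall>\<^sub>F n in sequentially. shift_dist g (h n) \<le> ennreal (e / 4)"
    using g(1) h e unfolding shift_continuous_def by (intro ennreal_tendsto_0D) auto
  ultimately show "\<forall>\<^sub>F n in sequentially. shift_dist f (h n) \<le> ennreal e"
  proof (elim eventually_mono)
    fix n assume a: "shift_dist g (h n) \<le> ennreal (e / 4)"
      and b: "\<And>k. shift_dist f k \<le> 2 * shift_dist g k + ennreal (e / 2)"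
    have "shift_dist f (h n) \<le> 2 * ennreal (e / 4) + ennreal (e / 2)"
      by (rule order_trans[OF b]) (intro add_mono mult_left_mono a order_refl, auto)
    also have "2 * ennreal (e / 4) = ennreal (2 * (e / 4))" using e by (simp only: numeral_mult_ennreal)
    finally show "shift_dist f (h n) \<le> ennreal e" using e by (simp flip: ennreal_plus)
  qed
qed

lemma shift_continuous_add:
  fixes f g :: "'a::euclidean_space \<Rightarrow> 'v::{real_normed_vector,second_countable_topology}"
  assumes [measurable]: "f \<in> borel_measurable borel" "g \<in> borel_measurable borel"
    and "shift_continuous f" "shift_continuous g"
  shows "shift_continuous (\<lambda>x. f x + g x)"
  unfolding shift_continuous_def
proof (intro allI impI)
  fix h :: "nat \<Rightarrow> 'a" assume h: "h \<longlonglongrightarrow> 0"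
  have "(\<lambda>n. 2 * shift_dist f (h n) + 2 * shift_dist g (h n)) \<longlonglongrightarrow> 2 * 0 + 2 * 0"
    using assms h unfolding shift_continuous_def by (intro tendsto_add ennreal_tendsto_cmult) auto
  then have "(\<lambda>n. 2 * shift_dist f (h n) + 2 * shift_dist g (h n)) \<longlonglongrightarrow> 0" by simp
  then show "(\<lambda>n. shift_dist (\<lambda>x. f x + g x) (h n)) \<longlonglongrightarrow> 0"
    by (rule ennreal_squeeze_0) (intro always_eventually allI shift_dist_add_le assms)
qed

text \<open>For a point of an open set all small translates stay in the set, so dominated convergence applies
  to the part of \<open>U\<close> that a translation moves out of \<open>U\<close>; the part that it moves into \<open>U\<close> is handled by the opposite
  translation.\<close>

lemma shift_continuous_indicator_open:
  fixes U :: "'a::euclidean_space set" and c :: "'v::{real_normed_vector,second_countable_topology}"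
  assumes U: "open U" "emeasure lborel U < \<infinity>"
  shows "shift_continuous (\<lambda>x. indicator U x *\<^sub>R c)"
  unfolding shift_continuous_def
proof (intro allI impI)
  fix h :: "nat \<Rightarrow> 'a" assume h: "h \<longlonglongrightarrow> 0"
  have [measurable]: "U \<in> sets borel" using U by auto
  define a :: "'a \<Rightarrow> ennreal" where "a k = (\<integral>\<^sup>+x. indicator U x * indicator (- U) (x + k) \<partial>lborel)" for k
  have lim: "(\<lambda>n. a (k n)) \<longlonglongrightarrow> 0" if k: "k \<longlonglongrightarrow> 0" for k
  proof -
    have "(\<lambda>n. a (k n)) \<longlonglongrightarrow> (\<integral>\<^sup>+x. 0 \<partial>(lborel :: 'a measure))"
      unfolding a_def
    proof (rule nn_integral_dominated_convergence[where w="indicator U"])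
      show "AE x in lborel. (\<lambda>i. indicator U x * indicator (- U) (x + k i)) \<longlonglongrightarrow> (0::ennreal)"
      proof (rule AE_I2)
        fix x :: 'a
        show "(\<lambda>i. indicator U x * indicator (- U) (x + k i)) \<longlonglongrightarrow> (0::ennreal)"
        proof (cases "x \<in> U")
          case True
          have "(\<lambda>i. x + k i) \<longlonglongrightarrow> x + 0" by (intro tendsto_intros k)
          then have "\<forall>\<^sub>F i in sequentially. x + k i \<in> U"
            using topological_tendstoD[OF _ U(1)] True by auto
          then have "\<forall>\<^sub>F i in sequentially. indicator U x * indicator (- U) (x + k i) = (0::ennreal)"
            by (rule eventually_mono) (auto simp: indicator_def)
          then show ?thesis by (rule tendsto_eventually)
        qed simp
      qed
      show "(\<integral>\<^sup>+x. indicator U x \<partial>lborel) < \<infinity>" using U by simp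
    qed (auto simp: indicator_def)
    then show ?thesis by simp
  qed
  have le: "shift_dist (\<lambda>x. indicator U x *\<^sub>R c) k \<le> ennreal ((norm c)\<^sup>2) * (a k + a (- k))" for k
  proof -
    have am: "a (- k) = (\<integral>\<^sup>+x. indicator U (x + k) * indicator (- U) x \<partial>lborel)"
      unfolding a_def using nn_integral_lborel_shift[of "\<lambda>x. indicator U x * indicator (- U) (x + - k)" k]
      by simp
    have "shift_dist (\<lambda>x. indicator U x *\<^sub>R c) k \<le> (\<integral>\<^sup>+x. ennreal ((norm c)\<^sup>2) *
        (indicator U x * indicator (- U) (x + k) + indicator U (x + k) * indicator (- U) x) \<partial>lborel)"
      unfolding shift_dist_def sqn_def
      by (intro nn_integral_mono) (auto simp: indicator_def)
    also have "\<dots> = ennreal ((norm c)\<^sup>2) * (a k + a (- k))"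
      unfolding am unfolding a_def by (subst nn_integral_cmult) (auto simp: nn_integral_add)
    finally show ?thesis .
  qed
  have "(\<lambda>n. ennreal ((norm c)\<^sup>2) * (a (h n) + a (- h n))) \<longlonglongrightarrow> ennreal ((norm c)\<^sup>2) * (0 + 0)"
    using tendsto_minus[OF h] by (intro ennreal_tendsto_cmult tendsto_add lim h) auto
  then have "(\<lambda>n. ennreal ((norm c)\<^sup>2) * (a (h n) + a (- h n))) \<longlonglongrightarrow> 0" by simp
  then show "(\<lambda>n. shift_dist (\<lambda>x. indicator U x *\<^sub>R c) (h n)) \<longlonglongrightarrow> 0"
    by (rule ennreal_squeeze_0) (intro always_eventually allI le)
qed

lemma shift_continuous_indicator:
  fixes A :: "'a::euclidean_space set" and c :: "'v::{real_normed_vector,second_countable_topology}"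
  assumes [measurable]: "A \<in> sets borel" and A: "emeasure lborel A < \<infinity>"
  shows "shift_continuous (\<lambda>x. indicator A x *\<^sub>R c)"
proof (rule shift_continuous_limit)
  fix e :: real assume e: "0 < e"
  define d where "d = e / (1 + (norm c)\<^sup>2)"
  have n0: "1 + (norm c)\<^sup>2 > 0" by (simp add: add_pos_nonneg)
  have d: "0 < d" "(norm c)\<^sup>2 * d \<le> e"
    using e n0 by (auto simp: d_def field_simps)
  obtain U where U: "open U" "A \<subseteq> U" "emeasure lborel (U - A) < ennreal d"
    using outer_regular_lborel[of A d] d by auto
  have [measurable]: "U \<in> sets borel" using U by auto
  have "emeasure lborel U \<le> emeasure lborel A + emeasure lborel (U - A)"
    using emeasure_subadditive[of A lborel "U - A"] U(2) by (simp add: Un_absorb1)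
  also have "\<dots> < \<infinity>" using A U(3) less_trans[OF U(3)] by (simp add: ennreal_add_less_top)
  finally have sc: "shift_continuous (\<lambda>x. indicator U x *\<^sub>R c)"
    by (intro shift_continuous_indicator_open U)
  have le: "sqn lborel (\<lambda>x. indicator A x *\<^sub>R c - indicator U x *\<^sub>R c) \<le> ennreal e"
  proof -
    have "sqn lborel (\<lambda>x. indicator A x *\<^sub>R c - indicator U x *\<^sub>R c) =
        (\<integral>\<^sup>+x. ennreal ((norm c)\<^sup>2) * indicator (U - A) x \<partial>lborel)"
      unfolding sqn_def using U(2) by (intro nn_integral_cong) (auto simp: indicator_def)
    also have "\<dots> = ennreal ((norm c)\<^sup>2) * emeasure lborel (U - A)"
      by (rule nn_integral_cmult_indicator) auto
    also have "\<dots> \<le> ennreal ((norm c)\<^sup>2) * ennreal d"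
      using U(3) by (intro mult_left_mono) auto
    also have "\<dots> \<le> ennreal e" using d by (simp add: ennreal_leI flip: ennreal_mult')
    finally show ?thesis .
  qed
  have gm: "(\<lambda>x. indicator U x *\<^sub>R c) \<in> borel_measurable borel" by measurable
  show "\<exists>g \<in> borel_measurable borel. shift_continuous g
      \<and> sqn lborel (\<lambda>x. indicator A x *\<^sub>R c - g x) \<le> ennreal e"
    by (rule bexI[where x="\<lambda>x. indicator U x *\<^sub>R c"], rule conjI[OF sc le], rule gm)
next
  show "(\<lambda>x. indicator A x *\<^sub>R c) \<in> borel_measurable borel" by measurable
qed

text \<open>Open sets of finite measure suffice: by outer regularity they approximate Borel sets, and
  square-integrable functions are limits of simple functions supported on such sets.\<close>

lemma shift_continuous_L2:
  fixes f :: "'a::euclidean_space \<Rightarrow> 'v::{banach,second_countable_topology}"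
  assumes [measurable]: "f \<in> borel_measurable borel" and f: "sqn lborel f < \<infinity>"
  shows "shift_continuous f"
proof (rule shift_continuous_limit)
  obtain s where s: "\<And>i. simple_function lborel (s i)" "\<And>x. (\<lambda>i. s i x) \<longlonglongrightarrow> f x"
      "\<And>i x. dist (s i x) 0 \<le> 2 * dist (f x) 0"
    using borel_measurable_implies_sequence_metric[of f lborel 0] by auto
  have [measurable]: "s i \<in> borel_measurable borel" for i
    using borel_measurable_simple_function[OF s(1)] by simp
  have sc: "shift_continuous (s i)" for i
  proof -
    let ?A = "\<lambda>y. s i -` {y}"
    have fin: "finite (range (s i))" using simple_functionD(1)[OF s(1)[of i]] by simp
    have A: "?A y \<in> sets borel" for y
      using measurable_sets[of "s i" borel borel "{y}"] by simp
    have "emeasure lborel (?A y) < \<infinity>" if "y \<noteq> 0" for y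
    proof -
      have "(norm (s i x))\<^sup>2 \<le> 4 * (norm (f x))\<^sup>2" for x
        using s(3)[of i x] power_mono[of "norm (s i x)" "2 * norm (f x)" 2]
        by (auto simp: power_mult_distrib)
      then have "(\<integral>\<^sup>+x. ennreal ((norm y)\<^sup>2) * indicator (?A y) x \<partial>lborel) \<le> (\<integral>\<^sup>+x. 4 * ennreal ((norm (f x))\<^sup>2) \<partial>lborel)"
        by (intro nn_integral_mono) (auto simp: indicator_def numeral_mult_ennreal intro!: ennreal_leI split: if_splits)
      also have "\<dots> = 4 * sqn lborel f" unfolding sqn_def by (simp add: nn_integral_cmult)
      also have "(\<integral>\<^sup>+x. ennreal ((norm y)\<^sup>2) * indicator (?A y) x \<partial>lborel) = ennreal ((norm y)\<^sup>2) * emeasure lborel (?A y)"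
        using A by (subst nn_integral_cmult_indicator) auto
      finally have *: "ennreal ((norm y)\<^sup>2) * emeasure lborel (?A y) \<le> 4 * sqn lborel f" .
      have "4 * sqn lborel f < \<infinity>" using f by (simp add: ennreal_mult_less_top)
      with * have "ennreal ((norm y)\<^sup>2) * emeasure lborel (?A y) < \<infinity>" by (rule le_less_trans)
      moreover have "ennreal ((norm y)\<^sup>2) \<noteq> 0" using that by simp
      ultimately show ?thesis by (auto simp: ennreal_mult_less_top)
    qed
    then have sc1: "shift_continuous (\<lambda>x. indicator (?A y) x *\<^sub>R y)" for y
    proof (cases "y = 0")
      case True
      then show ?thesis by (simp add: shift_continuous_def shift_dist_def sqn_def)
    qed (intro shift_continuous_indicator A)
    have "shift_continuous (\<lambda>x. \<Sum>y\<in>B. indicator (?A y) x *\<^sub>R y)" if "finite B" for B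
      using that
    proof induction
      case empty
      then show ?case by (simp add: shift_continuous_def shift_dist_def sqn_def)
    next
      case (insert y B)
      have [measurable]: "?A y \<in> sets borel" for y by (rule A)
      have "shift_continuous (\<lambda>x. indicator (?A y) x *\<^sub>R y + (\<Sum>y\<in>B. indicator (?A y) x *\<^sub>R y))"
        by (intro shift_continuous_add sc1 insert.IH) measurable
      then show ?case by (simp only: sum.insert[OF insert.hyps])
    qed
    from this[OF fin] have "shift_continuous (\<lambda>x. \<Sum>y\<in>range (s i). indicator (?A y) x *\<^sub>R y)" .
    moreover have "(\<lambda>x. \<Sum>y\<in>range (s i). indicator (?A y) x *\<^sub>R y) = s i"
    proof
      fix x
      have "(\<Sum>y\<in>range (s i). indicator (?A y) x *\<^sub>R y) = (\<Sum>y\<in>range (s i). if y = s i x then y else 0)"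
        by (rule sum.cong) (simp_all add: indicator_def)
      also have "\<dots> = s i x" by (subst sum.delta[OF fin]) simp
      finally show "(\<Sum>y\<in>range (s i). indicator (?A y) x *\<^sub>R y) = s i x" .
    qed
    ultimately show ?thesis by simp
  qed
  have lim: "(\<lambda>i. sqn lborel (\<lambda>x. f x - s i x)) \<longlonglongrightarrow> 0"
  proof -
    have "(\<lambda>i. \<integral>\<^sup>+x. ennreal ((norm (f x - s i x))\<^sup>2) \<partial>lborel) \<longlonglongrightarrow> (\<integral>\<^sup>+x. 0 \<partial>(lborel :: 'a measure))"
    proof (rule nn_integral_dominated_convergence[where w="\<lambda>x. 9 * ennreal ((norm (f x))\<^sup>2)"])
      have "norm (f x - s j x) \<le> 3 * norm (f x)" for x j
        using norm_triangle_ineq4[of "f x" "s j x"] s(3)[of j x] by simp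
      then have "(norm (f x - s j x))\<^sup>2 \<le> 9 * (norm (f x))\<^sup>2" for x j
        using power_mono[of "norm (f x - s j x)" "3 * norm (f x)" 2] by (simp add: power_mult_distrib)
      then show "AE x in lborel. ennreal ((norm (f x - s j x))\<^sup>2) \<le> 9 * ennreal ((norm (f x))\<^sup>2)" for j
        by (simp add: numeral_mult_ennreal ennreal_leI)
      have "(\<lambda>j. ennreal ((norm (f x - s j x))\<^sup>2)) \<longlonglongrightarrow> ennreal ((norm (f x - f x))\<^sup>2)" for x
        by (intro tendsto_intros tendsto_ennrealI s)
      then show "AE x in lborel. (\<lambda>j. ennreal ((norm (f x - s j x))\<^sup>2)) \<longlonglongrightarrow> 0" by simp
      show "(\<integral>\<^sup>+x. 9 * ennreal ((norm (f x))\<^sup>2) \<partial>lborel) < \<infinity>"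
        using f unfolding sqn_def by (subst nn_integral_cmult) (auto simp: ennreal_mult_less_top)
    qed auto
    then show ?thesis by (simp add: sqn_def)
  qed
  fix e :: real assume "0 < e"
  then obtain i where "sqn lborel (\<lambda>x. f x - s i x) \<le> ennreal e"
    using ennreal_tendsto_0D[OF lim] by (auto simp: eventually_sequentially)
  then show "\<exists>g \<in> borel_measurable borel. shift_continuous g \<and> sqn lborel (\<lambda>x. f x - g x) \<le> ennreal e"
    using sc by (intro bexI[of _ "s i"] conjI) auto
qed (rule assms)

section \<open>The Gaussian and its Fourier integral\<close>

lemma measurable_cis [measurable]: "cis \<in> borel_measurable borel"
  by (intro borel_measurable_continuous_onI continuous_intros)

text \<open>Up to scaling this is the characteristic function of the standard normal distribution.\<close>

lemma gaussian_fourier_real: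
  assumes t: "0 < t"
  shows "integrable lborel (\<lambda>x::real. cis (a * x) * of_real (exp (- t * x\<^sup>2)))"
    and "(LINT x|lborel. cis (a * x) * of_real (exp (- t * x\<^sup>2)))
      = of_real ((pi / t) powr (1/2) * exp (- a\<^sup>2 / (4 * t)))"
proof -
  define c where "c = sqrt (2 * t)"
  have c: "c > 0" "c\<^sup>2 = 2 * t" using t by (auto simp: c_def)
  define b where "b = a / c"
  have "char std_normal_distribution b = (LINT x|lborel. std_normal_density x *\<^sub>R iexp (b * x))"
    unfolding char_def by (subst integral_density) auto
  also have "\<dots> = \<bar>c\<bar> *\<^sub>R (LINT x|lborel. std_normal_density (0 + c * x) *\<^sub>R iexp (b * (0 + c * x)))"
    using c by (intro lborel_integral_real_affine) simp
  also have "(\<lambda>x. std_normal_density (0 + c * x) *\<^sub>R iexp (b * (0 + c * x)))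
      = (\<lambda>x. of_real (1 / sqrt (2 * pi)) * (cis (a * x) * of_real (exp (- t * x\<^sup>2))))"
    using c by (auto simp: fun_eq_iff std_normal_density_def b_def power_mult_distrib cis_conv_exp scaleR_conv_of_real)
  finally have E: "of_real (exp (- b\<^sup>2 / 2)) =
     of_real (c / sqrt (2 * pi)) * (LINT x|lborel. cis (a * x) * of_real (exp (- t * x\<^sup>2)))"
    using c by (simp add: char_std_normal_distribution scaleR_conv_of_real)
  have k: "1 / (c / sqrt (2 * pi)) = (pi / t) powr (1/2)"
    using t by (simp add: c_def powr_half_sqrt real_sqrt_mult real_sqrt_divide)
  have bb: "- b\<^sup>2 / 2 = - a\<^sup>2 / (4 * t)" using t c by (simp add: b_def power_divide)
  show *: "(LINT x|lborel. cis (a * x) * of_real (exp (- t * x\<^sup>2)))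
      = of_real ((pi / t) powr (1/2) * exp (- a\<^sup>2 / (4 * t)))"
    unfolding k[symmetric] bb[symmetric] of_real_mult E using c by (simp flip: of_real_mult)
  have "(pi / t) powr (1/2) * exp (- a\<^sup>2 / (4 * t)) \<noteq> 0" using t by simp
  then have nz: "of_real ((pi / t) powr (1/2) * exp (- a\<^sup>2 / (4 * t))) \<noteq> (0::complex)"
    by (simp only: of_real_eq_0_iff not_False_eq_True)
  show "integrable lborel (\<lambda>x::real. cis (a * x) * of_real (exp (- t * x\<^sup>2)))"
  proof (rule ccontr)
    assume "\<not> integrable lborel (\<lambda>x::real. cis (a * x) * of_real (exp (- t * x\<^sup>2)))"
    from not_integrable_integral_eq[OF this] * nz show False by (simp only:)
  qed
qed

lemma lborel_integral_prod:
  fixes f :: "'a::euclidean_space \<Rightarrow> real \<Rightarrow> complex"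
  assumes int: "\<And>b. b \<in> Basis \<Longrightarrow> integrable lborel (f b)"
  shows "integrable lborel (\<lambda>x::'a. \<Prod>b\<in>Basis. f b (x \<bullet> b))"
    and "(LINT x|lborel. (\<Prod>b\<in>Basis. f b (x \<bullet> b))) = (\<Prod>b\<in>Basis. LINT x|lborel. f b x)"
proof -
  interpret product_sigma_finite "\<lambda>_::'a. lborel :: real measure"
    by standard
  have [measurable]: "f b \<in> borel_measurable borel" if "b \<in> Basis" for b
    using int[OF that] by auto
  have T: "(\<lambda>f. \<Sum>b\<in>Basis. f b *\<^sub>R b) \<in> measurable (\<Pi>\<^sub>M b\<in>(Basis::'a set). lborel) borel"
    by measurable
  have F: "(\<lambda>x::'a. \<Prod>b\<in>Basis. f b (x \<bullet> b)) \<in> borel_measurable borel"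
    by measurable
  have ip: "(\<Sum>b\<in>Basis. y b *\<^sub>R b) \<bullet> b' = y b'" if "b' \<in> Basis" for y and b' :: 'a
    using that by (simp add: inner_sum_left inner_Basis if_distrib cong: if_cong)
  have eq: "(\<Prod>b\<in>Basis. f b ((\<Sum>b\<in>Basis. y b *\<^sub>R b) \<bullet> b)) = (\<Prod>b\<in>Basis. f b (y b))" for y
    by (intro prod.cong) (simp_all add: ip)
  have "integrable (\<Pi>\<^sub>M b\<in>(Basis::'a set). lborel) (\<lambda>y. \<Prod>b\<in>Basis. f b (y b))"
    by (rule product_integrable_prod) (auto intro: int)
  then show "integrable lborel (\<lambda>x::'a. \<Prod>b\<in>Basis. f b (x \<bullet> b))"
    by (subst lborel_eq) (simp only: integrable_distr_eq[OF T F] eq)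
  have "integral\<^sup>L lborel (\<lambda>x::'a. \<Prod>b\<in>Basis. f b (x \<bullet> b)) =
      integral\<^sup>L (\<Pi>\<^sub>M b\<in>(Basis::'a set). lborel) (\<lambda>y. \<Prod>b\<in>Basis. f b (y b))"
    by (subst lborel_eq) (simp only: integral_distr[OF T F] eq)
  also have "\<dots> = (\<Prod>b\<in>Basis. LINT x|lborel. f b x)"
    by (rule product_integral_prod) (auto intro: int)
  finally show "(LINT x|lborel. (\<Prod>b\<in>Basis. f b (x \<bullet> b))) = (\<Prod>b\<in>Basis. LINT x|lborel. f b x)" .
qed

lemma cis_sum: "finite A \<Longrightarrow> cis (\<Sum>i\<in>A. f i) = (\<Prod>i\<in>A. cis (f i))"
  by (induction rule: finite_induct) (simp_all flip: cis_mult)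

lemma gaussian_fourier:
  fixes x :: "'a::euclidean_space"
  assumes t: "0 < t"
  shows "integrable lborel (\<lambda>\<xi>::'a. cis (x \<bullet> \<xi>) * of_real (exp (- t * (norm \<xi>)\<^sup>2)))"
    and "(LINT \<xi>|lborel. cis (x \<bullet> \<xi>) * of_real (exp (- t * (norm \<xi>)\<^sup>2)))
      = of_real ((pi / t) powr (DIM('a) / 2) * exp (- (norm x)\<^sup>2 / (4 * t)))"
proof -
  have nsq: "(norm y)\<^sup>2 = (\<Sum>b\<in>Basis. (y \<bullet> b)\<^sup>2)" for y :: 'a
    by (simp add: norm_eq_sqrt_inner euclidean_inner[of y y] power2_eq_square sum_nonneg)
  have eq: "cis (x \<bullet> \<xi>) * of_real (exp (- t * (norm \<xi>)\<^sup>2)) =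
      (\<Prod>b\<in>Basis. cis ((x \<bullet> b) * (\<xi> \<bullet> b)) * of_real (exp (- t * (\<xi> \<bullet> b)\<^sup>2)))" for \<xi> :: 'a
    by (simp add: nsq euclidean_inner[of x \<xi>] cis_sum exp_sum sum_distrib_left prod.distrib flip: sum_negf)
  have i: "integrable lborel (\<lambda>y. cis ((x \<bullet> b) * y) * of_real (exp (- t * y\<^sup>2)))" for b :: 'a
    by (rule gaussian_fourier_real[OF t])
  show "integrable lborel (\<lambda>\<xi>::'a. cis (x \<bullet> \<xi>) * of_real (exp (- t * (norm \<xi>)\<^sup>2)))"
    unfolding eq by (rule lborel_integral_prod(1)[of "\<lambda>b y. cis ((x \<bullet> b) * y) * of_real (exp (- t * y\<^sup>2))"]) (rule i)
  have "(LINT \<xi>|lborel. cis (x \<bullet> \<xi>) * of_real (exp (- t * (norm \<xi>)\<^sup>2))) =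
      (\<Prod>b\<in>(Basis::'a set). LINT y|lborel. cis ((x \<bullet> b) * y) * of_real (exp (- t * y\<^sup>2)))"
    unfolding eq by (rule lborel_integral_prod(2)[of "\<lambda>b y. cis ((x \<bullet> b) * y) * of_real (exp (- t * y\<^sup>2))"]) (rule i)
  also have "\<dots> = (\<Prod>b\<in>(Basis::'a set). of_real ((pi / t) powr (1/2) * exp (- (x \<bullet> b)\<^sup>2 / (4 * t))))"
    by (intro prod.cong refl gaussian_fourier_real(2)[OF t])
  also have "\<dots> = of_real (((pi / t) powr (1/2)) ^ DIM('a) * exp (\<Sum>b\<in>(Basis::'a set). - (x \<bullet> b)\<^sup>2 / (4 * t)))"
    by (simp add: prod.distrib exp_sum)
  also have "(\<Sum>b\<in>(Basis::'a set). - (x \<bullet> b)\<^sup>2 / (4 * t)) = - (norm x)\<^sup>2 / (4 * t)"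
    by (simp add: nsq sum_divide_distrib sum_negf)
  also have "((pi / t) powr (1/2)) ^ DIM('a) = (pi / t) powr (DIM('a) / 2)"
    using t by (simp add: powr_powr flip: powr_realpow)
  finally show "(LINT \<xi>|lborel. cis (x \<bullet> \<xi>) * of_real (exp (- t * (norm \<xi>)\<^sup>2)))
      = of_real ((pi / t) powr (DIM('a) / 2) * exp (- (norm x)\<^sup>2 / (4 * t)))" .
qed

text \<open>The heat kernel at time \<open>t\<close>: the inverse Fourier transform of \<open>exp (- t |\<xi>|\<^sup>2)\<close> as a
  probability density.\<close>

definition gauss :: "real \<Rightarrow> 'a::euclidean_space \<Rightarrow> real" where
  "gauss t z = (4 * pi * t) powr (- (DIM('a) / 2)) * exp (- (norm z)\<^sup>2 / (4 * t))"

lemma gauss_nonneg [simp]: "0 \<le> gauss t z"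
  by (simp add: gauss_def)

lemma gauss_measurable [measurable]: "gauss t \<in> borel_measurable borel"
  unfolding gauss_def by measurable

lemma gauss_integral:
  assumes t: "0 < t"
  shows "(\<integral>\<^sup>+z. ennreal (gauss t z) \<partial>(lborel :: 'a::euclidean_space measure)) = 1"
proof -
  define s where "s = 1 / (4 * t)"
  have s: "0 < s" using t by (simp add: s_def)
  have i: "integrable lborel (\<lambda>\<xi>::'a. complex_of_real (exp (- s * (norm \<xi>)\<^sup>2)))"
    using gaussian_fourier(1)[OF s, of 0] by simp
  then have i': "integrable lborel (\<lambda>\<xi>::'a. exp (- s * (norm \<xi>)\<^sup>2))"
    using integrable_Re[OF i] by simp
  have "complex_of_real (LINT \<xi>|lborel. exp (- s * (norm (\<xi>::'a))\<^sup>2)) = of_real ((pi / s) powr (DIM('a) / 2))"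
    using gaussian_fourier(2)[OF s, of "0::'a"] by simp
  then have I: "(LINT \<xi>|lborel. exp (- s * (norm (\<xi>::'a))\<^sup>2)) = (pi / s) powr (DIM('a) / 2)"
    unfolding of_real_eq_iff .
  have eq: "gauss t = (\<lambda>z::'a. (4 * pi * t) powr (- (DIM('a) / 2)) * exp (- s * (norm z)\<^sup>2))"
    by (auto simp: gauss_def s_def fun_eq_iff)
  have "(\<integral>\<^sup>+z. ennreal (gauss t z) \<partial>(lborel :: 'a measure)) = ennreal (LINT z|lborel. gauss t (z::'a))"
    by (rule nn_integral_eq_integral) (auto simp: eq intro!: integrable_mult_right i'[unfolded mult_minus_left])
  also have "(LINT z|lborel. gauss t (z::'a)) = (4 * pi * t) powr (- (DIM('a) / 2)) * (pi / s) powr (DIM('a) / 2)"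
    unfolding eq by (simp add: I[unfolded mult_minus_left])
  also have "\<dots> = 1" using t by (simp add: s_def powr_minus mult_ac)
  finally show ?thesis by simp
qed

section \<open>Plancherel's theorem\<close>

lemma integrable_pair_mult:
  fixes a b :: "'a::euclidean_space \<Rightarrow> complex"
  assumes a: "integrable lborel a" and b: "integrable lborel b"
    and [measurable]: "(\<lambda>(x, y). k x y) \<in> borel_measurable (lborel \<Otimes>\<^sub>M lborel)"
    and k: "\<And>x y. norm (k x y) \<le> (B::real)"
  shows "integrable (lborel \<Otimes>\<^sub>M lborel) (\<lambda>(x, y). k x y * a x * b y)"
proof (rule integrableI_bounded)
  have [measurable]: "a \<in> borel_measurable borel" "b \<in> borel_measurable borel"
    using borel_measurable_integrable[OF a] borel_measurable_integrable[OF b] by simp_all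
  have B: "0 \<le> B" using k[of undefined undefined] norm_ge_zero order_trans by blast
  show "(\<lambda>(x, y). k x y * a x * b y) \<in> borel_measurable (lborel \<Otimes>\<^sub>M lborel)" by measurable
  have "(\<integral>\<^sup>+z. ennreal (norm (case z of (x, y) \<Rightarrow> k x y * a x * b y)) \<partial>(lborel \<Otimes>\<^sub>M lborel))
     \<le> (\<integral>\<^sup>+z. ennreal B * ennreal (norm (a (fst z))) * ennreal (norm (b (snd z))) \<partial>(lborel \<Otimes>\<^sub>M lborel))"
    using k B by (intro nn_integral_mono)
      (auto simp: norm_mult simp flip: ennreal_mult intro!: ennreal_leI mult_right_mono)
  also have "\<dots> = (\<integral>\<^sup>+x. \<integral>\<^sup>+y. ennreal B * ennreal (norm (a x)) * ennreal (norm (b y)) \<partial>lborel \<partial>lborel)"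
    by (subst lborel.nn_integral_fst[symmetric]) auto
  also have "\<dots> = ennreal B * (\<integral>\<^sup>+x. ennreal (norm (a x)) \<partial>lborel) * (\<integral>\<^sup>+y. ennreal (norm (b y)) \<partial>lborel)"
    by (simp add: nn_integral_cmult nn_integral_multc)
  also have "\<dots> < \<infinity>"
    using a b by (auto simp: integrable_iff_bounded ennreal_mult_less_top)
  finally show "(\<integral>\<^sup>+z. ennreal (norm (case z of (x, y) \<Rightarrow> k x y * a x * b y)) \<partial>(lborel \<Otimes>\<^sub>M lborel)) < \<infinity>" .
qed

text \<open>The multiplication formula: Fubini's theorem for the bounded kernel \<open>cis (s (x \<bullet> \<xi>))\<close>.\<close>

lemma cis_multiplication_formula:
  fixes a b :: "'a::euclidean_space \<Rightarrow> complex"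
  assumes a: "integrable lborel a" and b: "integrable lborel b"
  shows "(LINT \<xi>|lborel. b \<xi> * (LINT x|lborel. cis (s * (x \<bullet> \<xi>)) * a x))
    = (LINT x|lborel. a x * (LINT \<xi>|lborel. cis (s * (x \<bullet> \<xi>)) * b \<xi>))"
proof -
  have "integrable (lborel \<Otimes>\<^sub>M lborel) (\<lambda>(x, y). cis (s * (x \<bullet> y)) * a x * b y)"
    by (rule integrable_pair_mult[OF a b, where B=1]) auto
  from lborel_pair.Fubini_integral[OF this]
  have "(LINT y|lborel. LINT x|lborel. cis (s * (x \<bullet> y)) * a x * b y) =
        (LINT x|lborel. LINT y|lborel. cis (s * (x \<bullet> y)) * a x * b y)" .
  moreover have "(LINT x|lborel. cis (s * (x \<bullet> y)) * a x * b y) = b y * (LINT x|lborel. cis (s * (x \<bullet> y)) * a x)" for y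
    by (simp add: mult.commute)
  moreover have "(LINT y|lborel. cis (s * (x \<bullet> y)) * a x * b y) = a x * (LINT y|lborel. cis (s * (x \<bullet> y)) * b y)" for x
    unfolding integral_mult_right_zero[symmetric] by (simp add: mult_ac)
  ultimately show ?thesis by (simp only:)
qed

lemma measurable_fourier_integral [measurable]:
  fixes f :: "'a::euclidean_space \<Rightarrow> complex"
  assumes [measurable]: "f \<in> borel_measurable borel"
  shows "fourier_integral f \<in> borel_measurable borel"
  unfolding fourier_integral_def by measurable

lemma norm_fourier_integral_le:
  fixes f :: "'a::euclidean_space \<Rightarrow> complex"
  shows "norm (fourier_integral f \<xi>) \<le> (2 * pi) powr (- real DIM('a) / 2) * (LINT x|lborel. norm (f x))"
proof -
  have "norm (LINT x|lborel. cis (- (x \<bullet> \<xi>)) * f x) \<le> (LINT x|lborel. norm (cis (- (x \<bullet> \<xi>)) * f x))"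
    by (rule integral_norm_bound)
  also have "\<dots> = (LINT x|lborel. norm (f x))" by (simp add: norm_mult)
  finally show ?thesis unfolding fourier_integral_def by (simp add: mult_left_mono)
qed

lemma integrable_cis_mult:
  fixes f :: "'a::euclidean_space \<Rightarrow> complex"
  assumes f: "integrable lborel f"
  shows "integrable lborel (\<lambda>x. cis (s * (x \<bullet> \<xi>)) * f x)"
proof -
  have [measurable]: "f \<in> borel_measurable borel" using borel_measurable_integrable[OF f] by simp
  show ?thesis by (rule Bochner_Integration.integrable_bound[OF f]) (auto simp: norm_mult)
qed

lemma heat_integrand_identity:
  "Re (a * cnj b * of_real w) = (1/2) * w * ((norm a)\<^sup>2 + (norm b)\<^sup>2) - (1/2) * w * (norm (b - a))\<^sup>2"
proof -
  have r: "Re (a * cnj b) = ((norm a)\<^sup>2 + (norm b)\<^sup>2 - (norm (b - a))\<^sup>2) / 2"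
    unfolding cmod_power2 by (simp add: power2_eq_square algebra_simps)
  have "Re (a * cnj b * of_real w) = Re (a * cnj b) * w" by simp
  also have "\<dots> = (1/2) * w * ((norm a)\<^sup>2 + (norm b)\<^sup>2) - (1/2) * w * (norm (b - a))\<^sup>2"
    unfolding r by (simp add: field_simps)
  finally show ?thesis .
qed

lemma measurable_cnj [measurable]: "cnj \<in> borel_measurable borel"
  by (intro borel_measurable_continuous_onI continuous_intros)

text \<open>Two applications of the multiplication formula turn the Gaussian regularisation of the squared norm
  of the transform into the Gaussian average, over translations \<open>h\<close>, of the correlation of \<open>f\<close> with
  its translate; polarisation expresses the correlation by the squared norm of \<open>f\<close> and the translation
  distance. Letting \<open>t \<rightarrow> 0\<close> gives Plancherel's theorem, and averaging over \<open>t\<close> gives the nonlocal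
  form of the Sobolev seminorm.\<close>

lemma heat_identity:
  fixes f :: "'a::euclidean_space \<Rightarrow> complex"
  assumes f: "integrable lborel f" and f2: "sqn lborel f < \<infinity>" and t: "0 < t"
  shows "(\<integral>\<^sup>+\<xi>. ennreal (exp (- t * (norm \<xi>)\<^sup>2)) * ennreal ((norm (fourier_integral f \<xi>))\<^sup>2) \<partial>lborel)
     + (\<integral>\<^sup>+h. ennreal (gauss t h / 2) * shift_dist f h \<partial>lborel) = sqn lborel f"
proof -
  note borel_measurable_integrable[OF f, simplified, measurable]
  define c where "c = (2 * pi) powr (- real DIM('a) / 2)"
  define g where "g \<xi> = complex_of_real (exp (- t * (norm \<xi>)\<^sup>2))" for \<xi> :: 'a
  define fh where "fh = fourier_integral f"
  have fh: "fh \<xi> = c *\<^sub>R (LINT x|lborel. cis (- (x \<bullet> \<xi>)) * f x)" for \<xi>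
    by (simp add: fh_def fourier_integral_def c_def)
  have [measurable]: "fh \<in> borel_measurable borel" unfolding fh_def by measurable
  have [measurable]: "g \<in> borel_measurable borel" unfolding g_def by measurable
  have gi: "integrable lborel g"
    using gaussian_fourier(1)[OF t, of "0::'a"] by (simp add: g_def[abs_def])
  define B where "B = c * (LINT x|lborel. norm (f x))"
  have B: "norm (fh \<xi>) \<le> B" for \<xi>
    unfolding fh_def B_def c_def by (rule norm_fourier_integral_le)
  define w where "w \<xi> = cnj (fh \<xi>) * g \<xi>" for \<xi>
  have [measurable]: "w \<in> borel_measurable borel" unfolding w_def by measurable
  have B0: "0 \<le> B" using order_trans[OF norm_ge_zero B[of 0]] .
  have wi: "integrable lborel w"
  proof (rule Bochner_Integration.integrable_bound)
    show "integrable lborel (\<lambda>x. of_real B * g x)" using gi by simp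
    show "AE x in lborel. norm (w x) \<le> norm (of_real B * g x)"
      using B B0 by (auto simp: w_def norm_mult intro!: mult_right_mono AE_I2)
  qed measurable
  define S where "S = (LINT \<xi>|lborel. w \<xi> * fh \<xi>)"
  have fc: "integrable lborel (\<lambda>y. cnj (f y))" using f by simp
  have inner: "(LINT \<xi>|lborel. cis (- 1 * (x \<bullet> \<xi>)) * w \<xi>) * c
      = (LINT h|lborel. cnj (f (x + h)) * of_real (gauss t h))" for x
  proof -
    define b where "b \<xi> = cis (- (x \<bullet> \<xi>)) * g \<xi>" for \<xi>
    have bi: "integrable lborel b"
      unfolding b_def using integrable_cis_mult[OF gi, of "- 1" x] by (simp add: inner_commute)
    have cj: "cnj (fh \<xi>) = of_real c * (LINT y|lborel. cis (1 * (y \<bullet> \<xi>)) * cnj (f y))" for \<xi>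
    proof -
      have "cnj (LINT y|lborel. cis (- (y \<bullet> \<xi>)) * f y) = (LINT y|lborel. cnj (cis (- (y \<bullet> \<xi>)) * f y))"
        by (rule Bochner_Integration.integral_cnj[symmetric])
      also have "\<dots> = (LINT y|lborel. cis (1 * (y \<bullet> \<xi>)) * cnj (f y))"
        by (simp only: complex_cnj_mult cis_cnj minus_minus mult_1)
      finally show ?thesis unfolding fh by (simp add: scaleR_conv_of_real)
    qed
    have "(LINT \<xi>|lborel. cis (- 1 * (x \<bullet> \<xi>)) * w \<xi>)
        = (LINT \<xi>|lborel. of_real c * (b \<xi> * (LINT y|lborel. cis (1 * (y \<bullet> \<xi>)) * cnj (f y))))"
      unfolding w_def cj b_def by (intro Bochner_Integration.integral_cong) (auto simp: mult_ac)
    also have "\<dots> = of_real c * (LINT y|lborel. cnj (f y) * (LINT \<xi>|lborel. cis (1 * (y \<bullet> \<xi>)) * b \<xi>))"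
      by (simp only: integral_mult_right_zero cis_multiplication_formula[OF fc bi])
    also have "(LINT y|lborel. cnj (f y) * (LINT \<xi>|lborel. cis (1 * (y \<bullet> \<xi>)) * b \<xi>)) =
        (LINT y|lborel. cnj (f y) * of_real ((pi / t) powr (DIM('a) / 2) * exp (- (norm (y - x))\<^sup>2 / (4 * t))))"
    proof (intro Bochner_Integration.integral_cong refl arg_cong2[where f="(*)"])
      fix y :: 'a
      have "(\<lambda>\<xi>. cis (1 * (y \<bullet> \<xi>)) * b \<xi>) = (\<lambda>\<xi>. cis ((y - x) \<bullet> \<xi>) * of_real (exp (- t * (norm \<xi>)\<^sup>2)))"
        by (simp add: b_def g_def fun_eq_iff mult.assoc[symmetric] cis_mult inner_diff_left)
      then show "(LINT \<xi>|lborel. cis (1 * (y \<bullet> \<xi>)) * b \<xi>) =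
          of_real ((pi / t) powr (DIM('a) / 2) * exp (- (norm (y - x))\<^sup>2 / (4 * t)))"
        by (simp only: gaussian_fourier(2)[OF t])
    qed
    also have "\<dots> = (LINT h|lborel. cnj (f (h + x)) * of_real ((pi / t) powr (DIM('a) / 2) * exp (- (norm h)\<^sup>2 / (4 * t))))"
      using integral_lborel_shift(1)[of "\<lambda>y. cnj (f y) * of_real ((pi / t) powr (DIM('a) / 2) * exp (- (norm (y - x))\<^sup>2 / (4 * t)))" x]
      by simp
    finally have "(LINT \<xi>|lborel. cis (- 1 * (x \<bullet> \<xi>)) * w \<xi>) * c =
      of_real (c * c) * (LINT h|lborel. cnj (f (h + x)) * of_real ((pi / t) powr (DIM('a) / 2) * exp (- (norm h)\<^sup>2 / (4 * t))))"
      by (simp add: mult_ac)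
    also have "\<dots> = (LINT h|lborel. cnj (f (x + h)) * of_real (gauss t h))"
    proof -
      have "(2 * pi) powr - real DIM('a) = (4 * pi * pi) powr - (real DIM('a) / 2)"
      proof -
        have a: "4 * pi * pi = (2 * pi) powr 2" by (simp add: power2_eq_square)
        show ?thesis unfolding a powr_powr by simp
      qed
      then have "c * c * (pi / t) powr (DIM('a) / 2) = (4 * pi * t) powr (- (DIM('a) / 2))"
        using t by (simp add: c_def powr_minus powr_mult powr_divide field_simps flip: powr_add)
      then have "gauss t h = c * c * ((pi / t) powr (DIM('a) / 2) * exp (- (norm h)\<^sup>2 / (4 * t)))" for h :: 'a
        by (simp add: gauss_def)
      then show ?thesis
        unfolding integral_mult_right_zero[symmetric]
        by (intro Bochner_Integration.integral_cong) (auto simp: mult_ac add.commute)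
    qed
    finally show ?thesis .
  qed
  have S1: "S = (LINT x|lborel. LINT h|lborel. f x * cnj (f (x + h)) * of_real (gauss t h))"
  proof -
    have "S = of_real c * (LINT \<xi>|lborel. w \<xi> * (LINT x|lborel. cis (- 1 * (x \<bullet> \<xi>)) * f x))"
    proof -
      have "w \<xi> * fh \<xi> = of_real c * (w \<xi> * (LINT x|lborel. cis (- 1 * (x \<bullet> \<xi>)) * f x))" for \<xi>
        by (simp add: fh scaleR_conv_of_real)
      then show ?thesis unfolding S_def by (simp only: integral_mult_right_zero)
    qed
    also have "\<dots> = of_real c * (LINT x|lborel. f x * (LINT \<xi>|lborel. cis (- 1 * (x \<bullet> \<xi>)) * w \<xi>))"
      by (simp only: cis_multiplication_formula[OF f wi])
    also have "\<dots> = (LINT x|lborel. f x * (LINT h|lborel. cnj (f (x + h)) * of_real (gauss t h)))"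
      unfolding integral_mult_right_zero[symmetric] inner[symmetric]
      by (intro Bochner_Integration.integral_cong) (auto simp: mult_ac)
    finally show ?thesis
      unfolding integral_mult_right_zero[symmetric] by (simp only: mult.assoc)
  qed
  define U where "U x h = 1/2 * gauss t h * ((norm (f x))\<^sup>2 + (norm (f (x + h)))\<^sup>2)" for x h
  define W where "W x h = 1/2 * gauss t h * (norm (f (x + h) - f x))\<^sup>2" for x h
  have [measurable]: "(\<lambda>z. U (fst z) (snd z)) \<in> borel_measurable (lborel \<Otimes>\<^sub>M lborel)"
    "(\<lambda>z. W (fst z) (snd z)) \<in> borel_measurable (lborel \<Otimes>\<^sub>M lborel)"
    unfolding U_def W_def by measurable
  have U0: "0 \<le> U x h" and W0: "0 \<le> W x h" for x h by (auto simp: U_def W_def)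
  have WU: "W x h \<le> 2 * U x h" for x h
  proof -
    have "(norm (f (x + h) + - f x))\<^sup>2 \<le> (1 + 1) * (norm (f (x + h)))\<^sup>2 + (1 + 1 / 1) * (norm (- f x))\<^sup>2"
      by (rule norm_sq_split) simp
    then have "(norm (f (x + h) - f x))\<^sup>2 \<le> 2 * ((norm (f x))\<^sup>2 + (norm (f (x + h)))\<^sup>2)" by simp
    then have "(1/2 * gauss t h) * (norm (f (x + h) - f x))\<^sup>2 \<le> (1/2 * gauss t h) * (2 * ((norm (f x))\<^sup>2 + (norm (f (x + h)))\<^sup>2))"
      by (intro mult_left_mono) auto
    then show ?thesis unfolding U_def W_def by (simp add: algebra_simps)
  qed
  have nU: "(\<integral>\<^sup>+z. ennreal (U (fst z) (snd z)) \<partial>(lborel \<Otimes>\<^sub>M lborel)) = sqn lborel f"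
  proof -
    have "(\<integral>\<^sup>+z. ennreal (U (fst z) (snd z)) \<partial>(lborel \<Otimes>\<^sub>M lborel)) = (\<integral>\<^sup>+h. \<integral>\<^sup>+x. ennreal (U x h) \<partial>lborel \<partial>lborel)"
      by (subst lborel_pair.nn_integral_snd[symmetric]) simp_all
    also have "\<dots> = (\<integral>\<^sup>+h. ennreal (1/2 * gauss t h) * (sqn lborel f + sqn lborel (\<lambda>x. f (x + h))) \<partial>lborel)"
    proof (intro nn_integral_cong)
      fix h :: 'a
      have "ennreal (U x h) = ennreal (1/2 * gauss t h) * (ennreal ((norm (f x))\<^sup>2) + ennreal ((norm (f (x + h)))\<^sup>2))" for x
      proof -
        have k: "ennreal (a * (b + c)) = ennreal a * (ennreal b + ennreal c)" if "0 \<le> a" "0 \<le> b" "0 \<le> c" for a b c :: real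
          using that by (simp add: ennreal_mult ennreal_plus)
        show ?thesis unfolding U_def by (rule k) auto
      qed
      then show "(\<integral>\<^sup>+x. ennreal (U x h) \<partial>lborel) = ennreal (1/2 * gauss t h) * (sqn lborel f + sqn lborel (\<lambda>x. f (x + h)))"
        by (simp add: sqn_def nn_integral_cmult nn_integral_add)
    qed
    also have "\<dots> = (\<integral>\<^sup>+h. ennreal (gauss t h) * sqn lborel f \<partial>(lborel :: 'a measure))"
    proof (intro nn_integral_cong)
      fix h :: 'a
      have "sqn lborel f + sqn lborel f = 2 * sqn lborel f" by (simp add: mult_2)
      moreover have "ennreal (1/2 * gauss t h) * 2 = ennreal (gauss t h)"
        by (subst mult.commute, subst numeral_mult_ennreal) auto
      ultimately show "ennreal (1/2 * gauss t h) * (sqn lborel f + sqn lborel (\<lambda>x. f (x + h))) = ennreal (gauss t h) * sqn lborel f"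
        by (simp add: sqn_shift mult.assoc[symmetric])
    qed
    also have "\<dots> = sqn lborel f"
      by (subst nn_integral_multc) (simp_all add: gauss_integral[OF t])
    finally show ?thesis .
  qed
  have iU: "integrable (lborel \<Otimes>\<^sub>M lborel) (\<lambda>z. U (fst z) (snd z))"
    using nU f2 by (intro integrableI_nonneg) (simp_all add: U0)
  have iW: "integrable (lborel \<Otimes>\<^sub>M lborel) (\<lambda>z. W (fst z) (snd z))"
    by (rule Bochner_Integration.integrable_bound[OF integrable_mult_right[OF iU, of 2]]) (auto simp: U0 W0 WU)
  have iP: "integrable (lborel \<Otimes>\<^sub>M lborel) (\<lambda>(x,h). f x * cnj (f (x + h)) * of_real (gauss t h))"
  proof (rule Bochner_Integration.integrable_bound[OF iU])
    have "norm (a * cnj b * of_real (gauss t (h::'a))) \<le> 1/2 * gauss t h * ((norm a)\<^sup>2 + (norm b)\<^sup>2)" for a b h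
    proof -
      have "norm a * norm b \<le> 1/2 * ((norm a)\<^sup>2 + (norm b)\<^sup>2)"
        using sum_squares_bound[of "norm a" "norm b"] by simp
      then have "norm a * norm b * gauss t h \<le> 1/2 * ((norm a)\<^sup>2 + (norm b)\<^sup>2) * gauss t h"
        by (rule mult_right_mono) simp
      then show ?thesis by (simp add: norm_mult mult_ac)
    qed
    then show "AE z in lborel \<Otimes>\<^sub>M lborel. norm (case z of (x, h) \<Rightarrow> f x * cnj (f (x + h)) * of_real (gauss t h)) \<le> norm (U (fst z) (snd z))"
      using U0 by (auto simp: U_def)
  qed measurable
  have "S = integral\<^sup>L (lborel \<Otimes>\<^sub>M lborel) (\<lambda>(x,h). f x * cnj (f (x + h)) * of_real (gauss t h))"
    unfolding S1 by (rule lborel_pair.integral_fst[OF iP])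
  then have "Re S = integral\<^sup>L (lborel \<Otimes>\<^sub>M lborel) (\<lambda>z. Re (case z of (x,h) \<Rightarrow> f x * cnj (f (x + h)) * of_real (gauss t h)))"
    using iP by simp
  also have "\<dots> = integral\<^sup>L (lborel \<Otimes>\<^sub>M lborel) (\<lambda>z. U (fst z) (snd z) - W (fst z) (snd z))"
    unfolding U_def W_def
    by (intro Bochner_Integration.integral_cong refl) (simp only: split_beta heat_integrand_identity)
  finally have ReS: "Re S + integral\<^sup>L (lborel \<Otimes>\<^sub>M lborel) (\<lambda>z. W (fst z) (snd z)) = integral\<^sup>L (lborel \<Otimes>\<^sub>M lborel) (\<lambda>z. U (fst z) (snd z))"
    using iU iW by simp
  have w_fh: "w \<xi> * fh \<xi> = of_real (exp (- t * (norm \<xi>)\<^sup>2) * (norm (fh \<xi>))\<^sup>2)" for \<xi>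
  proof -
    have "cnj (fh \<xi>) * fh \<xi> = of_real ((norm (fh \<xi>))\<^sup>2)" using complex_norm_square[of "fh \<xi>"] by (simp add: mult.commute)
    then show ?thesis unfolding w_def g_def by (simp add: mult_ac)
  qed
  have iS: "integrable lborel (\<lambda>\<xi>. w \<xi> * fh \<xi>)"
  proof (rule Bochner_Integration.integrable_bound)
    show "integrable lborel (\<lambda>x. of_real B * w x)" using wi by simp
    show "AE x in lborel. norm (w x * fh x) \<le> norm (of_real B * w x)"
      using B B0 by (auto simp: norm_mult mult.commute intro!: mult_right_mono AE_I2)
  qed measurable
  have iS': "integrable lborel (\<lambda>\<xi>. exp (- t * (norm \<xi>)\<^sup>2) * (norm (fh \<xi>))\<^sup>2)"
    using integrable_Re[OF iS] unfolding w_fh Re_complex_of_real .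
  have ReS0: "Re S = (LINT \<xi>|lborel. exp (- t * (norm \<xi>)\<^sup>2) * (norm (fh \<xi>))\<^sup>2)"
    by (simp add: S_def w_fh del: of_real_mult)
  have A1: "(\<integral>\<^sup>+\<xi>. ennreal (exp (- t * (norm \<xi>)\<^sup>2)) * ennreal ((norm (fh \<xi>))\<^sup>2) \<partial>lborel) = ennreal (Re S)"
    using nn_integral_eq_integral[OF iS'] by (simp add: ennreal_mult ReS0)
  have A2: "(\<integral>\<^sup>+h. ennreal (gauss t h / 2) * shift_dist f h \<partial>lborel) =
     ennreal (integral\<^sup>L (lborel \<Otimes>\<^sub>M lborel) (\<lambda>z. W (fst z) (snd z)))"
  proof -
    have "(\<integral>\<^sup>+h. ennreal (gauss t h / 2) * shift_dist f h \<partial>lborel) = (\<integral>\<^sup>+h. \<integral>\<^sup>+x. ennreal (W x h) \<partial>lborel \<partial>lborel)"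
      unfolding shift_dist_def sqn_def
      by (intro nn_integral_cong, subst nn_integral_cmult[symmetric], simp) (simp add: W_def ennreal_mult[symmetric])
    also have "\<dots> = (\<integral>\<^sup>+z. ennreal (W (fst z) (snd z)) \<partial>(lborel \<Otimes>\<^sub>M lborel))"
      by (subst lborel_pair.nn_integral_snd[symmetric]) simp_all
    also have "\<dots> = ennreal (integral\<^sup>L (lborel \<Otimes>\<^sub>M lborel) (\<lambda>z. W (fst z) (snd z)))"
      by (rule nn_integral_eq_integral[OF iW]) (simp add: W0)
    finally show ?thesis .
  qed
  have A3: "sqn lborel f = ennreal (integral\<^sup>L (lborel \<Otimes>\<^sub>M lborel) (\<lambda>z. U (fst z) (snd z)))"
    unfolding nU[symmetric] by (rule nn_integral_eq_integral[OF iU]) (simp add: U0)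
  have "0 \<le> Re S" unfolding ReS0 by (intro integral_nonneg_AE) simp
  moreover have "0 \<le> integral\<^sup>L (lborel \<Otimes>\<^sub>M lborel) (\<lambda>z. W (fst z) (snd z))"
    by (intro integral_nonneg_AE) (simp add: W0)
  ultimately show ?thesis
    unfolding fh_def[symmetric] A1 A2 A3 ReS[symmetric] by (simp add: ennreal_plus)
qed

lemma gauss_scale:
  fixes z :: "'a::euclidean_space"
  assumes s: "0 < s"
  shows "s ^ DIM('a) * gauss (s\<^sup>2) (s *\<^sub>R z) = gauss 1 z"
proof -
  have "(4 * pi * s\<^sup>2) powr (- (DIM('a) / 2)) = (4 * pi) powr (- (DIM('a) / 2)) * (s powr 2) powr (- (DIM('a) / 2))"
    using s by (subst powr_mult[symmetric]) auto
  also have "(s powr 2) powr (- (DIM('a) / 2)) = s powr (- real DIM('a))"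
    unfolding powr_powr by simp
  also have "\<dots> = inverse (s ^ DIM('a))" using s by (simp add: powr_minus powr_realpow)
  finally show ?thesis using s by (simp add: gauss_def power_mult_distrib)
qed

text \<open>Rescaling by the standard deviation \<open>s\<close> makes the Gaussian fixed and shrinks the translations; then
  continuity of translations in the mean and dominated convergence apply.\<close>

lemma gauss_shift_tendsto_0:
  fixes f :: "'a::euclidean_space \<Rightarrow> complex"
  assumes [measurable]: "f \<in> borel_measurable borel" and f2: "sqn lborel f < \<infinity>"
  shows "(\<lambda>n. \<integral>\<^sup>+h. ennreal (gauss ((1 / real (Suc n))\<^sup>2) h / 2) * shift_dist f h \<partial>lborel) \<longlonglongrightarrow> 0"
proof -
  define s where "s n = 1 / real (Suc n)" for n
  have s: "0 < s n" for n by (simp add: s_def)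
  have eq: "(\<integral>\<^sup>+h. ennreal (gauss ((s n)\<^sup>2) h / 2) * shift_dist f h \<partial>lborel) =
      (\<integral>\<^sup>+z. ennreal (gauss 1 z / 2) * shift_dist f (s n *\<^sub>R z) \<partial>lborel)" for n
  proof -
    have "(\<integral>\<^sup>+h. ennreal (gauss ((s n)\<^sup>2) h / 2) * shift_dist f h \<partial>lborel) =
      ennreal (\<bar>s n\<bar> ^ DIM('a)) * (\<integral>\<^sup>+z. ennreal (gauss ((s n)\<^sup>2) (0 + s n *\<^sub>R z) / 2) * shift_dist f (0 + s n *\<^sub>R z) \<partial>lborel)"
      using s[of n] by (intro nn_integral_lborel_affine) auto
    also have "\<dots> = (\<integral>\<^sup>+z. ennreal (s n ^ DIM('a)) * (ennreal (gauss ((s n)\<^sup>2) (s n *\<^sub>R z) / 2) * shift_dist f (s n *\<^sub>R z)) \<partial>lborel)"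
      using s[of n] by (subst nn_integral_cmult) auto
    also have "\<dots> = (\<integral>\<^sup>+z. ennreal (gauss 1 z / 2) * shift_dist f (s n *\<^sub>R z) \<partial>lborel)"
    proof (intro nn_integral_cong)
      fix z :: 'a
      have "ennreal (s n ^ DIM('a)) * ennreal (gauss ((s n)\<^sup>2) (s n *\<^sub>R z) / 2) = ennreal (gauss 1 z / 2)"
        using s[of n] gauss_scale[OF s[of n], of z] by (simp flip: ennreal_mult)
      then show "ennreal (s n ^ DIM('a)) * (ennreal (gauss ((s n)\<^sup>2) (s n *\<^sub>R z) / 2) * shift_dist f (s n *\<^sub>R z))
         = ennreal (gauss 1 z / 2) * shift_dist f (s n *\<^sub>R z)"
        by (simp only: mult.assoc[symmetric])
    qed
    finally show ?thesis .
  qed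
  have "(\<lambda>n. \<integral>\<^sup>+z. ennreal (gauss 1 z / 2) * shift_dist f (s n *\<^sub>R z) \<partial>lborel) \<longlonglongrightarrow> (\<integral>\<^sup>+z. 0 \<partial>(lborel :: 'a measure))"
  proof (rule nn_integral_dominated_convergence[where w="\<lambda>z. ennreal (gauss 1 z) * (4 * sqn lborel f)"])
    show "AE z in lborel. ennreal (gauss 1 z / 2) * shift_dist f (s j *\<^sub>R z) \<le> ennreal (gauss 1 z) * (4 * sqn lborel f)" for j
      by (intro AE_I2 mult_mono shift_dist_le ennreal_leI) auto
    have "(\<integral>\<^sup>+z. ennreal (gauss 1 z) * (4 * sqn lborel f) \<partial>(lborel :: 'a measure)) = 4 * sqn lborel f"
      by (subst nn_integral_multc) (simp_all add: gauss_integral)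
    then show "(\<integral>\<^sup>+z. ennreal (gauss 1 z) * (4 * sqn lborel f) \<partial>(lborel :: 'a measure)) < \<infinity>"
      using f2 by (simp add: ennreal_mult_less_top)
    show "AE z in lborel. (\<lambda>i. ennreal (gauss 1 z / 2) * shift_dist f (s i *\<^sub>R z)) \<longlonglongrightarrow> 0"
    proof (rule AE_I2)
      fix z :: 'a
      have "s \<longlonglongrightarrow> 0" unfolding s_def by (rule LIMSEQ_Suc[OF lim_1_over_n])
      then have "(\<lambda>i. s i *\<^sub>R z) \<longlonglongrightarrow> 0 *\<^sub>R z" by (intro tendsto_intros)
      then have "(\<lambda>i. shift_dist f (s i *\<^sub>R z)) \<longlonglongrightarrow> 0"
        using shift_continuous_L2[OF assms] unfolding shift_continuous_def by simp
      then have "(\<lambda>i. ennreal (gauss 1 z / 2) * shift_dist f (s i *\<^sub>R z)) \<longlonglongrightarrow> ennreal (gauss 1 z / 2) * 0"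
        by (intro ennreal_tendsto_cmult) auto
      then show "(\<lambda>i. ennreal (gauss 1 z / 2) * shift_dist f (s i *\<^sub>R z)) \<longlonglongrightarrow> 0" by simp
    qed
  qed measurable
  then show ?thesis unfolding eq[unfolded s_def] s_def by simp
qed

text \<open>The limit \<open>t \<rightarrow> 0\<close> of the heat identity: monotone convergence in frequency, while the translation
  term tends to \<open>0\<close>.\<close>

lemma plancherel_integrable:
  fixes f :: "'a::euclidean_space \<Rightarrow> complex"
  assumes f: "integrable lborel f" and f2: "sqn lborel f < \<infinity>"
  shows "sqn lborel (fourier_integral f) = sqn lborel f"
proof -
  note borel_measurable_integrable[OF f, simplified, measurable]
  define t where "t n = (1 / real (Suc n))\<^sup>2" for n
  have t: "0 < t n" for n by (simp add: t_def)
  define G where "G n \<xi> = ennreal (exp (- t n * (norm \<xi>)\<^sup>2)) * ennreal ((norm (fourier_integral f \<xi>))\<^sup>2)" for n \<xi>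
  have [measurable]: "G n \<in> borel_measurable borel" for n unfolding G_def by measurable
  have lim: "(\<lambda>n. integral\<^sup>N lborel (G n)) \<longlonglongrightarrow> sqn lborel (fourier_integral f)"
    unfolding sqn_def
  proof (rule nn_integral_LIMSEQ)
    show "incseq G"
    proof (intro incseq_SucI le_funI)
      fix n and \<xi> :: 'a
      have "t (Suc n) \<le> t n" unfolding t_def by (intro power_mono) (auto simp: frac_le)
      then show "G n \<xi> \<le> G (Suc n) \<xi>"
        unfolding G_def by (intro mult_right_mono ennreal_leI) (auto intro: mult_right_mono)
    qed
    show "(\<lambda>n. G n \<xi>) \<longlonglongrightarrow> ennreal ((norm (fourier_integral f \<xi>))\<^sup>2)" for \<xi>
    proof -
      have "t \<longlonglongrightarrow> 0\<^sup>2" unfolding t_def by (intro tendsto_power LIMSEQ_Suc[OF lim_1_over_n])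
      then have "(\<lambda>n. exp (- t n * (norm \<xi>)\<^sup>2) * (norm (fourier_integral f \<xi>))\<^sup>2) \<longlonglongrightarrow> exp (- 0 * (norm \<xi>)\<^sup>2) * (norm (fourier_integral f \<xi>))\<^sup>2"
        by (intro tendsto_intros) simp
      then have "(\<lambda>n. ennreal (exp (- t n * (norm \<xi>)\<^sup>2) * (norm (fourier_integral f \<xi>))\<^sup>2)) \<longlonglongrightarrow> ennreal (exp (- 0 * (norm \<xi>)\<^sup>2) * (norm (fourier_integral f \<xi>))\<^sup>2)"
        by (rule tendsto_ennrealI)
      then show ?thesis unfolding G_def by (simp add: ennreal_mult)
    qed
  qed measurable
  have "(\<lambda>n. integral\<^sup>N lborel (G n) + (\<integral>\<^sup>+h. ennreal (gauss (t n) h / 2) * shift_dist f h \<partial>lborel))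
      \<longlonglongrightarrow> sqn lborel (fourier_integral f) + 0"
    using gauss_shift_tendsto_0[OF _ f2] unfolding t_def[symmetric] by (intro tendsto_add lim) simp
  moreover have "integral\<^sup>N lborel (G n) + (\<integral>\<^sup>+h. ennreal (gauss (t n) h / 2) * shift_dist f h \<partial>lborel) = sqn lborel f" for n
    unfolding G_def by (rule heat_identity[OF f f2 t])
  ultimately have "(\<lambda>n::nat. sqn lborel f) \<longlonglongrightarrow> sqn lborel (fourier_integral f)" by simp
  then show ?thesis by (simp add: LIMSEQ_const_iff)
qed

lemma L2_iff: "f \<in> L2 \<longleftrightarrow> f \<in> borel_measurable borel \<and> sqn lborel f < \<infinity>"
  unfolding L2_def sqn_def by (auto simp: integrable_iff_bounded)

lemma L2D:
  assumes "f \<in> L2"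
  shows "f \<in> borel_measurable borel" "sqn lborel f < \<infinity>"
  using assms by (simp_all only: L2_iff)

lemma sqn_eq_L2_norm:
  assumes "f \<in> L2"
  shows "sqn lborel f = ennreal ((L2_norm f)\<^sup>2)"
proof -
  have i: "integrable lborel (\<lambda>x. (norm (f x))\<^sup>2)" using assms by (simp add: L2_def)
  have "sqn lborel f = ennreal (LINT x|lborel. (norm (f x))\<^sup>2)"
    unfolding sqn_def by (rule nn_integral_eq_integral[OF i]) simp
  also have "(LINT x|lborel. (norm (f x))\<^sup>2) = (L2_norm f)\<^sup>2"
    unfolding L2_norm_def by (simp add: integral_nonneg_AE)
  finally show ?thesis .
qed

lemma L2_norm_nonneg [simp]: "0 \<le> L2_norm f"
  by (simp add: L2_norm_def integral_nonneg_AE)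

lemma L2_diff: "f \<in> L2 \<Longrightarrow> g \<in> L2 \<Longrightarrow> (\<lambda>x. f x - g x) \<in> L2"
  using sqn_diff_le[of f lborel g] unfolding L2_iff
  by (auto intro: le_less_trans simp: ennreal_mult_less_top ennreal_add_less_top)

text \<open>The truncation through which the Fourier transform on \<open>L\<^sup>2\<close> is defined.\<close>

definition truncate :: "real \<Rightarrow> ('a::euclidean_space \<Rightarrow> complex) \<Rightarrow> 'a \<Rightarrow> complex" where
  "truncate R f = (\<lambda>x. indicator (cball 0 R) x *\<^sub>R f x)"

lemma truncate_measurable [measurable]:
  assumes [measurable]: "f \<in> borel_measurable borel"
  shows "truncate R f \<in> borel_measurable borel"
proof -
  have [measurable]: "cball 0 R \<in> sets (borel :: 'a::euclidean_space measure)" by simp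
  show ?thesis unfolding truncate_def by measurable
qed

lemma truncate_integrable:
  fixes f :: "'a::euclidean_space \<Rightarrow> complex"
  assumes f: "f \<in> L2"
  shows "integrable lborel (truncate R f)" "sqn lborel (truncate R f) < \<infinity>"
proof -
  note L2D(1)[OF f, measurable]
  have "integrable lborel (\<lambda>x::'a. indicator (cball 0 R) x + (norm (f x))\<^sup>2)"
    using f by (intro Bochner_Integration.integrable_add integrable_real_indicator)
      (use emeasure_bounded_finite[OF bounded_cball[of "0::'a" R]] in \<open>auto simp: L2_def\<close>)
  then show "integrable lborel (truncate R f)"
  proof (rule Bochner_Integration.integrable_bound)
    have "norm (f x) \<le> 1 + (norm (f x))\<^sup>2" for x
    proof -
      have "2 * norm (f x) \<le> (norm (f x))\<^sup>2 + 1" using sum_squares_bound[of "norm (f x)" 1] by simp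
      with norm_ge_zero[of "f x"] show ?thesis by linarith
    qed
    then show "AE x in lborel. norm (truncate R f x) \<le> norm (indicator (cball 0 R) x + (norm (f x))\<^sup>2)"
      by (auto simp: truncate_def indicator_def)
  qed measurable
  have "sqn lborel (truncate R f) \<le> sqn lborel f"
    unfolding sqn_def truncate_def by (intro nn_integral_mono ennreal_leI) (auto simp: indicator_def)
  then show "sqn lborel (truncate R f) < \<infinity>" using L2D(2)[OF f] by (rule le_less_trans)
qed

lemma truncate_tendsto:
  fixes f :: "'a::euclidean_space \<Rightarrow> complex"
  assumes f: "f \<in> L2"
  shows "((\<lambda>R. sqn lborel (\<lambda>x. truncate R f x - f x)) \<longlongrightarrow> 0) at_top"
proof -
  note L2D(1)[OF f, measurable]
  have seq: "(\<lambda>n. sqn lborel (\<lambda>x. truncate (real n) f x - f x)) \<longlonglongrightarrow> (\<integral>\<^sup>+x. 0 \<partial>(lborel :: 'a measure))"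
    unfolding sqn_def
  proof (rule nn_integral_dominated_convergence[where w="\<lambda>x. ennreal ((norm (f x))\<^sup>2)"])
    show "AE x in lborel. ennreal ((norm (truncate (real j) f x - f x))\<^sup>2) \<le> ennreal ((norm (f x))\<^sup>2)" for j
      by (auto simp: truncate_def indicator_def)
    show "(\<integral>\<^sup>+x. ennreal ((norm (f x))\<^sup>2) \<partial>lborel) < \<infinity>"
      using L2D(2)[OF f] by (simp add: sqn_def)
    show "AE x in lborel. (\<lambda>j. ennreal ((norm (truncate (real j) f x - f x))\<^sup>2)) \<longlonglongrightarrow> 0"
    proof (rule AE_I2)
      fix x :: 'a
      obtain k :: nat where "norm x \<le> real k" using real_arch_simple by blast
      then have "\<forall>\<^sub>F j in sequentially. ennreal ((norm (truncate (real j) f x - f x))\<^sup>2) = 0"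
        by (intro eventually_sequentiallyI[of k]) (auto simp: truncate_def indicator_def)
      then show "(\<lambda>j. ennreal ((norm (truncate (real j) f x - f x))\<^sup>2)) \<longlonglongrightarrow> 0"
        by (rule tendsto_eventually)
    qed
  qed measurable
  have mono: "sqn lborel (\<lambda>x. truncate R f x - f x) \<le> sqn lborel (\<lambda>x. truncate R' f x - f x)" if "R' \<le> R" for R R'
    unfolding sqn_def using that by (intro nn_integral_mono ennreal_leI) (auto simp: truncate_def indicator_def)
  show ?thesis
  proof (rule ennreal_tendsto_0I)
    fix e :: real assume "0 < e"
    with seq obtain n where "sqn lborel (\<lambda>x. truncate (real n) f x - f x) \<le> ennreal e"
      using ennreal_tendsto_0D[of "\<lambda>n. sqn lborel (\<lambda>x. truncate (real n) f x - f x)" sequentially e]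
      by (auto simp: eventually_sequentially)
    then show "\<forall>\<^sub>F R in at_top. sqn lborel (\<lambda>x. truncate R f x - f x) \<le> ennreal e"
      using mono order_trans by (intro eventually_at_top_linorderI[of "real n"]) blast
  qed
qed

lemma fourier_integral_diff:
  assumes f: "integrable lborel f" and g: "integrable lborel g"
  shows "fourier_integral (\<lambda>x. f x - g x) \<xi> = fourier_integral f \<xi> - fourier_integral g \<xi>"
proof -
  have i: "integrable lborel (\<lambda>x. cis (- (x \<bullet> \<xi>)) * h x)" if "integrable lborel h" for h
    using integrable_cis_mult[OF that, of "-1" \<xi>] by simp
  have "(LINT x|lborel. cis (- (x \<bullet> \<xi>)) * (f x - g x)) = (LINT x|lborel. cis (- (x \<bullet> \<xi>)) * f x) - (LINT x|lborel. cis (- (x \<bullet> \<xi>)) * g x)"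
    unfolding right_diff_distrib by (rule Bochner_Integration.integral_diff[OF i[OF f] i[OF g]])
  then show ?thesis unfolding fourier_integral_def by (simp only: scaleR_diff_right)
qed

lemma sqn_fourier_integral_diff:
  fixes f g :: "'a::euclidean_space \<Rightarrow> complex"
  assumes f: "integrable lborel f" "sqn lborel f < \<infinity>" and g: "integrable lborel g" "sqn lborel g < \<infinity>"
  shows "sqn lborel (\<lambda>\<xi>. fourier_integral f \<xi> - fourier_integral g \<xi>) = sqn lborel (\<lambda>x. f x - g x)"
proof -
  have m: "f \<in> borel_measurable lborel" "g \<in> borel_measurable lborel" using f g by (auto intro: borel_measurable_integrable)
  have fin: "sqn lborel (\<lambda>x. f x - g x) < \<infinity>"
    using sqn_diff_le[OF m] f(2) g(2) by (auto intro: le_less_trans simp: ennreal_mult_less_top ennreal_add_less_top)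
  have "sqn lborel (fourier_integral (\<lambda>x. f x - g x)) = sqn lborel (\<lambda>x. f x - g x)"
    by (rule plancherel_integrable[OF Bochner_Integration.integrable_diff[OF f(1) g(1)] fin])
  moreover have "fourier_integral (\<lambda>x. f x - g x) = (\<lambda>\<xi>. fourier_integral f \<xi> - fourier_integral g \<xi>)"
    by (rule ext) (rule fourier_integral_diff[OF f(1) g(1)])
  ultimately show ?thesis by simp
qed

lemma sqn_triangle3:
  fixes f g h :: "'x \<Rightarrow> 'v::{real_normed_vector,second_countable_topology}"
  assumes [measurable]: "f \<in> borel_measurable M" "g \<in> borel_measurable M" "h \<in> borel_measurable M"
  shows "sqn M (\<lambda>x. f x - g x) \<le> 2 * sqn M (\<lambda>x. f x - h x) + 2 * sqn M (\<lambda>x. h x - g x)"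
  using sqn_add_le[of "\<lambda>x. f x - h x" M "\<lambda>x. h x - g x"] by simp

text \<open>By Plancherel's identity for integrable functions the transforms of the truncations are Cauchy.\<close>

lemma fourier_exists:
  fixes f :: "'a::euclidean_space \<Rightarrow> complex"
  assumes f: "f \<in> L2"
  shows "\<exists>g. is_fourier_transform f g"
proof -
  note L2D(1)[OF f, measurable]
  let ?F = "\<lambda>R. fourier_integral (truncate R f)"
  have FF: "sqn lborel (\<lambda>\<xi>. ?F R \<xi> - ?F R' \<xi>) \<le> 2 * sqn lborel (\<lambda>x. truncate R f x - f x) + 2 * sqn lborel (\<lambda>x. truncate R' f x - f x)" for R R'
    unfolding sqn_fourier_integral_diff[OF truncate_integrable[OF f] truncate_integrable[OF f]]
    using sqn_triangle3[of "truncate R f" lborel "truncate R' f" f]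
    by (simp add: sqn_diff_commute[of lborel f "truncate R' f"])
  have small: "\<exists>K. \<forall>R\<ge>K. sqn lborel (\<lambda>x. truncate R f x - f x) \<le> ennreal e" if "0 < e" for e
    using ennreal_tendsto_0D[OF truncate_tendsto[OF f] that] by (simp add: eventually_at_top_linorder)
  have FF': "\<exists>K. \<forall>R\<ge>K. \<forall>R'\<ge>K. sqn lborel (\<lambda>\<xi>. ?F R \<xi> - ?F R' \<xi>) \<le> ennreal e" if e: "0 < e" for e
  proof -
    obtain K where K: "\<And>R. R \<ge> K \<Longrightarrow> sqn lborel (\<lambda>x. truncate R f x - f x) \<le> ennreal (e / 4)"
      using small[of "e / 4"] e by auto
    have "sqn lborel (\<lambda>\<xi>. ?F R \<xi> - ?F R' \<xi>) \<le> ennreal e" if "R \<ge> K" "R' \<ge> K" for R R'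
    proof -
      have "sqn lborel (\<lambda>\<xi>. ?F R \<xi> - ?F R' \<xi>) \<le> 2 * ennreal (e / 4) + 2 * ennreal (e / 4)"
        by (rule order_trans[OF FF]) (intro add_mono mult_left_mono K that, auto)
      also have "\<dots> = ennreal e" using e by (simp add: numeral_mult_ennreal flip: ennreal_plus)
      finally show ?thesis .
    qed
    then show ?thesis by blast
  qed
  have ca: "\<exists>N. \<forall>m\<ge>N. \<forall>n\<ge>N. sqn lborel (\<lambda>\<xi>. ?F (real m) \<xi> - ?F (real n) \<xi>) \<le> ennreal e" if e: "0 < e" for e
  proof -
    obtain K where K: "\<And>R R'. R \<ge> K \<Longrightarrow> R' \<ge> K \<Longrightarrow> sqn lborel (\<lambda>\<xi>. ?F R \<xi> - ?F R' \<xi>) \<le> ennreal e"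
      using FF'[OF e] by blast
    obtain N :: nat where "K \<le> real N" using real_arch_simple by blast
    then show ?thesis using K by (meson of_nat_le_iff order_trans)
  qed
  have Fm: "?F (real n) \<in> borel_measurable lborel" for n by measurable
  obtain g and r :: "nat \<Rightarrow> nat" where g: "g \<in> borel_measurable lborel" and "strict_mono r"
      and "AE \<xi> in lborel. (\<lambda>n. ?F (real (r n)) \<xi>) \<longlonglongrightarrow> g \<xi>"
      and lim: "(\<lambda>n. sqn lborel (\<lambda>\<xi>. ?F (real n) \<xi> - g \<xi>)) \<longlonglongrightarrow> 0"
    by (rule sqn_complete[of "\<lambda>n. ?F (real n)" lborel, OF Fm ca])
  have [measurable]: "g \<in> borel_measurable borel" using g by simp
  have *: "((\<lambda>R. sqn lborel (\<lambda>\<xi>. ?F R \<xi> - g \<xi>)) \<longlongrightarrow> 0) at_top"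
  proof (rule ennreal_tendsto_0I)
    fix e :: real assume e: "0 < e"
    obtain K where K: "\<And>R R'. R \<ge> K \<Longrightarrow> R' \<ge> K \<Longrightarrow> sqn lborel (\<lambda>\<xi>. ?F R \<xi> - ?F R' \<xi>) \<le> ennreal (e / 4)"
      using FF'[of "e / 4"] e by auto
    obtain N :: nat where N: "\<And>n. n \<ge> N \<Longrightarrow> sqn lborel (\<lambda>\<xi>. ?F (real n) \<xi> - g \<xi>) \<le> ennreal (e / 4)"
      using ennreal_tendsto_0D[OF lim, of "e / 4"] e by (auto simp: eventually_sequentially)
    obtain N' :: nat where N': "K \<le> real N'" using real_arch_simple by blast
    define n where "n = max N N'"
    have "sqn lborel (\<lambda>\<xi>. ?F R \<xi> - g \<xi>) \<le> ennreal e" if "R \<ge> K" for R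
    proof -
      have "sqn lborel (\<lambda>\<xi>. ?F R \<xi> - g \<xi>) \<le> 2 * sqn lborel (\<lambda>\<xi>. ?F R \<xi> - ?F (real n) \<xi>) + 2 * sqn lborel (\<lambda>\<xi>. ?F (real n) \<xi> - g \<xi>)"
        by (rule sqn_triangle3) measurable
      also have "\<dots> \<le> 2 * ennreal (e / 4) + 2 * ennreal (e / 4)"
        using N' by (intro add_mono mult_left_mono K N that) (auto simp: n_def)
      also have "\<dots> = ennreal e" using e by (simp add: numeral_mult_ennreal flip: ennreal_plus)
      finally show ?thesis .
    qed
    then show "\<forall>\<^sub>F R in at_top. sqn lborel (\<lambda>\<xi>. ?F R \<xi> - g \<xi>) \<le> ennreal e"
      by (intro eventually_at_top_linorderI[of K]) blast
  qed
  have fin: "sqn lborel g < \<infinity>"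
  proof -
    obtain n :: nat where n: "sqn lborel (\<lambda>\<xi>. ?F (real n) \<xi> - g \<xi>) \<le> ennreal 1"
      using ennreal_tendsto_0D[OF lim, of 1] by (auto simp: eventually_sequentially)
    have "sqn lborel (\<lambda>\<xi>. ?F (real n) \<xi> - (?F (real n) \<xi> - g \<xi>)) \<le> 2 * sqn lborel (?F (real n)) + 2 * sqn lborel (\<lambda>\<xi>. ?F (real n) \<xi> - g \<xi>)"
      by (rule sqn_diff_le) measurable
    also have "\<dots> < \<infinity>"
      using le_less_trans[OF n] truncate_integrable(2)[OF f, of "real n"] plancherel_integrable[OF truncate_integrable[OF f], of "real n"]
      by (simp add: ennreal_mult_less_top ennreal_add_less_top)
    finally show ?thesis by simp
  qed
  show ?thesis
    unfolding is_fourier_transform_def using * fin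
    by (intro exI[of _ g] conjI) (simp_all add: L2_iff sqn_def truncate_def)
qed

lemma fourier_L2:
  assumes "f \<in> L2"
  shows "fourier f \<in> L2"
    and fourier_limit: "((\<lambda>R. sqn lborel (\<lambda>\<xi>. fourier_integral (truncate R f) \<xi> - fourier f \<xi>)) \<longlongrightarrow> 0) at_top"
proof -
  have "is_fourier_transform f (fourier f)"
    unfolding fourier_def by (rule someI_ex[OF fourier_exists[OF assms]])
  then show "fourier f \<in> L2" "((\<lambda>R. sqn lborel (\<lambda>\<xi>. fourier_integral (truncate R f) \<xi> - fourier f \<xi>)) \<longlongrightarrow> 0) at_top"
    unfolding is_fourier_transform_def sqn_def truncate_def by auto
qed

theorem plancherel:
  fixes f :: "'a::euclidean_space \<Rightarrow> complex"
  assumes f: "f \<in> L2"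
  shows "sqn lborel (fourier f) = sqn lborel f"
proof -
  note L2D(1)[OF f, measurable] L2D(1)[OF fourier_L2(1)[OF f], measurable]
  have "((\<lambda>R. sqn lborel (fourier_integral (truncate R f))) \<longlongrightarrow> sqn lborel (fourier f)) at_top"
    using L2D(2)[OF fourier_L2(1)[OF f]] by (intro sqn_tendsto fourier_limit f) measurable
  moreover have "((\<lambda>R. sqn lborel (truncate R f)) \<longlongrightarrow> sqn lborel f) at_top"
    using L2D(2)[OF f] by (intro sqn_tendsto truncate_tendsto f) measurable
  ultimately show ?thesis
    unfolding plancherel_integrable[OF truncate_integrable[OF f]]
    using tendsto_unique trivial_limit_at_top_linorder by blast
qed

section \<open>Surjectivity of the Fourier transform\<close>

lemma L2_norm_alt: "f \<in> L2 \<Longrightarrow> L2_norm f = sqrt (enn2real (sqn lborel f))"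
  by (simp add: sqn_eq_L2_norm)

lemma ennreal_power2_le_imp_le:
  assumes "(x::ennreal)\<^sup>2 \<le> (ennreal c)\<^sup>2" "0 \<le> c"
  shows "x \<le> ennreal c"
proof (cases x)
  case (real r)
  with assms have "r\<^sup>2 \<le> c\<^sup>2" by (simp add: ennreal_power ennreal_le_iff)
  then have "r \<le> c" using assms(2) by (rule power2_le_imp_le)
  then show ?thesis using real by (simp add: ennreal_leI)
next
  case top
  then show ?thesis using assms by (simp add: ennreal_power top_unique)
qed

lemma L2_prod:
  fixes a b :: "'a::euclidean_space \<Rightarrow> complex"
  assumes a: "a \<in> L2" and b: "b \<in> L2"
  shows "integrable lborel (\<lambda>x. a x * b x)"
    and "norm (LINT x|lborel. a x * b x) \<le> L2_norm a * L2_norm b"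
proof -
  note [measurable] = L2D(1)[OF a] L2D(1)[OF b]
  have "(\<integral>\<^sup>+x. ennreal (norm (a x)) * ennreal (norm (b x)) \<partial>lborel)\<^sup>2
      \<le> (\<integral>\<^sup>+x. (ennreal (norm (a x)))\<^sup>2 \<partial>lborel) * (\<integral>\<^sup>+x. (ennreal (norm (b x)))\<^sup>2 \<partial>lborel)"
    by (rule Cauchy_Schwarz_nn_integral) measurable
  also have "\<dots> = ennreal ((L2_norm a)\<^sup>2) * ennreal ((L2_norm b)\<^sup>2)"
    using sqn_eq_L2_norm[OF a] sqn_eq_L2_norm[OF b] by (simp add: sqn_def ennreal_power)
  also have "\<dots> = (ennreal (L2_norm a * L2_norm b))\<^sup>2"
    by (simp add: ennreal_power power_mult_distrib ennreal_mult)
  finally have "(\<integral>\<^sup>+x. ennreal (norm (a x * b x)) \<partial>lborel)\<^sup>2 \<le> (ennreal (L2_norm a * L2_norm b))\<^sup>2"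
    by (simp add: norm_mult ennreal_mult)
  then have le: "(\<integral>\<^sup>+x. ennreal (norm (a x * b x)) \<partial>lborel) \<le> ennreal (L2_norm a * L2_norm b)"
    by (rule ennreal_power2_le_imp_le) simp
  show i: "integrable lborel (\<lambda>x. a x * b x)"
    using le_less_trans[OF le] by (intro integrableI_bounded) auto
  have "ennreal (norm (LINT x|lborel. a x * b x)) \<le> ennreal (L2_norm a * L2_norm b)"
    by (rule order_trans[OF integral_norm_bound_ennreal[OF i] le])
  then show "norm (LINT x|lborel. a x * b x) \<le> L2_norm a * L2_norm b"
    by (simp add: ennreal_le_iff)
qed

lemma L2_prod_tendsto:
  fixes a b :: "'a::euclidean_space \<Rightarrow> complex"
  assumes L2: "\<And>n. a' n \<in> L2" "\<And>n. b' n \<in> L2" "a \<in> L2" "b \<in> L2"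
    and lim: "((\<lambda>n. sqn lborel (\<lambda>x. a' n x - a x)) \<longlongrightarrow> 0) \<F>" "((\<lambda>n. sqn lborel (\<lambda>x. b' n x - b x)) \<longlongrightarrow> 0) \<F>"
  shows "((\<lambda>n. LINT x|lborel. a' n x * b' n x) \<longlongrightarrow> (LINT x|lborel. a x * b x)) \<F>"
proof -
  have to0: "((\<lambda>n. L2_norm (\<lambda>x. f n x - g x)) \<longlongrightarrow> 0) \<F>"
    if "\<And>n. f n \<in> L2" "g \<in> L2" "((\<lambda>n. sqn lborel (\<lambda>x. f n x - g x)) \<longlongrightarrow> 0) \<F>" for f :: "_ \<Rightarrow> 'a \<Rightarrow> complex" and g
  proof -
    have "((\<lambda>n. enn2real (sqn lborel (\<lambda>x. f n x - g x))) \<longlongrightarrow> enn2real 0) \<F>"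
      by (rule tendsto_enn2real) (use that(3) in simp_all)
    then have "((\<lambda>n. sqrt (enn2real (sqn lborel (\<lambda>x. f n x - g x)))) \<longlongrightarrow> 0) \<F>"
      using tendsto_real_sqrt by fastforce
    then show ?thesis by (simp only: L2_norm_alt[OF L2_diff[OF that(1,2)]])
  qed
  have b'': "((\<lambda>n. L2_norm (b' n)) \<longlongrightarrow> L2_norm b) \<F>"
  proof (rule LIM_zero_cancel, rule Lim_null_comparison)
    show "((\<lambda>n. L2_norm (\<lambda>x. b' n x - b x)) \<longlongrightarrow> 0) \<F>" by (rule to0[OF L2(2,4) lim(2)])
    show "\<forall>\<^sub>F n in \<F>. norm (L2_norm (b' n) - L2_norm b) \<le> L2_norm (\<lambda>x. b' n x - b x)"
      unfolding L2_norm_alt[OF L2_diff[OF L2(2,4)]] L2_norm_alt[OF L2(2)] L2_norm_alt[OF L2(4)] real_norm_def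
      by (intro always_eventually allI sqn_diff_norms L2D(2) L2) (use L2D(1)[OF L2(2)] L2D(1)[OF L2(4)] in simp_all)
  qed
  show ?thesis
  proof (rule LIM_zero_cancel, rule Lim_null_comparison)
    show "((\<lambda>n. L2_norm (\<lambda>x. a' n x - a x) * L2_norm (b' n) + L2_norm a * L2_norm (\<lambda>x. b' n x - b x)) \<longlongrightarrow> 0) \<F>"
      using tendsto_add[OF tendsto_mult[OF to0[OF L2(1,3) lim(1)] b''] tendsto_mult[OF tendsto_const to0[OF L2(2,4) lim(2)]]]
      by simp
    have "norm ((LINT x|lborel. a' n x * b' n x) - (LINT x|lborel. a x * b x))
        \<le> L2_norm (\<lambda>x. a' n x - a x) * L2_norm (b' n) + L2_norm a * L2_norm (\<lambda>x. b' n x - b x)" for n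
    proof -
      have "(LINT x|lborel. a' n x * b' n x) - (LINT x|lborel. a x * b x) =
        (LINT x|lborel. (a' n x * b' n x - a x * b x))"
        by (rule Bochner_Integration.integral_diff[symmetric]) (intro L2_prod L2)+
      also have "\<dots> = (LINT x|lborel. ((a' n x - a x) * b' n x + a x * (b' n x - b x)))"
        by (simp add: algebra_simps)
      also have "\<dots> = (LINT x|lborel. (a' n x - a x) * b' n x) + (LINT x|lborel. a x * (b' n x - b x))"
        by (rule Bochner_Integration.integral_add) (intro L2_prod L2_diff L2)+
      finally have eq: "(LINT x|lborel. a' n x * b' n x) - (LINT x|lborel. a x * b x) =
        (LINT x|lborel. (a' n x - a x) * b' n x) + (LINT x|lborel. a x * (b' n x - b x))" .
      show ?thesis
        unfolding eq by (intro order_trans[OF norm_triangle_ineq add_mono] L2_prod L2_diff L2)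
    qed
    then show "\<forall>\<^sub>F n in \<F>. norm ((LINT x|lborel. a' n x * b' n x) - (LINT x|lborel. a x * b x))
        \<le> L2_norm (\<lambda>x. a' n x - a x) * L2_norm (b' n) + L2_norm a * L2_norm (\<lambda>x. b' n x - b x)"
      by (intro always_eventually allI)
  qed
qed

lemma truncate_L2: "f \<in> L2 \<Longrightarrow> truncate R f \<in> L2"
  unfolding L2_iff[of "truncate R f"]
  by (intro conjI truncate_integrable(2) truncate_measurable L2D(1))

text \<open>Both sides are continuous in \<open>L\<^sup>2\<close>, so the formula passes to the limit from the truncations.\<close>

lemma fourier_multiplication_formula:
  fixes f g :: "'a::euclidean_space \<Rightarrow> complex"
  assumes f: "f \<in> L2" and g: "g \<in> L2"
  shows "(LINT \<xi>|lborel. fourier f \<xi> * g \<xi>) = (LINT x|lborel. f x * fourier g x)"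
proof -
  have FL2: "fourier_integral (truncate R h) \<in> L2" if "h \<in> L2" for h :: "'a \<Rightarrow> complex" and R
    using plancherel_integrable[OF truncate_integrable[OF that], of R] truncate_integrable(2)[OF that, of R] L2D(1)[OF that]
    by (simp add: L2_iff)
  have eq: "(LINT \<xi>|lborel. fourier_integral (truncate R f) \<xi> * truncate R g \<xi>)
      = (LINT x|lborel. truncate R f x * fourier_integral (truncate R g) x)" for R
  proof -
    let ?c = "complex_of_real ((2 * pi) powr (- real DIM('a) / 2))"
    have F1: "fourier_integral h \<xi> = ?c * (LINT x|lborel. cis (- 1 * (x \<bullet> \<xi>)) * h x)" for h and \<xi> :: 'a
      by (simp add: fourier_integral_def scaleR_conv_of_real)
    have "(LINT \<xi>|lborel. fourier_integral (truncate R f) \<xi> * truncate R g \<xi>) =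
        (LINT \<xi>|lborel. ?c * (truncate R g \<xi> * (LINT x|lborel. cis (- 1 * (x \<bullet> \<xi>)) * truncate R f x)))"
      unfolding F1 by (simp only: mult_ac)
    also have "\<dots> = ?c * (LINT x|lborel. truncate R f x * (LINT \<xi>|lborel. cis (- 1 * (x \<bullet> \<xi>)) * truncate R g \<xi>))"
      unfolding integral_mult_right_zero
      by (simp only: cis_multiplication_formula[OF truncate_integrable(1)[OF f] truncate_integrable(1)[OF g]])
    also have "\<dots> = (LINT x|lborel. ?c * (truncate R f x * (LINT \<xi>|lborel. cis (- 1 * (x \<bullet> \<xi>)) * truncate R g \<xi>)))"
      by (rule integral_mult_right_zero[symmetric])
    also have "\<dots> = (LINT x|lborel. truncate R f x * fourier_integral (truncate R g) x)"
    proof (rule Bochner_Integration.integral_cong[OF refl])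
      fix x :: 'a
      have "(LINT \<xi>|lborel. cis (- 1 * (x \<bullet> \<xi>)) * truncate R g \<xi>) = (LINT \<xi>|lborel. cis (- 1 * (\<xi> \<bullet> x)) * truncate R g \<xi>)"
        by (simp only: inner_commute)
      then show "?c * (truncate R f x * (LINT \<xi>|lborel. cis (- 1 * (x \<bullet> \<xi>)) * truncate R g \<xi>)) = truncate R f x * fourier_integral (truncate R g) x"
        unfolding F1 by (simp only: mult_ac)
    qed
    finally show ?thesis .
  qed
  have "((\<lambda>R. LINT \<xi>|lborel. fourier_integral (truncate R f) \<xi> * truncate R g \<xi>) \<longlongrightarrow> (LINT \<xi>|lborel. fourier f \<xi> * g \<xi>)) at_top"
    by (intro L2_prod_tendsto FL2 truncate_L2 fourier_L2(1) f g fourier_limit truncate_tendsto)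
  moreover have "((\<lambda>R. LINT x|lborel. truncate R f x * fourier_integral (truncate R g) x) \<longlongrightarrow> (LINT x|lborel. f x * fourier g x)) at_top"
    by (intro L2_prod_tendsto FL2 truncate_L2 fourier_L2(1) f g fourier_limit truncate_tendsto)
  ultimately show ?thesis
    unfolding eq using tendsto_unique trivial_limit_at_top_linorder by blast
qed

text \<open>By the multiplication formula the adjoint of the Fourier transform is its conjugate
  \<open>g \<mapsto> cnj (fourier (cnj g))\<close>, again an isometry; an isometry whose adjoint is isometric is
  surjective.\<close>

lemma fourier_surj:
  fixes g :: "'a::euclidean_space \<Rightarrow> complex"
  assumes g: "g \<in> L2"
  shows "\<exists>w\<in>L2. AE \<xi> in lborel. fourier w \<xi> = g \<xi>"
proof -
  have cL2: "(\<lambda>x. cnj (h x)) \<in> L2" and cn: "sqn lborel (\<lambda>x. cnj (h x)) = sqn lborel h" if "h \<in> L2" for h :: "'a \<Rightarrow> complex"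
  proof -
    note [measurable] = L2D(1)[OF that]
    show "sqn lborel (\<lambda>x. cnj (h x)) = sqn lborel h" by (simp add: sqn_def)
    have "(\<lambda>x. cnj (h x)) \<in> borel_measurable borel" by measurable
    then show "(\<lambda>x. cnj (h x)) \<in> L2" using L2D(2)[OF that] by (simp add: L2_iff sqn_def)
  qed
  have nn: "(LINT x|lborel. h x * cnj (h x)) = of_real (enn2real (sqn lborel h))" if h: "h \<in> L2" for h :: "'a \<Rightarrow> complex"
  proof -
    have "(LINT x|lborel. h x * cnj (h x)) = of_real (LINT x|lborel. (norm (h x))\<^sup>2)"
      by (simp add: complex_norm_square[symmetric] flip: of_real_power)
    also have "(LINT x|lborel. (norm (h x))\<^sup>2) = enn2real (sqn lborel h)"
      unfolding sqn_def using L2D(1)[OF h] by (intro integral_eq_nn_integral) auto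
    finally show ?thesis .
  qed
  define w where "w x = cnj (fourier (\<lambda>y. cnj (g y)) x)" for x
  have w: "w \<in> L2" unfolding w_def by (intro cL2 fourier_L2 g)
  have wn: "sqn lborel w = sqn lborel g"
    unfolding w_def cn[OF fourier_L2(1)[OF cL2[OF g]]] plancherel[OF cL2[OF g]] cn[OF g] ..
  have Fw: "fourier w \<in> L2" "sqn lborel (fourier w) = sqn lborel w"
    by (rule fourier_L2[OF w], rule plancherel[OF w])
  let ?n = "complex_of_real (enn2real (sqn lborel g))"
  have 1: "(LINT \<xi>|lborel. fourier w \<xi> * cnj (g \<xi>)) = ?n"
  proof -
    have "(LINT \<xi>|lborel. fourier w \<xi> * cnj (g \<xi>)) = (LINT x|lborel. w x * fourier (\<lambda>y. cnj (g y)) x)"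
      by (rule fourier_multiplication_formula[OF w cL2[OF g]])
    also have "\<dots> = (LINT x|lborel. w x * cnj (w x))" by (simp add: w_def)
    finally show ?thesis using nn[OF w] wn by simp
  qed
  have 2: "(LINT \<xi>|lborel. g \<xi> * cnj (fourier w \<xi>)) = ?n"
  proof -
    have "(LINT \<xi>|lborel. g \<xi> * cnj (fourier w \<xi>)) = (LINT \<xi>|lborel. cnj (fourier w \<xi> * cnj (g \<xi>)))"
      by (simp add: mult.commute)
    also have "\<dots> = cnj (LINT \<xi>|lborel. fourier w \<xi> * cnj (g \<xi>))" by (rule Bochner_Integration.integral_cnj)
    finally show ?thesis using 1 by simp
  qed
  define d where "d \<xi> = fourier w \<xi> - g \<xi>" for \<xi>
  have d: "d \<in> L2" unfolding d_def by (rule L2_diff[OF Fw(1) g])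
  note p = L2_prod(1)[OF Fw(1) cL2[OF Fw(1)]] L2_prod(1)[OF g cL2[OF g]] L2_prod(1)[OF Fw(1) cL2[OF g]] L2_prod(1)[OF g cL2[OF Fw(1)]]
  have "(LINT \<xi>|lborel. d \<xi> * cnj (d \<xi>)) = (LINT \<xi>|lborel. (fourier w \<xi> * cnj (fourier w \<xi>) + g \<xi> * cnj (g \<xi>)) - (fourier w \<xi> * cnj (g \<xi>) + g \<xi> * cnj (fourier w \<xi>)))"
    by (simp add: d_def algebra_simps)
  also have "\<dots> = (?n + ?n) - (?n + ?n)"
    using p nn[OF Fw(1)] nn[OF g] Fw(2) wn by (simp add: 1 2)
  finally have "enn2real (sqn lborel d) = 0" using nn[OF d] by simp
  then have "sqn lborel d = 0" using L2D(2)[OF d] by (auto simp: enn2real_eq_0_iff)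
  then have "AE \<xi> in lborel. d \<xi> = 0" using sqn_eq_0_iff[of d lborel] L2D(1)[OF d] by simp
  then show ?thesis using w by (intro bexI[of _ w]) (auto simp: d_def)
qed

section \<open>The nonlocal form of fractional Sobolev norms\<close>

lemma heat_formula_integrable:
  fixes f :: "'a::euclidean_space \<Rightarrow> complex"
  assumes f: "integrable lborel f" "sqn lborel f < \<infinity>" and t: "0 < t"
  shows "(\<integral>\<^sup>+h. ennreal (gauss t h / 2) * shift_dist f h \<partial>lborel) =
    (\<integral>\<^sup>+\<xi>. ennreal (1 - exp (- t * (norm \<xi>)\<^sup>2)) * ennreal ((norm (fourier_integral f \<xi>))\<^sup>2) \<partial>lborel)"
    (is "?B = ?D")
proof -
  note borel_measurable_integrable[OF f(1), simplified, measurable]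
  let ?A = "\<integral>\<^sup>+\<xi>. ennreal (exp (- t * (norm \<xi>)\<^sup>2)) * ennreal ((norm (fourier_integral f \<xi>))\<^sup>2) \<partial>lborel"
  have "?A + ?D = sqn lborel (fourier_integral f)"
  proof -
    have "?A + ?D = (\<integral>\<^sup>+\<xi>. ennreal (exp (- t * (norm \<xi>)\<^sup>2)) * ennreal ((norm (fourier_integral f \<xi>))\<^sup>2)
        + ennreal (1 - exp (- t * (norm \<xi>)\<^sup>2)) * ennreal ((norm (fourier_integral f \<xi>))\<^sup>2) \<partial>lborel)"
      by (rule nn_integral_add[symmetric]) measurable
    also have "\<dots> = sqn lborel (fourier_integral f)"
      unfolding sqn_def
    proof (intro nn_integral_cong)
      fix \<xi> :: 'a
      have "exp (- t * (norm \<xi>)\<^sup>2) \<le> 1" using t by simp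
      then show "ennreal (exp (- t * (norm \<xi>)\<^sup>2)) * ennreal ((norm (fourier_integral f \<xi>))\<^sup>2)
        + ennreal (1 - exp (- t * (norm \<xi>)\<^sup>2)) * ennreal ((norm (fourier_integral f \<xi>))\<^sup>2) = ennreal ((norm (fourier_integral f \<xi>))\<^sup>2)"
        unfolding distrib_right[symmetric] by (subst ennreal_plus[symmetric]) auto
    qed
    finally show ?thesis .
  qed
  also have "\<dots> = sqn lborel f" by (rule plancherel_integrable[OF f])
  also have "\<dots> = ?A + ?B" by (rule heat_identity[OF f t, symmetric])
  finally have eq: "?A + ?D = ?A + ?B" .
  have "?A \<le> ?A + ?B" by simp
  also have "\<dots> < \<infinity>" using heat_identity[OF f t] f(2) by simp
  finally have "?A \<noteq> \<top>" by simp
  then show ?thesis using eq by (simp add: ennreal_add_left_cancel)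
qed

text \<open>The measure lives on pairs of an increment \<open>h\<close>, weighted by \<open>\<rho>\<close>, and a base point. It turns an average of
  translation distances into one square norm, so that Minkowski's inequality, Fatou's lemma and the Brezis--Lieb
  lemma apply to seminorms as they stand.\<close>

definition pair_measure :: "('a::euclidean_space \<Rightarrow> ennreal) \<Rightarrow> ('a \<times> 'a) measure" where
  "pair_measure \<rho> = density (lborel \<Otimes>\<^sub>M lborel) (\<lambda>z. \<rho> (fst z))"

definition increment :: "('a::euclidean_space \<Rightarrow> 'v::real_normed_vector) \<Rightarrow> 'a \<times> 'a \<Rightarrow> 'v" where
  "increment f z = f (snd z + fst z) - f (snd z)"

lemma increment_measurable [measurable]:
  fixes f :: "'a::euclidean_space \<Rightarrow> 'v::{real_normed_vector,second_countable_topology}"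
  assumes [measurable]: "f \<in> borel_measurable borel"
  shows "increment f \<in> borel_measurable (lborel \<Otimes>\<^sub>M lborel)" "increment f \<in> borel_measurable (pair_measure \<rho>)"
proof -
  show "increment f \<in> borel_measurable (lborel \<Otimes>\<^sub>M lborel)"
    unfolding increment_def by measurable
  then show "increment f \<in> borel_measurable (pair_measure \<rho>)" by (simp add: pair_measure_def)
qed

lemma sqn_increment:
  fixes f :: "'a::euclidean_space \<Rightarrow> 'v::{real_normed_vector,second_countable_topology}"
  assumes [measurable]: "f \<in> borel_measurable borel" "\<rho> \<in> borel_measurable borel"
  shows "sqn (pair_measure \<rho>) (increment f) = (\<integral>\<^sup>+h. \<rho> h * shift_dist f h \<partial>lborel)"
proof -
  have "sqn (pair_measure \<rho>) (increment f) = (\<integral>\<^sup>+z. \<rho> (fst z) * ennreal ((norm (increment f z))\<^sup>2) \<partial>(lborel \<Otimes>\<^sub>M lborel))"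
    unfolding sqn_def pair_measure_def by (rule nn_integral_density) measurable
  also have "\<dots> = (\<integral>\<^sup>+h. \<integral>\<^sup>+x. \<rho> h * ennreal ((norm (f (x + h) - f x))\<^sup>2) \<partial>lborel \<partial>lborel)"
    by (subst lborel.nn_integral_fst[symmetric]) (simp_all add: increment_def)
  also have "\<dots> = (\<integral>\<^sup>+h. \<rho> h * shift_dist f h \<partial>lborel)"
    unfolding shift_dist_def sqn_def by (intro nn_integral_cong nn_integral_cmult) measurable
  finally show ?thesis .
qed

text \<open>Both sides are square norms, dominated by the \<open>L\<^sup>2\<close> norm, of functions depending linearly on \<open>f\<close>, so the
  formula passes to the limit from the truncations.\<close>

lemma heat_formula:
  fixes f :: "'a::euclidean_space \<Rightarrow> complex"
  assumes f: "f \<in> L2" and t: "0 < t"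
  shows "(\<integral>\<^sup>+h. ennreal (gauss t h / 2) * shift_dist f h \<partial>lborel) =
    (\<integral>\<^sup>+\<xi>. ennreal (1 - exp (- t * (norm \<xi>)\<^sup>2)) * ennreal ((norm (fourier f \<xi>))\<^sup>2) \<partial>lborel)"
proof -
  note [measurable] = L2D(1)[OF f] L2D(1)[OF fourier_L2(1)[OF f]]
  let ?\<rho> = "\<lambda>h::'a. ennreal (gauss t h / 2)"
  let ?\<sigma> = "\<lambda>\<xi>::'a. ennreal (1 - exp (- t * (norm \<xi>)\<^sup>2))"
  let ?fR = "\<lambda>R. truncate R f"
  have \<rho>le: "(\<integral>\<^sup>+h. ?\<rho> h * shift_dist g h \<partial>lborel) \<le> 4 * sqn lborel g"
    if [measurable]: "g \<in> borel_measurable borel" for g :: "'a \<Rightarrow> complex"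
  proof -
    have "(\<integral>\<^sup>+h. ?\<rho> h * shift_dist g h \<partial>lborel) \<le> (\<integral>\<^sup>+h. ennreal (gauss t h) * (4 * sqn lborel g) \<partial>(lborel :: 'a measure))"
      by (intro nn_integral_mono mult_mono shift_dist_le ennreal_leI that) auto
    also have "\<dots> = 4 * sqn lborel g"
      by (subst nn_integral_multc) (simp_all add: gauss_integral[OF t])
    finally show ?thesis .
  qed
  have l1: "((\<lambda>R. sqn (pair_measure ?\<rho>) (increment (?fR R))) \<longlongrightarrow> sqn (pair_measure ?\<rho>) (increment f)) at_top"
  proof (rule sqn_tendsto)
    have "sqn (pair_measure ?\<rho>) (increment f) \<le> 4 * sqn lborel f"
      by (subst sqn_increment) (auto intro: \<rho>le)
    also have "\<dots> < \<infinity>" using L2D(2)[OF f] by (simp add: ennreal_mult_less_top)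
    finally show "sqn (pair_measure ?\<rho>) (increment f) < \<infinity>" .
    have "((\<lambda>R. 4 * sqn lborel (\<lambda>x. ?fR R x - f x)) \<longlongrightarrow> 4 * 0) at_top"
      by (intro ennreal_tendsto_cmult truncate_tendsto f) auto
    then have "((\<lambda>R. 4 * sqn lborel (\<lambda>x. ?fR R x - f x)) \<longlongrightarrow> 0) at_top" by simp
    then show "((\<lambda>R. sqn (pair_measure ?\<rho>) (\<lambda>z. increment (?fR R) z - increment f z)) \<longlongrightarrow> 0) at_top"
    proof (rule ennreal_squeeze_0, intro always_eventually allI)
      fix R
      have "(\<lambda>z. increment (?fR R) z - increment f z) = increment (\<lambda>x. ?fR R x - f x)"
        by (auto simp: increment_def fun_eq_iff)
      then have "sqn (pair_measure ?\<rho>) (\<lambda>z. increment (?fR R) z - increment f z) = (\<integral>\<^sup>+h. ?\<rho> h * shift_dist (\<lambda>x. ?fR R x - f x) h \<partial>lborel)"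
        by (simp add: sqn_increment)
      also have "\<dots> \<le> 4 * sqn lborel (\<lambda>x. ?fR R x - f x)" by (rule \<rho>le) measurable
      finally show "sqn (pair_measure ?\<rho>) (\<lambda>z. increment (?fR R) z - increment f z) \<le> 4 * sqn lborel (\<lambda>x. ?fR R x - f x)" .
    qed
  qed measurable
  have sd: "sqn (density lborel ?\<sigma>) g = (\<integral>\<^sup>+\<xi>. ?\<sigma> \<xi> * ennreal ((norm (g \<xi>))\<^sup>2) \<partial>lborel)"
    if [measurable]: "g \<in> borel_measurable borel" for g :: "'a \<Rightarrow> complex"
    unfolding sqn_def by (rule nn_integral_density) measurable
  have sdle: "sqn (density lborel ?\<sigma>) g \<le> sqn lborel g"
    if [measurable]: "g \<in> borel_measurable borel" for g :: "'a \<Rightarrow> complex"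
  proof -
    have "?\<sigma> \<xi> \<le> 1" for \<xi> by simp
    then have le: "?\<sigma> \<xi> * e \<le> e" for \<xi> e using mult_right_mono[of "?\<sigma> \<xi>" 1 e] by simp
    show ?thesis unfolding sd[OF that] unfolding sqn_def by (intro nn_integral_mono le)
  qed
  have l2: "((\<lambda>R. sqn (density lborel ?\<sigma>) (fourier_integral (?fR R))) \<longlongrightarrow> sqn (density lborel ?\<sigma>) (fourier f)) at_top"
  proof (rule sqn_tendsto)
    show "sqn (density lborel ?\<sigma>) (fourier f) < \<infinity>"
      by (rule le_less_trans[OF sdle L2D(2)[OF fourier_L2(1)[OF f]]]) measurable
    show "((\<lambda>R. sqn (density lborel ?\<sigma>) (\<lambda>\<xi>. fourier_integral (?fR R) \<xi> - fourier f \<xi>)) \<longlongrightarrow> 0) at_top"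
      using fourier_limit[OF f] by (rule ennreal_squeeze_0) (intro always_eventually allI sdle, measurable)
  qed (simp_all, measurable)
  have inc: "sqn (pair_measure ?\<rho>) (increment g) = (\<integral>\<^sup>+h. ?\<rho> h * shift_dist g h \<partial>lborel)"
    if [measurable]: "g \<in> borel_measurable borel" for g :: "'a \<Rightarrow> complex"
    by (rule sqn_increment) measurable
  have tm: "truncate R f \<in> borel_measurable borel" "fourier_integral (truncate R f) \<in> borel_measurable borel"
    "fourier f \<in> borel_measurable borel" for R
    by measurable
  have eq: "sqn (pair_measure ?\<rho>) (increment (?fR R)) = sqn (density lborel ?\<sigma>) (fourier_integral (?fR R))" for R
    unfolding inc[OF tm(1)] sd[OF tm(2)] by (rule heat_formula_integrable[OF truncate_integrable[OF f] t])
  have "sqn (pair_measure ?\<rho>) (increment f) = sqn (density lborel ?\<sigma>) (fourier f)"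
    using l1 l2 unfolding eq using tendsto_unique trivial_limit_at_top_linorder by blast
  then show ?thesis unfolding inc[OF L2D(1)[OF f]] sd[OF tm(3)] .
qed

text \<open>The density, up to a constant, of the jump measure of the stable subordinator of index \<open>\<alpha>\<close>. It decomposes
  \<open>s \<mapsto> s\<^sup>\<alpha>\<close> into the functions \<open>s \<mapsto> 1 - exp (- t s)\<close> to which the heat formula applies.\<close>

definition stable_tail :: "real \<Rightarrow> real \<Rightarrow> real" where
  "stable_tail \<alpha> t = indicator {0<..} t * t powr (- 1 - \<alpha>)"

lemma stable_tail_measurable [measurable]: "stable_tail \<alpha> \<in> borel_measurable borel"
  unfolding stable_tail_def by measurable

lemma stable_tail_nonneg [simp]: "0 \<le> stable_tail \<alpha> t"
  by (simp add: stable_tail_def)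

lemma stable_tail_scale: "0 < s \<Longrightarrow> stable_tail \<alpha> (s * t) = s powr (- 1 - \<alpha>) * stable_tail \<alpha> t"
  by (simp add: stable_tail_def indicator_def powr_mult zero_less_mult_iff)

definition subordination_const :: "real \<Rightarrow> ennreal" where
  "subordination_const \<alpha> = (\<integral>\<^sup>+t. ennreal (stable_tail \<alpha> t * (1 - exp (- t))) \<partial>lborel)"

text \<open>The integral of the heat kernel in dimension \<open>d\<close> at distance \<open>1\<close> against the stable tail.\<close>

definition kernel_const :: "nat \<Rightarrow> real \<Rightarrow> ennreal" where
  "kernel_const d \<alpha> = (\<integral>\<^sup>+t. ennreal (stable_tail \<alpha> t * ((4 * pi * t) powr (- (real d / 2)) * exp (- 1 / (4 * t)) / 2)) \<partial>lborel)"

lemma positive_nn_integral: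
  assumes [measurable]: "f \<in> borel_measurable borel" and pos: "\<And>t::real. 0 < t \<Longrightarrow> 0 < f t"
  shows "(\<integral>\<^sup>+t. ennreal (f t) \<partial>lborel) \<noteq> 0"
proof
  assume "(\<integral>\<^sup>+t. ennreal (f t) \<partial>lborel) = 0"
  then have "AE t in lborel. ennreal (f t) = 0"
    by (subst (asm) nn_integral_0_iff_AE) auto
  then have "AE t in lborel. t \<notin> {0<..<1::real}"
    by eventually_elim (use pos in \<open>fastforce simp: ennreal_eq_0_iff\<close>)
  then have "emeasure lborel {0<..<1::real} = 0"
    by (subst (asm) AE_iff_measurable[of "{0<..<1::real}"]) auto
  then show False by simp
qed

lemma subordination_const_pos: "subordination_const \<alpha> \<noteq> 0"
  unfolding subordination_const_def
  by (rule positive_nn_integral) (simp_all add: stable_tail_def)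

lemma kernel_const_pos: "kernel_const d \<alpha> \<noteq> 0"
  unfolding kernel_const_def
  by (rule positive_nn_integral) (simp_all add: stable_tail_def)

lemma subordination_const_finite:
  assumes \<alpha>: "0 < \<alpha>" "\<alpha> < 1"
  shows "subordination_const \<alpha> < \<infinity>"
proof -
  have i1: "((\<lambda>t. t powr (- \<alpha>)) has_integral (1 powr (- \<alpha> + 1) / (- \<alpha> + 1))) {0..1}"
    using \<alpha> by (intro has_integral_powr_from_0) auto
  have i2: "((\<lambda>t. t powr (- 1 - \<alpha>)) has_integral - (1 powr ((- 1 - \<alpha>) + 1)) / ((- 1 - \<alpha>) + 1)) {1..}"
    using \<alpha> by (intro has_integral_powr_to_inf) auto
  have n1: "(\<integral>\<^sup>+t. ennreal (t powr (- \<alpha>)) * indicator {0..1} t \<partial>lborel) < \<infinity>"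
  proof -
    have "(\<integral>\<^sup>+t. ennreal (t powr (- \<alpha>)) * indicator {0..1} t \<partial>lborel) = (\<integral>\<^sup>+t. ennreal (indicator {0..1} t * t powr (- \<alpha>)) \<partial>lborel)"
      by (intro nn_integral_cong) (simp add: indicator_def)
    then show ?thesis using nn_integral_has_integral_lebesgue[OF _ i1] by (simp add: nn_integral_completion)
  qed
  have n2: "(\<integral>\<^sup>+t. ennreal (t powr (- 1 - \<alpha>)) * indicator {1..} t \<partial>lborel) < \<infinity>"
  proof -
    have "(\<integral>\<^sup>+t. ennreal (t powr (- 1 - \<alpha>)) * indicator {1..} t \<partial>lborel) = (\<integral>\<^sup>+t. ennreal (indicator {1..} t * t powr (- 1 - \<alpha>)) \<partial>lborel)"
      by (intro nn_integral_cong) (simp add: indicator_def)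
    then show ?thesis using nn_integral_has_integral_lebesgue[OF _ i2] by (simp add: nn_integral_completion)
  qed
  have le: "ennreal (stable_tail \<alpha> t * (1 - exp (- t))) \<le>
      ennreal (t powr (- \<alpha>)) * indicator {0..1} t + ennreal (t powr (- 1 - \<alpha>)) * indicator {1..} t" for t
  proof (cases "0 < t")
    case True
    show ?thesis
    proof (cases "t \<le> 1")
      case t1: True
      have "1 - exp (- t) \<le> t" using exp_ge_add_one_self[of "- t"] by simp
      then have "t powr (- 1 - \<alpha>) * (1 - exp (- t)) \<le> t powr (- 1 - \<alpha>) * t powr 1"
        using True by (intro mult_left_mono) auto
      also have "\<dots> = t powr (- \<alpha>)" by (simp only: powr_add[symmetric]) simp
      finally have "ennreal (stable_tail \<alpha> t * (1 - exp (- t))) \<le> ennreal (t powr (- \<alpha>))"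
        using True by (intro ennreal_leI) (simp add: stable_tail_def)
      then show ?thesis using True t1 by (auto intro: order_trans simp: indicator_def add_increasing2)
    next
      case False
      have "t powr (- 1 - \<alpha>) * (1 - exp (- t)) \<le> t powr (- 1 - \<alpha>) * 1"
        by (intro mult_left_mono) auto
      then have "ennreal (stable_tail \<alpha> t * (1 - exp (- t))) \<le> ennreal (t powr (- 1 - \<alpha>))"
        using True by (intro ennreal_leI) (simp add: stable_tail_def)
      then show ?thesis using True False by (simp add: indicator_def)
    qed
  qed (simp add: stable_tail_def)
  have "subordination_const \<alpha> \<le> (\<integral>\<^sup>+t. ennreal (t powr (- \<alpha>)) * indicator {0..1} t + ennreal (t powr (- 1 - \<alpha>)) * indicator {1..} t \<partial>lborel)"
    unfolding subordination_const_def by (intro nn_integral_mono le)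
  also have "\<dots> = (\<integral>\<^sup>+t. ennreal (t powr (- \<alpha>)) * indicator {0..1} t \<partial>lborel) + (\<integral>\<^sup>+t. ennreal (t powr (- 1 - \<alpha>)) * indicator {1..} t \<partial>lborel)"
    by (rule nn_integral_add) measurable
  also have "\<dots> < \<infinity>" using n1 n2 by (simp add: ennreal_add_less_top)
  finally show ?thesis .
qed

lemma subordination:
  assumes "0 \<le> s"
  shows "(\<integral>\<^sup>+t. ennreal (stable_tail \<alpha> t * (1 - exp (- t * s))) \<partial>lborel) = ennreal (s powr \<alpha>) * subordination_const \<alpha>"
proof (cases "s = 0")
  case False
  with assms have s: "0 < s" by simp
  have "(\<integral>\<^sup>+t. ennreal (stable_tail \<alpha> t * (1 - exp (- t * s))) \<partial>lborel) =
    ennreal \<bar>1 / s\<bar> * (\<integral>\<^sup>+t. ennreal (stable_tail \<alpha> (0 + 1 / s * t) * (1 - exp (- (0 + 1 / s * t) * s))) \<partial>lborel)"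
    using s by (intro nn_integral_real_affine) auto
  also have "\<dots> = (\<integral>\<^sup>+t. ennreal \<bar>1 / s\<bar> * ennreal (stable_tail \<alpha> (0 + 1 / s * t) * (1 - exp (- (0 + 1 / s * t) * s))) \<partial>lborel)"
    by (rule nn_integral_cmult[symmetric]) measurable
  also have "\<dots> = (\<integral>\<^sup>+t. ennreal (s powr \<alpha>) * ennreal (stable_tail \<alpha> t * (1 - exp (- t))) \<partial>lborel)"
  proof (rule nn_integral_cong)
    fix t
    have "1 / s * (1 / s) powr (- 1 - \<alpha>) = (1 / s) powr (1 + (- 1 - \<alpha>))"
      using s by (subst powr_add) simp
    also have "\<dots> = s powr \<alpha>" using s by (simp add: powr_minus powr_divide inverse_eq_divide)
    finally have k: "1 / s * (1 / s) powr (- 1 - \<alpha>) = s powr \<alpha>" .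
    have "1 / s * (stable_tail \<alpha> (1 / s * t) * (1 - exp (- (1 / s * t) * s)))
       = (1 / s * (1 / s) powr (- 1 - \<alpha>)) * (stable_tail \<alpha> t * (1 - exp (- t)))"
      using s by (subst stable_tail_scale) (auto simp: mult_ac)
    then have "\<bar>1 / s\<bar> * (stable_tail \<alpha> (0 + 1 / s * t) * (1 - exp (- (0 + 1 / s * t) * s)))
        = s powr \<alpha> * (stable_tail \<alpha> t * (1 - exp (- t)))"
      using s unfolding k by simp
    then show "ennreal \<bar>1 / s\<bar> * ennreal (stable_tail \<alpha> (0 + 1 / s * t) * (1 - exp (- (0 + 1 / s * t) * s)))
       = ennreal (s powr \<alpha>) * ennreal (stable_tail \<alpha> t * (1 - exp (- t)))"
      by (simp only: ennreal_mult'[symmetric] abs_ge_zero powr_ge_zero)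
  qed
  also have "\<dots> = ennreal (s powr \<alpha>) * subordination_const \<alpha>"
    unfolding subordination_const_def by (rule nn_integral_cmult) measurable
  finally show ?thesis .
qed simp

text \<open>The substitution \<open>t \<mapsto> |h|\<^sup>2 t\<close> extracts a power of \<open>|h|\<close> and leaves a constant.\<close>

lemma subordinated_kernel:
  fixes h :: "'a::euclidean_space"
  assumes "h \<noteq> 0"
  shows "(\<integral>\<^sup>+t. ennreal (stable_tail \<alpha> t) * ennreal (gauss t h / 2) \<partial>lborel)
    = kernel_const DIM('a) \<alpha> * ennreal (norm h powr (- (real DIM('a) + 2 * \<alpha>)))"
proof -
  define r where "r = norm h"
  have r: "0 < r" using assms by (simp add: r_def)
  then have r2: "0 < r\<^sup>2" by simp
  let ?G = "\<lambda>t. stable_tail \<alpha> t * (gauss t h / 2)"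
  let ?H = "\<lambda>t. stable_tail \<alpha> t * ((4 * pi * t) powr (- (real DIM('a) / 2)) * exp (- 1 / (4 * t)) / 2)"
  have [measurable]: "(\<lambda>t. gauss t h) \<in> borel_measurable borel" unfolding gauss_def by measurable
  have [measurable]: "?G \<in> borel_measurable borel" by measurable
  have [measurable]: "?H \<in> borel_measurable borel" by measurable
  have p: "r\<^sup>2 * ((r\<^sup>2) powr (- 1 - \<alpha>) * (r\<^sup>2) powr (- (real DIM('a) / 2))) = r powr (- (real DIM('a) + 2 * \<alpha>))"
  proof -
    have "r\<^sup>2 = r powr 2" using r by simp
    then have "r\<^sup>2 * ((r\<^sup>2) powr (- 1 - \<alpha>) * (r\<^sup>2) powr (- (real DIM('a) / 2))) =
      r powr 2 * (r powr (2 * (- 1 - \<alpha>)) * r powr (2 * - (real DIM('a) / 2)))"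
      by (simp only: powr_powr)
    also have "\<dots> = r powr (2 + (2 * (- 1 - \<alpha>) + 2 * - (real DIM('a) / 2)))"
      by (simp only: powr_add)
    finally show ?thesis by (simp add: algebra_simps)
  qed
  have "(\<integral>\<^sup>+t. ennreal (stable_tail \<alpha> t) * ennreal (gauss t h / 2) \<partial>lborel) = (\<integral>\<^sup>+t. ennreal (?G t) \<partial>lborel)"
    by (intro nn_integral_cong ennreal_mult'[symmetric]) simp
  also have "\<dots> = ennreal \<bar>r\<^sup>2\<bar> * (\<integral>\<^sup>+t. ennreal (?G (0 + r\<^sup>2 * t)) \<partial>lborel)"
    using r2 by (intro nn_integral_real_affine measurable_compose[OF _ measurable_ennreal]) simp_all
  also have "\<dots> = (\<integral>\<^sup>+t. ennreal \<bar>r\<^sup>2\<bar> * ennreal (?G (0 + r\<^sup>2 * t)) \<partial>lborel)"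
    by (rule nn_integral_cmult[symmetric]) measurable
  also have "\<dots> = (\<integral>\<^sup>+t. ennreal (?H t) * ennreal (r powr (- (real DIM('a) + 2 * \<alpha>))) \<partial>lborel)"
  proof (rule nn_integral_cong)
    fix t :: real
    have "r\<^sup>2 * ?G (r\<^sup>2 * t) = ?H t * r powr (- (real DIM('a) + 2 * \<alpha>))"
    proof (cases "0 < t")
      case True
      have "gauss (r\<^sup>2 * t) h = (r\<^sup>2 * (4 * pi * t)) powr (- (real DIM('a) / 2)) * exp (- (r\<^sup>2) / (4 * (r\<^sup>2 * t)))"
        by (simp add: gauss_def r_def mult_ac)
      also have "(r\<^sup>2 * (4 * pi * t)) powr (- (real DIM('a) / 2)) = (r\<^sup>2) powr (- (real DIM('a) / 2)) * (4 * pi * t) powr (- (real DIM('a) / 2))"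
        by (rule powr_mult)
      also have "- (r\<^sup>2) / (4 * (r\<^sup>2 * t)) = - 1 / (4 * t)" using r True by (simp add: field_simps)
      finally show ?thesis
        unfolding stable_tail_scale[OF r2] p[symmetric] by (simp add: mult_ac)
    qed (use r2 in \<open>simp add: stable_tail_def zero_less_mult_iff\<close>)
    then show "ennreal \<bar>r\<^sup>2\<bar> * ennreal (?G (0 + r\<^sup>2 * t)) = ennreal (?H t) * ennreal (r powr (- (real DIM('a) + 2 * \<alpha>)))"
      by (subst (1 2) ennreal_mult'[symmetric]) auto
  qed
  also have "\<dots> = kernel_const DIM('a) \<alpha> * ennreal (r powr (- (real DIM('a) + 2 * \<alpha>)))"
    unfolding kernel_const_def by (rule nn_integral_multc) measurable
  finally show ?thesis by (simp add: r_def)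
qed

text \<open>The constant is normalised so that the square of the seminorm built from this kernel is exactly the squared
  \<open>L\<^sup>2\<close> norm of \<open>|\<xi>|\<^sup>\<alpha>\<close> times the Fourier transform, as \<open>gagliardo_fourier\<close> shows.\<close>

definition gag_kernel :: "real \<Rightarrow> 'a::euclidean_space \<Rightarrow> ennreal" where
  "gag_kernel \<alpha> h = (kernel_const DIM('a) \<alpha> / subordination_const \<alpha>) * ennreal (norm h powr (- (real DIM('a) + 2 * \<alpha>)))"

definition gagliardo :: "real \<Rightarrow> ('a::euclidean_space \<Rightarrow> 'v::real_normed_vector) \<Rightarrow> ennreal" where
  "gagliardo \<alpha> u = sqn (pair_measure (gag_kernel \<alpha>)) (increment u)"

lemma gag_kernel_measurable [measurable]: "gag_kernel \<alpha> \<in> borel_measurable borel"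
  unfolding gag_kernel_def by measurable

lemma gagliardo_alt:
  fixes u :: "'a::euclidean_space \<Rightarrow> 'v::{real_normed_vector,second_countable_topology}"
  assumes "u \<in> borel_measurable borel"
  shows "gagliardo \<alpha> u = (\<integral>\<^sup>+h. gag_kernel \<alpha> h * shift_dist u h \<partial>lborel)"
  unfolding gagliardo_def by (rule sqn_increment[OF assms]) measurable

text \<open>Integrating the heat formula in \<open>t\<close> against the stable tail produces the kernel on the side of increments
  and, with \<open>s = |\<xi>|\<^sup>2\<close>, the symbol \<open>|\<xi>|\<^sup>2\<^sup>\<alpha>\<close> on the side of frequencies.\<close>

theorem gagliardo_fourier:
  fixes u :: "'a::euclidean_space \<Rightarrow> complex"
  assumes u: "u \<in> L2" and \<alpha>: "0 < \<alpha>" "\<alpha> < 1"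
  shows "gagliardo \<alpha> u = (\<integral>\<^sup>+\<xi>. ennreal (norm \<xi> powr (2 * \<alpha>)) * ennreal ((norm (fourier u \<xi>))\<^sup>2) \<partial>lborel)"
proof -
  note [measurable] = L2D(1)[OF u] L2D(1)[OF fourier_L2(1)[OF u]]
  let ?C = "subordination_const \<alpha>" and ?\<kappa> = "kernel_const DIM('a) \<alpha>"
  have gm[measurable]: "(\<lambda>z. gauss (fst z) (snd z :: 'a)) \<in> borel_measurable (lborel \<Otimes>\<^sub>M lborel)"
    unfolding gauss_def by measurable
  have gm'[measurable]: "(\<lambda>t. gauss t (h :: 'a)) \<in> borel_measurable borel" for h
    unfolding gauss_def by measurable
  have L: "(\<integral>\<^sup>+t. ennreal (stable_tail \<alpha> t) * (\<integral>\<^sup>+h. ennreal (gauss t h / 2) * shift_dist u h \<partial>lborel) \<partial>lborel)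
      = ?C * gagliardo \<alpha> u"
  proof -
    have "(\<integral>\<^sup>+t. ennreal (stable_tail \<alpha> t) * (\<integral>\<^sup>+h. ennreal (gauss t h / 2) * shift_dist u h \<partial>lborel) \<partial>lborel) =
        (\<integral>\<^sup>+t. \<integral>\<^sup>+h. ennreal (stable_tail \<alpha> t) * (ennreal (gauss t h / 2) * shift_dist u h) \<partial>lborel \<partial>lborel)"
      by (intro nn_integral_cong nn_integral_cmult[symmetric]) measurable
    also have "\<dots> = (\<integral>\<^sup>+h. \<integral>\<^sup>+t. ennreal (stable_tail \<alpha> t) * (ennreal (gauss t h / 2) * shift_dist u h) \<partial>lborel \<partial>lborel)"
      by (rule lborel_pair.Fubini'[symmetric]) measurable
    also have "\<dots> = (\<integral>\<^sup>+h. (\<integral>\<^sup>+t. ennreal (stable_tail \<alpha> t) * ennreal (gauss t h / 2) \<partial>lborel) * shift_dist u h \<partial>lborel)"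
      by (subst nn_integral_multc[symmetric]) (simp_all add: mult.assoc)
    also have "\<dots> = (\<integral>\<^sup>+h. ?C * (gag_kernel \<alpha> h * shift_dist u h) \<partial>lborel)"
    proof (rule nn_integral_cong_AE)
      have "AE h in lborel. h \<noteq> (0::'a)" by (rule AE_lborel_singleton)
      then show "AE h in lborel. (\<integral>\<^sup>+t. ennreal (stable_tail \<alpha> t) * ennreal (gauss t h / 2) \<partial>lborel) * shift_dist u h
         = ?C * (gag_kernel \<alpha> h * shift_dist u h)"
      proof eventually_elim
        fix h :: 'a assume "h \<noteq> 0"
        have "?C * (?\<kappa> / ?C) = ?\<kappa>"
          using subordination_const_finite[OF \<alpha>] subordination_const_pos[of \<alpha>]
          by (simp add: ennreal_divide_times ennreal_mult_divide_eq mult.commute[of ?C])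
        then show "(\<integral>\<^sup>+t. ennreal (stable_tail \<alpha> t) * ennreal (gauss t h / 2) \<partial>lborel) * shift_dist u h
         = ?C * (gag_kernel \<alpha> h * shift_dist u h)"
          unfolding subordinated_kernel[OF \<open>h \<noteq> 0\<close>] gag_kernel_def by (simp add: mult.assoc[symmetric])
      qed
    qed
    also have "\<dots> = ?C * (\<integral>\<^sup>+h. gag_kernel \<alpha> h * shift_dist u h \<partial>lborel)"
      by (rule nn_integral_cmult) measurable
    finally show ?thesis by (simp add: gagliardo_alt)
  qed
  have R: "(\<integral>\<^sup>+t. ennreal (stable_tail \<alpha> t) * (\<integral>\<^sup>+\<xi>. ennreal (1 - exp (- t * (norm \<xi>)\<^sup>2)) * ennreal ((norm (fourier u \<xi>))\<^sup>2) \<partial>lborel) \<partial>lborel)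
      = ?C * (\<integral>\<^sup>+\<xi>. ennreal (norm \<xi> powr (2 * \<alpha>)) * ennreal ((norm (fourier u \<xi>))\<^sup>2) \<partial>lborel)"
  proof -
    have "(\<integral>\<^sup>+t. ennreal (stable_tail \<alpha> t) * (\<integral>\<^sup>+\<xi>. ennreal (1 - exp (- t * (norm \<xi>)\<^sup>2)) * ennreal ((norm (fourier u \<xi>))\<^sup>2) \<partial>lborel) \<partial>lborel) =
        (\<integral>\<^sup>+t. \<integral>\<^sup>+\<xi>. ennreal (stable_tail \<alpha> t) * (ennreal (1 - exp (- t * (norm \<xi>)\<^sup>2)) * ennreal ((norm (fourier u \<xi>))\<^sup>2)) \<partial>lborel \<partial>lborel)"
      by (intro nn_integral_cong nn_integral_cmult[symmetric]) measurable
    also have "\<dots> = (\<integral>\<^sup>+\<xi>. \<integral>\<^sup>+t. ennreal (stable_tail \<alpha> t) * (ennreal (1 - exp (- t * (norm \<xi>)\<^sup>2)) * ennreal ((norm (fourier u \<xi>))\<^sup>2)) \<partial>lborel \<partial>lborel)"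
      by (rule lborel_pair.Fubini'[symmetric]) measurable
    also have "\<dots> = (\<integral>\<^sup>+\<xi>. (\<integral>\<^sup>+t. ennreal (stable_tail \<alpha> t * (1 - exp (- t * (norm \<xi>)\<^sup>2))) \<partial>lborel) * ennreal ((norm (fourier u \<xi>))\<^sup>2) \<partial>lborel)"
      by (subst nn_integral_multc[symmetric]) (simp_all add: mult.assoc[symmetric] ennreal_mult')
    also have "\<dots> = (\<integral>\<^sup>+\<xi>. ?C * (ennreal (norm \<xi> powr (2 * \<alpha>)) * ennreal ((norm (fourier u \<xi>))\<^sup>2)) \<partial>lborel)"
    proof (rule nn_integral_cong)
      fix \<xi> :: 'a
      have "((norm \<xi>)\<^sup>2) powr \<alpha> = norm \<xi> powr (2 * \<alpha>)"
        by (cases "\<xi> = 0") (simp_all add: powr_powr[symmetric])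
      then show "(\<integral>\<^sup>+t. ennreal (stable_tail \<alpha> t * (1 - exp (- t * (norm \<xi>)\<^sup>2))) \<partial>lborel) * ennreal ((norm (fourier u \<xi>))\<^sup>2)
        = ?C * (ennreal (norm \<xi> powr (2 * \<alpha>)) * ennreal ((norm (fourier u \<xi>))\<^sup>2))"
        by (subst subordination) (simp_all add: mult_ac)
    qed
    also have "\<dots> = ?C * (\<integral>\<^sup>+\<xi>. ennreal (norm \<xi> powr (2 * \<alpha>)) * ennreal ((norm (fourier u \<xi>))\<^sup>2) \<partial>lborel)"
      by (rule nn_integral_cmult) measurable
    finally show ?thesis .
  qed
  have "(\<integral>\<^sup>+t. ennreal (stable_tail \<alpha> t) * (\<integral>\<^sup>+h. ennreal (gauss t h / 2) * shift_dist u h \<partial>lborel) \<partial>lborel)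
     = (\<integral>\<^sup>+t. ennreal (stable_tail \<alpha> t) * (\<integral>\<^sup>+\<xi>. ennreal (1 - exp (- t * (norm \<xi>)\<^sup>2)) * ennreal ((norm (fourier u \<xi>))\<^sup>2) \<partial>lborel) \<partial>lborel)"
  proof (rule nn_integral_cong)
    fix t :: real
    show "ennreal (stable_tail \<alpha> t) * (\<integral>\<^sup>+h. ennreal (gauss t h / 2) * shift_dist u h \<partial>lborel)
      = ennreal (stable_tail \<alpha> t) * (\<integral>\<^sup>+\<xi>. ennreal (1 - exp (- t * (norm \<xi>)\<^sup>2)) * ennreal ((norm (fourier u \<xi>))\<^sup>2) \<partial>lborel)"
      using heat_formula[OF u, of t] by (cases "0 < t") (simp_all add: stable_tail_def)
  qed
  then have "?C * gagliardo \<alpha> u = ?C * (\<integral>\<^sup>+\<xi>. ennreal (norm \<xi> powr (2 * \<alpha>)) * ennreal ((norm (fourier u \<xi>))\<^sup>2) \<partial>lborel)"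
    unfolding L R .
  then show ?thesis
    using subordination_const_finite[OF \<alpha>] subordination_const_pos[of \<alpha>] by (auto simp: ennreal_mult_cancel_left)
qed

lemma powr_one_plus_le:
  fixes x :: real
  assumes x: "0 \<le> x" and a: "0 < a" "a \<le> 1"
  shows "(1 + x) powr a \<le> 1 + x powr a"
proof (cases "x = 0")
  case False
  then have x0: "0 < x" using x by simp
  have "(1 + x) powr a = (1 + x) powr (1 + (a - 1))" by simp
  also have "\<dots> = (1 + x) powr (a - 1) + x * (1 + x) powr (a - 1)"
    unfolding powr_add using x0 by (simp add: distrib_right)
  also have "\<dots> \<le> 1 + x * x powr (a - 1)"
  proof (intro add_mono mult_left_mono)
    show "(1 + x) powr (a - 1) \<le> 1" using powr_mono2'[of "a - 1" 1 "1 + x"] a x0 by simp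
    show "(1 + x) powr (a - 1) \<le> x powr (a - 1)" using a x0 by (intro powr_mono2') auto
  qed (use x in auto)
  also have "x * x powr (a - 1) = x powr (1 + (a - 1))" unfolding powr_add using x0 by simp
  finally show ?thesis by simp
qed (use a in simp)

lemma bessel_weighted_measurable:
  assumes "u \<in> L2"
  shows "bessel_weighted \<alpha> u \<in> borel_measurable borel"
proof -
  note [measurable] = L2D(1)[OF fourier_L2(1)[OF assms]]
  show ?thesis unfolding bessel_weighted_def by measurable
qed

lemma sqn_bessel:
  fixes u :: "'a::euclidean_space \<Rightarrow> complex"
  assumes u: "u \<in> L2" and \<alpha>: "0 < \<alpha>" "\<alpha> < 1"
  shows "sqn lborel (bessel_weighted \<alpha> u) \<le> sqn lborel u + gagliardo \<alpha> u"
    and "sqn lborel u \<le> sqn lborel (bessel_weighted \<alpha> u)"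
    and "gagliardo \<alpha> u \<le> sqn lborel (bessel_weighted \<alpha> u)"
proof -
  note [measurable] = L2D(1)[OF fourier_L2(1)[OF u]]
  have n: "(norm (bessel_weighted \<alpha> u \<xi>))\<^sup>2 = (1 + (norm \<xi>)\<^sup>2) powr \<alpha> * (norm (fourier u \<xi>))\<^sup>2" for \<xi>
    by (simp add: bessel_weighted_def power_mult_distrib powr_power add_nonneg_eq_0_iff)
  have p: "((norm \<xi>)\<^sup>2) powr \<alpha> = norm \<xi> powr (2 * \<alpha>)" for \<xi> :: 'a
    by (cases "\<xi> = 0") (simp_all add: powr_powr[symmetric])
  have "sqn lborel (bessel_weighted \<alpha> u) \<le> (\<integral>\<^sup>+\<xi>. ennreal ((norm (fourier u \<xi>))\<^sup>2) + ennreal (norm \<xi> powr (2 * \<alpha>)) * ennreal ((norm (fourier u \<xi>))\<^sup>2) \<partial>lborel)"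
    unfolding sqn_def
  proof (intro nn_integral_mono)
    fix \<xi> :: 'a
    have "(1 + (norm \<xi>)\<^sup>2) powr \<alpha> \<le> 1 + ((norm \<xi>)\<^sup>2) powr \<alpha>"
      using \<alpha> by (intro powr_one_plus_le) auto
    then have "(norm (bessel_weighted \<alpha> u \<xi>))\<^sup>2 \<le> (1 + norm \<xi> powr (2 * \<alpha>)) * (norm (fourier u \<xi>))\<^sup>2"
      unfolding n p by (intro mult_right_mono) auto
    then have "ennreal ((norm (bessel_weighted \<alpha> u \<xi>))\<^sup>2) \<le> ennreal ((norm (fourier u \<xi>))\<^sup>2 + norm \<xi> powr (2 * \<alpha>) * (norm (fourier u \<xi>))\<^sup>2)"
      by (intro ennreal_leI) (simp add: algebra_simps)
    also have "\<dots> = ennreal ((norm (fourier u \<xi>))\<^sup>2) + ennreal (norm \<xi> powr (2 * \<alpha>)) * ennreal ((norm (fourier u \<xi>))\<^sup>2)"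
      by (subst ennreal_plus) (simp_all add: ennreal_mult')
    finally show "ennreal ((norm (bessel_weighted \<alpha> u \<xi>))\<^sup>2) \<le> ennreal ((norm (fourier u \<xi>))\<^sup>2) + ennreal (norm \<xi> powr (2 * \<alpha>)) * ennreal ((norm (fourier u \<xi>))\<^sup>2)" .
  qed
  also have "\<dots> = sqn lborel (fourier u) + gagliardo \<alpha> u"
    unfolding gagliardo_fourier[OF u \<alpha>] sqn_def by (rule nn_integral_add) measurable
  finally show "sqn lborel (bessel_weighted \<alpha> u) \<le> sqn lborel u + gagliardo \<alpha> u"
    by (simp only: plancherel[OF u])
  have "sqn lborel (fourier u) \<le> sqn lborel (bessel_weighted \<alpha> u)"
    unfolding sqn_def
  proof (intro nn_integral_mono ennreal_leI)
    fix \<xi> :: 'a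
    have "1 \<le> (1 + (norm \<xi>)\<^sup>2) powr \<alpha>" using \<alpha> by (intro ge_one_powr_ge_zero) auto
    then have "1 * (norm (fourier u \<xi>))\<^sup>2 \<le> (norm (bessel_weighted \<alpha> u \<xi>))\<^sup>2"
      unfolding n by (intro mult_right_mono) auto
    then show "(norm (fourier u \<xi>))\<^sup>2 \<le> (norm (bessel_weighted \<alpha> u \<xi>))\<^sup>2" by simp
  qed
  then show "sqn lborel u \<le> sqn lborel (bessel_weighted \<alpha> u)"
    by (simp only: plancherel[OF u])
  show "gagliardo \<alpha> u \<le> sqn lborel (bessel_weighted \<alpha> u)"
    unfolding gagliardo_fourier[OF u \<alpha>] sqn_def
  proof (intro nn_integral_mono)
    fix \<xi> :: 'a
    have "((norm \<xi>)\<^sup>2) powr \<alpha> \<le> (1 + (norm \<xi>)\<^sup>2) powr \<alpha>" using \<alpha> by (intro powr_mono2) auto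
    then have "norm \<xi> powr (2 * \<alpha>) * (norm (fourier u \<xi>))\<^sup>2 \<le> (norm (bessel_weighted \<alpha> u \<xi>))\<^sup>2"
      unfolding n p by (intro mult_right_mono) auto
    then show "ennreal (norm \<xi> powr (2 * \<alpha>)) * ennreal ((norm (fourier u \<xi>))\<^sup>2) \<le> ennreal ((norm (bessel_weighted \<alpha> u \<xi>))\<^sup>2)"
      by (subst ennreal_mult'[symmetric]) (auto intro!: ennreal_leI)
  qed
qed

theorem H_space_iff:
  fixes u :: "'a::euclidean_space \<Rightarrow> complex"
  assumes \<alpha>: "0 < \<alpha>" "\<alpha> < 1"
  shows "u \<in> H_space \<alpha> \<longleftrightarrow> u \<in> borel_measurable borel \<and> sqn lborel u < \<infinity> \<and> gagliardo \<alpha> u < \<infinity>"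
proof (cases "u \<in> L2")
  case True
  have "bessel_weighted \<alpha> u \<in> L2 \<longleftrightarrow> sqn lborel (bessel_weighted \<alpha> u) < \<infinity>"
    using bessel_weighted_measurable[OF True] by (simp add: L2_iff)
  also have "\<dots> \<longleftrightarrow> gagliardo \<alpha> u < \<infinity>"
    using sqn_bessel(1,3)[OF True \<alpha>] L2D(2)[OF True]
    by (metis ennreal_add_less_top infinity_ennreal_def le_less_trans)
  finally show ?thesis using True L2D[OF True] by (simp add: H_space_def)
next
  case False
  then show ?thesis by (auto simp: H_space_def L2_iff)
qed

lemma H_norm_bounds:
  fixes u :: "'a::euclidean_space \<Rightarrow> complex"
  assumes u: "u \<in> H_space \<alpha>" and \<alpha>: "0 < \<alpha>" "\<alpha> < 1"
  shows "ennreal ((H_norm \<alpha> u)\<^sup>2) \<le> sqn lborel u + gagliardo \<alpha> u"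
    and "sqn lborel u \<le> ennreal ((H_norm \<alpha> u)\<^sup>2)"
    and "gagliardo \<alpha> u \<le> ennreal ((H_norm \<alpha> u)\<^sup>2)"
proof -
  have L: "u \<in> L2" "bessel_weighted \<alpha> u \<in> L2" using u by (auto simp: H_space_def)
  have e: "ennreal ((H_norm \<alpha> u)\<^sup>2) = sqn lborel (bessel_weighted \<alpha> u)"
    unfolding H_norm_def by (rule sqn_eq_L2_norm[OF L(2), symmetric])
  show "ennreal ((H_norm \<alpha> u)\<^sup>2) \<le> sqn lborel u + gagliardo \<alpha> u"
    "sqn lborel u \<le> ennreal ((H_norm \<alpha> u)\<^sup>2)" "gagliardo \<alpha> u \<le> ennreal ((H_norm \<alpha> u)\<^sup>2)"
    unfolding e by (rule sqn_bessel[OF L(1) \<alpha>])+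
qed

text \<open>Surjectivity of the Fourier transform provides the function that the choice in \<open>frac_laplacian\<close> selects.\<close>

lemma frac_laplacian_sqn:
  fixes u :: "'a::euclidean_space \<Rightarrow> complex"
  assumes u: "u \<in> H_space \<alpha>" and \<alpha>: "0 < \<alpha>" "\<alpha> < 1"
  shows "frac_laplacian (\<alpha> / 2) u \<in> L2" and "sqn lborel (frac_laplacian (\<alpha> / 2) u) = gagliardo \<alpha> u"
proof -
  have L: "u \<in> L2" using u by (auto simp: H_space_def)
  note [measurable] = L2D(1)[OF fourier_L2(1)[OF L]]
  define g where "g \<xi> = (norm \<xi> powr (2 * (\<alpha> / 2))) *\<^sub>R fourier u \<xi>" for \<xi>
  have gm: "g \<in> borel_measurable borel" unfolding g_def by measurable
  have "(norm (g \<xi>))\<^sup>2 = norm \<xi> powr (2 * \<alpha>) * (norm (fourier u \<xi>))\<^sup>2" for \<xi>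
    by (simp add: g_def power_mult_distrib power2_eq_square flip: powr_add)
  then have gs: "sqn lborel g = gagliardo \<alpha> u"
    unfolding gagliardo_fourier[OF L \<alpha>] sqn_def by (simp add: ennreal_mult')
  have "gagliardo \<alpha> u < \<infinity>" using u \<alpha> by (simp add: H_space_iff)
  then have gL: "g \<in> L2" using gm gs by (simp add: L2_iff)
  let ?P = "\<lambda>w. w \<in> L2 \<and> (AE \<xi> in lborel. fourier w \<xi> = (norm \<xi> powr (2 * (\<alpha> / 2))) *\<^sub>R fourier u \<xi>)"
  have "\<exists>w. ?P w" using fourier_surj[OF gL] unfolding g_def by blast
  from someI_ex[OF this] have P: "?P (frac_laplacian (\<alpha> / 2) u)"
    unfolding frac_laplacian_def .
  then show w: "frac_laplacian (\<alpha> / 2) u \<in> L2" by blast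
  have "sqn lborel (frac_laplacian (\<alpha> / 2) u) = sqn lborel (fourier (frac_laplacian (\<alpha> / 2) u))"
    by (rule plancherel[OF w, symmetric])
  also have "\<dots> = sqn lborel g"
    using P by (intro sqn_cong_AE) (simp add: g_def)
  finally show "sqn lborel (frac_laplacian (\<alpha> / 2) u) = gagliardo \<alpha> u" by (simp only: gs)
qed

section \<open>Properties of the nonlocal seminorm\<close>

lemma shift_dist_shift:
  fixes u :: "'a::euclidean_space \<Rightarrow> 'v::{real_normed_vector,second_countable_topology}"
  assumes [measurable]: "u \<in> borel_measurable borel"
  shows "shift_dist (\<lambda>x. u (x + y)) h = shift_dist u h"
  unfolding shift_dist_def using sqn_shift[of "\<lambda>x. u (x + h) - u x" y] by (simp add: add_ac)

lemma gagliardo_shift: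
  fixes u :: "'a::euclidean_space \<Rightarrow> 'v::{real_normed_vector,second_countable_topology}"
  assumes [measurable]: "u \<in> borel_measurable borel"
  shows "gagliardo \<alpha> (\<lambda>x. u (x + y)) = gagliardo \<alpha> u"
  by (subst (1 2) gagliardo_alt) (simp_all add: shift_dist_shift)

lemma gag_kernel_scale:
  assumes "0 < s"
  shows "gag_kernel \<alpha> (s *\<^sub>R h) = ennreal (s powr (- (real DIM('a) + 2 * \<alpha>))) * gag_kernel \<alpha> (h::'a::euclidean_space)"
proof -
  have "ennreal (norm (s *\<^sub>R h) powr (- (real DIM('a) + 2 * \<alpha>))) =
      ennreal (s powr (- (real DIM('a) + 2 * \<alpha>))) * ennreal (norm h powr (- (real DIM('a) + 2 * \<alpha>)))"
    using assms by (simp add: powr_mult ennreal_mult')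
  then show ?thesis unfolding gag_kernel_def by (simp only: mult_ac)
qed

lemma sqn_dilate:
  fixes u :: "'a::euclidean_space \<Rightarrow> 'v::{real_normed_vector,second_countable_topology}"
  assumes [measurable]: "u \<in> borel_measurable borel" and s: "0 < s"
  shows "sqn lborel u = ennreal (s ^ DIM('a)) * sqn lborel (\<lambda>x. u (s *\<^sub>R x))"
  unfolding sqn_def using nn_integral_lborel_affine[of "\<lambda>x. ennreal ((norm (u x))\<^sup>2)" s 0] s by simp

lemma gagliardo_dilate:
  fixes u :: "'a::euclidean_space \<Rightarrow> 'v::{real_normed_vector,second_countable_topology}"
  assumes [measurable]: "u \<in> borel_measurable borel" and s: "0 < s"
  shows "gagliardo \<alpha> (\<lambda>x. u (s *\<^sub>R x)) = ennreal (s powr (2 * \<alpha> - real DIM('a))) * gagliardo \<alpha> u"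
proof -
  have D: "shift_dist u (s *\<^sub>R h) = ennreal (s ^ DIM('a)) * shift_dist (\<lambda>x. u (s *\<^sub>R x)) h" for h
    unfolding shift_dist_def using sqn_dilate[of "\<lambda>x. u (x + s *\<^sub>R h) - u x" s] s
    by (simp add: scaleR_add_right)
  have e: "s ^ DIM('a) * (s powr (- (real DIM('a) + 2 * \<alpha>)) * s ^ DIM('a)) = s powr (real DIM('a) - 2 * \<alpha>)"
    using s by (simp add: powr_realpow[symmetric] flip: powr_add)
  have "gagliardo \<alpha> u = (\<integral>\<^sup>+h. gag_kernel \<alpha> h * shift_dist u h \<partial>lborel)"
    by (rule gagliardo_alt) measurable
  also have "\<dots> = ennreal (s ^ DIM('a)) * (\<integral>\<^sup>+h. gag_kernel \<alpha> (s *\<^sub>R h) * shift_dist u (s *\<^sub>R h) \<partial>lborel)"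
    using nn_integral_lborel_affine[of "\<lambda>h. gag_kernel \<alpha> h * shift_dist u h" s 0] s by simp
  also have "(\<integral>\<^sup>+h. gag_kernel \<alpha> (s *\<^sub>R h) * shift_dist u (s *\<^sub>R h) \<partial>lborel) =
      (\<integral>\<^sup>+h. ennreal (s powr (- (real DIM('a) + 2 * \<alpha>)) * s ^ DIM('a)) * (gag_kernel \<alpha> h * shift_dist (\<lambda>x. u (s *\<^sub>R x)) h) \<partial>lborel)"
    unfolding gag_kernel_scale[OF s] D using s by (intro nn_integral_cong) (simp add: ennreal_mult mult_ac)
  also have "\<dots> = ennreal (s powr (- (real DIM('a) + 2 * \<alpha>)) * s ^ DIM('a)) * (\<integral>\<^sup>+h. gag_kernel \<alpha> h * shift_dist (\<lambda>x. u (s *\<^sub>R x)) h \<partial>lborel)"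
    by (rule nn_integral_cmult) measurable
  also have "(\<integral>\<^sup>+h. gag_kernel \<alpha> h * shift_dist (\<lambda>x. u (s *\<^sub>R x)) h \<partial>lborel) = gagliardo \<alpha> (\<lambda>x. u (s *\<^sub>R x))"
    by (rule gagliardo_alt[symmetric]) measurable
  also have "ennreal (s ^ DIM('a)) * (ennreal (s powr (- (real DIM('a) + 2 * \<alpha>)) * s ^ DIM('a)) * gagliardo \<alpha> (\<lambda>x. u (s *\<^sub>R x)))
      = ennreal (s powr (real DIM('a) - 2 * \<alpha>)) * gagliardo \<alpha> (\<lambda>x. u (s *\<^sub>R x))"
    using s unfolding e[symmetric] by (simp add: ennreal_mult mult.assoc)
  finally have "ennreal (s powr (2 * \<alpha> - real DIM('a))) * gagliardo \<alpha> u =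
     ennreal (s powr (2 * \<alpha> - real DIM('a)) * s powr (real DIM('a) - 2 * \<alpha>)) * gagliardo \<alpha> (\<lambda>x. u (s *\<^sub>R x))"
    by (simp add: ennreal_mult mult.assoc)
  also have "s powr (2 * \<alpha> - real DIM('a)) * s powr (real DIM('a) - 2 * \<alpha>) = 1"
    using s by (simp flip: powr_add)
  finally show ?thesis by simp
qed

lemma sqn_pair:
  fixes f :: "'x \<Rightarrow> 'v::{real_inner,second_countable_topology}" and g :: "'x \<Rightarrow> 'w::{real_inner,second_countable_topology}"
  assumes [measurable]: "f \<in> borel_measurable M" "g \<in> borel_measurable M"
  shows "sqn M (\<lambda>x. (f x, g x)) = sqn M f + sqn M g"
proof -
  have "sqn M (\<lambda>x. (f x, g x)) = (\<integral>\<^sup>+x. ennreal ((norm (f x))\<^sup>2) + ennreal ((norm (g x))\<^sup>2) \<partial>M)"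
    unfolding sqn_def by (intro nn_integral_cong) (simp add: norm_Pair)
  also have "\<dots> = sqn M f + sqn M g" unfolding sqn_def by (rule nn_integral_add) measurable
  finally show ?thesis .
qed

lemma gagliardo_pair:
  fixes f :: "'a::euclidean_space \<Rightarrow> 'v::{real_inner,second_countable_topology}" and g :: "'a \<Rightarrow> 'w::{real_inner,second_countable_topology}"
  assumes [measurable]: "f \<in> borel_measurable borel" "g \<in> borel_measurable borel"
  shows "gagliardo \<alpha> (\<lambda>x. (f x, g x)) = gagliardo \<alpha> f + gagliardo \<alpha> g"
proof -
  have "increment (\<lambda>x. (f x, g x)) = (\<lambda>z. (increment f z, increment g z))"
    by (simp add: increment_def fun_eq_iff)
  then show ?thesis unfolding gagliardo_def by (simp add: sqn_pair)
qed

section \<open>Level set estimates and the Gagliardo--Nirenberg inequality\<close>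

abbreviation ball_mass :: "('a::euclidean_space \<Rightarrow> 'v::real_normed_vector) \<Rightarrow> 'a \<Rightarrow> real \<Rightarrow> ennreal" where
  "ball_mass u x \<rho> \<equiv> \<integral>\<^sup>+y. indicator (cball x \<rho>) y * ennreal ((norm (u y))\<^sup>2) \<partial>lborel"

abbreviation powr_integral :: "'x measure \<Rightarrow> real \<Rightarrow> ('x \<Rightarrow> 'v::real_normed_vector) \<Rightarrow> ennreal" where
  "powr_integral M p f \<equiv> \<integral>\<^sup>+x. ennreal (norm (f x) powr p) \<partial>M"

lemma gag_kernel_lower:
  fixes \<alpha> :: real
  assumes \<alpha>: "0 < \<alpha>" "\<alpha> < 1"
  shows "\<exists>c>0. \<forall>h::'a::euclidean_space. ennreal (c * norm h powr (- (real DIM('a) + 2 * \<alpha>))) \<le> gag_kernel \<alpha> h"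
proof -
  have "0 < kernel_const DIM('a) \<alpha> / subordination_const \<alpha>"
    using kernel_const_pos[of "DIM('a)" \<alpha>] subordination_const_finite[OF \<alpha>] by (simp add: ennreal_zero_less_divide zero_less_iff_neq_zero)
  then obtain b where "0 < b" "b < kernel_const DIM('a) \<alpha> / subordination_const \<alpha>"
    using dense by blast
  moreover from this obtain c where "b = ennreal c" "0 \<le> c" by (cases b) auto
  ultimately have c: "0 < c" "ennreal c \<le> kernel_const DIM('a) \<alpha> / subordination_const \<alpha>" by auto
  have "ennreal (c * norm h powr (- (real DIM('a) + 2 * \<alpha>))) \<le> gag_kernel \<alpha> h" for h :: 'a
  proof -
    have "ennreal (c * norm h powr (- (real DIM('a) + 2 * \<alpha>))) = ennreal c * ennreal (norm h powr (- (real DIM('a) + 2 * \<alpha>)))"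
      using c(1) by (simp add: ennreal_mult)
    also have "\<dots> \<le> gag_kernel \<alpha> h" unfolding gag_kernel_def by (intro mult_right_mono c(2)) simp
    finally show ?thesis .
  qed
  then show ?thesis using c(1) by blast
qed

text \<open>On a ball of radius \<open>\<rho>\<close> the kernel is bounded below by a multiple of \<open>\<rho>\<^sup>-\<^sup>(\<^sup>N\<^sup>+\<^sup>2\<^sup>\<alpha>\<^sup>)\<close>.\<close>

lemma ball_shift_dist:
  assumes \<alpha>: "0 < \<alpha>" "\<alpha> < 1"
  shows "\<exists>C>0. \<forall>(u::'a::euclidean_space \<Rightarrow> 'v::euclidean_space) \<rho>. u \<in> borel_measurable borel \<longrightarrow> 0 < \<rho> \<longrightarrow>
    (\<integral>\<^sup>+h. indicator (cball 0 \<rho>) h * shift_dist u h \<partial>lborel) \<le> ennreal (C * \<rho> powr (real DIM('a) + 2 * \<alpha>)) * gagliardo \<alpha> u"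
proof -
  obtain c where c: "0 < c" "\<And>h::'a. ennreal (c * norm h powr (- (real DIM('a) + 2 * \<alpha>))) \<le> gag_kernel \<alpha> h"
    using gag_kernel_lower[OF \<alpha>] by blast
  have "(\<integral>\<^sup>+h. indicator (cball 0 \<rho>) h * shift_dist u h \<partial>lborel) \<le> ennreal (1 / c * \<rho> powr (real DIM('a) + 2 * \<alpha>)) * gagliardo \<alpha> u"
    if [measurable]: "u \<in> borel_measurable borel" and \<rho>: "0 < \<rho>" for u :: "'a \<Rightarrow> 'v" and \<rho>
  proof -
    let ?k = "ennreal (1 / c * \<rho> powr (real DIM('a) + 2 * \<alpha>))"
    have "(\<integral>\<^sup>+h. indicator (cball 0 \<rho>) h * shift_dist u h \<partial>lborel) \<le> (\<integral>\<^sup>+h. ?k * (gag_kernel \<alpha> h * shift_dist u h) \<partial>lborel)"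
    proof (rule nn_integral_mono_AE)
      have "AE h in lborel. h \<noteq> (0::'a)" by (rule AE_lborel_singleton)
      then show "AE h in lborel. indicator (cball 0 \<rho>) h * shift_dist u h \<le> ?k * (gag_kernel \<alpha> h * shift_dist u h)"
      proof eventually_elim
        fix h :: 'a assume h: "h \<noteq> 0"
        have "indicator (cball 0 \<rho>) h \<le> ?k * ennreal (c * norm h powr (- (real DIM('a) + 2 * \<alpha>)))"
        proof (cases "h \<in> cball 0 \<rho>")
          case True
          have "1 \<le> (\<rho> / norm h) powr (real DIM('a) + 2 * \<alpha>)"
            using True h \<alpha> by (intro ge_one_powr_ge_zero) auto
          also have "\<dots> = (1 / c * \<rho> powr (real DIM('a) + 2 * \<alpha>)) * (c * norm h powr (- (real DIM('a) + 2 * \<alpha>)))"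
          proof -
            define e where "e = real DIM('a) + 2 * \<alpha>"
            show ?thesis
              unfolding e_def[symmetric] using c \<rho> h by (simp add: powr_divide powr_minus field_simps)
          qed
          finally have "ennreal 1 \<le> ennreal ((1 / c * \<rho> powr (real DIM('a) + 2 * \<alpha>)) * (c * norm h powr (- (real DIM('a) + 2 * \<alpha>))))"
            by (rule ennreal_leI)
          then show ?thesis using True c by (subst ennreal_mult'[symmetric]) auto
        qed simp
        also have "\<dots> \<le> ?k * gag_kernel \<alpha> h" by (intro mult_left_mono c(2)) simp
        finally show "indicator (cball 0 \<rho>) h * shift_dist u h \<le> ?k * (gag_kernel \<alpha> h * shift_dist u h)"
          unfolding mult.assoc[symmetric] by (intro mult_right_mono) auto
      qed
    qed
    also have "\<dots> = ?k * (\<integral>\<^sup>+h. gag_kernel \<alpha> h * shift_dist u h \<partial>lborel)"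
      by (rule nn_integral_cmult) measurable
    finally show ?thesis by (simp only: gagliardo_alt[OF that(1)])
  qed
  then show ?thesis using c(1) by (intro exI[of _ "1 / c"]) auto
qed

lemma shift_dist_add:
  fixes u :: "'a::euclidean_space \<Rightarrow> 'v::{real_normed_vector,second_countable_topology}"
  assumes [measurable]: "u \<in> borel_measurable borel"
  shows "shift_dist u (h + k) \<le> 2 * shift_dist u h + 2 * shift_dist u k"
proof -
  have "shift_dist u (h + k) = sqn lborel (\<lambda>x. (u (x + h + k) - u (x + h)) + (u (x + h) - u x))"
    unfolding shift_dist_def by (simp add: add_ac)
  also have "\<dots> \<le> 2 * sqn lborel (\<lambda>x. u (x + h + k) - u (x + h)) + 2 * sqn lborel (\<lambda>x. u (x + h) - u x)"
    by (rule sqn_add_le) measurable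
  also have "sqn lborel (\<lambda>x. u (x + h + k) - u (x + h)) = shift_dist u k"
    unfolding shift_dist_def using sqn_shift[of "\<lambda>x. u (x + k) - u x" h] by (simp add: add_ac)
  finally show ?thesis by (simp add: shift_dist_def add.commute)
qed

text \<open>Averaging \<open>|u(x+k) - u(x)| \<le> |u(x+k) - u(x+k-h)| + |u(x+(k-h)) - u(x)|\<close> over a ball of increments
  \<open>h\<close> of radius \<open>|k|\<close>.\<close>

lemma shift_dist_gagliardo:
  assumes \<alpha>: "0 < \<alpha>" "\<alpha> < 1"
  shows "\<exists>C>0. \<forall>(u::'a::euclidean_space \<Rightarrow> 'v::euclidean_space) k. u \<in> borel_measurable borel \<longrightarrow>
    shift_dist u k \<le> ennreal (C * norm k powr (2 * \<alpha>)) * gagliardo \<alpha> u"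
proof -
  obtain C where C: "0 < C" "\<And>(u::'a \<Rightarrow> 'v) \<rho>. u \<in> borel_measurable borel \<Longrightarrow> 0 < \<rho> \<Longrightarrow>
    (\<integral>\<^sup>+h. indicator (cball 0 \<rho>) h * shift_dist u h \<partial>lborel) \<le> ennreal (C * \<rho> powr (real DIM('a) + 2 * \<alpha>)) * gagliardo \<alpha> u"
    using ball_shift_dist[OF \<alpha>] by blast
  define V where "V = unit_ball_vol (real DIM('a))"
  have V: "0 < V" by (simp add: V_def unit_ball_vol_pos)
  define C' where "C' = 2 * C * (1 + 2 powr (real DIM('a) + 2 * \<alpha>)) / V"
  have "shift_dist u k \<le> ennreal (C' * norm k powr (2 * \<alpha>)) * gagliardo \<alpha> u"
    if [measurable]: "u \<in> borel_measurable borel" for u :: "'a \<Rightarrow> 'v" and k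
  proof (cases "k = 0")
    case True
    then show ?thesis by (simp add: shift_dist_def sqn_def)
  next
    case False
    define r where "r = norm k"
    have r: "0 < r" using False by (simp add: r_def)
    have neg: "shift_dist u (- h) = shift_dist u h" for h
    proof -
      have "shift_dist u (- h) = sqn lborel (\<lambda>x. u (x + h + - h) - u (x + h))"
        unfolding shift_dist_def using sqn_shift[of "\<lambda>x. u (x + - h) - u x" h] by simp
      then show ?thesis unfolding shift_dist_def by (simp add: sqn_diff_commute)
    qed
    have [measurable]: "cball (z::'a) s \<in> sets borel" for z s by simp
    have 1: "ennreal (V * r ^ DIM('a)) * shift_dist u k = (\<integral>\<^sup>+h. indicator (cball 0 r) h * shift_dist u k \<partial>(lborel :: 'a measure))"
      using r by (subst nn_integral_multc) (simp_all add: emeasure_cball V_def)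
    also have "\<dots> \<le> (\<integral>\<^sup>+h. 2 * (indicator (cball 0 r) h * shift_dist u h) + 2 * (indicator (cball 0 (2 * r)) (h - k) * shift_dist u (h - k)) \<partial>lborel)"
    proof (intro nn_integral_mono)
      fix h :: 'a
      have "shift_dist u k \<le> 2 * shift_dist u h + 2 * shift_dist u (h - k)"
        using shift_dist_add[OF that, of h "k - h"] neg[of "k - h"] by simp
      moreover have "h \<in> cball 0 r \<Longrightarrow> h - k \<in> cball 0 (2 * r)"
        using norm_triangle_ineq4[of h k] by (simp add: r_def)
      ultimately show "indicator (cball 0 r) h * shift_dist u k \<le> 2 * (indicator (cball 0 r) h * shift_dist u h) + 2 * (indicator (cball 0 (2 * r)) (h - k) * shift_dist u (h - k))"
        by (auto simp: indicator_def)
    qed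
    also have "\<dots> = 2 * (\<integral>\<^sup>+h. indicator (cball 0 r) h * shift_dist u h \<partial>lborel) + 2 * (\<integral>\<^sup>+h. indicator (cball 0 (2 * r)) (h - k) * shift_dist u (h - k) \<partial>lborel)"
      by (simp add: nn_integral_add nn_integral_cmult)
    also have "(\<integral>\<^sup>+h. indicator (cball 0 (2 * r)) (h - k) * shift_dist u (h - k) \<partial>lborel) = (\<integral>\<^sup>+h. indicator (cball 0 (2 * r)) h * shift_dist u h \<partial>lborel)"
      using nn_integral_lborel_shift[of "\<lambda>h. indicator (cball 0 (2 * r)) h * shift_dist u h" "- k"] by simp
    also have "2 * (\<integral>\<^sup>+h. indicator (cball 0 r) h * shift_dist u h \<partial>lborel) + 2 * (\<integral>\<^sup>+h. indicator (cball 0 (2 * r)) h * shift_dist u h \<partial>lborel)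
        \<le> 2 * (ennreal (C * r powr (real DIM('a) + 2 * \<alpha>)) * gagliardo \<alpha> u) + 2 * (ennreal (C * (2 * r) powr (real DIM('a) + 2 * \<alpha>)) * gagliardo \<alpha> u)"
      using r by (intro add_mono mult_left_mono C that) auto
    also have "\<dots> = ennreal (2 * (C * r powr (real DIM('a) + 2 * \<alpha>)) + 2 * (C * (2 * r) powr (real DIM('a) + 2 * \<alpha>))) * gagliardo \<alpha> u"
      using C(1) by (subst ennreal_plus) (simp_all add: ennreal_mult distrib_right mult.assoc)
    also have "2 * (C * r powr (real DIM('a) + 2 * \<alpha>)) + 2 * (C * (2 * r) powr (real DIM('a) + 2 * \<alpha>)) = (V * r ^ DIM('a)) * (C' * r powr (2 * \<alpha>))"
    proof -
      have "r powr (real DIM('a) + 2 * \<alpha>) = r ^ DIM('a) * r powr (2 * \<alpha>)"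
        using r by (simp add: powr_add powr_realpow)
      then show ?thesis using V r by (simp add: C'_def powr_mult field_simps)
    qed
    also have "ennreal ((V * r ^ DIM('a)) * (C' * r powr (2 * \<alpha>))) = ennreal (V * r ^ DIM('a)) * ennreal (C' * r powr (2 * \<alpha>))"
      using V r by (intro ennreal_mult') auto
    finally have "ennreal (V * r ^ DIM('a)) * shift_dist u k \<le> ennreal (V * r ^ DIM('a)) * (ennreal (C' * r powr (2 * \<alpha>)) * gagliardo \<alpha> u)"
      by (simp only: mult.assoc)
    then show ?thesis
      using V r by (subst (asm) ennreal_mult_le_mult_iff) (auto simp: r_def)
  qed
  moreover have "0 < C'" using C(1) V by (auto simp: C'_def intro!: divide_pos_pos mult_pos_pos add_pos_pos)
  ultimately show ?thesis by blast
qed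

text \<open>Where \<open>|u| > m\<close> but all masses on balls of radius \<open>\<rho>\<close> are small compared to \<open>m\<^sup>2 \<rho>\<^sup>N\<close>, the
  value of \<open>u\<close> at a point must come from its increments on the ball rather than from its ball average.\<close>

lemma level_set_estimate:
  assumes \<alpha>: "0 < \<alpha>" "\<alpha> < 1"
  shows "\<exists>C>0. \<forall>(u::'a::euclidean_space \<Rightarrow> 'v::euclidean_space) \<rho> m. u \<in> borel_measurable borel \<longrightarrow> sqn lborel u < \<infinity> \<longrightarrow> 0 < \<rho> \<longrightarrow> 0 < m \<longrightarrow>
    (\<forall>x. ball_mass u x \<rho> \<le> ennreal (unit_ball_vol (real DIM('a)) * \<rho> ^ DIM('a) * m\<^sup>2 / 4)) \<longrightarrow>
    (\<integral>\<^sup>+x. indicator {x. m < norm (u x)} x * ennreal ((norm (u x))\<^sup>2) \<partial>lborel) \<le> ennreal (C * \<rho> powr (2 * \<alpha>)) * gagliardo \<alpha> u"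
proof -
  obtain C where C: "0 < C" "\<And>(u::'a \<Rightarrow> 'v) \<rho>. u \<in> borel_measurable borel \<Longrightarrow> 0 < \<rho> \<Longrightarrow>
    (\<integral>\<^sup>+h. indicator (cball 0 \<rho>) h * shift_dist u h \<partial>lborel) \<le> ennreal (C * \<rho> powr (real DIM('a) + 2 * \<alpha>)) * gagliardo \<alpha> u"
    using ball_shift_dist[OF \<alpha>] by blast
  define V where "V = unit_ball_vol (real DIM('a))"
  have V: "0 < V" by (simp add: V_def unit_ball_vol_pos)
  have "(\<integral>\<^sup>+x. indicator {x. m < norm (u x)} x * ennreal ((norm (u x))\<^sup>2) \<partial>lborel) \<le> ennreal (4 * C / V * \<rho> powr (2 * \<alpha>)) * gagliardo \<alpha> u"
    if [measurable]: "u \<in> borel_measurable borel" and fin: "sqn lborel u < \<infinity>" and \<rho>: "0 < \<rho>" and m: "0 < m"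
      and small: "\<And>x. ball_mass u x \<rho> \<le> ennreal (V * \<rho> ^ DIM('a) * m\<^sup>2 / 4)"
    for u :: "'a \<Rightarrow> 'v" and \<rho> m
  proof -
    define b where "b = V * \<rho> ^ DIM('a)"
    have b: "0 < b" using V \<rho> by (simp add: b_def)
    have cb[measurable]: "cball (z::'a) s \<in> sets borel" for z s by simp
    define A where "A x = (\<integral>\<^sup>+h. indicator (cball 0 \<rho>) h * ennreal ((norm (u (x + h) - u x))\<^sup>2) \<partial>lborel)" for x
    have [measurable]: "A \<in> borel_measurable borel" unfolding A_def by measurable
    have bd: "(\<integral>\<^sup>+h. indicator (cball 0 \<rho>) h * ennreal c \<partial>(lborel :: 'a measure)) = ennreal b * ennreal c" for c
      using \<rho> by (subst nn_integral_multc) (simp_all add: emeasure_cball b_def V_def)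
    have pt: "indicator {x. m < norm (u x)} x * ennreal ((norm (u x))\<^sup>2) \<le> ennreal (4 / b) * A x" for x
    proof (cases "m < norm (u x)")
      case True
      let ?s = "(norm (u x))\<^sup>2"
      have "ennreal b * ennreal ?s = (\<integral>\<^sup>+h. indicator (cball 0 \<rho>) h * ennreal ?s \<partial>(lborel :: 'a measure))"
        by (rule bd[symmetric])
      also have "\<dots> \<le> (\<integral>\<^sup>+h. 2 * (indicator (cball 0 \<rho>) h * ennreal ((norm (u (x + h) - u x))\<^sup>2)) + 2 * (indicator (cball x \<rho>) (h + x) * ennreal ((norm (u (h + x)))\<^sup>2)) \<partial>lborel)"
      proof (intro nn_integral_mono)
        fix h :: 'a
        have "(norm ((u (x + h) - u x) + - u (x + h)))\<^sup>2 \<le> (1 + 1) * (norm (u (x + h) - u x))\<^sup>2 + (1 + 1 / 1) * (norm (- u (x + h)))\<^sup>2"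
          by (rule norm_sq_split) simp
        then have "ennreal ?s \<le> ennreal (2 * (norm (u (x + h) - u x))\<^sup>2 + 2 * (norm (u (h + x)))\<^sup>2)"
          by (intro ennreal_leI) (simp add: add.commute)
        also have "\<dots> = 2 * ennreal ((norm (u (x + h) - u x))\<^sup>2) + 2 * ennreal ((norm (u (h + x)))\<^sup>2)"
          by (simp add: ennreal_plus ennreal_mult)
        moreover have "h \<in> cball 0 \<rho> \<Longrightarrow> h + x \<in> cball x \<rho>" by (simp add: dist_norm)
        ultimately show "indicator (cball 0 \<rho>) h * ennreal ?s \<le> 2 * (indicator (cball 0 \<rho>) h * ennreal ((norm (u (x + h) - u x))\<^sup>2)) + 2 * (indicator (cball x \<rho>) (h + x) * ennreal ((norm (u (h + x)))\<^sup>2))"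
          by (auto simp: indicator_def)
      qed
      also have "\<dots> = 2 * A x + 2 * (\<integral>\<^sup>+h. indicator (cball x \<rho>) (h + x) * ennreal ((norm (u (h + x)))\<^sup>2) \<partial>lborel)"
        unfolding A_def by (simp add: nn_integral_add nn_integral_cmult)
      also have "(\<integral>\<^sup>+h. indicator (cball x \<rho>) (h + x) * ennreal ((norm (u (h + x)))\<^sup>2) \<partial>lborel) = ball_mass u x \<rho>"
        using nn_integral_lborel_shift[of "\<lambda>y. indicator (cball x \<rho>) y * ennreal ((norm (u y))\<^sup>2)" x] by simp
      also have "2 * A x + 2 * \<dots> \<le> 2 * A x + 2 * ennreal (b * m\<^sup>2 / 4)"
        using small[of x] by (intro add_mono mult_left_mono order_refl) (auto simp: b_def)
      also have "\<dots> \<le> 2 * A x + ennreal (b * ?s / 2)"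
      proof -
        have "m\<^sup>2 \<le> ?s" using True m by (intro power_mono) auto
        then have "2 * (b * m\<^sup>2 / 4) \<le> b * ?s / 2" using b by simp
        then have "2 * ennreal (b * m\<^sup>2 / 4) \<le> ennreal (b * ?s / 2)"
          using b by (subst numeral_mult_ennreal) (auto intro: ennreal_leI)
        then show ?thesis by (rule add_left_mono)
      qed
      finally have h: "ennreal (b * ?s) \<le> 2 * A x + ennreal (b * ?s / 2)" using b by (simp add: ennreal_mult)
      show ?thesis
      proof (cases "A x")
        case (real a)
        have "ennreal (b * ?s) \<le> ennreal (2 * a + b * ?s / 2)"
          using h b real by (simp add: numeral_mult_ennreal ennreal_plus)
        then have "b * ?s \<le> 2 * a + b * ?s / 2" using real b by (subst (asm) ennreal_le_iff) auto
        then have "?s \<le> 4 / b * a" using b by (simp add: field_simps)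
        then have "ennreal ?s \<le> ennreal (4 / b) * ennreal a" using b real by (subst ennreal_mult[symmetric]) (auto intro: ennreal_leI)
        then show ?thesis using True real by simp
      next
        case top
        then show ?thesis using b by (simp add: ennreal_mult_top)
      qed
    qed simp
    have "(\<integral>\<^sup>+x. indicator {x. m < norm (u x)} x * ennreal ((norm (u x))\<^sup>2) \<partial>lborel) \<le> (\<integral>\<^sup>+x. ennreal (4 / b) * A x \<partial>lborel)"
      by (intro nn_integral_mono pt)
    also have "\<dots> = ennreal (4 / b) * (\<integral>\<^sup>+x. A x \<partial>lborel)" by (rule nn_integral_cmult) measurable
    also have "(\<integral>\<^sup>+x. A x \<partial>lborel) = (\<integral>\<^sup>+h. indicator (cball 0 \<rho>) h * shift_dist u h \<partial>lborel)"
    proof -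
      have "(\<integral>\<^sup>+x. A x \<partial>lborel) = (\<integral>\<^sup>+h. \<integral>\<^sup>+x. indicator (cball 0 \<rho>) h * ennreal ((norm (u (x + h) - u x))\<^sup>2) \<partial>lborel \<partial>lborel)"
        unfolding A_def by (rule lborel_pair.Fubini') measurable
      also have "\<dots> = (\<integral>\<^sup>+h. indicator (cball 0 \<rho>) h * shift_dist u h \<partial>lborel)"
        unfolding shift_dist_def sqn_def by (intro nn_integral_cong nn_integral_cmult) measurable
      finally show ?thesis .
    qed
    also have "ennreal (4 / b) * \<dots> \<le> ennreal (4 / b) * (ennreal (C * \<rho> powr (real DIM('a) + 2 * \<alpha>)) * gagliardo \<alpha> u)"
      by (intro mult_left_mono C(2) that(1) \<rho>) simp
    also have "\<dots> = ennreal (4 / b * (C * \<rho> powr (real DIM('a) + 2 * \<alpha>))) * gagliardo \<alpha> u"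
      using b C(1) by (subst ennreal_mult) (auto simp: mult.assoc)
    also have "4 / b * (C * \<rho> powr (real DIM('a) + 2 * \<alpha>)) = 4 * C / V * \<rho> powr (2 * \<alpha>)"
      using \<rho> V by (simp add: b_def powr_add powr_realpow)
    finally show ?thesis .
  qed
  then show ?thesis using C(1) V unfolding V_def by (intro exI[of _ "4 * C / unit_ball_vol (real DIM('a))"]) auto
qed

text \<open>Dyadic summation of the level set estimate. With \<open>\<sigma>\<close> small this is a Gagliardo--Nirenberg
  inequality; with \<open>\<sigma> = 1\<close> it shows that bounded families without concentration of mass vanish in \<open>L\<^sup>p\<close>.\<close>

lemma concentration_estimate:
  assumes \<alpha>: "0 < \<alpha>" "\<alpha> < 1" and p: "2 < p" "p < 2 + 4 * \<alpha> / real DIM('a)"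
  shows "\<exists>C>0. \<forall>(u::'a::euclidean_space \<Rightarrow> 'v::euclidean_space) M K \<eta> \<sigma>. u \<in> borel_measurable borel \<longrightarrow>
    sqn lborel u \<le> ennreal M \<longrightarrow> gagliardo \<alpha> u \<le> ennreal K \<longrightarrow> 0 \<le> M \<longrightarrow> 0 \<le> K \<longrightarrow> 0 < \<eta> \<longrightarrow> 0 < \<sigma> \<longrightarrow>
    (\<forall>x. ball_mass u x \<sigma> \<le> ennreal \<eta>) \<longrightarrow>
    powr_integral lborel p u \<le>
      ennreal ((4 * \<eta> / (unit_ball_vol (real DIM('a)) * \<sigma> ^ DIM('a))) powr ((p - 2) / 2) * (M + C * \<sigma> powr (2 * \<alpha>) * K))"
proof -
  obtain C1 where C1: "0 < C1" "\<And>(u::'a \<Rightarrow> 'v) \<rho> l. u \<in> borel_measurable borel \<Longrightarrow> sqn lborel u < \<infinity> \<Longrightarrow> 0 < \<rho> \<Longrightarrow> 0 < l \<Longrightarrow>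
    (\<And>x. ball_mass u x \<rho> \<le> ennreal (unit_ball_vol (real DIM('a)) * \<rho> ^ DIM('a) * l\<^sup>2 / 4)) \<Longrightarrow>
    (\<integral>\<^sup>+x. indicator {x. l < norm (u x)} x * ennreal ((norm (u x))\<^sup>2) \<partial>lborel) \<le> ennreal (C1 * \<rho> powr (2 * \<alpha>)) * gagliardo \<alpha> u"
    using level_set_estimate[OF \<alpha>, where 'a='a and 'v='v] by meson
  define N where "N = real DIM('a)"
  have N: "0 < N" by (simp add: N_def)
  define V where "V = unit_ball_vol (real DIM('a))"
  have V: "0 < V" by (simp add: V_def unit_ball_vol_pos)
  \<comment> \<open>Doubling the level multiplies the power by \<open>e\<close> and the bound for the mass of the level set by \<open>d\<close>; subcriticality of \<open>p\<close> makes the geometric series converge.\<close>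
  define e where "e = 2 powr (p - 2)"
  define d where "d = 2 powr (- (4 * \<alpha> / N))"
  have ed: "0 < e" "0 < d" "e * d < 1"
  proof -
    have "e * d = 2 powr (p - 2 - 4 * \<alpha> / N)" unfolding e_def d_def by (simp flip: powr_add)
    also have "\<dots> < 2 powr 0" using p by (intro powr_less_mono) (auto simp: N_def)
    finally show "e * d < 1" by simp
  qed (auto simp: e_def d_def)
  define C where "C = C1 * e / (1 - e * d)"
  have "powr_integral lborel p u \<le> ennreal ((4 * \<eta> / (V * \<sigma> ^ DIM('a))) powr ((p - 2) / 2) * (M + C * \<sigma> powr (2 * \<alpha>) * K))"
    if [measurable]: "u \<in> borel_measurable borel" and M: "sqn lborel u \<le> ennreal M" and K: "gagliardo \<alpha> u \<le> ennreal K"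
      and MK: "0 \<le> M" "0 \<le> K" and \<eta>: "0 < \<eta>" and \<sigma>: "0 < \<sigma>"
      and small: "\<And>x. ball_mass u x \<sigma> \<le> ennreal \<eta>"
    for u :: "'a \<Rightarrow> 'v" and M K \<eta> \<sigma>
  proof -
    define l0 where "l0 = sqrt (4 * \<eta> / (V * \<sigma> ^ DIM('a)))"
    have l0: "0 < l0" using \<eta> V \<sigma> by (simp add: l0_def)
    have l02: "V * \<sigma> ^ DIM('a) * l0\<^sup>2 / 4 = \<eta>" using \<eta> V \<sigma> by (simp add: l0_def)
    define L where "L = l0 powr (p - 2)"
    have L: "L = (4 * \<eta> / (V * \<sigma> ^ DIM('a))) powr ((p - 2) / 2)"
      using \<eta> V \<sigma> by (simp add: L_def l0_def powr_half_sqrt[symmetric] powr_powr)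
    define T where "T k = (\<integral>\<^sup>+x. indicator {x. 2 ^ k * l0 < norm (u x)} x * ennreal ((norm (u x))\<^sup>2) \<partial>lborel)" for k :: nat
    have T: "T k \<le> ennreal (C1 * \<sigma> powr (2 * \<alpha>) * K * d ^ k)" for k
    proof -
      \<comment> \<open>On the level \<open>2\<^sup>k l0\<close> the radius shrinks so that the volume of the ball times the squared level stays fixed.\<close>
      define \<rho> where "\<rho> = \<sigma> * 2 powr (- (2 * real k / N))"
      have \<rho>: "0 < \<rho>" "\<rho> \<le> \<sigma>"
      proof -
        have "2 powr (- (2 * real k / N)) \<le> 2 powr 0" using N by (intro powr_mono) auto
        then show "\<rho> \<le> \<sigma>" using \<sigma> by (simp add: \<rho>_def mult_left_le)
      qed (use \<sigma> in \<open>simp add: \<rho>_def\<close>)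
      have "\<rho> ^ DIM('a) = \<sigma> ^ DIM('a) * (2 powr (- (2 * real k / N))) powr N"
      proof -
        have "(2 powr (- (2 * real k / N))) powr N = (2 powr (- (2 * real k / N))) ^ DIM('a)"
          unfolding N_def by (rule powr_realpow) simp
        then show ?thesis by (simp add: \<rho>_def power_mult_distrib)
      qed
      also have "(2 powr (- (2 * real k / N))) powr N = 2 powr (- real (2 * k))"
        unfolding powr_powr using N by simp
      also have "\<dots> = 1 / 2 ^ (2 * k)" by (simp only: powr_minus powr_realpow inverse_eq_divide zero_less_numeral)
      finally have "\<rho> ^ DIM('a) = \<sigma> ^ DIM('a) * (1 / 2 ^ (2 * k))" .
      moreover have "(2 ^ k * l0)\<^sup>2 = 2 ^ (2 * k) * l0\<^sup>2" by (simp add: power_mult_distrib power_even_eq)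
      ultimately have "V * \<rho> ^ DIM('a) * (2 ^ k * l0)\<^sup>2 / 4 = V * \<sigma> ^ DIM('a) * l0\<^sup>2 / 4" by simp
      then have r: "V * \<rho> ^ DIM('a) * (2 ^ k * l0)\<^sup>2 / 4 = \<eta>"
        using l02 by simp
      have "ball_mass u x \<rho> \<le> ennreal (V * \<rho> ^ DIM('a) * (2 ^ k * l0)\<^sup>2 / 4)" for x
        unfolding r using \<rho> by (intro order_trans[OF nn_integral_mono small[of x]] mult_right_mono) (auto simp: indicator_def)
      then have "T k \<le> ennreal (C1 * \<rho> powr (2 * \<alpha>)) * gagliardo \<alpha> u"
        unfolding T_def V_def using l0 \<rho>(1) le_less_trans[OF M] by (intro C1 that(1)) auto
      also have "\<dots> \<le> ennreal (C1 * \<rho> powr (2 * \<alpha>)) * ennreal K" by (intro mult_left_mono K) simp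
      also have "\<dots> = ennreal (C1 * \<rho> powr (2 * \<alpha>) * K)" using C1 MK by (simp add: ennreal_mult)
      also have "\<rho> powr (2 * \<alpha>) = \<sigma> powr (2 * \<alpha>) * d ^ k"
      proof -
        have "(2 powr (- (2 * real k / N))) powr (2 * \<alpha>) = 2 powr (- (4 * \<alpha> / N) * real k)"
          unfolding powr_powr by (simp add: field_simps)
        also have "\<dots> = (2 powr (- (4 * \<alpha> / N))) powr real k" by (simp only: powr_powr)
        also have "\<dots> = d ^ k" unfolding d_def by (simp add: powr_realpow)
        finally show ?thesis by (simp add: \<rho>_def powr_mult)
      qed
      finally show ?thesis by (simp add: mult_ac)
    qed
    have pt: "ennreal (norm (u x) powr p) \<le> ennreal L * ennreal ((norm (u x))\<^sup>2)
        + (\<Sum>k. ennreal (L * e ^ Suc k) * (indicator {x. 2 ^ k * l0 < norm (u x)} x * ennreal ((norm (u x))\<^sup>2)))" for x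
    proof -
      define t where "t = norm (u x)"
      have t0: "0 \<le> t" by (simp add: t_def)
      have tp: "t powr p = t powr (p - 2) * t\<^sup>2"
        using t0 p by (cases "t = 0") (auto simp flip: powr_add powr_numeral)
      show ?thesis
      proof (cases "t \<le> l0")
        case True
        then have "t powr (p - 2) \<le> L" unfolding L_def using t0 p by (intro powr_mono2) auto
        then have "t powr p \<le> L * t\<^sup>2" unfolding tp by (intro mult_right_mono) auto
        then have "ennreal (t powr p) \<le> ennreal L * ennreal (t\<^sup>2)"
          by (subst ennreal_mult[symmetric]) (auto simp: L_def intro: ennreal_leI)
        then show ?thesis unfolding t_def by (rule order_trans) simp
      next
        case False
        obtain n :: nat where "t / l0 < 2 ^ n" using real_arch_pow[of 2 "t / l0"] by auto
        then have ex: "t \<le> 2 ^ n * l0" using l0 by (simp add: field_simps)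
        define m where "m = (LEAST n. t \<le> 2 ^ n * l0)"
        have m: "t \<le> 2 ^ m * l0" unfolding m_def by (rule LeastI[of "\<lambda>n. t \<le> 2 ^ n * l0", OF ex])
        have "m \<noteq> 0" using m False by (cases m) auto
        then obtain k where k: "m = Suc k" by (cases m) auto
        have k1: "2 ^ k * l0 < t" using not_less_Least[of k "\<lambda>n. t \<le> 2 ^ n * l0"] k unfolding m_def by auto
        have "t powr (p - 2) \<le> (2 ^ Suc k * l0) powr (p - 2)" using m k t0 p by (intro powr_mono2) auto
        also have "\<dots> = L * e ^ Suc k"
        proof -
          have "(2 ^ Suc k) powr (p - 2) = e ^ Suc k"
            unfolding e_def by (subst (1 2) powr_realpow[symmetric]) (simp_all add: powr_powr mult.commute)
          then show ?thesis by (simp add: powr_mult L_def mult.commute)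
        qed
        finally have "t powr p \<le> (L * e ^ Suc k) * t\<^sup>2" unfolding tp by (intro mult_right_mono) auto
        then have "ennreal (t powr p) \<le> ennreal (L * e ^ Suc k) * ennreal (t\<^sup>2)"
          using ed by (subst ennreal_mult[symmetric]) (auto simp: L_def intro: ennreal_leI)
        also have "\<dots> = ennreal (L * e ^ Suc k) * (indicator {x. 2 ^ k * l0 < norm (u x)} x * ennreal ((norm (u x))\<^sup>2))"
          using k1 by (simp add: t_def)
        also have "\<dots> \<le> (\<Sum>k. ennreal (L * e ^ Suc k) * (indicator {x. 2 ^ k * l0 < norm (u x)} x * ennreal ((norm (u x))\<^sup>2)))"
          using sum_le_suminf[of "\<lambda>k. ennreal (L * e ^ Suc k) * (indicator {x. 2 ^ k * l0 < norm (u x)} x * ennreal ((norm (u x))\<^sup>2))" "{k}"]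
          by simp
        finally show ?thesis unfolding t_def by (rule order_trans) simp
      qed
    qed
    have "powr_integral lborel p u \<le> (\<integral>\<^sup>+x. ennreal L * ennreal ((norm (u x))\<^sup>2)
        + (\<Sum>k. ennreal (L * e ^ Suc k) * (indicator {x. 2 ^ k * l0 < norm (u x)} x * ennreal ((norm (u x))\<^sup>2))) \<partial>lborel)"
      by (intro nn_integral_mono pt)
    also have "\<dots> = ennreal L * sqn lborel u + (\<Sum>k. ennreal (L * e ^ Suc k) * T k)"
      unfolding T_def sqn_def by (simp add: nn_integral_add nn_integral_cmult nn_integral_suminf)
    also have "\<dots> \<le> ennreal L * ennreal M + (\<Sum>k. ennreal (L * C1 * \<sigma> powr (2 * \<alpha>) * K * e * (e * d) ^ k))"
    proof (intro add_mono mult_left_mono M suminf_le)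
      fix k
      have "ennreal (L * e ^ Suc k) * T k \<le> ennreal (L * e ^ Suc k) * ennreal (C1 * \<sigma> powr (2 * \<alpha>) * K * d ^ k)"
        by (intro mult_left_mono T) simp
      also have "\<dots> = ennreal ((L * e ^ Suc k) * (C1 * \<sigma> powr (2 * \<alpha>) * K * d ^ k))"
        using ed C1 MK by (intro ennreal_mult[symmetric]) (auto simp: L_def)
      also have "(L * e ^ Suc k) * (C1 * \<sigma> powr (2 * \<alpha>) * K * d ^ k) = L * C1 * \<sigma> powr (2 * \<alpha>) * K * e * (e * d) ^ k"
        by (simp add: power_mult_distrib mult_ac)
      finally show "ennreal (L * e ^ Suc k) * T k \<le> ennreal (L * C1 * \<sigma> powr (2 * \<alpha>) * K * e * (e * d) ^ k)" .
    qed auto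
    also have "(\<Sum>k. ennreal (L * C1 * \<sigma> powr (2 * \<alpha>) * K * e * (e * d) ^ k)) = ennreal (L * C1 * \<sigma> powr (2 * \<alpha>) * K * e * (1 / (1 - e * d)))"
    proof -
      have s: "(\<lambda>k. (e * d) ^ k) sums (1 / (1 - e * d))"
        using ed by (intro geometric_sums) auto
      have "(\<lambda>k. L * C1 * \<sigma> powr (2 * \<alpha>) * K * e * (e * d) ^ k) sums (L * C1 * \<sigma> powr (2 * \<alpha>) * K * e * (1 / (1 - e * d)))"
        by (rule sums_mult[OF s])
      then show ?thesis
        using ed C1 MK by (subst suminf_ennreal2) (auto simp: sums_iff L_def)
    qed
    also have "ennreal L * ennreal M + \<dots> = ennreal (L * (M + C * \<sigma> powr (2 * \<alpha>) * K))"
      using ed C1 MK by (simp add: C_def L_def ennreal_mult[symmetric] ennreal_plus[symmetric] algebra_simps del: ennreal_plus)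
    finally show ?thesis unfolding L .
  qed
  moreover have "0 < C" using C1 ed by (simp add: C_def)
  ultimately show ?thesis unfolding V_def by blast
qed

lemma ball_mass_le: "(\<integral>\<^sup>+y. indicator S y * ennreal ((norm (u y))\<^sup>2) \<partial>M) \<le> sqn M u"
  unfolding sqn_def by (intro nn_integral_mono) (auto simp: indicator_def)

lemma gagliardo_nirenberg:
  assumes \<alpha>: "0 < \<alpha>" "\<alpha> < 1" and p: "2 < p" "p < 2 + 4 * \<alpha> / real DIM('a)"
    and \<epsilon>: "0 < \<epsilon>" and M: "0 \<le> M"
  shows "\<exists>D\<ge>0. \<forall>(u::'a::euclidean_space \<Rightarrow> 'v::euclidean_space) K. u \<in> borel_measurable borel \<longrightarrow>
    sqn lborel u \<le> ennreal M \<longrightarrow> gagliardo \<alpha> u \<le> ennreal K \<longrightarrow> 0 \<le> K \<longrightarrow>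
    powr_integral lborel p u \<le> ennreal (\<epsilon> * K + D)"
proof -
  obtain C where C: "0 < C" "\<And>(u::'a \<Rightarrow> 'v) M K \<eta> \<sigma>. u \<in> borel_measurable borel \<Longrightarrow>
    sqn lborel u \<le> ennreal M \<Longrightarrow> gagliardo \<alpha> u \<le> ennreal K \<Longrightarrow> 0 \<le> M \<Longrightarrow> 0 \<le> K \<Longrightarrow> 0 < \<eta> \<Longrightarrow> 0 < \<sigma> \<Longrightarrow>
    (\<And>x. ball_mass u x \<sigma> \<le> ennreal \<eta>) \<Longrightarrow>
    powr_integral lborel p u \<le>
      ennreal ((4 * \<eta> / (unit_ball_vol (real DIM('a)) * \<sigma> ^ DIM('a))) powr ((p - 2) / 2) * (M + C * \<sigma> powr (2 * \<alpha>) * K))"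
    using concentration_estimate[OF \<alpha> p, where 'v='v] by meson
  define N where "N = real DIM('a)"
  have N: "0 < N" by (simp add: N_def)
  define V where "V = unit_ball_vol (real DIM('a))"
  have V: "0 < V" by (simp add: V_def unit_ball_vol_pos)
  \<comment> \<open>The threshold \<open>\<eta>\<close> exceeds the total mass, so no ball violates it; the radius \<open>\<sigma>\<close> makes the coefficient of \<open>K\<close> equal to \<open>\<epsilon>\<close>.\<close>
  define \<eta> where "\<eta> = M + 1"
  have \<eta>: "0 < \<eta>" using M by (simp add: \<eta>_def)
  define q where "q = (p - 2) / 2"
  define \<gamma> where "\<gamma> = 2 * \<alpha> - N * q"
  have \<gamma>: "0 < \<gamma>" using p N by (simp add: \<gamma>_def q_def N_def field_simps)
  define c where "c = (4 * \<eta> / V) powr q * C"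
  have c: "0 < c" using \<eta> V C by (simp add: c_def)
  define \<sigma> where "\<sigma> = (\<epsilon> / c) powr (1 / \<gamma>)"
  have \<sigma>: "0 < \<sigma>" using \<epsilon> c by (simp add: \<sigma>_def)
  have \<sigma>\<gamma>: "\<sigma> powr \<gamma> = \<epsilon> / c" using \<epsilon> c \<gamma> by (simp add: \<sigma>_def powr_powr)
  define X where "X = (4 * \<eta> / (V * \<sigma> ^ DIM('a))) powr q"
  have X0: "0 \<le> X" by (simp add: X_def)
  have "X = (4 * \<eta> / V) powr q * \<sigma> powr (- (N * q))"
  proof -
    have "X = (4 * \<eta> / V) powr q / (\<sigma> powr N) powr q"
      unfolding X_def N_def using \<sigma> by (simp add: powr_realpow powr_divide[symmetric])
    then show ?thesis by (simp add: powr_powr powr_minus divide_inverse)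
  qed
  then have "X * (C * \<sigma> powr (2 * \<alpha>)) = c * (\<sigma> powr (- (N * q)) * \<sigma> powr (2 * \<alpha>))"
    by (simp add: c_def)
  also have "\<sigma> powr (- (N * q)) * \<sigma> powr (2 * \<alpha>) = \<epsilon> / c"
    unfolding powr_add[symmetric] \<sigma>\<gamma>[symmetric] \<gamma>_def by simp
  finally have XC: "X * (C * \<sigma> powr (2 * \<alpha>)) = \<epsilon>" using c by simp
  have "powr_integral lborel p u \<le> ennreal (\<epsilon> * K + X * M)"
    if u: "u \<in> borel_measurable borel" "sqn lborel u \<le> ennreal M" "gagliardo \<alpha> u \<le> ennreal K" "0 \<le> K" for u :: "'a \<Rightarrow> 'v" and K
  proof -
    have "ball_mass u x \<sigma> \<le> ennreal \<eta>" for x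
      by (rule order_trans[OF ball_mass_le order_trans[OF u(2)]]) (simp add: \<eta>_def ennreal_leI)
    then have "powr_integral lborel p u \<le> ennreal (X * (M + C * \<sigma> powr (2 * \<alpha>) * K))"
      unfolding X_def q_def V_def by (intro C u M \<eta> \<sigma>)
    also have "X * (M + C * \<sigma> powr (2 * \<alpha>) * K) = \<epsilon> * K + X * M"
      unfolding XC[symmetric] by (simp add: algebra_simps)
    finally show ?thesis .
  qed
  then show ?thesis using X0 M by (intro exI[of _ "X * M"]) auto
qed

text \<open>Lions' vanishing lemma, in quantitative form.\<close>

lemma vanishing:
  assumes \<alpha>: "0 < \<alpha>" "\<alpha> < 1" and p: "2 < p" "p < 2 + 4 * \<alpha> / real DIM('a)"
    and \<epsilon>: "0 < \<epsilon>" and B: "0 \<le> B"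
  shows "\<exists>\<delta>>0. \<forall>u::'a::euclidean_space \<Rightarrow> 'v::euclidean_space. u \<in> borel_measurable borel \<longrightarrow>
    sqn lborel u \<le> ennreal B \<longrightarrow> gagliardo \<alpha> u \<le> ennreal B \<longrightarrow>
    (\<forall>x. ball_mass u x 1 \<le> ennreal \<delta>) \<longrightarrow>
    powr_integral lborel p u \<le> ennreal \<epsilon>"
proof -
  obtain C where C: "0 < C" "\<And>(u::'a \<Rightarrow> 'v) M K \<eta> \<sigma>. u \<in> borel_measurable borel \<Longrightarrow>
    sqn lborel u \<le> ennreal M \<Longrightarrow> gagliardo \<alpha> u \<le> ennreal K \<Longrightarrow> 0 \<le> M \<Longrightarrow> 0 \<le> K \<Longrightarrow> 0 < \<eta> \<Longrightarrow> 0 < \<sigma> \<Longrightarrow>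
    (\<And>x. ball_mass u x \<sigma> \<le> ennreal \<eta>) \<Longrightarrow>
    powr_integral lborel p u \<le>
      ennreal ((4 * \<eta> / (unit_ball_vol (real DIM('a)) * \<sigma> ^ DIM('a))) powr ((p - 2) / 2) * (M + C * \<sigma> powr (2 * \<alpha>) * K))"
    using concentration_estimate[OF \<alpha> p, where 'v='v] by meson
  define V where "V = unit_ball_vol (real DIM('a))"
  have V: "0 < V" by (simp add: V_def unit_ball_vol_pos)
  define D where "D = B + C * B + 1"
  have D: "0 < D" using B C by (simp add: D_def add_nonneg_pos)
  define \<delta> where "\<delta> = V / 4 * (\<epsilon> / D) powr (2 / (p - 2))"
  have \<delta>: "0 < \<delta>" using V \<epsilon> D by (simp add: \<delta>_def)
  have "(4 * \<delta> / V) powr ((p - 2) / 2) = \<epsilon> / D"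
  proof -
    have a: "2 / (p - 2) * ((p - 2) / 2) = 1" using p by simp
    have b: "4 * \<delta> / V = (\<epsilon> / D) powr (2 / (p - 2))" using V by (simp add: \<delta>_def)
    show ?thesis unfolding b powr_powr a using \<epsilon> D by simp
  qed
  then have "(4 * \<delta> / (V * 1 ^ DIM('a))) powr ((p - 2) / 2) * (B + C * 1 powr (2 * \<alpha>) * B) = \<epsilon> / D * (B + C * B)"
    by simp
  also have "\<dots> \<le> \<epsilon> / D * D" using \<epsilon> D by (intro mult_left_mono) (auto simp: D_def)
  finally have le: "(4 * \<delta> / (V * 1 ^ DIM('a))) powr ((p - 2) / 2) * (B + C * 1 powr (2 * \<alpha>) * B) \<le> \<epsilon>"
    using D by simp
  have "powr_integral lborel p u \<le> ennreal \<epsilon>"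
    if u: "u \<in> borel_measurable borel" "sqn lborel u \<le> ennreal B" "gagliardo \<alpha> u \<le> ennreal B"
      "\<And>x. ball_mass u x 1 \<le> ennreal \<delta>" for u :: "'a \<Rightarrow> 'v"
    by (rule order_trans[OF C(2)[OF u(1-3) B B \<delta> zero_less_one u(4)]])
      (intro ennreal_leI, use le in \<open>simp only: V_def\<close>)
  then show ?thesis using \<delta> by blast
qed

section \<open>Homogeneous functionals and the Brezis--Lieb lemma\<close>

text \<open>Continuity and homogeneity are all that the Brezis--Lieb lemma uses. The class contains powers of single
  components, the coupling term, and the quadratic forms behind masses and kinetic energy.\<close>

definition homogeneous :: "real \<Rightarrow> ('v::euclidean_space \<Rightarrow> real) \<Rightarrow> bool" where
  "homogeneous p J \<longleftrightarrow> continuous_on UNIV J \<and> (\<forall>t\<ge>0. \<forall>z. J (t *\<^sub>R z) = t powr p * J z)"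

lemma homogeneous_measurable: "homogeneous p J \<Longrightarrow> J \<in> borel_measurable borel"
  by (auto simp: homogeneous_def intro: borel_measurable_continuous_onI)

lemma homogeneous_0: "homogeneous p J \<Longrightarrow> J 0 = 0"
  unfolding homogeneous_def using powr_0[of p] by (metis mult_zero_left order_refl scaleR_zero_left)

lemma homogeneous_bound:
  assumes "homogeneous p J"
  shows "\<exists>C\<ge>0. \<forall>z. \<bar>J z\<bar> \<le> C * norm z powr p"
proof -
  have "compact (J ` sphere 0 1)"
    using assms by (intro compact_continuous_image) (auto simp: homogeneous_def intro: continuous_on_subset)
  then have "bounded (J ` sphere 0 1)" by (rule compact_imp_bounded)
  then obtain C where "\<forall>y \<in> J ` sphere 0 1. norm y \<le> C" unfolding bounded_iff by blast
  then have C: "\<And>z. z \<in> sphere 0 1 \<Longrightarrow> \<bar>J z\<bar> \<le> C" by simp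
  have "\<bar>J z\<bar> \<le> max 0 C * norm z powr p" for z
  proof (cases "z = 0")
    case False
    have "J z = J (norm z *\<^sub>R (z /\<^sub>R norm z))" using False by simp
    also have "\<dots> = norm z powr p * J (z /\<^sub>R norm z)" using assms by (simp only: homogeneous_def norm_ge_zero)
    finally have "\<bar>J z\<bar> = norm z powr p * \<bar>J (z /\<^sub>R norm z)\<bar>" by (simp add: abs_mult)
    also have "\<dots> \<le> norm z powr p * max 0 C" using C[of "z /\<^sub>R norm z"] False by (intro mult_left_mono) auto
    finally show ?thesis by (simp add: mult.commute)
  qed (use homogeneous_0[OF assms] in simp)
  then show ?thesis by (intro exI[of _ "max 0 C"]) auto
qed

text \<open>If \<open>|b|\<close> is small relative to \<open>|a|\<close>, rescaling to \<open>|a| = 1\<close> reduces to uniform continuity on a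
  ball; otherwise both terms are controlled by \<open>|b|\<^sup>p\<close>.\<close>

lemma homogeneous_increment:
  fixes J :: "'v::euclidean_space \<Rightarrow> real"
  assumes J: "homogeneous p J" and p: "0 < p" and \<epsilon>: "0 < \<epsilon>"
  shows "\<exists>C\<ge>0. \<forall>a b. \<bar>J (a + b) - J a\<bar> \<le> \<epsilon> * norm a powr p + C * norm b powr p"
proof -
  obtain K where K: "0 \<le> K" "\<And>z. \<bar>J z\<bar> \<le> K * norm z powr p" using homogeneous_bound[OF J] by blast
  have "uniformly_continuous_on (cball 0 2) J"
    using J by (intro compact_uniformly_continuous) (auto simp: homogeneous_def intro: continuous_on_subset)
  then obtain d where d: "0 < d" "\<And>x y. x \<in> cball 0 2 \<Longrightarrow> y \<in> cball 0 2 \<Longrightarrow> dist y x < d \<Longrightarrow> dist (J y) (J x) < \<epsilon>"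
    unfolding uniformly_continuous_on_def using \<epsilon> by metis
  define c where "c = min (d / 2) 1"
  have c: "0 < c" "c \<le> 1" "c < d" using d by (auto simp: c_def)
  define C where "C = K * (((1 / c) + 1) powr p + (1 / c) powr p)"
  have C0: "0 \<le> C" using K by (simp add: C_def)
  have "\<bar>J (a + b) - J a\<bar> \<le> \<epsilon> * norm a powr p + C * norm b powr p" for a b
  proof (cases "norm b \<le> c * norm a")
    case True
    show ?thesis
    proof (cases "a = 0")
      case False
      let ?a = "a /\<^sub>R norm a" and ?b = "b /\<^sub>R norm a"
      have nb: "norm ?b \<le> c" using True False by (simp add: field_simps)
      have na: "norm ?a = 1" using False by simp
      have "dist (J (?a + ?b)) (J ?a) < \<epsilon>"
      proof (rule d(2))
        show "?a + ?b \<in> cball 0 2" using norm_triangle_ineq[of ?a ?b] na nb c by simp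
        show "dist (?a + ?b) ?a < d" using nb c by (simp add: dist_norm)
      qed (use na in auto)
      then have le: "\<bar>J (?a + ?b) - J ?a\<bar> \<le> \<epsilon>" by (simp add: dist_real_def)
      have sc: "J z = norm a powr p * J (z /\<^sub>R norm a)" for z
      proof -
        have "J z = J (norm a *\<^sub>R (z /\<^sub>R norm a))" using False by simp
        also have "\<dots> = norm a powr p * J (z /\<^sub>R norm a)" using J by (simp only: homogeneous_def norm_ge_zero)
        finally show ?thesis .
      qed
      have "J (a + b) - J a = norm a powr p * (J (?a + ?b) - J ?a)"
        unfolding sc[of "a + b"] sc[of a] by (simp add: algebra_simps)
      then have "\<bar>J (a + b) - J a\<bar> = norm a powr p * \<bar>J (?a + ?b) - J ?a\<bar>" by (simp add: abs_mult)
      also have "\<dots> \<le> norm a powr p * \<epsilon>" using le by (intro mult_left_mono) auto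
      finally show ?thesis using C0 by (simp add: mult.commute add_increasing2)
    qed (use True homogeneous_0[OF J] C0 in auto)
  next
    case False
    then have ab: "norm a \<le> (1 / c) * norm b" using c by (simp add: field_simps)
    have "\<bar>J (a + b) - J a\<bar> \<le> K * norm (a + b) powr p + K * norm a powr p"
      using K(2)[of "a + b"] K(2)[of a] by linarith
    also have "\<dots> \<le> K * (((1 / c) + 1) * norm b) powr p + K * ((1 / c) * norm b) powr p"
    proof (intro add_mono mult_left_mono powr_mono2)
      show "norm (a + b) \<le> (1 / c + 1) * norm b"
        using norm_triangle_ineq[of a b] ab by (simp add: algebra_simps)
    qed (use ab K p in auto)
    also have "\<dots> = C * norm b powr p" by (simp only: C_def powr_mult) (simp add: algebra_simps)
    finally show ?thesis using \<epsilon> by (simp add: add_increasing)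
  qed
  then show ?thesis using C0 by blast
qed

lemma powr_norm_add_le:
  fixes a b :: "'v::real_normed_vector"
  assumes "0 < p"
  shows "norm (a - b) powr p \<le> 2 powr p * (norm a powr p + norm b powr p)"
proof -
  have "norm (a - b) \<le> 2 * max (norm a) (norm b)" using norm_triangle_ineq4[of a b] by linarith
  then have "norm (a - b) powr p \<le> (2 * max (norm a) (norm b)) powr p" using assms by (intro powr_mono2) auto
  also have "\<dots> = 2 powr p * max (norm a) (norm b) powr p" by (rule powr_mult)
  also have "\<dots> \<le> 2 powr p * (norm a powr p + norm b powr p)"
    by (intro mult_left_mono) (auto simp: max_def)
  finally show ?thesis .
qed

text \<open>The increment estimate bounds the defect by \<open>\<epsilon> |f\<^sub>n - g|\<^sup>p\<close>, whose integral is uniformly small, plus a part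
  dominated by a multiple of \<open>|g|\<^sup>p\<close>, to which dominated convergence applies.\<close>

lemma brezis_lieb:
  fixes f :: "nat \<Rightarrow> 'x \<Rightarrow> 'v::euclidean_space" and J :: "'v \<Rightarrow> real"
  assumes [measurable]: "\<And>n. f n \<in> borel_measurable M" "g \<in> borel_measurable M"
    and J: "homogeneous p J" and p: "0 < p"
    and conv: "AE x in M. (\<lambda>n. f n x) \<longlonglongrightarrow> g x"
    and B: "\<And>n. powr_integral M p (f n) \<le> ennreal B"
  shows "(\<lambda>n. \<integral>\<^sup>+x. ennreal \<bar>J (f n x) - J (f n x - g x) - J (g x)\<bar> \<partial>M) \<longlonglongrightarrow> 0"
    and "powr_integral M p g \<le> ennreal B"
proof -
  note [measurable] = homogeneous_measurable[OF J]
  show gB: "powr_integral M p g \<le> ennreal B"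
  proof -
    have "AE x in M. liminf (\<lambda>n. ennreal (norm (f n x) powr p)) = ennreal (norm (g x) powr p)"
      using conv by eventually_elim
        (intro lim_imp_Liminf trivial_limit_sequentially tendsto_ennrealI tendsto_powr' tendsto_norm tendsto_const, auto simp: p)
    then have "powr_integral M p g = (\<integral>\<^sup>+x. liminf (\<lambda>n. ennreal (norm (f n x) powr p)) \<partial>M)"
      by (intro nn_integral_cong_AE) (auto elim: eventually_mono)
    also have "\<dots> \<le> liminf (\<lambda>n. \<integral>\<^sup>+x. ennreal (norm (f n x) powr p) \<partial>M)" by (intro nn_integral_liminf) measurable
    also have "\<dots> \<le> ennreal B" by (intro Liminf_le always_eventually allI B) simp
    finally show ?thesis .
  qed
  define B' where "B' = 2 powr p * (max 0 B + max 0 B)"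
  have B'0: "0 \<le> B'" by (simp add: B'_def)
  have fgB: "(\<integral>\<^sup>+x. ennreal (norm (f n x - g x) powr p) \<partial>M) \<le> ennreal B'" for n
  proof -
    have "(\<integral>\<^sup>+x. ennreal (norm (f n x - g x) powr p) \<partial>M) \<le> (\<integral>\<^sup>+x. ennreal (2 powr p) * (ennreal (norm (f n x) powr p) + ennreal (norm (g x) powr p)) \<partial>M)"
      using powr_norm_add_le[OF p] by (intro nn_integral_mono) (simp add: ennreal_leI flip: ennreal_plus ennreal_mult)
    also have "\<dots> = ennreal (2 powr p) * (powr_integral M p (f n) + powr_integral M p g)"
      by (simp add: nn_integral_cmult nn_integral_add)
    also have "\<dots> \<le> ennreal (2 powr p) * (ennreal (max 0 B) + ennreal (max 0 B))"
      using B[of n] gB by (intro mult_left_mono add_mono) (auto intro: order_trans ennreal_leI)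
    also have "\<dots> = ennreal B'" unfolding B'_def by (subst ennreal_mult, simp, simp, subst ennreal_plus) simp_all
    finally show ?thesis .
  qed
  obtain K where K: "0 \<le> K" "\<And>z. \<bar>J z\<bar> \<le> K * norm z powr p" using homogeneous_bound[OF J] by blast
  define W where "W n x = \<bar>J (f n x) - J (f n x - g x) - J (g x)\<bar>" for n x
  have [measurable]: "W n \<in> borel_measurable M" for n unfolding W_def by measurable
  have "(\<lambda>n. \<integral>\<^sup>+x. ennreal (W n x) \<partial>M) \<longlonglongrightarrow> 0"
  proof (rule ennreal_tendsto_0I)
    fix e :: real assume e: "0 < e"
    define \<epsilon> where "\<epsilon> = e / 2 / (B' + 1)"
    have \<epsilon>: "0 < \<epsilon>" using e B'0 by (simp add: \<epsilon>_def)
    have \<epsilon>B: "\<epsilon> * B' \<le> e / 2" using e B'0 by (simp add: \<epsilon>_def field_simps)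
    obtain C where C: "0 \<le> C" "\<And>a b. \<bar>J (a + b) - J a\<bar> \<le> \<epsilon> * norm a powr p + C * norm b powr p"
      using homogeneous_increment[OF J p \<epsilon>] by blast
    define X where "X n x = max 0 (W n x - \<epsilon> * norm (f n x - g x) powr p)" for n x
    have [measurable]: "X n \<in> borel_measurable M" for n unfolding X_def by measurable
    have Xle: "X n x \<le> (C + K) * norm (g x) powr p" for n x
    proof -
      have "W n x \<le> \<bar>J ((f n x - g x) + g x) - J (f n x - g x)\<bar> + \<bar>J (g x)\<bar>" unfolding W_def by simp
      also have "\<dots> \<le> \<epsilon> * norm (f n x - g x) powr p + C * norm (g x) powr p + K * norm (g x) powr p"
        using C(2)[of "f n x - g x" "g x"] K(2)[of "g x"] by linarith
      finally show ?thesis using C K by (simp add: X_def algebra_simps)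
    qed
    have "(\<lambda>n. \<integral>\<^sup>+x. ennreal (X n x) \<partial>M) \<longlonglongrightarrow> (\<integral>\<^sup>+x. 0 \<partial>M)"
    proof (rule nn_integral_dominated_convergence[where w="\<lambda>x. ennreal (C + K) * ennreal (norm (g x) powr p)"])
      show "AE x in M. ennreal (X j x) \<le> ennreal (C + K) * ennreal (norm (g x) powr p)" for j
      proof (rule AE_I2)
        fix x
        have "ennreal (X j x) \<le> ennreal ((C + K) * norm (g x) powr p)" by (intro ennreal_leI Xle)
        also have "\<dots> = ennreal (C + K) * ennreal (norm (g x) powr p)" using C K by (intro ennreal_mult) auto
        finally show "ennreal (X j x) \<le> ennreal (C + K) * ennreal (norm (g x) powr p)" .
      qed
      have "(\<integral>\<^sup>+x. ennreal (C + K) * ennreal (norm (g x) powr p) \<partial>M) = ennreal (C + K) * powr_integral M p g"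
        by (rule nn_integral_cmult) measurable
      also have "\<dots> < \<infinity>" using le_less_trans[OF gB] by (simp add: ennreal_mult_less_top)
      finally show "(\<integral>\<^sup>+x. ennreal (C + K) * ennreal (norm (g x) powr p) \<partial>M) < \<infinity>" .
      show "AE x in M. (\<lambda>i. ennreal (X i x)) \<longlonglongrightarrow> 0"
        using conv
      proof eventually_elim
        fix x assume c: "(\<lambda>n. f n x) \<longlonglongrightarrow> g x"
        have cJ: "isCont J z" for z using J by (simp add: homogeneous_def continuous_on_eq_continuous_at)
        have d0: "(\<lambda>n. f n x - g x) \<longlonglongrightarrow> 0" using c by (simp add: LIM_zero)
        have "(\<lambda>n. W n x) \<longlonglongrightarrow> \<bar>J (g x) - J 0 - J (g x)\<bar>"
          unfolding W_def by (intro tendsto_intros isCont_tendsto_compose[OF cJ] c d0)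
        then have W0: "(\<lambda>n. W n x) \<longlonglongrightarrow> 0" by (simp add: homogeneous_0[OF J])
        have "(\<lambda>n. norm (f n x - g x) powr p) \<longlonglongrightarrow> norm (0::'v) powr p"
          using p by (intro tendsto_powr' tendsto_norm d0 tendsto_const) auto
        then have "(\<lambda>n. norm (f n x - g x) powr p) \<longlonglongrightarrow> 0" by simp
        then have "(\<lambda>n. X n x) \<longlonglongrightarrow> max 0 (0 - \<epsilon> * 0)"
          unfolding X_def by (intro tendsto_max tendsto_diff tendsto_mult tendsto_const W0)
        then have "(\<lambda>n. ennreal (X n x)) \<longlonglongrightarrow> ennreal (max 0 (0 - \<epsilon> * 0))" by (rule tendsto_ennrealI)
        then show "(\<lambda>i. ennreal (X i x)) \<longlonglongrightarrow> 0" by simp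
      qed
    qed measurable
    then have "(\<lambda>n. \<integral>\<^sup>+x. ennreal (X n x) \<partial>M) \<longlonglongrightarrow> 0" by simp
    then have "\<forall>\<^sub>F n in sequentially. (\<integral>\<^sup>+x. ennreal (X n x) \<partial>M) \<le> ennreal (e / 2)"
      using e by (intro ennreal_tendsto_0D) auto
    then show "\<forall>\<^sub>F n in sequentially. (\<integral>\<^sup>+x. ennreal (W n x) \<partial>M) \<le> ennreal e"
    proof eventually_elim
      fix n assume X: "(\<integral>\<^sup>+x. ennreal (X n x) \<partial>M) \<le> ennreal (e / 2)"
      have "(\<integral>\<^sup>+x. ennreal (W n x) \<partial>M) \<le> (\<integral>\<^sup>+x. ennreal (X n x) + ennreal \<epsilon> * ennreal (norm (f n x - g x) powr p) \<partial>M)"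
      proof (intro nn_integral_mono)
        fix x
        have "W n x \<le> X n x + \<epsilon> * norm (f n x - g x) powr p" by (simp add: X_def)
        then have "ennreal (W n x) \<le> ennreal (X n x + \<epsilon> * norm (f n x - g x) powr p)" by (rule ennreal_leI)
        also have "\<dots> = ennreal (X n x) + ennreal \<epsilon> * ennreal (norm (f n x - g x) powr p)"
          using \<epsilon> by (subst ennreal_plus) (auto simp: X_def ennreal_mult)
        finally show "ennreal (W n x) \<le> ennreal (X n x) + ennreal \<epsilon> * ennreal (norm (f n x - g x) powr p)" .
      qed
      also have "\<dots> = (\<integral>\<^sup>+x. ennreal (X n x) \<partial>M) + ennreal \<epsilon> * (\<integral>\<^sup>+x. ennreal (norm (f n x - g x) powr p) \<partial>M)"
        by (simp add: nn_integral_add nn_integral_cmult)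
      also have "\<dots> \<le> ennreal (e / 2) + ennreal \<epsilon> * ennreal B'" by (intro add_mono mult_left_mono X fgB) simp
      also have "\<dots> = ennreal (e / 2 + \<epsilon> * B')" using e \<epsilon> B'0 by (simp add: ennreal_mult ennreal_plus)
      also have "\<dots> \<le> ennreal e" using \<epsilon>B by (intro ennreal_leI) simp
      finally show "(\<integral>\<^sup>+x. ennreal (W n x) \<partial>M) \<le> ennreal e" .
    qed
  qed
  then show "(\<lambda>n. \<integral>\<^sup>+x. ennreal \<bar>J (f n x) - J (f n x - g x) - J (g x)\<bar> \<partial>M) \<longlonglongrightarrow> 0" unfolding W_def .
qed

section \<open>Local compactness\<close>

lemma ball_integral_sq_le:
  fixes w :: "'a::euclidean_space \<Rightarrow> 'v::euclidean_space"
  assumes [measurable]: "w \<in> borel_measurable borel" and \<rho>: "0 \<le> \<rho>"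
  shows "ennreal ((norm (LINT h|lborel. indicator (cball 0 \<rho>) h *\<^sub>R w h))\<^sup>2) \<le>
    ennreal (unit_ball_vol (real DIM('a)) * \<rho> ^ DIM('a)) * ball_mass w 0 \<rho>"
proof (cases "integrable lborel (\<lambda>h. indicator (cball 0 \<rho>) h *\<^sub>R w h)")
  case True
  have [measurable]: "cball (z::'a) s \<in> sets borel" for z s by simp
  let ?S = "cball (0::'a) \<rho>"
  have "ennreal (norm (LINT h|lborel. indicator ?S h *\<^sub>R w h)) \<le> (\<integral>\<^sup>+h. ennreal (norm (indicator ?S h *\<^sub>R w h)) \<partial>lborel)"
    by (rule integral_norm_bound_ennreal[OF True])
  also have "\<dots> = (\<integral>\<^sup>+h. indicator ?S h * (indicator ?S h * ennreal (norm (w h))) \<partial>lborel)"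
    by (intro nn_integral_cong) (auto simp: indicator_def)
  finally have "(ennreal (norm (LINT h|lborel. indicator ?S h *\<^sub>R w h)))\<^sup>2 \<le> (\<integral>\<^sup>+h. indicator ?S h * (indicator ?S h * ennreal (norm (w h))) \<partial>lborel)\<^sup>2"
    by (intro power_mono) auto
  also have "\<dots> \<le> (\<integral>\<^sup>+h. (indicator ?S h)\<^sup>2 \<partial>lborel) * (\<integral>\<^sup>+h. (indicator ?S h * ennreal (norm (w h)))\<^sup>2 \<partial>lborel)"
    by (rule Cauchy_Schwarz_nn_integral) measurable
  also have "(\<integral>\<^sup>+h. (indicator ?S h)\<^sup>2 \<partial>lborel) = emeasure lborel ?S"
  proof -
    have "(indicator ?S h)\<^sup>2 = (indicator ?S h :: ennreal)" for h by (cases "h \<in> ?S") auto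
    then show ?thesis by (simp add: nn_integral_indicator)
  qed
  also have "(\<integral>\<^sup>+h. (indicator ?S h * ennreal (norm (w h)))\<^sup>2 \<partial>lborel) = (\<integral>\<^sup>+h. indicator ?S h * ennreal ((norm (w h))\<^sup>2) \<partial>lborel)"
    by (intro nn_integral_cong) (auto simp: indicator_def ennreal_power)
  finally show ?thesis using \<rho> by (simp add: ennreal_power emeasure_cball)
qed (simp add: not_integrable_integral_eq)

lemma integrable_on_ball:
  fixes w :: "'a::euclidean_space \<Rightarrow> 'v::euclidean_space"
  assumes [measurable]: "w \<in> borel_measurable borel" and fin: "sqn lborel w < \<infinity>"
  shows "integrable lborel (\<lambda>h. indicator (cball 0 \<rho>) h *\<^sub>R w h)"
proof (rule integrableI_bounded)
  have [measurable]: "cball (z::'a) s \<in> sets borel" for z s by simp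
  show "(\<lambda>h. indicator (cball 0 \<rho>) h *\<^sub>R w h) \<in> borel_measurable lborel" by measurable
  have "(\<integral>\<^sup>+h. ennreal (norm (indicator (cball 0 \<rho>) h *\<^sub>R w h)) \<partial>lborel) \<le> (\<integral>\<^sup>+h. indicator (cball 0 \<rho>) h + ennreal ((norm (w h))\<^sup>2) \<partial>lborel)"
  proof (intro nn_integral_mono)
    fix h :: 'a
    have "2 * norm (w h) \<le> (norm (w h))\<^sup>2 + 1" using sum_squares_bound[of "norm (w h)" 1] by simp
    with norm_ge_zero[of "w h"] have "norm (w h) \<le> 1 + (norm (w h))\<^sup>2" by linarith
    then have "ennreal (norm (w h)) \<le> ennreal (1 + (norm (w h))\<^sup>2)" by (rule ennreal_leI)
    also have "\<dots> = 1 + ennreal ((norm (w h))\<^sup>2)" by (subst ennreal_plus) auto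
    finally show "ennreal (norm (indicator (cball 0 \<rho>) h *\<^sub>R w h)) \<le> indicator (cball 0 \<rho>) h + ennreal ((norm (w h))\<^sup>2)"
      by (simp add: indicator_def)
  qed
  also have "\<dots> = emeasure lborel (cball (0::'a) \<rho>) + sqn lborel w"
    unfolding sqn_def by (simp add: nn_integral_add)
  also have "\<dots> < \<infinity>" using fin emeasure_bounded_finite[OF bounded_cball[of "0::'a" \<rho>]] by simp
  finally show "(\<integral>\<^sup>+h. ennreal (norm (indicator (cball 0 \<rho>) h *\<^sub>R w h)) \<partial>lborel) < \<infinity>" .
qed

definition ball_integral :: "real \<Rightarrow> ('a::euclidean_space \<Rightarrow> 'v::euclidean_space) \<Rightarrow> 'a \<Rightarrow> 'v" where
  "ball_integral \<rho> u x = (LINT h|lborel. indicator (cball 0 \<rho>) h *\<^sub>R u (x + h))"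

lemma ball_integral_measurable [measurable]:
  fixes u :: "'a::euclidean_space \<Rightarrow> 'v::euclidean_space"
  assumes [measurable]: "u \<in> borel_measurable borel"
  shows "ball_integral \<rho> u \<in> borel_measurable borel"
proof -
  have [measurable]: "cball (z::'a) s \<in> sets borel" for z s by simp
  show ?thesis unfolding ball_integral_def by measurable
qed

lemma ball_integral_bound:
  fixes u :: "'a::euclidean_space \<Rightarrow> 'v::euclidean_space"
  assumes [measurable]: "u \<in> borel_measurable borel" and \<rho>: "0 \<le> \<rho>"
  shows "ennreal ((norm (ball_integral \<rho> u x))\<^sup>2) \<le> ennreal (unit_ball_vol (real DIM('a)) * \<rho> ^ DIM('a)) * sqn lborel u"
proof -
  have "ennreal ((norm (ball_integral \<rho> u x))\<^sup>2) \<le> ennreal (unit_ball_vol (real DIM('a)) * \<rho> ^ DIM('a)) * (\<integral>\<^sup>+h. indicator (cball 0 \<rho>) h * ennreal ((norm (u (x + h)))\<^sup>2) \<partial>lborel)"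
    unfolding ball_integral_def by (rule ball_integral_sq_le[OF _ \<rho>]) measurable
  also have "\<dots> \<le> ennreal (unit_ball_vol (real DIM('a)) * \<rho> ^ DIM('a)) * sqn lborel (\<lambda>h. u (x + h))"
    by (intro mult_left_mono ball_mass_le) simp
  also have "sqn lborel (\<lambda>h. u (x + h)) = sqn lborel u" using sqn_shift[of u x] by (simp add: add.commute)
  finally show ?thesis .
qed

lemma ball_integral_diff:
  fixes u :: "'a::euclidean_space \<Rightarrow> 'v::euclidean_space"
  assumes [measurable]: "u \<in> borel_measurable borel" and fin: "sqn lborel u < \<infinity>" and \<rho>: "0 \<le> \<rho>"
  shows "ennreal ((norm (ball_integral \<rho> u x - ball_integral \<rho> u y))\<^sup>2) \<le> ennreal (unit_ball_vol (real DIM('a)) * \<rho> ^ DIM('a)) * shift_dist u (x - y)"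
proof -
  have i: "integrable lborel (\<lambda>h. indicator (cball 0 \<rho>) h *\<^sub>R u (z + h))" for z
  proof (rule integrable_on_ball)
    show "sqn lborel (\<lambda>h. u (z + h)) < \<infinity>" using sqn_shift[of u z] fin by (simp add: add.commute)
  qed measurable
  have "ball_integral \<rho> u x - ball_integral \<rho> u y = (LINT h|lborel. indicator (cball 0 \<rho>) h *\<^sub>R (u (x + h) - u (y + h)))"
    unfolding ball_integral_def by (simp add: scaleR_diff_right i)
  also have "ennreal ((norm \<dots>)\<^sup>2) \<le> ennreal (unit_ball_vol (real DIM('a)) * \<rho> ^ DIM('a)) * (\<integral>\<^sup>+h. indicator (cball 0 \<rho>) h * ennreal ((norm (u (x + h) - u (y + h)))\<^sup>2) \<partial>lborel)"
    by (rule ball_integral_sq_le[OF _ \<rho>]) measurable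
  also have "\<dots> \<le> ennreal (unit_ball_vol (real DIM('a)) * \<rho> ^ DIM('a)) * sqn lborel (\<lambda>h. u (x + h) - u (y + h))"
    by (intro mult_left_mono ball_mass_le) simp
  also have "sqn lborel (\<lambda>h. u (x + h) - u (y + h)) = shift_dist u (x - y)"
    unfolding shift_dist_def using sqn_shift[of "\<lambda>h. u (h + (x - y)) - u h" y] by (simp add: add_ac)
  finally show ?thesis .
qed

text \<open>By the Cauchy--Schwarz inequality the squared error of a ball average is at most the average over the ball of
  the squared increments.\<close>

lemma ball_integral_error:
  assumes \<alpha>: "0 < \<alpha>" "\<alpha> < 1"
  shows "\<exists>C>0. \<forall>(u::'a::euclidean_space \<Rightarrow> 'v::euclidean_space) \<rho>. u \<in> borel_measurable borel \<longrightarrow> sqn lborel u < \<infinity> \<longrightarrow> 0 < \<rho> \<longrightarrow>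
    sqn lborel (\<lambda>x. u x - ball_integral \<rho> u x /\<^sub>R (unit_ball_vol (real DIM('a)) * \<rho> ^ DIM('a))) \<le> ennreal (C * \<rho> powr (2 * \<alpha>)) * gagliardo \<alpha> u"
proof -
  obtain C where C: "0 < C" "\<And>(u::'a \<Rightarrow> 'v) \<rho>. u \<in> borel_measurable borel \<Longrightarrow> 0 < \<rho> \<Longrightarrow>
    (\<integral>\<^sup>+h. indicator (cball 0 \<rho>) h * shift_dist u h \<partial>lborel) \<le> ennreal (C * \<rho> powr (real DIM('a) + 2 * \<alpha>)) * gagliardo \<alpha> u"
    using ball_shift_dist[OF \<alpha>] by blast
  define V where "V = unit_ball_vol (real DIM('a))"
  have V: "0 < V" by (simp add: V_def unit_ball_vol_pos)
  have "sqn lborel (\<lambda>x. u x - ball_integral \<rho> u x /\<^sub>R (V * \<rho> ^ DIM('a))) \<le> ennreal (C / V * \<rho> powr (2 * \<alpha>)) * gagliardo \<alpha> u"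
    if [measurable]: "u \<in> borel_measurable borel" and fin: "sqn lborel u < \<infinity>" and \<rho>: "0 < \<rho>" for u :: "'a \<Rightarrow> 'v" and \<rho>
  proof -
    have [measurable]: "cball (z::'a) s \<in> sets borel" for z s by simp
    define b where "b = V * \<rho> ^ DIM('a)"
    have b: "0 < b" using V \<rho> by (simp add: b_def)
    have pt: "ennreal ((norm (u x - ball_integral \<rho> u x /\<^sub>R b))\<^sup>2) \<le> ennreal (1 / b) * (\<integral>\<^sup>+h. indicator (cball 0 \<rho>) h * ennreal ((norm (u (x + h) - u x))\<^sup>2) \<partial>lborel)" for x
    proof -
      have i: "integrable lborel (\<lambda>h. indicator (cball 0 \<rho>) h *\<^sub>R u (x + h))"
      proof (rule integrable_on_ball)
        show "sqn lborel (\<lambda>h. u (x + h)) < \<infinity>" using sqn_shift[of u x] fin by (simp add: add.commute)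
      qed measurable
      have i2: "integrable lborel (\<lambda>h::'a. indicator (cball 0 \<rho>) h *\<^sub>R u x)"
        using emeasure_bounded_finite[OF bounded_cball[of "0::'a" \<rho>]]
        by (intro integrable_scaleR_left integrable_real_indicator) auto
      have "(LINT h|lborel. indicator (cball 0 \<rho>) h *\<^sub>R (u (x + h) - u x)) = ball_integral \<rho> u x - b *\<^sub>R u x"
      proof -
        have "(LINT h|lborel. indicator (cball 0 \<rho>) h *\<^sub>R (u (x + h) - u x)) = ball_integral \<rho> u x - (LINT h|lborel. indicator (cball (0::'a) \<rho>) h *\<^sub>R u x)"
          unfolding ball_integral_def by (simp only: scaleR_diff_right Bochner_Integration.integral_diff[OF i i2])
        also have "(LINT h|lborel. indicator (cball (0::'a) \<rho>) h *\<^sub>R u x) = b *\<^sub>R u x"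
          using emeasure_bounded_finite[OF bounded_cball[of "0::'a" \<rho>]] \<rho> content_cball[of \<rho> "0::'a"]
          by (simp add: b_def V_def)
        finally show ?thesis .
      qed
      then have "ennreal ((norm (ball_integral \<rho> u x - b *\<^sub>R u x))\<^sup>2) \<le> ennreal b * (\<integral>\<^sup>+h. indicator (cball 0 \<rho>) h * ennreal ((norm (u (x + h) - u x))\<^sup>2) \<partial>lborel)"
        using ball_integral_sq_le[of "\<lambda>h. u (x + h) - u x" \<rho>] \<rho> by (simp add: b_def V_def)
      then have "ennreal (1 / b\<^sup>2) * ennreal ((norm (ball_integral \<rho> u x - b *\<^sub>R u x))\<^sup>2) \<le> ennreal (1 / b\<^sup>2) * (ennreal b * (\<integral>\<^sup>+h. indicator (cball 0 \<rho>) h * ennreal ((norm (u (x + h) - u x))\<^sup>2) \<partial>lborel))"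
        by (rule mult_left_mono) simp
      moreover have "ennreal ((norm (u x - ball_integral \<rho> u x /\<^sub>R b))\<^sup>2) = ennreal (1 / b\<^sup>2) * ennreal ((norm (ball_integral \<rho> u x - b *\<^sub>R u x))\<^sup>2)"
      proof -
        have "u x - ball_integral \<rho> u x /\<^sub>R b = (- 1 / b) *\<^sub>R (ball_integral \<rho> u x - b *\<^sub>R u x)"
          using b by (simp add: scaleR_diff_right divide_inverse)
        then have "(norm (u x - ball_integral \<rho> u x /\<^sub>R b))\<^sup>2 = (1 / b\<^sup>2) * (norm (ball_integral \<rho> u x - b *\<^sub>R u x))\<^sup>2"
          using b by (simp add: power_mult_distrib power_divide)
        then show ?thesis by (simp only:) (rule ennreal_mult, auto)
      qed
      ultimately have "ennreal ((norm (u x - ball_integral \<rho> u x /\<^sub>R b))\<^sup>2) \<le> ennreal (1 / b\<^sup>2) * (ennreal b * (\<integral>\<^sup>+h. indicator (cball 0 \<rho>) h * ennreal ((norm (u (x + h) - u x))\<^sup>2) \<partial>lborel))"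
        by (simp only:)
      also have "\<dots> = ennreal (1 / b\<^sup>2 * b) * (\<integral>\<^sup>+h. indicator (cball 0 \<rho>) h * ennreal ((norm (u (x + h) - u x))\<^sup>2) \<partial>lborel)"
        using b by (subst ennreal_mult) (auto simp: mult.assoc)
      also have "1 / b\<^sup>2 * b = 1 / b" using b by (simp add: power2_eq_square)
      finally show ?thesis .
    qed
    have "sqn lborel (\<lambda>x. u x - ball_integral \<rho> u x /\<^sub>R b) \<le> (\<integral>\<^sup>+x. ennreal (1 / b) * (\<integral>\<^sup>+h. indicator (cball 0 \<rho>) h * ennreal ((norm (u (x + h) - u x))\<^sup>2) \<partial>lborel) \<partial>lborel)"
      unfolding sqn_def by (intro nn_integral_mono pt)
    also have "\<dots> = ennreal (1 / b) * (\<integral>\<^sup>+x. \<integral>\<^sup>+h. indicator (cball 0 \<rho>) h * ennreal ((norm (u (x + h) - u x))\<^sup>2) \<partial>lborel \<partial>lborel)"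
      by (rule nn_integral_cmult) measurable
    also have "(\<integral>\<^sup>+x. \<integral>\<^sup>+h. indicator (cball 0 \<rho>) h * ennreal ((norm (u (x + h) - u x))\<^sup>2) \<partial>lborel \<partial>lborel) = (\<integral>\<^sup>+h. indicator (cball 0 \<rho>) h * shift_dist u h \<partial>lborel)"
    proof -
      have "(\<integral>\<^sup>+x. \<integral>\<^sup>+h. indicator (cball 0 \<rho>) h * ennreal ((norm (u (x + h) - u x))\<^sup>2) \<partial>lborel \<partial>lborel) = (\<integral>\<^sup>+h. \<integral>\<^sup>+x. indicator (cball 0 \<rho>) h * ennreal ((norm (u (x + h) - u x))\<^sup>2) \<partial>lborel \<partial>lborel)"
        by (rule lborel_pair.Fubini') measurable
      also have "\<dots> = (\<integral>\<^sup>+h. indicator (cball 0 \<rho>) h * shift_dist u h \<partial>lborel)"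
        unfolding shift_dist_def sqn_def by (intro nn_integral_cong nn_integral_cmult) measurable
      finally show ?thesis .
    qed
    also have "ennreal (1 / b) * \<dots> \<le> ennreal (1 / b) * (ennreal (C * \<rho> powr (real DIM('a) + 2 * \<alpha>)) * gagliardo \<alpha> u)"
      by (intro mult_left_mono C(2) that(1) \<rho>) simp
    also have "\<dots> = ennreal (1 / b * (C * \<rho> powr (real DIM('a) + 2 * \<alpha>))) * gagliardo \<alpha> u"
      using b C(1) by (subst ennreal_mult) (auto simp: mult.assoc)
    also have "1 / b * (C * \<rho> powr (real DIM('a) + 2 * \<alpha>)) = C / V * \<rho> powr (2 * \<alpha>)"
      using \<rho> V by (simp add: b_def powr_add powr_realpow)
    finally show ?thesis by (simp only: b_def)
  qed
  then show ?thesis using C(1) V unfolding V_def by (intro exI[of _ "C / unit_ball_vol (real DIM('a))"]) auto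
qed

text \<open>The integrals over balls are bounded and, by the bound for translation distances, equicontinuous uniformly
  along the sequence. A diagonal argument gives convergence on a countable dense set for all radii
  \<open>1 / (m + 1)\<close> at once, and equicontinuity extends it to all points.\<close>

lemma ball_integrals_converge:
  fixes u :: "nat \<Rightarrow> 'a::euclidean_space \<Rightarrow> 'v::euclidean_space"
  assumes \<alpha>: "0 < \<alpha>" "\<alpha> < 1" and um[measurable]: "\<And>n. u n \<in> borel_measurable borel"
    and B: "0 \<le> B" "\<And>n. sqn lborel (u n) \<le> ennreal B" "\<And>n. gagliardo \<alpha> (u n) \<le> ennreal B"
  shows "\<exists>k :: nat \<Rightarrow> nat. strict_mono k \<and> (\<forall>m x. convergent (\<lambda>n. ball_integral (1 / real (Suc m)) (u (k n)) x))"
proof -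
  define V where "V = unit_ball_vol (real DIM('a))"
  have V: "0 < V" by (simp add: V_def unit_ball_vol_pos)
  define \<rho> where "\<rho> m = 1 / real (Suc m)" for m
  have \<rho>: "0 \<le> \<rho> m" "\<rho> m \<le> 1" for m by (auto simp: \<rho>_def)
  have V\<rho>: "V * \<rho> m ^ DIM('a) \<le> V" for m using V \<rho>[of m] by (simp add: mult_left_le power_le_one)
  have fin: "sqn lborel (u n) < \<infinity>" for n using le_less_trans[OF B(2)] by simp
  obtain C where C: "0 < C" "\<And>(u::'a \<Rightarrow> 'v) k. u \<in> borel_measurable borel \<Longrightarrow> shift_dist u k \<le> ennreal (C * norm k powr (2 * \<alpha>)) * gagliardo \<alpha> u"
    using shift_dist_gagliardo[OF \<alpha>, where 'a='a and 'v='v] by meson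
  define I where "I n m x = ball_integral (\<rho> m) (u n) x" for n m x
  have Ib: "(norm (I n m x))\<^sup>2 \<le> V * B" for n m x
  proof -
    have "ennreal ((norm (I n m x))\<^sup>2) \<le> ennreal (V * \<rho> m ^ DIM('a)) * sqn lborel (u n)"
      unfolding I_def V_def by (rule ball_integral_bound[OF um \<rho>(1)])
    also have "\<dots> \<le> ennreal V * ennreal B" by (intro mult_mono ennreal_leI V\<rho> B) auto
    also have "\<dots> = ennreal (V * B)" using V B by (simp add: ennreal_mult)
    finally show ?thesis using V B by (subst (asm) ennreal_le_iff) auto
  qed
  have Id: "(norm (I n m x - I n m y))\<^sup>2 \<le> V * C * B * norm (x - y) powr (2 * \<alpha>)" for n m x y
  proof -
    have "ennreal ((norm (I n m x - I n m y))\<^sup>2) \<le> ennreal (V * \<rho> m ^ DIM('a)) * shift_dist (u n) (x - y)"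
      unfolding I_def V_def by (rule ball_integral_diff[OF um fin \<rho>(1)])
    also have "\<dots> \<le> ennreal V * (ennreal (C * norm (x - y) powr (2 * \<alpha>)) * ennreal B)"
      using C(1) by (intro mult_mono ennreal_leI V\<rho> order_trans[OF C(2)[OF um]] B) auto
    also have "\<dots> = ennreal (V * C * B * norm (x - y) powr (2 * \<alpha>))" using V B C by (simp add: ennreal_mult[symmetric] mult_ac)
    finally show ?thesis using V B C by (subst (asm) ennreal_le_iff) auto
  qed
  obtain D :: "'a set" where D: "countable D" "\<And>X. open X \<Longrightarrow> X \<noteq> {} \<Longrightarrow> \<exists>d\<in>D. d \<in> X"
    using countable_dense_setE by blast
  have "countable ((UNIV :: nat set) \<times> D)" using D by auto
  moreover have "norm ((\<lambda>(m, x). I n m x) z) \<le> sqrt (V * B)" for n and z :: "nat \<times> 'a"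
    using Ib by (auto simp: split_beta intro: real_le_rsqrt)
  ultimately obtain k where k: "strict_mono (k::nat\<Rightarrow>nat)" "\<And>z. z \<in> UNIV \<times> D \<Longrightarrow> \<exists>l. (\<lambda>n. (\<lambda>(m, x). I (k n) m x) z) \<longlonglongrightarrow> l"
    using function_convergent_subsequence[of "(UNIV :: nat set) \<times> D" "\<lambda>n (m, x). I n m x" "sqrt (V * B)"] by blast
  have kD: "convergent (\<lambda>n. I (k n) m q)" if "q \<in> D" for m q
    using k(2)[of "(m, q)"] that by (auto simp: convergent_def)
  have conv: "convergent (\<lambda>n. I (k n) m x)" for m x
  proof -
    have "Cauchy (\<lambda>n. I (k n) m x)"
    proof (rule metric_CauchyI)
      fix e :: real assume e: "0 < e"
      define c where "c = V * C * B"
      have c: "0 \<le> c" using V C B by (simp add: c_def)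
      define \<delta> where "\<delta> = ((e / 3)\<^sup>2 / (c + 1)) powr (1 / (2 * \<alpha>))"
      have \<delta>: "0 < \<delta>" using e c by (simp add: \<delta>_def)
      have \<delta>p: "\<delta> powr (2 * \<alpha>) = (e / 3)\<^sup>2 / (c + 1)" using e c \<alpha> by (simp add: \<delta>_def powr_powr)
      obtain q where q: "q \<in> D" "dist x q < \<delta>" using D(2)[of "ball x \<delta>"] \<delta> by (auto simp: mem_ball)
      have close: "dist (I n m x) (I n m q) \<le> e / 3" for n
      proof -
        have "(norm (I n m x - I n m q))\<^sup>2 \<le> c * norm (x - q) powr (2 * \<alpha>)" using Id[of n m x q] by (simp add: c_def)
        also have "\<dots> \<le> c * \<delta> powr (2 * \<alpha>)" using q \<alpha> c by (intro mult_left_mono powr_mono2) (auto simp: dist_norm)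
        also have "\<dots> \<le> (e / 3)\<^sup>2" unfolding \<delta>p using c e by (simp add: field_simps)
        finally have "norm (I n m x - I n m q) \<le> e / 3" by (rule power2_le_imp_le) (use e in simp)
        then show ?thesis by (simp add: dist_norm)
      qed
      have e3: "0 < e / 3" using e by simp
      obtain N where N: "\<And>i j. i \<ge> N \<Longrightarrow> j \<ge> N \<Longrightarrow> dist (I (k i) m q) (I (k j) m q) < e / 3"
        using metric_CauchyD[OF convergent_Cauchy[OF kD[OF q(1)]] e3] by blast
      have "dist (I (k i) m x) (I (k j) m x) < e" if "i \<ge> N" "j \<ge> N" for i j
        using N[OF that] close[of "k i"] close[of "k j"] dist_triangle[of "I (k i) m x" "I (k j) m x" "I (k i) m q"]
          dist_triangle[of "I (k i) m q" "I (k j) m x" "I (k j) m q"] by (simp add: dist_commute)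
      then show "\<exists>M. \<forall>i\<ge>M. \<forall>j\<ge>M. dist (I (k i) m x) (I (k j) m x) < e" by blast
    qed
    then show ?thesis by (simp add: Cauchy_convergent_iff)
  qed
  show ?thesis using k(1) conv unfolding I_def \<rho>_def by blast
qed

text \<open>The averages over balls of radius \<open>1 / (m + 1)\<close> approximate the functions in \<open>L\<^sup>2\<close> uniformly along the
  sequence, so their convergence makes the sequence itself Cauchy. The convergence of the averages is only pointwise and bounded; a
  Gaussian weight, which makes constants integrable, turns it into convergence of square norms.\<close>

lemma local_compactness:
  fixes u :: "nat \<Rightarrow> 'a::euclidean_space \<Rightarrow> 'v::euclidean_space"
  assumes \<alpha>: "0 < \<alpha>" "\<alpha> < 1" and um[measurable]: "\<And>n. u n \<in> borel_measurable borel"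
    and B: "0 \<le> B" "\<And>n. sqn lborel (u n) \<le> ennreal B" "\<And>n. gagliardo \<alpha> (u n) \<le> ennreal B"
  obtains r :: "nat \<Rightarrow> nat" and U where "strict_mono r" "U \<in> borel_measurable borel"
    "AE x in lborel. (\<lambda>n. u (r n) x) \<longlonglongrightarrow> U x"
    "(\<lambda>n. \<integral>\<^sup>+x. indicator (cball 0 1) x * ennreal ((norm (u (r n) x - U x))\<^sup>2) \<partial>lborel) \<longlonglongrightarrow> 0"
proof -
  from ball_integrals_converge[OF \<alpha>, where u=u and B=B, OF um B] obtain k :: "nat \<Rightarrow> nat" where k: "strict_mono k"
    "\<And>m x. convergent (\<lambda>n. ball_integral (1 / real (Suc m)) (u (k n)) x)"
    by blast
  define V where "V = unit_ball_vol (real DIM('a))"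
  have V: "0 < V" by (simp add: V_def unit_ball_vol_pos)
  define \<rho> where "\<rho> m = 1 / real (Suc m)" for m
  have \<rho>: "0 < \<rho> m" "\<rho> m \<le> 1" for m by (auto simp: \<rho>_def)
  have V\<rho>: "V * \<rho> m ^ DIM('a) \<le> V" for m using V \<rho>[of m] by (simp add: mult_left_le power_le_one)
  define I where "I n m x = ball_integral (\<rho> m) (u (k n)) x" for n m x
  define L where "L m x = lim (\<lambda>n. I n m x)" for m x
  have IL: "(\<lambda>n. I n m x) \<longlonglongrightarrow> L m x" for m x
    using k(2) by (simp add: L_def I_def \<rho>_def convergent_LIMSEQ_iff)
  have Im[measurable]: "I n m \<in> borel_measurable borel" for n m unfolding I_def by measurable
  have Lm[measurable]: "L m \<in> borel_measurable borel" for m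
    by (rule borel_measurable_LIMSEQ_metric[OF Im IL])
  have Ib: "(norm (I n m x))\<^sup>2 \<le> V * B" for n m x
  proof -
    have "ennreal ((norm (I n m x))\<^sup>2) \<le> ennreal (V * \<rho> m ^ DIM('a)) * sqn lborel (u (k n))"
      unfolding I_def V_def by (rule ball_integral_bound[OF um less_imp_le[OF \<rho>(1)]])
    also have "\<dots> \<le> ennreal V * ennreal B" by (intro mult_mono ennreal_leI V\<rho> B) auto
    also have "\<dots> = ennreal (V * B)" using V B by (simp add: ennreal_mult)
    finally show ?thesis using V B by (subst (asm) ennreal_le_iff) auto
  qed
  have Lb: "(norm (L m x))\<^sup>2 \<le> V * B" for m x
    by (rule LIMSEQ_le_const2[OF tendsto_power[OF tendsto_norm[OF IL[of m x]]]]) (use Ib in blast)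
  obtain C where C: "0 < C" "\<And>(u::'a \<Rightarrow> 'v) \<rho>. u \<in> borel_measurable borel \<Longrightarrow> sqn lborel u < \<infinity> \<Longrightarrow> 0 < \<rho> \<Longrightarrow>
    sqn lborel (\<lambda>x. u x - ball_integral \<rho> u x /\<^sub>R (V * \<rho> ^ DIM('a))) \<le> ennreal (C * \<rho> powr (2 * \<alpha>)) * gagliardo \<alpha> u"
    using ball_integral_error[OF \<alpha>, where 'a='a and 'v='v] unfolding V_def by meson
  define w where "w x = exp (- (norm x)\<^sup>2)" for x :: 'a
  have w: "0 < w x" "w x \<le> 1" for x by (auto simp: w_def)
  have [measurable]: "w \<in> borel_measurable borel" unfolding w_def by measurable
  define \<mu> where "\<mu> = density lborel (\<lambda>x. ennreal (w x))"
  have [measurable_cong, simp]: "sets \<mu> = sets borel" by (simp add: \<mu>_def)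
  have nn\<mu>: "(\<integral>\<^sup>+x. f x \<partial>\<mu>) = (\<integral>\<^sup>+x. ennreal (w x) * f x \<partial>lborel)" if "f \<in> borel_measurable borel" for f
    unfolding \<mu>_def using that by (intro nn_integral_density) simp_all
  have fin\<mu>: "(\<integral>\<^sup>+x. ennreal c \<partial>\<mu>) < \<infinity>" for c
  proof -
    have wg: "w x = pi powr (DIM('a) / 2) * gauss (1/4) x" for x
      by (simp add: w_def gauss_def powr_minus)
    have "(\<integral>\<^sup>+x. ennreal (w x) \<partial>lborel) = ennreal (pi powr (DIM('a) / 2)) * (\<integral>\<^sup>+x. ennreal (gauss (1/4) (x::'a)) \<partial>lborel)"
      unfolding wg by (subst nn_integral_cmult[symmetric]) (auto simp: ennreal_mult)
    then have "(\<integral>\<^sup>+x. ennreal (w x) \<partial>lborel) < \<infinity>" by (simp add: gauss_integral ennreal_mult_less_top)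
    moreover have "(\<integral>\<^sup>+x. ennreal c \<partial>\<mu>) = (\<integral>\<^sup>+x. ennreal (w x) \<partial>lborel) * ennreal c"
      by (subst nn\<mu>, simp) (rule nn_integral_multc, measurable)
    ultimately show ?thesis by (simp add: ennreal_mult_less_top)
  qed
  have \<mu>le: "sqn \<mu> f \<le> sqn lborel f" if [measurable]: "f \<in> borel_measurable borel" for f :: "'a \<Rightarrow> 'v"
  proof -
    have "ennreal (w x) * e \<le> e" for x e using mult_right_mono[of "ennreal (w x)" 1 e] w[of x] by (simp add: ennreal_le_1)
    then show ?thesis unfolding sqn_def by (subst nn\<mu>) (auto intro!: nn_integral_mono)
  qed
  have um\<mu>[measurable]: "u n \<in> borel_measurable \<mu>" for n by (simp add: measurable_cong_sets[OF \<open>sets \<mu> = sets borel\<close> refl])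
  have IL\<mu>: "(\<lambda>n. sqn \<mu> (\<lambda>x. I n m x - L m x)) \<longlonglongrightarrow> 0" for m
  proof -
    have "(\<lambda>n. sqn \<mu> (\<lambda>x. I n m x - L m x)) \<longlonglongrightarrow> (\<integral>\<^sup>+x. 0 \<partial>\<mu>)"
      unfolding sqn_def
    proof (rule nn_integral_dominated_convergence[where w="\<lambda>x. ennreal (4 * (V * B))"])
      have "(norm (I j m x - L m x))\<^sup>2 \<le> 4 * (V * B)" for j x
      proof -
        have "(norm (I j m x + - L m x))\<^sup>2 \<le> (1 + 1) * (norm (I j m x))\<^sup>2 + (1 + 1 / 1) * (norm (- L m x))\<^sup>2"
          by (rule norm_sq_split) simp
        then show ?thesis using Ib[of j m x] Lb[of m x] by simp
      qed
      then show "AE x in \<mu>. ennreal ((norm (I j m x - L m x))\<^sup>2) \<le> ennreal (4 * (V * B))" for j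
        by (intro AE_I2 ennreal_leI)
      show "(\<integral>\<^sup>+x. ennreal (4 * (V * B)) \<partial>\<mu>) < \<infinity>" by (rule fin\<mu>)
      have "(\<lambda>i. ennreal ((norm (I i m x - L m x))\<^sup>2)) \<longlonglongrightarrow> ennreal ((norm (L m x - L m x))\<^sup>2)" for x
        by (intro tendsto_ennrealI tendsto_power tendsto_norm tendsto_diff IL tendsto_const)
      then show "AE x in \<mu>. (\<lambda>i. ennreal ((norm (I i m x - L m x))\<^sup>2)) \<longlonglongrightarrow> 0" by simp
    qed measurable
    then show ?thesis by simp
  qed
  have ca: "\<exists>N. \<forall>i\<ge>N. \<forall>j\<ge>N. sqn \<mu> (\<lambda>x. u (k i) x - u (k j) x) \<le> ennreal e" if e: "0 < e" for e
  proof -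
    have "\<exists>m. C * \<rho> m powr (2 * \<alpha>) * B \<le> e / 16"
    proof -
      have "(\<lambda>m. C * \<rho> m powr (2 * \<alpha>) * B) \<longlonglongrightarrow> C * 0 powr (2 * \<alpha>) * B"
        unfolding \<rho>_def using \<alpha> LIMSEQ_Suc[OF lim_1_over_n[where 'a=real]]
        by (intro tendsto_mult tendsto_const tendsto_powr') auto
      then have "(\<lambda>m. C * \<rho> m powr (2 * \<alpha>) * B) \<longlonglongrightarrow> 0" by simp
      then have "\<forall>\<^sub>F m in sequentially. C * \<rho> m powr (2 * \<alpha>) * B < e / 16" using e by (intro order_tendstoD) auto
      then show ?thesis by (auto simp: eventually_sequentially intro: less_imp_le)
    qed
    then obtain m where m: "C * \<rho> m powr (2 * \<alpha>) * B \<le> e / 16" by blast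
    define b where "b = V * \<rho> m ^ DIM('a)"
    have b: "0 < b" using V \<rho> by (simp add: b_def)
    define R where "R i x = u (k i) x - I i m x /\<^sub>R b" for i x
    have [measurable]: "R i \<in> borel_measurable borel" "R i \<in> borel_measurable \<mu>" for i unfolding R_def by measurable
    have R: "sqn \<mu> (R i) \<le> ennreal (e / 16)" for i
    proof -
      have "sqn \<mu> (R i) \<le> sqn lborel (R i)" by (rule \<mu>le) measurable
      also have "\<dots> \<le> ennreal (C * \<rho> m powr (2 * \<alpha>)) * gagliardo \<alpha> (u (k i))"
        unfolding R_def I_def b_def using le_less_trans[OF B(2)] by (intro C um \<rho>) auto
      also have "\<dots> \<le> ennreal (C * \<rho> m powr (2 * \<alpha>)) * ennreal B" by (intro mult_left_mono B) simp
      also have "\<dots> = ennreal (C * \<rho> m powr (2 * \<alpha>) * B)" using C B by (simp add: ennreal_mult)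
      finally show ?thesis by (rule order_trans[OF _ ennreal_leI[OF m]])
    qed
    have "\<forall>\<^sub>F n in sequentially. sqn \<mu> (\<lambda>x. I n m x - L m x) \<le> ennreal (b\<^sup>2 * (e / 16))"
      using e b by (intro ennreal_tendsto_0D[OF IL\<mu>]) simp
    then obtain N where N: "\<And>n. n \<ge> N \<Longrightarrow> sqn \<mu> (\<lambda>x. I n m x - L m x) \<le> ennreal (b\<^sup>2 * (e / 16))"
      by (auto simp: eventually_sequentially)
    have "sqn \<mu> (\<lambda>x. u (k i) x - u (k j) x) \<le> ennreal e" if ij: "i \<ge> N" "j \<ge> N" for i j
    proof -
      have "(\<lambda>x. u (k i) x - u (k j) x) = (\<lambda>x. (R i x - R j x) + (1 / b) *\<^sub>R (I i m x - I j m x))"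
        by (auto simp: R_def fun_eq_iff scaleR_diff_right divide_inverse)
      then have "sqn \<mu> (\<lambda>x. u (k i) x - u (k j) x) \<le> 2 * sqn \<mu> (\<lambda>x. R i x - R j x) + 2 * sqn \<mu> (\<lambda>x. (1 / b) *\<^sub>R (I i m x - I j m x))"
        by (simp only:) (rule sqn_add_le, measurable)
      also have "sqn \<mu> (\<lambda>x. (1 / b) *\<^sub>R (I i m x - I j m x)) = ennreal ((1 / b)\<^sup>2) * sqn \<mu> (\<lambda>x. I i m x - I j m x)"
        by (rule sqn_scaleR) measurable
      also have "2 * sqn \<mu> (\<lambda>x. R i x - R j x) + 2 * (ennreal ((1 / b)\<^sup>2) * sqn \<mu> (\<lambda>x. I i m x - I j m x))
        \<le> 2 * (2 * ennreal (e / 16) + 2 * ennreal (e / 16)) + 2 * (ennreal ((1 / b)\<^sup>2) * (2 * ennreal (b\<^sup>2 * (e / 16)) + 2 * ennreal (b\<^sup>2 * (e / 16))))"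
      proof (intro add_mono mult_left_mono)
        have "sqn \<mu> (\<lambda>x. R i x - R j x) \<le> 2 * sqn \<mu> (R i) + 2 * sqn \<mu> (R j)" by (rule sqn_diff_le) measurable
        also have "\<dots> \<le> 2 * ennreal (e / 16) + 2 * ennreal (e / 16)" by (intro add_mono mult_left_mono R) auto
        finally show "sqn \<mu> (\<lambda>x. R i x - R j x) \<le> 2 * ennreal (e / 16) + 2 * ennreal (e / 16)" .
        have "sqn \<mu> (\<lambda>x. I i m x - I j m x) \<le> 2 * sqn \<mu> (\<lambda>x. I i m x - L m x) + 2 * sqn \<mu> (\<lambda>x. L m x - I j m x)"
          by (rule sqn_triangle3) measurable
        also have "\<dots> \<le> 2 * ennreal (b\<^sup>2 * (e / 16)) + 2 * ennreal (b\<^sup>2 * (e / 16))"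
          unfolding sqn_diff_commute[of \<mu> "L m" "I j m"] by (intro add_mono mult_left_mono N ij) auto
        finally show "sqn \<mu> (\<lambda>x. I i m x - I j m x) \<le> 2 * ennreal (b\<^sup>2 * (e / 16)) + 2 * ennreal (b\<^sup>2 * (e / 16))" .
      qed auto
      also have "\<dots> = ennreal (2 * (2 * (e / 16) + 2 * (e / 16)) + 2 * ((1 / b)\<^sup>2 * (2 * (b\<^sup>2 * (e / 16)) + 2 * (b\<^sup>2 * (e / 16)))))"
      proof -
        have "2 * (2 * ennreal x + 2 * ennreal x) + 2 * (ennreal z * (2 * ennreal y + 2 * ennreal y)) = ennreal (2 * (2 * x + 2 * x) + 2 * (z * (2 * y + 2 * y)))"
          if "0 \<le> x" "0 \<le> y" "0 \<le> z" for x y z :: real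
          using that by (simp add: numeral_mult_ennreal ennreal_plus[symmetric] ennreal_mult[symmetric] del: ennreal_plus)
        then show ?thesis using e by simp
      qed
      also have "2 * (2 * (e / 16) + 2 * (e / 16)) + 2 * ((1 / b)\<^sup>2 * (2 * (b\<^sup>2 * (e / 16)) + 2 * (b\<^sup>2 * (e / 16)))) = e"
        using b by (simp add: power_divide field_simps)
      finally show ?thesis .
    qed
    then show ?thesis by blast
  qed
  have vm: "u (k n) \<in> borel_measurable \<mu>" for n by measurable
  obtain U and r :: "nat \<Rightarrow> nat" where U: "U \<in> borel_measurable \<mu>" and r: "strict_mono r"
      and AE\<mu>: "AE x in \<mu>. (\<lambda>n. u (k (r n)) x) \<longlonglongrightarrow> U x"
      and lim: "(\<lambda>n. sqn \<mu> (\<lambda>x. u (k n) x - U x)) \<longlonglongrightarrow> 0"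
    by (rule sqn_complete[of "\<lambda>n. u (k n)" \<mu>, OF vm ca])
  have Um[measurable]: "U \<in> borel_measurable borel"
    using U by (simp add: measurable_cong_sets[OF \<open>sets \<mu> = sets borel\<close> refl])
  have AEl: "AE x in lborel. (\<lambda>n. u ((k \<circ> r) n) x) \<longlonglongrightarrow> U x"
    using AE\<mu> w(1) unfolding \<mu>_def by (subst (asm) AE_density) (auto elim: eventually_mono)
  have "(\<lambda>n. ennreal (exp 1) * sqn \<mu> (\<lambda>x. u (k (r n)) x - U x)) \<longlonglongrightarrow> ennreal (exp 1) * 0"
    using LIMSEQ_subseq_LIMSEQ[OF lim r] by (intro ennreal_tendsto_cmult) (auto simp: o_def)
  then have lim': "(\<lambda>n. ennreal (exp 1) * sqn \<mu> (\<lambda>x. u (k (r n)) x - U x)) \<longlonglongrightarrow> 0" by simp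
  have "(\<lambda>n. \<integral>\<^sup>+x. indicator (cball 0 1) x * ennreal ((norm (u ((k \<circ> r) n) x - U x))\<^sup>2) \<partial>lborel) \<longlonglongrightarrow> 0"
  proof (rule ennreal_squeeze_0[OF lim'], intro always_eventually allI)
    fix n
    have "(\<integral>\<^sup>+x. indicator (cball 0 1) x * ennreal ((norm (u ((k \<circ> r) n) x - U x))\<^sup>2) \<partial>lborel)
      \<le> (\<integral>\<^sup>+x. ennreal (exp 1) * (ennreal (w x) * ennreal ((norm (u (k (r n)) x - U x))\<^sup>2)) \<partial>lborel)"
    proof (intro nn_integral_mono)
      fix x :: 'a
      have "indicator (cball 0 1) x \<le> ennreal (exp 1) * ennreal (w x)"
      proof (cases "x \<in> cball 0 1")
        case True
        then have "(norm x)\<^sup>2 \<le> 1" by (simp add: power_le_one)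
        then have "1 \<le> exp (1 - (norm x)\<^sup>2)" by simp
        then have "1 \<le> exp 1 * w x" by (simp add: w_def flip: exp_add)
        then have "ennreal 1 \<le> ennreal (exp 1 * w x)" by (rule ennreal_leI)
        also have "\<dots> = ennreal (exp 1) * ennreal (w x)" using w(1)[of x] by (intro ennreal_mult) auto
        finally show ?thesis using True by simp
      qed simp
      then show "indicator (cball 0 1) x * ennreal ((norm (u ((k \<circ> r) n) x - U x))\<^sup>2) \<le> ennreal (exp 1) * (ennreal (w x) * ennreal ((norm (u (k (r n)) x - U x))\<^sup>2))"
        unfolding mult.assoc[symmetric] o_def by (intro mult_right_mono) auto
    qed
    also have "\<dots> = ennreal (exp 1) * sqn \<mu> (\<lambda>x. u (k (r n)) x - U x)"
      unfolding sqn_def by (subst nn\<mu>, measurable) (rule nn_integral_cmult, measurable)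
    finally show "(\<integral>\<^sup>+x. indicator (cball 0 1) x * ennreal ((norm (u ((k \<circ> r) n) x - U x))\<^sup>2) \<partial>lborel)
      \<le> ennreal (exp 1) * sqn \<mu> (\<lambda>x. u (k (r n)) x - U x)" .
  qed
  then show ?thesis using AEl by (intro that[of "k \<circ> r" U] strict_mono_o k r Um)
qed

lemma sqn_fatou:
  fixes f :: "nat \<Rightarrow> 'x \<Rightarrow> 'v::{real_normed_vector,second_countable_topology}"
  assumes [measurable]: "\<And>n. f n \<in> borel_measurable M" "g \<in> borel_measurable M"
    and conv: "AE x in M. (\<lambda>n. f n x) \<longlonglongrightarrow> g x" and B: "\<And>n. sqn M (f n) \<le> B"
  shows "sqn M g \<le> B"
proof -
  have "AE x in M. liminf (\<lambda>n. ennreal ((norm (f n x))\<^sup>2)) = ennreal ((norm (g x))\<^sup>2)"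
    using conv by eventually_elim
      (intro lim_imp_Liminf trivial_limit_sequentially tendsto_ennrealI tendsto_power tendsto_norm)
  then have "sqn M g = (\<integral>\<^sup>+x. liminf (\<lambda>n. ennreal ((norm (f n x))\<^sup>2)) \<partial>M)"
    unfolding sqn_def by (intro nn_integral_cong_AE) (auto elim: eventually_mono)
  also have "\<dots> \<le> liminf (\<lambda>n. sqn M (f n))" unfolding sqn_def by (intro nn_integral_liminf) measurable
  also have "\<dots> \<le> B" by (intro Liminf_le always_eventually allI B) simp
  finally show ?thesis .
qed

lemma AE_increment_tendsto:
  fixes u :: "nat \<Rightarrow> 'a::euclidean_space \<Rightarrow> 'v::euclidean_space"
  assumes [measurable]: "\<rho> \<in> borel_measurable borel"
    and conv: "AE x in lborel. (\<lambda>n. u n x) \<longlonglongrightarrow> U x"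
  shows "AE z in pair_measure \<rho>. (\<lambda>n. increment (u n) z) \<longlonglongrightarrow> increment U z"
proof -
  obtain N where N: "{x. \<not> (\<lambda>n. u n x) \<longlonglongrightarrow> U x} \<subseteq> N" "emeasure lborel N = 0" "N \<in> sets lborel"
    using AE_E[OF conv] by auto
  have Nb[measurable]: "N \<in> sets borel" using N by simp
  have sh: "AE x in lborel. x + h \<notin> N" for h
  proof -
    have "(\<integral>\<^sup>+x. indicator N (x + h) \<partial>lborel) = (\<integral>\<^sup>+x. indicator N x \<partial>lborel)"
      by (rule nn_integral_lborel_shift) measurable
    also have "\<dots> = 0" using N by simp
    finally have "AE x in lborel. indicator N (x + h) = (0::ennreal)"
      by (subst (asm) nn_integral_0_iff_AE) measurable
    then show ?thesis by eventually_elim (auto simp: indicator_def split: if_splits)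
  qed
  have "AE z in lborel \<Otimes>\<^sub>M lborel. snd z \<notin> N \<and> snd z + fst z \<notin> N"
  proof (rule lborel_pair.AE_pair_measure)
    show "{z \<in> space (lborel \<Otimes>\<^sub>M lborel). snd z \<notin> N \<and> snd z + fst z \<notin> N} \<in> sets (lborel \<Otimes>\<^sub>M lborel)" by measurable
    show "AE h in lborel. AE x in lborel. snd (h, x) \<notin> N \<and> snd (h, x) + fst (h, x) \<notin> N"
      using sh[of 0] sh by (auto intro!: AE_I2)
  qed
  then have "AE z in lborel \<Otimes>\<^sub>M lborel. (\<lambda>n. increment (u n) z) \<longlonglongrightarrow> increment U z"
  proof eventually_elim
    fix z :: "'a \<times> 'a" assume "snd z \<notin> N \<and> snd z + fst z \<notin> N"
    then have "(\<lambda>n. u n (snd z)) \<longlonglongrightarrow> U (snd z)" "(\<lambda>n. u n (snd z + fst z)) \<longlonglongrightarrow> U (snd z + fst z)"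
      using N(1) by blast+
    then show "(\<lambda>n. increment (u n) z) \<longlonglongrightarrow> increment U z"
      unfolding increment_def by (intro tendsto_diff)
  qed
  then show ?thesis unfolding pair_measure_def by (subst AE_density) (auto elim: eventually_mono)
qed

section \<open>Integral functionals of pairs\<close>

lemma homogeneous_integrable:
  fixes f :: "'x \<Rightarrow> 'v::euclidean_space"
  assumes J: "homogeneous p J" and [measurable]: "f \<in> borel_measurable M"
    and fin: "powr_integral M p f < \<infinity>"
  shows "integrable M (\<lambda>x. J (f x))"
proof -
  note [measurable] = homogeneous_measurable[OF J]
  obtain K where K: "0 \<le> K" "\<And>z. \<bar>J z\<bar> \<le> K * norm z powr p" using homogeneous_bound[OF J] by blast
  show ?thesis
  proof (rule integrableI_bounded)
    have "(\<integral>\<^sup>+x. ennreal (norm (J (f x))) \<partial>M) \<le> (\<integral>\<^sup>+x. ennreal K * ennreal (norm (f x) powr p) \<partial>M)"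
      using K by (intro nn_integral_mono) (simp add: ennreal_mult[symmetric] ennreal_leI)
    also have "\<dots> = ennreal K * powr_integral M p f" by (rule nn_integral_cmult) measurable
    also have "\<dots> < \<infinity>" using fin by (simp add: ennreal_mult_less_top)
    finally show "(\<integral>\<^sup>+x. ennreal (norm (J (f x))) \<partial>M) < \<infinity>" .
  qed measurable
qed

lemma abs_integral_le_nn:
  fixes h :: "'x \<Rightarrow> real"
  assumes "integrable M h" "(\<integral>\<^sup>+x. ennreal \<bar>h x\<bar> \<partial>M) \<le> ennreal e" "0 \<le> e"
  shows "\<bar>LINT x|M. h x\<bar> \<le> e"
proof -
  have "ennreal \<bar>LINT x|M. h x\<bar> \<le> ennreal e"
    using integral_norm_bound_ennreal[OF assms(1)] assms(2) by (simp add: order_trans)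
  then show ?thesis using assms(3) by (subst (asm) ennreal_le_iff) auto
qed

lemma diff_powr_finite:
  fixes f g :: "'x \<Rightarrow> 'v::euclidean_space"
  assumes [measurable]: "f \<in> borel_measurable M" "g \<in> borel_measurable M" and p: "0 < p"
    and f: "powr_integral M p f < \<infinity>" and g: "powr_integral M p g < \<infinity>"
  shows "(\<integral>\<^sup>+x. ennreal (norm (f x - g x) powr p) \<partial>M) < \<infinity>"
proof -
  have "(\<integral>\<^sup>+x. ennreal (norm (f x - g x) powr p) \<partial>M) \<le> (\<integral>\<^sup>+x. ennreal (2 powr p) * (ennreal (norm (f x) powr p) + ennreal (norm (g x) powr p)) \<partial>M)"
    using powr_norm_add_le[OF p] by (intro nn_integral_mono) (simp add: ennreal_leI flip: ennreal_plus ennreal_mult)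
  also have "\<dots> = ennreal (2 powr p) * (powr_integral M p f + powr_integral M p g)"
    by (simp add: nn_integral_cmult nn_integral_add)
  also have "\<dots> < \<infinity>" using f g by (simp add: ennreal_mult_less_top)
  finally show ?thesis .
qed

lemma brezis_lieb_integral:
  fixes f :: "nat \<Rightarrow> 'x \<Rightarrow> 'v::euclidean_space" and J :: "'v \<Rightarrow> real"
  assumes m: "\<And>n. f n \<in> borel_measurable M" "g \<in> borel_measurable M"
    and J: "homogeneous p J" and p: "0 < p"
    and conv: "AE x in M. (\<lambda>n. f n x) \<longlonglongrightarrow> g x"
    and B: "\<And>n. powr_integral M p (f n) \<le> ennreal B"
  shows "(\<lambda>n. (LINT x|M. J (f n x)) - (LINT x|M. J (f n x - g x)) - (LINT x|M. J (g x))) \<longlonglongrightarrow> 0"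
proof -
  have BL: "(\<lambda>n. \<integral>\<^sup>+x. ennreal \<bar>J (f n x) - J (f n x - g x) - J (g x)\<bar> \<partial>M) \<longlonglongrightarrow> 0"
    and gB: "powr_integral M p g \<le> ennreal B"
    using brezis_lieb[where f=f and g=g and M=M and J=J and p=p and B=B, OF m J p conv B] by blast+
  have fF: "powr_integral M p (f n) < \<infinity>" for n using le_less_trans[OF B] by simp
  have gF: "powr_integral M p g < \<infinity>" using le_less_trans[OF gB] by simp
  have i1: "integrable M (\<lambda>x. J (f n x))" for n by (rule homogeneous_integrable[OF J m(1) fF])
  have i2: "integrable M (\<lambda>x. J (g x))" by (rule homogeneous_integrable[OF J m(2) gF])
  have i3: "integrable M (\<lambda>x. J (f n x - g x))" for n
    by (rule homogeneous_integrable[OF J borel_measurable_diff[OF m(1) m(2)] diff_powr_finite[OF m(1) m(2) p fF gF]])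
  have eq: "(LINT x|M. J (f n x)) - (LINT x|M. J (f n x - g x)) - (LINT x|M. J (g x)) = (LINT x|M. J (f n x) - J (f n x - g x) - J (g x))" for n
    using i1 i2 i3 by simp
  show ?thesis unfolding eq
  proof (rule LIMSEQ_I)
    fix e :: real assume e: "0 < e"
    have "\<forall>\<^sub>F n in sequentially. (\<integral>\<^sup>+x. ennreal \<bar>J (f n x) - J (f n x - g x) - J (g x)\<bar> \<partial>M) \<le> ennreal (e / 2)"
      using e by (intro ennreal_tendsto_0D[OF BL]) simp
    then obtain N where N: "\<And>n. n \<ge> N \<Longrightarrow> (\<integral>\<^sup>+x. ennreal \<bar>J (f n x) - J (f n x - g x) - J (g x)\<bar> \<partial>M) \<le> ennreal (e / 2)"
      by (auto simp: eventually_sequentially)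
    have "norm ((LINT x|M. J (f n x) - J (f n x - g x) - J (g x)) - 0) < e" if "n \<ge> N" for n
      using abs_integral_le_nn[OF Bochner_Integration.integrable_diff[OF Bochner_Integration.integrable_diff[OF i1 i3] i2] N[OF that]] e
      by simp
    then show "\<exists>no. \<forall>n\<ge>no. norm ((LINT x|M. J (f n x) - J (f n x - g x) - J (g x)) - 0) < e" by blast
  qed
qed

lemma homogeneous_integral_continuous:
  fixes U Z :: "nat \<Rightarrow> 'x \<Rightarrow> 'v::euclidean_space" and J :: "'v \<Rightarrow> real"
  assumes m[measurable]: "\<And>n. U n \<in> borel_measurable M" "\<And>n. Z n \<in> borel_measurable M"
    and J: "homogeneous p J" and p: "0 < p"
    and G: "\<And>n. powr_integral M p (U n) \<le> ennreal G"
    and Zfin: "\<And>n. powr_integral M p (Z n) < \<infinity>"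
    and Z: "(\<lambda>n. \<integral>\<^sup>+x. ennreal (norm (Z n x) powr p) \<partial>M) \<longlonglongrightarrow> 0"
  shows "(\<lambda>n. (LINT x|M. J (U n x + Z n x)) - (LINT x|M. J (U n x))) \<longlonglongrightarrow> 0"
proof (rule LIMSEQ_I)
  fix e :: real assume e: "0 < e"
  define \<epsilon> where "\<epsilon> = e / 4 / (max 0 G + 1)"
  have \<epsilon>: "0 < \<epsilon>" using e by (simp add: \<epsilon>_def)
  have \<epsilon>G: "\<epsilon> * max 0 G \<le> e / 4" using e by (simp add: \<epsilon>_def field_simps)
  obtain C where C: "0 \<le> C" "\<And>a b. \<bar>J (a + b) - J a\<bar> \<le> \<epsilon> * norm a powr p + C * norm b powr p"
    using homogeneous_increment[OF J p \<epsilon>] by blast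
  have "\<forall>\<^sub>F n in sequentially. powr_integral M p (Z n) \<le> ennreal (e / 4 / (C + 1))"
    using e C by (intro ennreal_tendsto_0D[OF Z]) simp
  then obtain N where N: "\<And>n. n \<ge> N \<Longrightarrow> powr_integral M p (Z n) \<le> ennreal (e / 4 / (C + 1))"
    by (auto simp: eventually_sequentially)
  have UF: "powr_integral M p (U n) < \<infinity>" for n using le_less_trans[OF G] by simp
  have i1: "integrable M (\<lambda>x. J (U n x))" for n by (rule homogeneous_integrable[OF J m(1) UF])
  have i2: "integrable M (\<lambda>x. J (U n x + Z n x))" for n
  proof (rule homogeneous_integrable[OF J])
    have "(\<integral>\<^sup>+x. ennreal (norm (- Z n x) powr p) \<partial>M) < \<infinity>" using Zfin by simp
    then have "(\<integral>\<^sup>+x. ennreal (norm (U n x - (- Z n x)) powr p) \<partial>M) < \<infinity>"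
      by (intro diff_powr_finite p UF) measurable
    then show "(\<integral>\<^sup>+x. ennreal (norm (U n x + Z n x) powr p) \<partial>M) < \<infinity>" by simp
  qed measurable
  note [measurable] = homogeneous_measurable[OF J]
  have "norm ((LINT x|M. J (U n x + Z n x)) - (LINT x|M. J (U n x)) - 0) < e" if n: "n \<ge> N" for n
  proof -
    have "(\<integral>\<^sup>+x. ennreal \<bar>J (U n x + Z n x) - J (U n x)\<bar> \<partial>M) \<le> (\<integral>\<^sup>+x. ennreal \<epsilon> * ennreal (norm (U n x) powr p) + ennreal C * ennreal (norm (Z n x) powr p) \<partial>M)"
    proof (intro nn_integral_mono)
      fix x
      have "ennreal \<bar>J (U n x + Z n x) - J (U n x)\<bar> \<le> ennreal (\<epsilon> * norm (U n x) powr p + C * norm (Z n x) powr p)"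
        by (intro ennreal_leI C)
      also have "\<dots> = ennreal \<epsilon> * ennreal (norm (U n x) powr p) + ennreal C * ennreal (norm (Z n x) powr p)"
        using \<epsilon> C by (subst ennreal_plus) (auto simp: ennreal_mult)
      finally show "ennreal \<bar>J (U n x + Z n x) - J (U n x)\<bar> \<le> ennreal \<epsilon> * ennreal (norm (U n x) powr p) + ennreal C * ennreal (norm (Z n x) powr p)" .
    qed
    also have "\<dots> = ennreal \<epsilon> * powr_integral M p (U n) + ennreal C * powr_integral M p (Z n)"
      by (simp add: nn_integral_add nn_integral_cmult)
    also have "\<dots> \<le> ennreal \<epsilon> * ennreal (max 0 G) + ennreal C * ennreal (e / 4 / (C + 1))"
      by (intro add_mono mult_left_mono N n order_trans[OF G] ennreal_leI) auto
    also have "\<dots> = ennreal (\<epsilon> * max 0 G + C * (e / 4 / (C + 1)))"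
    proof -
      have k0: "0 \<le> e / 4 / (C + 1)" using e C by simp
      have sum: "ennreal \<epsilon> * ennreal g + ennreal C * ennreal k = ennreal (\<epsilon> * g + C * k)" if "0 \<le> g" "0 \<le> k" for g k
        using that \<epsilon> C by (simp add: ennreal_mult ennreal_plus)
      show ?thesis by (rule sum[OF _ k0]) simp
    qed
    also have "\<dots> \<le> ennreal (e / 2)"
    proof (rule ennreal_leI)
      have "C * (e / 4 / (C + 1)) \<le> e / 4" using e C by (simp add: field_simps)
      then show "\<epsilon> * max 0 G + C * (e / 4 / (C + 1)) \<le> e / 2" using \<epsilon>G by linarith
    qed
    finally have "\<bar>LINT x|M. J (U n x + Z n x) - J (U n x)\<bar> \<le> e / 2"
      using e by (intro abs_integral_le_nn Bochner_Integration.integrable_diff i1 i2) auto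
    then show ?thesis using e i1 i2 by simp
  qed
  then show "\<exists>no. \<forall>n\<ge>no. norm ((LINT x|M. J (U n x + Z n x)) - (LINT x|M. J (U n x)) - 0) < e" by blast
qed

definition mass1 :: "('a::euclidean_space \<Rightarrow> complex \<times> complex) \<Rightarrow> real" where
  "mass1 U = (LINT x|lborel. (norm (fst (U x)))\<^sup>2)"

definition mass2 :: "('a::euclidean_space \<Rightarrow> complex \<times> complex) \<Rightarrow> real" where
  "mass2 U = (LINT x|lborel. (norm (snd (U x)))\<^sup>2)"

definition kinetic :: "real \<Rightarrow> ('a::euclidean_space \<Rightarrow> complex \<times> complex) \<Rightarrow> real" where
  "kinetic \<alpha> U = (LINT z|pair_measure (gag_kernel \<alpha>). (norm (increment U z))\<^sup>2)"

text \<open>Comparable to the squared norm of the energy space, as \<open>HH_norm_bounds\<close> shows.\<close>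

abbreviation H_sqn :: "real \<Rightarrow> ('a::euclidean_space \<Rightarrow> complex \<times> complex) \<Rightarrow> real" where
  "H_sqn \<alpha> U \<equiv> mass1 U + mass2 U + kinetic \<alpha> U"

text \<open>The pairs in the energy space, regarded as one vector-valued function so that the estimates for functions with
  values in a Euclidean space apply to both components at once.\<close>

definition admissible :: "real \<Rightarrow> ('a::euclidean_space \<Rightarrow> complex \<times> complex) \<Rightarrow> bool" where
  "admissible \<alpha> U \<longleftrightarrow> U \<in> borel_measurable borel \<and> sqn lborel U < \<infinity> \<and> gagliardo \<alpha> U < \<infinity>"

definition bounded_by :: "real \<Rightarrow> real \<Rightarrow> ('a::euclidean_space \<Rightarrow> complex \<times> complex) \<Rightarrow> bool" where
  "bounded_by \<alpha> B U \<longleftrightarrow> U \<in> borel_measurable borel \<and> sqn lborel U \<le> ennreal B \<and> gagliardo \<alpha> U \<le> ennreal B"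

lemma bounded_by_admissible: "bounded_by \<alpha> B U \<Longrightarrow> admissible \<alpha> U"
  unfolding bounded_by_def admissible_def by (auto intro: le_less_trans)

lemma bounded_by_mono: "bounded_by \<alpha> B U \<Longrightarrow> B \<le> B' \<Longrightarrow> bounded_by \<alpha> B' U"
  unfolding bounded_by_def using ennreal_leI order_trans by blast

lemma mass_nonneg [simp]: "0 \<le> mass1 U" "0 \<le> mass2 U" "0 \<le> kinetic \<alpha> U"
  by (simp_all add: mass1_def mass2_def kinetic_def integral_nonneg_AE)

lemma sqn_eq_integral:
  fixes f :: "'x \<Rightarrow> 'v::euclidean_space"
  assumes [measurable]: "f \<in> borel_measurable M" and fin: "sqn M f < \<infinity>"
  shows "integrable M (\<lambda>x. (norm (f x))\<^sup>2)" and "sqn M f = ennreal (LINT x|M. (norm (f x))\<^sup>2)"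
proof -
  show i: "integrable M (\<lambda>x. (norm (f x))\<^sup>2)"
    using fin unfolding sqn_def by (intro integrableI_bounded) simp_all
  show "sqn M f = ennreal (LINT x|M. (norm (f x))\<^sup>2)"
    unfolding sqn_def by (rule nn_integral_eq_integral[OF i]) simp
qed

lemma fst_measurable [measurable]:
  fixes U :: "'x \<Rightarrow> complex \<times> complex"
  assumes "U \<in> borel_measurable M"
  shows "(\<lambda>x. fst (U x)) \<in> borel_measurable M"
  by (rule measurable_compose[OF assms]) (intro borel_measurable_continuous_onI continuous_intros)

lemma snd_measurable [measurable]:
  fixes U :: "'x \<Rightarrow> complex \<times> complex"
  assumes "U \<in> borel_measurable M"
  shows "(\<lambda>x. snd (U x)) \<in> borel_measurable M"
  by (rule measurable_compose[OF assms]) (intro borel_measurable_continuous_onI continuous_intros)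

lemma sqn_components:
  fixes U :: "'a::euclidean_space \<Rightarrow> complex \<times> complex"
  assumes [measurable]: "U \<in> borel_measurable M"
  shows "sqn M U = sqn M (\<lambda>x. fst (U x)) + sqn M (\<lambda>x. snd (U x))"
  using sqn_pair[OF fst_measurable[OF assms] snd_measurable[OF assms]] by simp

lemma admissible_masses:
  assumes U: "admissible \<alpha> U"
  shows "sqn lborel (\<lambda>x. fst (U x)) = ennreal (mass1 U)" "sqn lborel (\<lambda>x. snd (U x)) = ennreal (mass2 U)"
    and "sqn lborel U = ennreal (mass1 U + mass2 U)" and "gagliardo \<alpha> U = ennreal (kinetic \<alpha> U)"
    and "integrable lborel (\<lambda>x. (norm (fst (U x)))\<^sup>2)" "integrable lborel (\<lambda>x. (norm (snd (U x)))\<^sup>2)"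
    and "integrable (pair_measure (gag_kernel \<alpha>)) (\<lambda>z. (norm (increment U z))\<^sup>2)"
proof -
  have [measurable]: "U \<in> borel_measurable borel" and f: "sqn lborel U < \<infinity>" "gagliardo \<alpha> U < \<infinity>"
    using U by (auto simp: admissible_def)
  have s: "sqn lborel U = sqn lborel (\<lambda>x. fst (U x)) + sqn lborel (\<lambda>x. snd (U x))"
    by (rule sqn_components) simp
  have f1: "sqn lborel (\<lambda>x. fst (U x)) < \<infinity>" "sqn lborel (\<lambda>x. snd (U x)) < \<infinity>"
    using f(1) unfolding s by (auto simp: ennreal_add_less_top)
  show 1: "sqn lborel (\<lambda>x. fst (U x)) = ennreal (mass1 U)" "sqn lborel (\<lambda>x. snd (U x)) = ennreal (mass2 U)"
    unfolding mass1_def mass2_def by (rule sqn_eq_integral(2), measurable, rule f1)+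
  show "sqn lborel U = ennreal (mass1 U + mass2 U)" unfolding s 1 by simp
  show "gagliardo \<alpha> U = ennreal (kinetic \<alpha> U)"
    unfolding gagliardo_def kinetic_def by (rule sqn_eq_integral(2), measurable) (use f(2) in \<open>simp add: gagliardo_def\<close>)
  show "integrable lborel (\<lambda>x. (norm (fst (U x)))\<^sup>2)" "integrable lborel (\<lambda>x. (norm (snd (U x)))\<^sup>2)"
    by (rule sqn_eq_integral(1), measurable, rule f1)+
  show "integrable (pair_measure (gag_kernel \<alpha>)) (\<lambda>z. (norm (increment U z))\<^sup>2)"
    by (rule sqn_eq_integral(1), measurable) (use f(2) in \<open>simp add: gagliardo_def\<close>)
qed

lemma admissible_bounded_by:
  assumes "admissible \<alpha> U" "mass1 U + mass2 U \<le> B" "kinetic \<alpha> U \<le> B"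
  shows "bounded_by \<alpha> B U"
  unfolding bounded_by_def admissible_masses(3,4)[OF assms(1)]
  using assms by (simp add: admissible_def ennreal_leI del: ennreal_plus)

lemma bounded_by_le:
  assumes "bounded_by \<alpha> B U" "0 \<le> B"
  shows "mass1 U + mass2 U \<le> B" "kinetic \<alpha> U \<le> B"
  using assms unfolding bounded_by_def admissible_masses(3,4)[OF bounded_by_admissible[OF assms(1)]]
  by (simp_all add: ennreal_le_iff del: ennreal_plus)

lemma admissible_shift:
  assumes U: "admissible \<alpha> U"
  shows "admissible \<alpha> (\<lambda>x. U (x + y))" "mass1 (\<lambda>x. U (x + y)) = mass1 U" "mass2 (\<lambda>x. U (x + y)) = mass2 U"
    "kinetic \<alpha> (\<lambda>x. U (x + y)) = kinetic \<alpha> U"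
proof -
  have [measurable]: "U \<in> borel_measurable borel" using U by (simp add: admissible_def)
  have "(\<lambda>x. U (x + y)) \<in> borel_measurable borel" by measurable
  then show A: "admissible \<alpha> (\<lambda>x. U (x + y))"
    using U sqn_shift[of U y] gagliardo_shift[of U \<alpha> y] by (simp add: admissible_def)
  show "mass1 (\<lambda>x. U (x + y)) = mass1 U" "mass2 (\<lambda>x. U (x + y)) = mass2 U"
    unfolding mass1_def mass2_def
    using integral_lborel_shift(1)[of "\<lambda>x. (norm (fst (U x)))\<^sup>2" y] integral_lborel_shift(1)[of "\<lambda>x. (norm (snd (U x)))\<^sup>2" y] by simp_all
  have "ennreal (kinetic \<alpha> (\<lambda>x. U (x + y))) = ennreal (kinetic \<alpha> U)"
    using admissible_masses(4)[OF A] admissible_masses(4)[OF U] gagliardo_shift[of U \<alpha> y] by simp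
  then show "kinetic \<alpha> (\<lambda>x. U (x + y)) = kinetic \<alpha> U" by simp
qed

lemma bounded_by_shift:
  assumes U: "bounded_by \<alpha> B U"
  shows "bounded_by \<alpha> B (\<lambda>x. U (x + y))"
proof -
  have [measurable]: "U \<in> borel_measurable borel" using U by (simp add: bounded_by_def)
  have "(\<lambda>x. U (x + y)) \<in> borel_measurable borel" by measurable
  then show ?thesis using U sqn_shift[of U y] gagliardo_shift[of U \<alpha> y] by (simp add: bounded_by_def)
qed

lemma gagliardo_diff_le:
  fixes U W :: "'a::euclidean_space \<Rightarrow> 'v::euclidean_space"
  assumes [measurable]: "U \<in> borel_measurable borel" "W \<in> borel_measurable borel"
  shows "gagliardo \<alpha> (\<lambda>x. U x - W x) \<le> 2 * gagliardo \<alpha> U + 2 * gagliardo \<alpha> W"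
proof -
  have "increment (\<lambda>x. U x - W x) = (\<lambda>z. increment U z - increment W z)"
    by (auto simp: increment_def fun_eq_iff)
  then show ?thesis
    unfolding gagliardo_def using sqn_diff_le[of "increment U" "pair_measure (gag_kernel \<alpha>)" "increment W"] by simp
qed

lemma bounded_by_diff:
  assumes U: "bounded_by \<alpha> B U" and W: "bounded_by \<alpha> B W" and B: "0 \<le> B"
  shows "bounded_by \<alpha> (4 * B) (\<lambda>x. U x - W x)"
proof -
  have m[measurable]: "U \<in> borel_measurable borel" "W \<in> borel_measurable borel"
    using U W by (simp_all add: bounded_by_def)
  have e: "2 * ennreal B + 2 * ennreal B = ennreal (4 * B)" using B by (simp add: numeral_mult_ennreal flip: ennreal_plus)
  have "sqn lborel (\<lambda>x. U x - W x) \<le> 2 * ennreal B + 2 * ennreal B"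
    using U W by (intro order_trans[OF sqn_diff_le] add_mono mult_left_mono) (auto simp: bounded_by_def)
  moreover have "gagliardo \<alpha> (\<lambda>x. U x - W x) \<le> 2 * ennreal B + 2 * ennreal B"
    using U W by (intro order_trans[OF gagliardo_diff_le] add_mono mult_left_mono) (auto simp: bounded_by_def)
  moreover have "(\<lambda>x. U x - W x) \<in> borel_measurable borel" by measurable
  ultimately show ?thesis unfolding bounded_by_def e by blast
qed

lemma homogeneous_norm_sq:
  "homogeneous 2 (\<lambda>z::'v::euclidean_space. (norm z)\<^sup>2)"
  "homogeneous 2 (\<lambda>z::complex \<times> complex. (norm (fst z))\<^sup>2)"
  "homogeneous 2 (\<lambda>z::complex \<times> complex. (norm (snd z))\<^sup>2)"
  unfolding homogeneous_def by (auto simp: power_mult_distrib intro!: continuous_intros)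

text \<open>The Brezis--Lieb lemma for quadratic forms, applied to the values and, in \<open>pair_measure\<close>, to the increments.\<close>

lemma splitting:
  fixes U :: "nat \<Rightarrow> 'a::euclidean_space \<Rightarrow> complex \<times> complex"
  assumes U: "\<And>n. bounded_by \<alpha> B (U n)" and W: "W \<in> borel_measurable borel"
    and conv: "AE x in lborel. (\<lambda>n. U n x) \<longlonglongrightarrow> W x"
  shows "bounded_by \<alpha> B W"
    and "(\<lambda>n. mass1 (U n) - mass1 (\<lambda>x. U n x - W x) - mass1 W) \<longlonglongrightarrow> 0"
    and "(\<lambda>n. mass2 (U n) - mass2 (\<lambda>x. U n x - W x) - mass2 W) \<longlonglongrightarrow> 0"
    and "(\<lambda>n. kinetic \<alpha> (U n) - kinetic \<alpha> (\<lambda>x. U n x - W x) - kinetic \<alpha> W) \<longlonglongrightarrow> 0"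
proof -
  have m[measurable]: "U n \<in> borel_measurable borel" for n using U by (simp add: bounded_by_def)
  note [measurable] = W
  have m': "U n \<in> borel_measurable lborel" "W \<in> borel_measurable lborel" for n by simp_all
  have s: "powr_integral M 2 f = sqn M f" for f :: "'x \<Rightarrow> complex \<times> complex" and M
    by (simp add: sqn_def)
  have B1: "powr_integral lborel 2 (U n) \<le> ennreal B" for n
    unfolding s using U by (simp add: bounded_by_def)
  have B2: "(\<integral>\<^sup>+z. ennreal (norm (increment (U n) z) powr 2) \<partial>pair_measure (gag_kernel \<alpha>)) \<le> ennreal B" for n
    unfolding s using U by (simp add: bounded_by_def gagliardo_def)
  have conv2: "AE z in pair_measure (gag_kernel \<alpha>). (\<lambda>n. increment (U n) z) \<longlonglongrightarrow> increment W z"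
    by (rule AE_increment_tendsto[OF gag_kernel_measurable conv])
  have mi: "increment (U n) \<in> borel_measurable (pair_measure (gag_kernel \<alpha>))" "increment W \<in> borel_measurable (pair_measure (gag_kernel \<alpha>))" for n
    by measurable
  have "sqn lborel W \<le> ennreal B"
    by (rule sqn_fatou[where f=U, OF m' conv]) (use U in \<open>simp add: bounded_by_def\<close>)
  moreover have "gagliardo \<alpha> W \<le> ennreal B"
    unfolding gagliardo_def by (rule sqn_fatou[where f="\<lambda>n. increment (U n)", OF mi conv2]) (use U in \<open>simp add: bounded_by_def gagliardo_def\<close>)
  ultimately show "bounded_by \<alpha> B W" using W by (simp add: bounded_by_def)
  show "(\<lambda>n. mass1 (U n) - mass1 (\<lambda>x. U n x - W x) - mass1 W) \<longlonglongrightarrow> 0"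
    unfolding mass1_def by (rule brezis_lieb_integral[where f=U, OF m' homogeneous_norm_sq(2) _ conv B1]) simp
  show "(\<lambda>n. mass2 (U n) - mass2 (\<lambda>x. U n x - W x) - mass2 W) \<longlonglongrightarrow> 0"
    unfolding mass2_def by (rule brezis_lieb_integral[where f=U, OF m' homogeneous_norm_sq(3) _ conv B1]) simp
  have "(\<lambda>n. (LINT z|pair_measure (gag_kernel \<alpha>). (norm (increment (U n) z))\<^sup>2)
      - (LINT z|pair_measure (gag_kernel \<alpha>). (norm (increment (U n) z - increment W z))\<^sup>2)
      - (LINT z|pair_measure (gag_kernel \<alpha>). (norm (increment W z))\<^sup>2)) \<longlonglongrightarrow> 0"
    by (rule brezis_lieb_integral[where f="\<lambda>n. increment (U n)", OF mi homogeneous_norm_sq(1) _ conv2 B2]) simp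
  moreover have "increment (U n) z - increment W z = increment (\<lambda>x. U n x - W x) z" for n z
    by (simp add: increment_def)
  ultimately show "(\<lambda>n. kinetic \<alpha> (U n) - kinetic \<alpha> (\<lambda>x. U n x - W x) - kinetic \<alpha> W) \<longlonglongrightarrow> 0"
    unfolding kinetic_def by simp
qed

section \<open>Superposition of moduli\<close>

text \<open>The components are \<open>(|U\<^sub>j|\<^sup>2 + |V\<^sub>j|\<^sup>2)\<^sup>1\<^sup>/\<^sup>2\<close>. Masses add up, the kinetic energy is subadditive and
  the potential energy superadditive, so this superposition replaces the usual scaling argument for strict subadditivity of the
  infimum, which is delicate when there are two constraints.\<close>

definition oplus :: "('a \<Rightarrow> complex \<times> complex) \<Rightarrow> ('a \<Rightarrow> complex \<times> complex) \<Rightarrow> 'a \<Rightarrow> complex \<times> complex" where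
  "oplus U V x = (complex_of_real (norm (fst (U x), fst (V x))), complex_of_real (norm (snd (U x), snd (V x))))"

lemma oplus_norms:
  "(norm (fst (oplus U V x)))\<^sup>2 = (norm (fst (U x)))\<^sup>2 + (norm (fst (V x)))\<^sup>2"
  "(norm (snd (oplus U V x)))\<^sup>2 = (norm (snd (U x)))\<^sup>2 + (norm (snd (V x)))\<^sup>2"
  by (simp_all add: oplus_def norm_Pair)

lemma oplus_measurable [measurable]:
  assumes [measurable]: "U \<in> borel_measurable M" "V \<in> borel_measurable M"
  shows "oplus U V \<in> borel_measurable M"
  unfolding oplus_def norm_Pair by measurable

text \<open>The modulus of the vector \<open>(U, V)\<close> has smaller increments than the vector itself, by the
  reverse triangle inequality.\<close>

lemma oplus_increment: "(norm (increment (oplus U V) z))\<^sup>2 \<le> (norm (increment U z))\<^sup>2 + (norm (increment V z))\<^sup>2"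
proof -
  have 1: "(norm (complex_of_real (norm a) - complex_of_real (norm b)))\<^sup>2 \<le> (norm (a - b))\<^sup>2" for a b :: "complex \<times> complex"
  proof -
    have "\<bar>norm a - norm b\<bar> \<le> norm (a - b)" by (rule norm_triangle_ineq3)
    then have "\<bar>norm a - norm b\<bar>\<^sup>2 \<le> (norm (a - b))\<^sup>2" by (intro power_mono) auto
    moreover have "norm (complex_of_real (norm a) - complex_of_real (norm b)) = \<bar>norm a - norm b\<bar>"
      by (metis norm_of_real of_real_diff)
    ultimately show ?thesis by simp
  qed
  obtain x y where xy: "x = snd z + fst z" "y = snd z" by blast
  have "(norm (increment (oplus U V) z))\<^sup>2 \<le>
     (norm ((fst (U x), fst (V x)) - (fst (U y), fst (V y))))\<^sup>2 + (norm ((snd (U x), snd (V x)) - (snd (U y), snd (V y))))\<^sup>2"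
    using 1[of "(fst (U x), fst (V x))" "(fst (U y), fst (V y))"] 1[of "(snd (U x), snd (V x))" "(snd (U y), snd (V y))"]
    by (simp add: increment_def oplus_def xy norm_Pair)
  also have "\<dots> = (norm (increment U z))\<^sup>2 + (norm (increment V z))\<^sup>2"
    by (simp add: increment_def xy norm_prod_def)
  finally show ?thesis .
qed

lemma oplus_admissible:
  assumes U: "admissible \<alpha> U" and V: "admissible \<alpha> V"
  shows "admissible \<alpha> (oplus U V)" "mass1 (oplus U V) = mass1 U + mass1 V" "mass2 (oplus U V) = mass2 U + mass2 V"
    "kinetic \<alpha> (oplus U V) \<le> kinetic \<alpha> U + kinetic \<alpha> V"
proof -
  have [measurable]: "U \<in> borel_measurable borel" "V \<in> borel_measurable borel"
    using U V by (simp_all add: admissible_def)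
  note iU = admissible_masses[OF U] and iV = admissible_masses[OF V]
  show m1: "mass1 (oplus U V) = mass1 U + mass1 V" "mass2 (oplus U V) = mass2 U + mass2 V"
    unfolding mass1_def mass2_def oplus_norms using iU(5,6) iV(5,6) by simp_all
  have "sqn lborel (oplus U V) \<le> sqn lborel U + sqn lborel V"
  proof -
    have "(norm (oplus U V x))\<^sup>2 = (norm (U x))\<^sup>2 + (norm (V x))\<^sup>2" for x
      using oplus_norms[of U V x] by (simp add: norm_prod_def)
    then have "sqn lborel (oplus U V) = (\<integral>\<^sup>+x. ennreal ((norm (U x))\<^sup>2) + ennreal ((norm (V x))\<^sup>2) \<partial>lborel)"
      unfolding sqn_def by simp
    also have "\<dots> = sqn lborel U + sqn lborel V" unfolding sqn_def by (rule nn_integral_add) simp_all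
    finally show ?thesis by simp
  qed
  also have "\<dots> < \<infinity>" using U V by (simp add: admissible_def)
  finally have s: "sqn lborel (oplus U V) < \<infinity>" .
  have "gagliardo \<alpha> (oplus U V) \<le> (\<integral>\<^sup>+z. ennreal ((norm (increment U z))\<^sup>2) + ennreal ((norm (increment V z))\<^sup>2) \<partial>pair_measure (gag_kernel \<alpha>))"
    unfolding gagliardo_def sqn_def using oplus_increment
    by (intro nn_integral_mono) (simp add: ennreal_leI flip: ennreal_plus)
  also have "\<dots> = gagliardo \<alpha> U + gagliardo \<alpha> V" unfolding gagliardo_def sqn_def by (rule nn_integral_add) simp_all
  finally have g: "gagliardo \<alpha> (oplus U V) \<le> gagliardo \<alpha> U + gagliardo \<alpha> V" .
  also have "\<dots> < \<infinity>" using U V by (simp add: admissible_def)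
  finally have g': "gagliardo \<alpha> (oplus U V) < \<infinity>" .
  have "oplus U V \<in> borel_measurable borel" by measurable
  then show A: "admissible \<alpha> (oplus U V)" using s g' by (simp add: admissible_def)
  have "ennreal (kinetic \<alpha> (oplus U V)) \<le> ennreal (kinetic \<alpha> U + kinetic \<alpha> V)"
    using g unfolding admissible_masses(4)[OF A] iU(4) iV(4) by (simp add: ennreal_plus)
  then show "kinetic \<alpha> (oplus U V) \<le> kinetic \<alpha> U + kinetic \<alpha> V" by (subst (asm) ennreal_le_iff) auto
qed

lemma powr_superadditive:
  fixes a b :: real
  assumes "0 \<le> a" "0 \<le> b" "1 < q"
  shows "a powr q + b powr q \<le> (a + b) powr q" and "0 < a \<Longrightarrow> 0 < b \<Longrightarrow> a powr q + b powr q < (a + b) powr q"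
proof -
  have st: "a powr q + b powr q < (a + b) powr q" if "0 < a" "0 < b" for a b
  proof -
    have "a powr q = a * a powr (q - 1)" "b powr q = b * b powr (q - 1)"
      using that by (simp_all add: powr_mult_base)
    moreover have "a * a powr (q - 1) < a * (a + b) powr (q - 1)" "b * b powr (q - 1) < b * (a + b) powr (q - 1)"
      using that assms(3) by (auto intro!: mult_strict_left_mono powr_less_mono2)
    moreover have "(a + b) powr q = a * (a + b) powr (q - 1) + b * (a + b) powr (q - 1)"
    proof -
      have "(a + b) powr q = (a + b) * (a + b) powr (q - 1)" using that by (simp add: powr_mult_base)
      then show ?thesis by (simp only: distrib_right)
    qed
    ultimately show ?thesis by linarith
  qed
  then show "0 < a \<Longrightarrow> 0 < b \<Longrightarrow> a powr q + b powr q < (a + b) powr q" by blast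
  show "a powr q + b powr q \<le> (a + b) powr q"
    using st[of a b] assms by (cases "a = 0"; cases "b = 0") auto
qed

text \<open>Weighted arithmetic--geometric means reduce the product to the superadditivity of \<open>x \<mapsto> x\<^sup>s\<^sup>+\<^sup>t\<close>.\<close>

lemma powr_product_superadditive:
  fixes a b c d :: real
  assumes nn: "0 \<le> a" "0 \<le> b" "0 \<le> c" "0 \<le> d" and st: "0 < s" "0 < t" "1 < s + t"
  shows "a powr s * c powr t + b powr s * d powr t \<le> (a + b) powr s * (c + d) powr t"
    and "0 < a \<Longrightarrow> 0 < d \<Longrightarrow> a powr s * c powr t + b powr s * d powr t < (a + b) powr s * (c + d) powr t"
proof -
  define q where "q = s + t"
  have q: "1 < q" using st by (simp add: q_def)
  have amgm: "x powr s * y powr t \<le> (s / q * x + t / q * y) powr q" if "0 \<le> x" "0 \<le> y" for x y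
  proof (cases "x = 0 \<or> y = 0")
    case True
    then show ?thesis by auto
  next
    case False
    then have xy: "0 < x" "0 < y" using that by auto
    have "x powr (s / q) * y powr (t / q) \<le> s / q * x + t / q * y"
      using st xy by (intro Youngs_inequality_0) (auto simp: q_def add_divide_distrib[symmetric])
    then have "(x powr (s / q) * y powr (t / q)) powr q \<le> (s / q * x + t / q * y) powr q"
      using q by (intro powr_mono2) auto
    then show ?thesis using q by (simp add: powr_mult powr_powr)
  qed
  have main: "a powr s * c powr t + b powr s * d powr t \<le> (a + b) powr s * (c + d) powr t \<and>
      (0 < a \<longrightarrow> 0 < d \<longrightarrow> a powr s * c powr t + b powr s * d powr t < (a + b) powr s * (c + d) powr t)"
    if ab: "0 < a + b" and cd: "0 < c + d"
  proof -
    define A where "A = a / (a + b)"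
    define C where "C = c / (c + d)"
    have A: "0 \<le> A" "0 \<le> 1 - A" "b / (a + b) = 1 - A" using nn ab by (auto simp: A_def field_simps)
    have C: "0 \<le> C" "0 \<le> 1 - C" "d / (c + d) = 1 - C" using nn cd by (auto simp: C_def field_simps)
    define X where "X = s / q * A + t / q * C"
    have X: "0 \<le> X" "0 \<le> 1 - X" "s / q * (1 - A) + t / q * (1 - C) = 1 - X"
    proof -
      have e: "s / q + t / q = 1" using q by (simp add: q_def add_divide_distrib[symmetric])
      show eq: "s / q * (1 - A) + t / q * (1 - C) = 1 - X" proof -
        have "s / q * (1 - A) + t / q * (1 - C) = (s / q + t / q) - X"
          by (simp add: X_def right_diff_distrib)
        then show ?thesis by (simp only: e)
      qed
      show "0 \<le> X" unfolding X_def using A C st q by simp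
      have "0 \<le> s / q * (1 - A) + t / q * (1 - C)" using A C st q by simp
      then show "0 \<le> 1 - X" unfolding eq .
    qed
    have le: "A powr s * C powr t + (1 - A) powr s * (1 - C) powr t \<le> X powr q + (1 - X) powr q"
      using amgm[OF A(1) C(1)] amgm[OF A(2) C(2)] unfolding X(3) X_def[symmetric] by linarith
    have le1: "X powr q + (1 - X) powr q \<le> 1" using powr_superadditive(1)[OF X(1,2) q] by simp
    have lt1: "X powr q + (1 - X) powr q < 1" if "0 < a" "0 < d"
    proof -
      have "0 < A" "0 < 1 - C" using that ab cd nn by (auto simp: A_def C_def field_simps)
      then have pos: "0 < s / q * A" "0 < t / q * (1 - C)" "0 \<le> t / q * C" "0 \<le> s / q * (1 - A)"
        using A C st q by (simp_all del: times_divide_eq_left)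
      have "0 < X" unfolding X_def by (rule add_pos_nonneg[OF pos(1,3)])
      moreover have "0 < 1 - X" unfolding X(3)[symmetric] by (rule add_nonneg_pos[OF pos(4,2)])
      ultimately show ?thesis using powr_superadditive(2)[OF X(1,2) q] by simp
    qed
    have f1: "a powr s * c powr t = (a + b) powr s * (c + d) powr t * (A powr s * C powr t)"
      using ab cd nn by (simp add: A_def C_def powr_divide)
    have f2: "b powr s * d powr t = (a + b) powr s * (c + d) powr t * ((1 - A) powr s * (1 - C) powr t)"
      using ab cd nn unfolding A(3)[symmetric] C(3)[symmetric] by (simp add: powr_divide)
    define D where "D = (a + b) powr s * (c + d) powr t"
    have D: "0 < D" using ab cd by (simp add: D_def)
    have sum: "a powr s * c powr t + b powr s * d powr t = D * (A powr s * C powr t + (1 - A) powr s * (1 - C) powr t)"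
      unfolding f1 f2 D_def by (simp add: distrib_left)
    have "D * (A powr s * C powr t + (1 - A) powr s * (1 - C) powr t) \<le> D * 1"
      using le le1 D by (intro mult_left_mono) auto
    moreover have "D * (A powr s * C powr t + (1 - A) powr s * (1 - C) powr t) < D * 1" if "0 < a" "0 < d"
      using le lt1[OF that] D by (intro mult_strict_left_mono) auto
    ultimately show ?thesis unfolding sum D_def[symmetric] by simp
  qed
  show "a powr s * c powr t + b powr s * d powr t \<le> (a + b) powr s * (c + d) powr t"
  proof (cases "0 < a + b \<and> 0 < c + d")
    case False
    then have "a = 0 \<and> b = 0 \<or> c = 0 \<and> d = 0" using nn by auto
    then show ?thesis by auto
  qed (use main in blast)
  show "0 < a \<Longrightarrow> 0 < d \<Longrightarrow> a powr s * c powr t + b powr s * d powr t < (a + b) powr s * (c + d) powr t"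
    using main nn by (simp add: add_pos_nonneg add_nonneg_pos)
qed

section \<open>The variational problem\<close>

locale nls_energy =
  fixes \<alpha> \<mu>1 \<mu>2 p1 p2 \<beta> r1 r2 :: real and space :: "'a::euclidean_space itself"
  assumes \<alpha>: "0 < \<alpha>" "\<alpha> < 1" and \<mu>: "0 < \<mu>1" "0 < \<mu>2" and \<beta>: "0 < \<beta>"
    and r: "1 < r1" "1 < r2" "r1 + r2 < 2 + 4 * \<alpha> / real DIM('a)"
    and p1: "2 < p1" "p1 < 2 + 4 * \<alpha> / real DIM('a)"
    and p2: "2 < p2" "p2 < 2 + 4 * \<alpha> / real DIM('a)"
begin

definition term1 :: "complex \<times> complex \<Rightarrow> real" where
  "term1 z = \<mu>1 / p1 * norm (fst z) powr p1"

definition term2 :: "complex \<times> complex \<Rightarrow> real" where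
  "term2 z = \<mu>2 / p2 * norm (snd z) powr p2"

definition term3 :: "complex \<times> complex \<Rightarrow> real" where
  "term3 z = F \<beta> r1 r2 (fst z) (snd z)"

definition potential :: "('a \<Rightarrow> complex \<times> complex) \<Rightarrow> real" where
  "potential U = (LINT x|lborel. term1 (U x) + term2 (U x) + term3 (U x))"

definition total_energy :: "('a \<Rightarrow> complex \<times> complex) \<Rightarrow> real" where
  "total_energy U = 1 / 2 * kinetic \<alpha> U - potential U"

lemma terms_homogeneous: "homogeneous p1 term1" "homogeneous p2 term2" "homogeneous (r1 + r2) term3"
proof -
  have c: "continuous_on UNIV (\<lambda>z::complex \<times> complex. norm (g z) powr q)"
    if "continuous_on UNIV g" "0 < q" for g :: "complex \<times> complex \<Rightarrow> complex" and q
    using that by (intro continuous_on_powr' continuous_intros) auto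
  show "homogeneous p1 term1" "homogeneous p2 term2"
    unfolding homogeneous_def term1_def[abs_def] term2_def[abs_def] using p1 p2
    by (auto simp: powr_mult intro!: continuous_on_mult_left c continuous_intros)
  show "homogeneous (r1 + r2) term3"
    unfolding homogeneous_def term3_def[abs_def] F_def using r
    by (auto simp: powr_mult powr_add intro!: continuous_on_mult continuous_on_const c continuous_intros)
qed

lemma exponents: "2 < p1" "p1 < 2 + 4 * \<alpha> / real DIM('a)" "2 < p2" "p2 < 2 + 4 * \<alpha> / real DIM('a)"
  "2 < r1 + r2" "r1 + r2 < 2 + 4 * \<alpha> / real DIM('a)"
  using p1 p2 r by auto

lemma terms_nonneg: "0 \<le> term1 z" "0 \<le> term2 z" "0 \<le> term3 z"
  using \<mu> \<beta> p1 p2 by (simp_all add: term1_def term2_def term3_def F_def)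

lemmas [measurable] = terms_homogeneous[THEN homogeneous_measurable]

lemma powr_integral_finite:
  assumes U: "admissible \<alpha> (U :: 'a \<Rightarrow> complex \<times> complex)" and p: "2 < p" "p < 2 + 4 * \<alpha> / real DIM('a)"
  shows "powr_integral lborel p U < \<infinity>"
proof -
  have "0 \<le> mass1 U + mass2 U" by simp
  from gagliardo_nirenberg[OF \<alpha> p zero_less_one this, where 'v="complex \<times> complex"]
  obtain D where "\<And>(u::'a \<Rightarrow> complex \<times> complex) K. u \<in> borel_measurable borel \<Longrightarrow>
    sqn lborel u \<le> ennreal (mass1 U + mass2 U) \<Longrightarrow> gagliardo \<alpha> u \<le> ennreal K \<Longrightarrow> 0 \<le> K \<Longrightarrow>
    powr_integral lborel p u \<le> ennreal (1 * K + D)" by blast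
  from this[of U "kinetic \<alpha> U"] U admissible_masses(3,4)[OF U]
  have "powr_integral lborel p U \<le> ennreal (1 * kinetic \<alpha> U + D)"
    by (simp add: admissible_def)
  then show ?thesis by (auto intro: le_less_trans)
qed

lemma terms_integrable:
  assumes U: "admissible \<alpha> (U :: 'a \<Rightarrow> complex \<times> complex)"
  shows "integrable lborel (\<lambda>x. term1 (U x))" "integrable lborel (\<lambda>x. term2 (U x))" "integrable lborel (\<lambda>x. term3 (U x))"
proof -
  have m: "U \<in> borel_measurable lborel" using U by (simp add: admissible_def)
  show "integrable lborel (\<lambda>x. term1 (U x))" "integrable lborel (\<lambda>x. term2 (U x))" "integrable lborel (\<lambda>x. term3 (U x))"
    by (rule homogeneous_integrable[OF terms_homogeneous(1) m powr_integral_finite[OF U exponents(1,2)]]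
      homogeneous_integrable[OF terms_homogeneous(2) m powr_integral_finite[OF U exponents(3,4)]]
      homogeneous_integrable[OF terms_homogeneous(3) m powr_integral_finite[OF U exponents(5,6)]])+
qed

lemma potential_sum:
  assumes U: "admissible \<alpha> (U :: 'a \<Rightarrow> complex \<times> complex)"
  shows "potential U = (LINT x|lborel. term1 (U x)) + (LINT x|lborel. term2 (U x)) + (LINT x|lborel. term3 (U x))"
  unfolding potential_def using terms_integrable[OF U] by simp

lemma potential_nonneg: "0 \<le> potential U"
  unfolding potential_def by (intro integral_nonneg_AE AE_I2 add_nonneg_nonneg terms_nonneg)

lemma potential_shift:
  assumes U: "admissible \<alpha> (U :: 'a \<Rightarrow> complex \<times> complex)"
  shows "potential (\<lambda>x. U (x + y)) = potential U"
proof -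
  have [measurable]: "U \<in> borel_measurable borel" using U by (simp add: admissible_def)
  show ?thesis unfolding potential_def
    by (rule integral_lborel_shift(1)[of "\<lambda>x. term1 (U x) + term2 (U x) + term3 (U x)" y]) measurable
qed

lemma total_energy_shift:
  assumes U: "admissible \<alpha> (U :: 'a \<Rightarrow> complex \<times> complex)"
  shows "total_energy (\<lambda>x. U (x + y)) = total_energy U"
  unfolding total_energy_def potential_shift[OF U] admissible_shift(4)[OF U] ..

lemma homogeneous_integral_le:
  fixes U :: "'a \<Rightarrow> complex \<times> complex"
  assumes J: "homogeneous p J" and K: "0 \<le> K" "\<And>z. \<bar>J z\<bar> \<le> K * norm z powr p"
    and m[measurable]: "U \<in> borel_measurable borel"
    and le: "powr_integral lborel p U \<le> ennreal c" and c: "0 \<le> c"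
  shows "(LINT x|lborel. J (U x)) \<le> K * c"
proof -
  have i: "integrable lborel (\<lambda>x. J (U x))"
    using le_less_trans[OF le] by (intro homogeneous_integrable[OF J]) auto
  have "(\<integral>\<^sup>+x. ennreal \<bar>J (U x)\<bar> \<partial>lborel) \<le> (\<integral>\<^sup>+x. ennreal K * ennreal (norm (U x) powr p) \<partial>lborel)"
    using K by (intro nn_integral_mono) (simp add: ennreal_mult[symmetric] ennreal_leI)
  also have "\<dots> = ennreal K * powr_integral lborel p U" by (rule nn_integral_cmult) measurable
  also have "\<dots> \<le> ennreal K * ennreal c" by (intro mult_left_mono le) simp
  also have "\<dots> = ennreal (K * c)" using K c by (simp add: ennreal_mult)
  finally have "\<bar>LINT x|lborel. J (U x)\<bar> \<le> K * c" using K c by (intro abs_integral_le_nn i) auto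
  then show ?thesis by simp
qed

lemma term_coercive:
  assumes J: "homogeneous p J" and p: "2 < p" "p < 2 + 4 * \<alpha> / real DIM('a)" and \<epsilon>: "0 < \<epsilon>" and M: "0 \<le> M"
  shows "\<exists>D\<ge>0. \<forall>U::'a \<Rightarrow> complex \<times> complex. admissible \<alpha> U \<longrightarrow> mass1 U + mass2 U \<le> M \<longrightarrow> (LINT x|lborel. J (U x)) \<le> \<epsilon> * kinetic \<alpha> U + D"
proof -
  obtain K where K: "0 \<le> K" "\<And>z. \<bar>J z\<bar> \<le> K * norm z powr p" using homogeneous_bound[OF J] by blast
  define e where "e = \<epsilon> / (K + 1)"
  have e: "0 < e" "K * e \<le> \<epsilon>" using K \<epsilon> by (auto simp: e_def field_simps)
  obtain D where D: "0 \<le> D" "\<And>(u::'a \<Rightarrow> complex \<times> complex) L. u \<in> borel_measurable borel \<Longrightarrow>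
    sqn lborel u \<le> ennreal M \<Longrightarrow> gagliardo \<alpha> u \<le> ennreal L \<Longrightarrow> 0 \<le> L \<Longrightarrow>
    powr_integral lborel p u \<le> ennreal (e * L + D)"
    using gagliardo_nirenberg[OF \<alpha> p e(1) M, where 'v="complex \<times> complex"] by blast
  have "(LINT x|lborel. J (U x)) \<le> \<epsilon> * kinetic \<alpha> U + K * D" if U: "admissible \<alpha> U" and UM: "mass1 U + mass2 U \<le> M" for U :: "'a \<Rightarrow> complex \<times> complex"
  proof -
    have m: "U \<in> borel_measurable borel" using U by (simp add: admissible_def)
    have "powr_integral lborel p U \<le> ennreal (e * kinetic \<alpha> U + D)"
      using UM by (intro D m) (simp_all add: admissible_masses(3,4)[OF U] ennreal_leI del: ennreal_plus)
    then have "(LINT x|lborel. J (U x)) \<le> K * (e * kinetic \<alpha> U + D)"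
      using D e by (intro homogeneous_integral_le[OF J K m]) auto
    also have "\<dots> \<le> \<epsilon> * kinetic \<alpha> U + K * D"
      using mult_right_mono[OF e(2), of "kinetic \<alpha> U"] by (simp add: algebra_simps)
    finally show ?thesis .
  qed
  then show ?thesis using K D by (intro exI[of _ "K * D"]) auto
qed

text \<open>By the Gagliardo--Nirenberg inequality each of the three terms of the potential energy is at most a twelfth of the
  kinetic energy plus a constant.\<close>

lemma energy_coercive:
  assumes M: "0 \<le> M"
  shows "\<exists>D\<ge>0. \<forall>U::'a \<Rightarrow> complex \<times> complex. admissible \<alpha> U \<longrightarrow> mass1 U + mass2 U \<le> M \<longrightarrow> kinetic \<alpha> U \<le> 4 * total_energy U + D"
proof -
  have t: "(0::real) < 1 / 12" by simp
  obtain D1 where D1: "0 \<le> D1" "\<And>U::'a \<Rightarrow> complex \<times> complex. admissible \<alpha> U \<Longrightarrow> mass1 U + mass2 U \<le> M \<Longrightarrow> (LINT x|lborel. term1 (U x)) \<le> 1/12 * kinetic \<alpha> U + D1"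
    using term_coercive[OF terms_homogeneous(1) exponents(1,2) t M] by blast
  obtain D2 where D2: "0 \<le> D2" "\<And>U::'a \<Rightarrow> complex \<times> complex. admissible \<alpha> U \<Longrightarrow> mass1 U + mass2 U \<le> M \<Longrightarrow> (LINT x|lborel. term2 (U x)) \<le> 1/12 * kinetic \<alpha> U + D2"
    using term_coercive[OF terms_homogeneous(2) exponents(3,4) t M] by blast
  obtain D3 where D3: "0 \<le> D3" "\<And>U::'a \<Rightarrow> complex \<times> complex. admissible \<alpha> U \<Longrightarrow> mass1 U + mass2 U \<le> M \<Longrightarrow> (LINT x|lborel. term3 (U x)) \<le> 1/12 * kinetic \<alpha> U + D3"
    using term_coercive[OF terms_homogeneous(3) exponents(5,6) t M] by blast
  have "kinetic \<alpha> U \<le> 4 * total_energy U + 4 * (D1 + D2 + D3)" if U: "admissible \<alpha> U" "mass1 U + mass2 U \<le> M" for U :: "'a \<Rightarrow> complex \<times> complex"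
    using D1(2)[OF U] D2(2)[OF U] D3(2)[OF U] unfolding total_energy_def potential_sum[OF U(1)] by simp
  then show ?thesis using D1(1) D2(1) D3(1) by (intro exI[of _ "4 * (D1 + D2 + D3)"]) auto
qed

lemma powr_integral_bounded:
  assumes p: "2 < p" "p < 2 + 4 * \<alpha> / real DIM('a)" and B: "0 \<le> B"
  shows "\<exists>G\<ge>0. \<forall>U::'a \<Rightarrow> complex \<times> complex. bounded_by \<alpha> B U \<longrightarrow> powr_integral lborel p U \<le> ennreal G"
proof -
  from gagliardo_nirenberg[OF \<alpha> p zero_less_one B, where 'v="complex \<times> complex"]
  obtain D where D: "0 \<le> D" "\<And>(u::'a \<Rightarrow> complex \<times> complex) K. u \<in> borel_measurable borel \<Longrightarrow>
    sqn lborel u \<le> ennreal B \<Longrightarrow> gagliardo \<alpha> u \<le> ennreal K \<Longrightarrow> 0 \<le> K \<Longrightarrow>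
    powr_integral lborel p u \<le> ennreal (1 * K + D)" by blast
  have "\<forall>U::'a \<Rightarrow> complex \<times> complex. bounded_by \<alpha> B U \<longrightarrow> powr_integral lborel p U \<le> ennreal (1 * B + D)"
    using D(2) B by (simp add: bounded_by_def)
  then show ?thesis using D(1) B by (intro exI[of _ "1 * B + D"]) auto
qed

text \<open>Small mass is in particular small on every unit ball, so the sequence vanishes.\<close>

lemma small_mass_powr:
  fixes Z :: "nat \<Rightarrow> 'a \<Rightarrow> complex \<times> complex"
  assumes p: "2 < p" "p < 2 + 4 * \<alpha> / real DIM('a)" and B: "0 \<le> B" and Z: "\<And>n. bounded_by \<alpha> B (Z n)"
    and lim: "(\<lambda>n. sqn lborel (Z n)) \<longlonglongrightarrow> 0"
  shows "(\<lambda>n. \<integral>\<^sup>+x. ennreal (norm (Z n x) powr p) \<partial>lborel) \<longlonglongrightarrow> 0"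
proof (rule ennreal_tendsto_0I)
  fix e :: real assume e: "0 < e"
  obtain \<delta> where \<delta>: "0 < \<delta>" "\<And>u::'a \<Rightarrow> complex \<times> complex. u \<in> borel_measurable borel \<Longrightarrow>
    sqn lborel u \<le> ennreal B \<Longrightarrow> gagliardo \<alpha> u \<le> ennreal B \<Longrightarrow>
    (\<And>x. ball_mass u x 1 \<le> ennreal \<delta>) \<Longrightarrow>
    powr_integral lborel p u \<le> ennreal e"
    using vanishing[OF \<alpha> p e B, where 'v="complex \<times> complex"] by meson
  have "\<forall>\<^sub>F n in sequentially. sqn lborel (Z n) \<le> ennreal \<delta>" by (rule ennreal_tendsto_0D[OF lim \<delta>(1)])
  then show "\<forall>\<^sub>F n in sequentially. powr_integral lborel p (Z n) \<le> ennreal e"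
  proof (rule eventually_mono)
    fix n assume s: "sqn lborel (Z n) \<le> ennreal \<delta>"
    show "powr_integral lborel p (Z n) \<le> ennreal e"
      by (rule \<delta>(2)) (use Z[of n] order_trans[OF ball_mass_le s] in \<open>auto simp: bounded_by_def\<close>)
  qed
qed

lemma potential_continuous:
  fixes U Z :: "nat \<Rightarrow> 'a \<Rightarrow> complex \<times> complex"
  assumes B: "0 \<le> B" and U: "\<And>n. bounded_by \<alpha> B (U n)" and Z: "\<And>n. bounded_by \<alpha> B (Z n)"
    and UZ: "\<And>n. admissible \<alpha> (\<lambda>x. U n x + Z n x)"
    and lim: "(\<lambda>n. sqn lborel (Z n)) \<longlonglongrightarrow> 0"
  shows "(\<lambda>n. potential (\<lambda>x. U n x + Z n x) - potential (U n)) \<longlonglongrightarrow> 0"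
proof -
  have m: "U n \<in> borel_measurable lborel" "Z n \<in> borel_measurable lborel" for n using U Z by (simp_all add: bounded_by_def)
  have one: "(\<lambda>n. (LINT x|lborel. J (U n x + Z n x)) - (LINT x|lborel. J (U n x))) \<longlonglongrightarrow> 0"
    if J: "homogeneous p J" and p: "2 < p" "p < 2 + 4 * \<alpha> / real DIM('a)" for J p
  proof -
    obtain G where G: "\<And>U::'a \<Rightarrow> complex \<times> complex. bounded_by \<alpha> B U \<Longrightarrow> powr_integral lborel p U \<le> ennreal G"
      using powr_integral_bounded[OF p B] by blast
    show ?thesis
    proof (rule homogeneous_integral_continuous[where p=p and G=G])
      show "powr_integral lborel p (Z n) < \<infinity>" for n
        using le_less_trans[OF G[OF Z]] by simp
    qed (use m J p G U small_mass_powr[OF p B Z lim] in auto)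
  qed
  have "(\<lambda>n. ((LINT x|lborel. term1 (U n x + Z n x)) - (LINT x|lborel. term1 (U n x)))
     + ((LINT x|lborel. term2 (U n x + Z n x)) - (LINT x|lborel. term2 (U n x)))
     + ((LINT x|lborel. term3 (U n x + Z n x)) - (LINT x|lborel. term3 (U n x)))) \<longlonglongrightarrow> 0 + 0 + 0"
    by (intro tendsto_add one[OF terms_homogeneous(1) exponents(1,2)] one[OF terms_homogeneous(2) exponents(3,4)] one[OF terms_homogeneous(3) exponents(5,6)])
  then show ?thesis
    unfolding potential_sum[OF UZ] potential_sum[OF bounded_by_admissible[OF U]] by (simp add: algebra_simps)
qed

lemma potential_splitting:
  fixes U :: "nat \<Rightarrow> 'a \<Rightarrow> complex \<times> complex"
  assumes B: "0 \<le> B" and U: "\<And>n. bounded_by \<alpha> B (U n)" and W: "W \<in> borel_measurable borel"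
    and conv: "AE x in lborel. (\<lambda>n. U n x) \<longlonglongrightarrow> W x"
  shows "(\<lambda>n. potential (U n) - potential (\<lambda>x. U n x - W x) - potential W) \<longlonglongrightarrow> 0"
proof -
  have m: "U n \<in> borel_measurable lborel" "W \<in> borel_measurable lborel" for n using U W by (simp_all add: bounded_by_def)
  have WB: "bounded_by \<alpha> B W" by (rule splitting(1)[where U=U, OF U W conv])
  have one: "(\<lambda>n. (LINT x|lborel. J (U n x)) - (LINT x|lborel. J (U n x - W x)) - (LINT x|lborel. J (W x))) \<longlonglongrightarrow> 0"
    if J: "homogeneous p J" and p: "2 < p" "p < 2 + 4 * \<alpha> / real DIM('a)" for J p
  proof -
    obtain G where G: "\<And>U::'a \<Rightarrow> complex \<times> complex. bounded_by \<alpha> B U \<Longrightarrow> powr_integral lborel p U \<le> ennreal G"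
      using powr_integral_bounded[OF p B] by blast
    show ?thesis
      by (rule brezis_lieb_integral[where f=U, OF m J _ conv G[OF U]]) (use p in simp)
  qed
  have V: "admissible \<alpha> (\<lambda>x. U n x - W x)" for n by (rule bounded_by_admissible[OF bounded_by_diff[OF U WB B]])
  have "(\<lambda>n. ((LINT x|lborel. term1 (U n x)) - (LINT x|lborel. term1 (U n x - W x)) - (LINT x|lborel. term1 (W x)))
     + ((LINT x|lborel. term2 (U n x)) - (LINT x|lborel. term2 (U n x - W x)) - (LINT x|lborel. term2 (W x)))
     + ((LINT x|lborel. term3 (U n x)) - (LINT x|lborel. term3 (U n x - W x)) - (LINT x|lborel. term3 (W x)))) \<longlonglongrightarrow> 0 + 0 + 0"
    by (intro tendsto_add one[OF terms_homogeneous(1) exponents(1,2)] one[OF terms_homogeneous(2) exponents(3,4)] one[OF terms_homogeneous(3) exponents(5,6)])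
  then show ?thesis
    unfolding potential_sum[OF V] potential_sum[OF bounded_by_admissible[OF U]] potential_sum[OF bounded_by_admissible[OF WB]]
    by (simp add: algebra_simps)
qed

lemma potential_vanishing:
  assumes B: "0 \<le> B" and e: "0 < e"
  shows "\<exists>\<delta>>0. \<forall>U::'a \<Rightarrow> complex \<times> complex. bounded_by \<alpha> B U \<longrightarrow>
    (\<forall>x. ball_mass U x 1 \<le> ennreal \<delta>) \<longrightarrow> potential U \<le> e"
proof -
  have one: "\<exists>\<delta>>0. \<forall>U::'a \<Rightarrow> complex \<times> complex. bounded_by \<alpha> B U \<longrightarrow>
    (\<forall>x. ball_mass U x 1 \<le> ennreal \<delta>) \<longrightarrow> (LINT x|lborel. J (U x)) \<le> e / 3"
    if J: "homogeneous p J" and p: "2 < p" "p < 2 + 4 * \<alpha> / real DIM('a)" for J p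
  proof -
    obtain K where K: "0 \<le> K" "\<And>z. \<bar>J z\<bar> \<le> K * norm z powr p" using homogeneous_bound[OF J] by blast
    define c where "c = e / 3 / (K + 1)"
    have c: "0 < c" "K * c \<le> e / 3" using K e by (auto simp: c_def field_simps)
    obtain \<delta> where \<delta>: "0 < \<delta>" "\<And>u::'a \<Rightarrow> complex \<times> complex. u \<in> borel_measurable borel \<Longrightarrow>
      sqn lborel u \<le> ennreal B \<Longrightarrow> gagliardo \<alpha> u \<le> ennreal B \<Longrightarrow>
      (\<And>x. ball_mass u x 1 \<le> ennreal \<delta>) \<Longrightarrow>
      powr_integral lborel p u \<le> ennreal c"
      using vanishing[OF \<alpha> p c(1) B, where 'v="complex \<times> complex"] by meson
    have "(LINT x|lborel. J (U x)) \<le> e / 3" if U: "bounded_by \<alpha> B U"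
      and s: "\<And>x. ball_mass U x 1 \<le> ennreal \<delta>" for U :: "'a \<Rightarrow> complex \<times> complex"
    proof -
      have m: "U \<in> borel_measurable borel" "sqn lborel U \<le> ennreal B" "gagliardo \<alpha> U \<le> ennreal B" using U by (simp_all add: bounded_by_def)
      have "(LINT x|lborel. J (U x)) \<le> K * c"
        using c by (intro homogeneous_integral_le[OF J K m(1) \<delta>(2)[OF m s]]) auto
      then show ?thesis using c by linarith
    qed
    then show ?thesis using \<delta>(1) by blast
  qed
  obtain d1 where d1: "0 < d1" "\<And>U::'a \<Rightarrow> complex \<times> complex. bounded_by \<alpha> B U \<Longrightarrow>
    (\<And>x. ball_mass U x 1 \<le> ennreal d1) \<Longrightarrow> (LINT x|lborel. term1 (U x)) \<le> e / 3"
    using one[OF terms_homogeneous(1) exponents(1,2)] by blast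
  obtain d2 where d2: "0 < d2" "\<And>U::'a \<Rightarrow> complex \<times> complex. bounded_by \<alpha> B U \<Longrightarrow>
    (\<And>x. ball_mass U x 1 \<le> ennreal d2) \<Longrightarrow> (LINT x|lborel. term2 (U x)) \<le> e / 3"
    using one[OF terms_homogeneous(2) exponents(3,4)] by blast
  obtain d3 where d3: "0 < d3" "\<And>U::'a \<Rightarrow> complex \<times> complex. bounded_by \<alpha> B U \<Longrightarrow>
    (\<And>x. ball_mass U x 1 \<le> ennreal d3) \<Longrightarrow> (LINT x|lborel. term3 (U x)) \<le> e / 3"
    using one[OF terms_homogeneous(3) exponents(5,6)] by blast
  define d where "d = min d1 (min d2 d3)"
  have d: "0 < d" "d \<le> d1" "d \<le> d2" "d \<le> d3" using d1(1) d2(1) d3(1) by (auto simp: d_def)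
  have "potential U \<le> e" if U: "bounded_by \<alpha> B U"
    and s: "\<And>x. ball_mass U x 1 \<le> ennreal d" for U :: "'a \<Rightarrow> complex \<times> complex"
    using d1(2)[OF U order_trans[OF s ennreal_leI[OF d(2)]]] d2(2)[OF U order_trans[OF s ennreal_leI[OF d(3)]]]
      d3(2)[OF U order_trans[OF s ennreal_leI[OF d(4)]]]
    unfolding potential_sum[OF bounded_by_admissible[OF U]] by simp
  then show ?thesis using d(1) by blast
qed

subsection \<open>Superposition lowers the energy\<close>

text \<open>Each term is homogeneous of degree above \<open>1\<close> in the squared moduli, which add up. For strictness, two nonzero
  values either share a nonzero component, and then its own power gains, or have complementary ones, and
  then the coupling term gains.\<close>

lemma terms_oplus:
  fixes U V :: "'a \<Rightarrow> complex \<times> complex"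
  shows "term1 (U x) + term1 (V x) \<le> term1 (oplus U V x)"
    and "term2 (U x) + term2 (V x) \<le> term2 (oplus U V x)"
    and "term3 (U x) + term3 (V x) \<le> term3 (oplus U V x)"
    and "U x \<noteq> 0 \<Longrightarrow> V x \<noteq> 0 \<Longrightarrow> term1 (U x) + term2 (U x) + term3 (U x) + (term1 (V x) + term2 (V x) + term3 (V x))
      < term1 (oplus U V x) + term2 (oplus U V x) + term3 (oplus U V x)"
proof -
  define a where "a = (norm (fst (U x)))\<^sup>2"
  define b where "b = (norm (fst (V x)))\<^sup>2"
  define c where "c = (norm (snd (U x)))\<^sup>2"
  define d where "d = (norm (snd (V x)))\<^sup>2"
  have nn: "0 \<le> a" "0 \<le> b" "0 \<le> c" "0 \<le> d" by (simp_all add: a_def b_def c_def d_def)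
  have pw: "n powr q = (n\<^sup>2) powr (q / 2)" if "0 \<le> n" for n q :: real
  proof -
    have "(n\<^sup>2) powr (q / 2) = (n powr 2) powr (q / 2)" using that by simp
    also have "\<dots> = n powr q" unfolding powr_powr by simp
    finally show ?thesis by simp
  qed
  have ex: "1 < p1 / 2" "1 < p2 / 2" "0 < r1 / 2" "0 < r2 / 2" "1 < r1 / 2 + r2 / 2" using p1 p2 r by auto
  have na: "norm (fst (U x)) powr q = a powr (q / 2)" "norm (fst (V x)) powr q = b powr (q / 2)"
    "norm (snd (U x)) powr q = c powr (q / 2)" "norm (snd (V x)) powr q = d powr (q / 2)" for q
    unfolding a_def b_def c_def d_def by (rule pw, simp)+
  have no: "norm (fst (oplus U V x)) powr q = (a + b) powr (q / 2)" "norm (snd (oplus U V x)) powr q = (c + d) powr (q / 2)" for q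
    unfolding a_def b_def c_def d_def oplus_norms[symmetric] by (rule pw, simp)+
  have t1: "term1 (U x) = \<mu>1 / p1 * a powr (p1 / 2)" "term1 (V x) = \<mu>1 / p1 * b powr (p1 / 2)" "term1 (oplus U V x) = \<mu>1 / p1 * (a + b) powr (p1 / 2)"
    unfolding term1_def na no by simp_all
  have t2: "term2 (U x) = \<mu>2 / p2 * c powr (p2 / 2)" "term2 (V x) = \<mu>2 / p2 * d powr (p2 / 2)" "term2 (oplus U V x) = \<mu>2 / p2 * (c + d) powr (p2 / 2)"
    unfolding term2_def na no by simp_all
  have t3: "term3 (U x) = \<beta> * (a powr (r1 / 2) * c powr (r2 / 2))" "term3 (V x) = \<beta> * (b powr (r1 / 2) * d powr (r2 / 2))"
    "term3 (oplus U V x) = \<beta> * ((a + b) powr (r1 / 2) * (c + d) powr (r2 / 2))"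
    unfolding term3_def F_def na no by (simp_all only: mult.assoc)
  have k: "0 < \<mu>1 / p1" "0 < \<mu>2 / p2" using \<mu> p1 p2 by auto
  show w1: "term1 (U x) + term1 (V x) \<le> term1 (oplus U V x)"
    unfolding t1 distrib_left[symmetric] using k by (intro mult_left_mono powr_superadditive(1) nn ex) auto
  show w2: "term2 (U x) + term2 (V x) \<le> term2 (oplus U V x)"
    unfolding t2 distrib_left[symmetric] using k by (intro mult_left_mono powr_superadditive(1) nn ex) auto
  show w3: "term3 (U x) + term3 (V x) \<le> term3 (oplus U V x)"
    unfolding t3 distrib_left[symmetric] using \<beta> by (intro mult_left_mono powr_product_superadditive(1) nn ex) auto
  show "term1 (U x) + term2 (U x) + term3 (U x) + (term1 (V x) + term2 (V x) + term3 (V x))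
      < term1 (oplus U V x) + term2 (oplus U V x) + term3 (oplus U V x)" if "U x \<noteq> 0" "V x \<noteq> 0"
  proof -
    have "0 < a \<or> 0 < c" "0 < b \<or> 0 < d" using that by (auto simp: a_def b_def c_def d_def prod_eq_iff)
    then consider "0 < a" "0 < b" | "0 < c" "0 < d" | "0 < a" "0 < d" | "0 < b" "0 < c" by blast
    then show ?thesis
    proof cases
      case 1
      then have "term1 (U x) + term1 (V x) < term1 (oplus U V x)"
        unfolding t1 distrib_left[symmetric] using k by (intro mult_strict_left_mono powr_superadditive(2) nn ex) auto
      then show ?thesis using w2 w3 by linarith
    next
      case 2
      then have "term2 (U x) + term2 (V x) < term2 (oplus U V x)"
        unfolding t2 distrib_left[symmetric] using k by (intro mult_strict_left_mono powr_superadditive(2) nn ex) auto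
      then show ?thesis using w1 w3 by linarith
    next
      case 3
      then have "term3 (U x) + term3 (V x) < term3 (oplus U V x)"
        unfolding t3 distrib_left[symmetric] using \<beta> by (intro mult_strict_left_mono powr_product_superadditive(2) nn ex) auto
      then show ?thesis using w1 w2 by linarith
    next
      case 4
      have "b powr (r1 / 2) * d powr (r2 / 2) + a powr (r1 / 2) * c powr (r2 / 2) < (b + a) powr (r1 / 2) * (d + c) powr (r2 / 2)"
        using 4 by (intro powr_product_superadditive(2) nn ex)
      then have "term3 (U x) + term3 (V x) < term3 (oplus U V x)"
        unfolding t3 distrib_left[symmetric] using \<beta> by (intro mult_strict_left_mono) (simp_all add: add.commute)
      then show ?thesis using w1 w2 by linarith
    qed
  qed
qed

lemma energy_oplus:
  fixes U V :: "'a \<Rightarrow> complex \<times> complex"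
  assumes U: "admissible \<alpha> U" and V: "admissible \<alpha> V"
  shows "total_energy (oplus U V) \<le> total_energy U + total_energy V"
    and "\<not> (AE x in lborel. U x = 0 \<or> V x = 0) \<Longrightarrow> total_energy (oplus U V) < total_energy U + total_energy V"
proof -
  note O = oplus_admissible[OF U V]
  let ?P = "\<lambda>W x. term1 (W x) + term2 (W x) + term3 (W x)"
  have i: "integrable lborel (?P W)" if "admissible \<alpha> W" for W :: "'a \<Rightarrow> complex \<times> complex"
    using terms_integrable[OF that] by simp
  define g where "g x = ?P (oplus U V) x - (?P U x + ?P V x)" for x
  have gi: "integrable lborel g" unfolding g_def using i[OF O(1)] i[OF U] i[OF V] by simp
  have g0: "0 \<le> g x" for x
    using terms_oplus(1,2,3)[of U x V] by (simp add: g_def)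
  have eq: "potential (oplus U V) = potential U + potential V + (LINT x|lborel. g x)"
    unfolding potential_def g_def using i[OF O(1)] i[OF U] i[OF V] by simp
  have Ig: "0 \<le> (LINT x|lborel. g x)" by (intro integral_nonneg_AE AE_I2 g0)
  show "total_energy (oplus U V) \<le> total_energy U + total_energy V"
    using O(4) Ig unfolding total_energy_def eq by simp
  assume ov: "\<not> (AE x in lborel. U x = 0 \<or> V x = 0)"
  have "(LINT x|lborel. g x) \<noteq> 0"
  proof
    assume "(LINT x|lborel. g x) = 0"
    then have "AE x in lborel. g x = 0" using integral_nonneg_eq_0_iff_AE[OF gi] g0 by simp
    then have "AE x in lborel. U x = 0 \<or> V x = 0"
    proof eventually_elim
      fix x assume "g x = 0"
      then show "U x = 0 \<or> V x = 0" using terms_oplus(4)[of U x V] by (auto simp: g_def)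
    qed
    with ov show False by blast
  qed
  then show "total_energy (oplus U V) < total_energy U + total_energy V"
    using O(4) Ig unfolding total_energy_def eq by simp
qed

text \<open>Some translate of \<open>V\<close> overlaps \<open>U\<close>: integrated over all translations, the measure of the overlap
  is the product of the measures of the supports.\<close>

lemma overlapping_translate:
  fixes U V :: "'a \<Rightarrow> complex \<times> complex"
  assumes [measurable]: "U \<in> borel_measurable borel" "V \<in> borel_measurable borel"
    and U: "sqn lborel U \<noteq> 0" and V: "sqn lborel V \<noteq> 0"
  shows "\<exists>z. \<not> (AE x in lborel. U x = 0 \<or> V (x + z) = 0)"
proof (rule ccontr)
  assume "\<not> ?thesis"
  then have ae: "AE x in lborel. U x = 0 \<or> V (x + z) = 0" for z by blast
  let ?u = "\<lambda>x. ennreal ((norm (U x))\<^sup>2)" and ?v = "\<lambda>x. ennreal ((norm (V x))\<^sup>2)"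
  have "(\<integral>\<^sup>+x. ?u x * ?v (x + z) \<partial>lborel) = 0" for z
    using ae[of z] by (subst nn_integral_0_iff_AE) (auto elim: eventually_mono)
  then have "0 = (\<integral>\<^sup>+z. \<integral>\<^sup>+x. ?u x * ?v (x + z) \<partial>lborel \<partial>(lborel :: 'a measure))" by simp
  also have "\<dots> = (\<integral>\<^sup>+x. \<integral>\<^sup>+z. ?u x * ?v (x + z) \<partial>lborel \<partial>lborel)"
    by (rule lborel_pair.Fubini') measurable
  also have "\<dots> = (\<integral>\<^sup>+x. ?u x * sqn lborel V \<partial>lborel)"
  proof (rule nn_integral_cong)
    fix x :: 'a
    have "(\<integral>\<^sup>+z. ?u x * ?v (x + z) \<partial>lborel) = ?u x * (\<integral>\<^sup>+z. ?v (x + z) \<partial>lborel)" by (rule nn_integral_cmult) measurable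
    also have "(\<integral>\<^sup>+z. ?v (x + z) \<partial>lborel) = sqn lborel V"
      using nn_integral_lborel_shift[of ?v x] by (simp add: sqn_def add.commute)
    finally show "(\<integral>\<^sup>+z. ?u x * ?v (x + z) \<partial>lborel) = ?u x * sqn lborel V" .
  qed
  also have "\<dots> = sqn lborel U * sqn lborel V" unfolding sqn_def[of lborel U] by (rule nn_integral_multc) measurable
  finally show False using U V by simp
qed

end

section \<open>Dilations and amplitude changes of pairs\<close>

lemma integral_lborel_dilate:
  fixes f :: "'a::euclidean_space \<Rightarrow> real"
  assumes [measurable]: "f \<in> borel_measurable borel" and s: "0 < s"
  shows "(LINT x|lborel. f (s *\<^sub>R x)) = s powr (- real DIM('a)) * (LINT x|lborel. f x)"
proof -
  have "(LINT x|lborel. f x) = integral\<^sup>L (density (distr lborel borel (\<lambda>x. 0 + s *\<^sub>R x)) (\<lambda>_. ennreal (\<bar>s\<bar> ^ DIM('a)))) f"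
    using lborel_affine[of s "0::'a"] s by simp
  also have "\<dots> = (LINT x|distr lborel borel (\<lambda>x. 0 + s *\<^sub>R x). (\<bar>s\<bar> ^ DIM('a)) *\<^sub>R f x)"
    by (rule integral_density) auto
  also have "\<dots> = (LINT x|lborel. (\<bar>s\<bar> ^ DIM('a)) *\<^sub>R f (0 + s *\<^sub>R x))"
    by (rule integral_distr) measurable
  also have "\<dots> = s ^ DIM('a) * (LINT x|lborel. f (s *\<^sub>R x))" using s by simp
  finally show ?thesis using s by (simp add: powr_minus powr_realpow)
qed

text \<open>The exponent makes the dilation preserve the masses.\<close>

definition dilate :: "real \<Rightarrow> ('a::euclidean_space \<Rightarrow> complex \<times> complex) \<Rightarrow> 'a \<Rightarrow> complex \<times> complex" where
  "dilate s U x = (s powr (real DIM('a) / 2)) *\<^sub>R U (s *\<^sub>R x)"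

lemma gagliardo_scaleR:
  fixes U :: "'a::euclidean_space \<Rightarrow> 'v::euclidean_space"
  assumes [measurable]: "U \<in> borel_measurable borel"
  shows "gagliardo \<alpha> (\<lambda>x. c *\<^sub>R U x) = ennreal (c\<^sup>2) * gagliardo \<alpha> U"
proof -
  have "increment (\<lambda>x. c *\<^sub>R U x) = (\<lambda>z. c *\<^sub>R increment U z)" by (auto simp: increment_def fun_eq_iff scaleR_diff_right)
  then show ?thesis unfolding gagliardo_def by (simp add: sqn_scaleR)
qed

lemma dilate_admissible:
  fixes U :: "'a::euclidean_space \<Rightarrow> complex \<times> complex"
  assumes U: "admissible \<alpha> U" and s: "0 < s"
  shows "admissible \<alpha> (dilate s U)" "mass1 (dilate s U) = mass1 U" "mass2 (dilate s U) = mass2 U"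
    "kinetic \<alpha> (dilate s U) = s powr (2 * \<alpha>) * kinetic \<alpha> U"
proof -
  have [measurable]: "U \<in> borel_measurable borel" using U by (simp add: admissible_def)
  define c where "c = s powr (real DIM('a) / 2)"
  have c2: "c\<^sup>2 = s powr real DIM('a)" using s by (simp add: c_def power2_eq_square flip: powr_add)
  have D: "dilate s U = (\<lambda>x. c *\<^sub>R U (s *\<^sub>R x))" by (simp add: dilate_def c_def fun_eq_iff)
  have m: "dilate s U \<in> borel_measurable borel" unfolding D by measurable
  have "sqn lborel (dilate s U) = ennreal (c\<^sup>2) * sqn lborel (\<lambda>x. U (s *\<^sub>R x))" unfolding D by (rule sqn_scaleR) measurable
  also have "\<dots> = sqn lborel U" using sqn_dilate[of U s] s by (simp add: c2 powr_realpow)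
  finally have sq: "sqn lborel (dilate s U) = sqn lborel U" .
  have g: "gagliardo \<alpha> (dilate s U) = ennreal (s powr (2 * \<alpha>)) * gagliardo \<alpha> U"
  proof -
    have "gagliardo \<alpha> (dilate s U) = ennreal (c\<^sup>2) * gagliardo \<alpha> (\<lambda>x. U (s *\<^sub>R x))" unfolding D by (rule gagliardo_scaleR) measurable
    also have "\<dots> = ennreal (c\<^sup>2) * (ennreal (s powr (2 * \<alpha> - real DIM('a))) * gagliardo \<alpha> U)"
      by (subst gagliardo_dilate[OF _ s]) simp_all
    also have "\<dots> = ennreal (c\<^sup>2 * s powr (2 * \<alpha> - real DIM('a))) * gagliardo \<alpha> U" by (simp add: ennreal_mult mult.assoc)
    also have "c\<^sup>2 * s powr (2 * \<alpha> - real DIM('a)) = s powr (2 * \<alpha>)" unfolding c2 by (simp flip: powr_add)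
    finally show ?thesis .
  qed
  show A: "admissible \<alpha> (dilate s U)" using U m sq g by (simp add: admissible_def ennreal_mult_less_top)
  have sc: "s powr real DIM('a) * s powr (- real DIM('a)) = 1" using s by (simp flip: powr_add)
  have "mass1 (dilate s U) = c\<^sup>2 * (LINT x|lborel. (norm (fst (U (s *\<^sub>R x))))\<^sup>2)"
    unfolding mass1_def D by (simp add: power_mult_distrib)
  also have "(LINT x|lborel. (norm (fst (U (s *\<^sub>R x))))\<^sup>2) = s powr (- real DIM('a)) * mass1 U"
    unfolding mass1_def by (rule integral_lborel_dilate[of "\<lambda>x. (norm (fst (U x)))\<^sup>2", OF _ s]) measurable
  finally show "mass1 (dilate s U) = mass1 U" unfolding c2 mult.assoc[symmetric] sc by simp
  have "mass2 (dilate s U) = c\<^sup>2 * (LINT x|lborel. (norm (snd (U (s *\<^sub>R x))))\<^sup>2)"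
    unfolding mass2_def D by (simp add: power_mult_distrib)
  also have "(LINT x|lborel. (norm (snd (U (s *\<^sub>R x))))\<^sup>2) = s powr (- real DIM('a)) * mass2 U"
    unfolding mass2_def by (rule integral_lborel_dilate[of "\<lambda>x. (norm (snd (U x)))\<^sup>2", OF _ s]) measurable
  finally show "mass2 (dilate s U) = mass2 U" unfolding c2 mult.assoc[symmetric] sc by simp
  have "ennreal (kinetic \<alpha> (dilate s U)) = ennreal (s powr (2 * \<alpha>) * kinetic \<alpha> U)"
    using g unfolding admissible_masses(4)[OF A] admissible_masses(4)[OF U] by (simp add: ennreal_mult)
  then show "kinetic \<alpha> (dilate s U) = s powr (2 * \<alpha>) * kinetic \<alpha> U" by (subst (asm) ennreal_inj) auto
qed

definition rescale :: "real \<Rightarrow> real \<Rightarrow> ('a \<Rightarrow> complex \<times> complex) \<Rightarrow> 'a \<Rightarrow> complex \<times> complex" where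
  "rescale a b U x = (a *\<^sub>R fst (U x), b *\<^sub>R snd (U x))"

lemma rescale_norm_le:
  fixes u v :: complex
  assumes "a\<^sup>2 \<le> m" "b\<^sup>2 \<le> m"
  shows "(norm (a *\<^sub>R u, b *\<^sub>R v))\<^sup>2 \<le> m * (norm (u, v))\<^sup>2"
  using mult_right_mono[OF assms(1), of "(norm u)\<^sup>2"] mult_right_mono[OF assms(2), of "(norm v)\<^sup>2"]
  by (simp add: norm_Pair power_mult_distrib distrib_left)

lemma rescale_bounds:
  fixes U :: "'a::euclidean_space \<Rightarrow> complex \<times> complex"
  assumes U: "admissible \<alpha> U" and m: "a\<^sup>2 \<le> m" "b\<^sup>2 \<le> m"
  shows "admissible \<alpha> (rescale a b U)" "mass1 (rescale a b U) = a\<^sup>2 * mass1 U" "mass2 (rescale a b U) = b\<^sup>2 * mass2 U"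
    "kinetic \<alpha> (rescale a b U) \<le> m * kinetic \<alpha> U"
proof -
  have [measurable]: "U \<in> borel_measurable borel" using U by (simp add: admissible_def)
  have m0: "0 \<le> m" using order_trans[OF zero_le_power2 m(1)] .
  have mm: "rescale a b U \<in> borel_measurable borel" unfolding rescale_def by measurable
  have le: "sqn M (\<lambda>x. (a *\<^sub>R fst (f x), b *\<^sub>R snd (f x))) \<le> ennreal m * sqn M f" if [measurable]: "f \<in> borel_measurable M" for f :: "'x \<Rightarrow> complex \<times> complex" and M
  proof -
    have "sqn M (\<lambda>x. (a *\<^sub>R fst (f x), b *\<^sub>R snd (f x))) \<le> (\<integral>\<^sup>+x. ennreal m * ennreal ((norm (f x))\<^sup>2) \<partial>M)"
      unfolding sqn_def
    proof (intro nn_integral_mono)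
      fix x
      show "ennreal ((norm (a *\<^sub>R fst (f x), b *\<^sub>R snd (f x)))\<^sup>2) \<le> ennreal m * ennreal ((norm (f x))\<^sup>2)"
        using rescale_norm_le[OF m, of "fst (f x)" "snd (f x)"] m0 by (simp add: ennreal_leI flip: ennreal_mult)
    qed
    also have "\<dots> = ennreal m * sqn M f" unfolding sqn_def by (rule nn_integral_cmult) measurable
    finally show ?thesis .
  qed
  have s: "sqn lborel (rescale a b U) \<le> ennreal m * sqn lborel U"
    unfolding rescale_def by (rule le) simp
  have "increment (rescale a b U) = (\<lambda>z. (a *\<^sub>R fst (increment U z), b *\<^sub>R snd (increment U z)))"
    by (auto simp: increment_def rescale_def fun_eq_iff scaleR_diff_right)
  then have g: "gagliardo \<alpha> (rescale a b U) \<le> ennreal m * gagliardo \<alpha> U"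
    unfolding gagliardo_def by (simp only:) (rule le, measurable)
  show A: "admissible \<alpha> (rescale a b U)"
    unfolding admissible_def using U mm le_less_trans[OF s] le_less_trans[OF g]
    by (simp add: admissible_def ennreal_mult_less_top)
  show "mass1 (rescale a b U) = a\<^sup>2 * mass1 U" "mass2 (rescale a b U) = b\<^sup>2 * mass2 U"
    unfolding mass1_def mass2_def rescale_def by (simp_all add: power_mult_distrib)
  have "ennreal (kinetic \<alpha> (rescale a b U)) \<le> ennreal (m * kinetic \<alpha> U)"
    using g m0 unfolding admissible_masses(4)[OF A] admissible_masses(4)[OF U] by (simp add: ennreal_mult)
  then show "kinetic \<alpha> (rescale a b U) \<le> m * kinetic \<alpha> U" using m0 by (subst (asm) ennreal_le_iff) auto
qed

section \<open>Compactness of minimizing sequences\<close>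

context nls_energy begin

text \<open>Spreading a function out lowers its kinetic energy faster than its potential energy, because
  the exponents are mass-subcritical.\<close>

lemma negative_energy:
  assumes U: "admissible \<alpha> (U :: 'a \<Rightarrow> complex \<times> complex)" and pos: "0 < mass1 U + mass2 U"
  shows "\<exists>\<phi>. admissible \<alpha> (\<phi> :: 'a \<Rightarrow> complex \<times> complex) \<and> mass1 \<phi> = mass1 U \<and> mass2 \<phi> = mass2 U \<and> total_energy \<phi> < 0"
proof -
  have um[measurable]: "U \<in> borel_measurable borel" using U by (simp add: admissible_def)
  let ?N = "real DIM('a)"
  have key: "\<exists>s>0. total_energy (dilate s U) < 0"
    if J: "homogeneous p J" and p: "2 < p" "p < 2 + 4 * \<alpha> / ?N" and T: "0 < (LINT x|lborel. J (U x))"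
      and le: "\<And>W::'a \<Rightarrow> complex \<times> complex. admissible \<alpha> W \<Longrightarrow> (LINT x|lborel. J (W x)) \<le> potential W" for J p
  proof -
    define T where "T = (LINT x|lborel. J (U x))"
    define k where "k = kinetic \<alpha> U"
    have k: "0 \<le> k" by (simp add: k_def)
    define q where "q = ?N * p / 2 - ?N"
    define g where "g = 2 * \<alpha> - q"
    have g: "0 < g" using p by (simp add: g_def q_def field_simps)
    \<comment> \<open>The kinetic energy scales like \<open>s\<^sup>2\<^sup>\<alpha>\<close>, the term \<open>T\<close> like \<open>s\<^sup>q\<close> with \<open>q < 2 \<alpha>\<close>; at this \<open>s\<close> the kinetic energy is at most \<open>s\<^sup>q T\<close>.\<close>
    define s where "s = (T / (k + 1)) powr (1 / g)"
    have s: "0 < s" using T k by (simp add: s_def T_def)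
    have sg: "s powr g = T / (k + 1)" using T k g by (simp add: s_def powr_powr T_def)
    note [measurable] = homogeneous_measurable[OF J]
    have "(LINT x|lborel. J (dilate s U x)) = (LINT x|lborel. s powr (?N * p / 2) * J (U (s *\<^sub>R x)))"
    proof (intro Bochner_Integration.integral_cong refl)
      fix x :: 'a
      have "J (dilate s U x) = (s powr (?N / 2)) powr p * J (U (s *\<^sub>R x))"
      proof -
        have h: "J (t *\<^sub>R z) = t powr p * J z" if "0 \<le> t" for t z using J that unfolding homogeneous_def by blast
        show ?thesis unfolding dilate_def by (rule h) simp
      qed
      then show "J (dilate s U x) = s powr (?N * p / 2) * J (U (s *\<^sub>R x))" by (simp add: powr_powr)
    qed
    also have "\<dots> = s powr (?N * p / 2) * (s powr (- ?N) * T)"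
      using integral_lborel_dilate[of "\<lambda>x. J (U x)" s] s by (simp add: T_def)
    also have "\<dots> = s powr q * T"
    proof -
      have "s powr (?N * p / 2) * s powr (- ?N) = s powr q" unfolding powr_add[symmetric] q_def by simp
      then show ?thesis by (simp only: mult.assoc[symmetric])
    qed
    finally have P: "s powr q * T \<le> potential (dilate s U)" using le[OF dilate_admissible(1)[OF U s]] by simp
    have "s powr (2 * \<alpha>) = s powr q * s powr g" by (simp add: g_def flip: powr_add)
    then have "total_energy (dilate s U) \<le> s powr q * (1/2 * (k * (T / (k + 1))) - T)"
      using P unfolding total_energy_def dilate_admissible(4)[OF U s] sg k_def[symmetric] by (simp add: algebra_simps)
    also have "\<dots> < 0"
    proof -
      have "0 < T" using T by (simp add: T_def)
      moreover have "k * (T / (k + 1)) \<le> T" using \<open>0 < T\<close> k by (simp add: field_simps)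
      moreover have "1/2 * x < y" if "0 < y" "x \<le> y" for x y :: real using that by simp
      ultimately have "1/2 * (k * (T / (k + 1))) < T" by blast
      then show ?thesis using s by (simp add: mult_less_0_iff)
    qed
    finally show ?thesis using s by blast
  qed
  have le: "(LINT x|lborel. term1 (W x)) \<le> potential W" "(LINT x|lborel. term2 (W x)) \<le> potential W" if "admissible \<alpha> W" for W :: "'a \<Rightarrow> complex \<times> complex"
  proof -
    have "0 \<le> (LINT x|lborel. term1 (W x))" "0 \<le> (LINT x|lborel. term2 (W x))" "0 \<le> (LINT x|lborel. term3 (W x))"
      by (intro integral_nonneg_AE AE_I2 terms_nonneg)+
    then show "(LINT x|lborel. term1 (W x)) \<le> potential W" "(LINT x|lborel. term2 (W x)) \<le> potential W"
      unfolding potential_sum[OF that] by auto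
  qed
  have ne: "\<exists>s>0. total_energy (dilate s U) < 0"
  proof (cases "0 < (LINT x|lborel. term1 (U x))")
    case True
    then show ?thesis by (rule key[OF terms_homogeneous(1) exponents(1,2) _ le(1)])
  next
    case F1: False
    show ?thesis
    proof (cases "0 < (LINT x|lborel. term2 (U x))")
      case True
      then show ?thesis by (rule key[OF terms_homogeneous(2) exponents(3,4) _ le(2)])
    next
      case F2: False
      have "(LINT x|lborel. term1 (U x)) = 0" "(LINT x|lborel. term2 (U x)) = 0"
      proof -
        have "0 \<le> (LINT x|lborel. term1 (U x))" "0 \<le> (LINT x|lborel. term2 (U x))"
          by (intro integral_nonneg_AE AE_I2 terms_nonneg)+
        then show "(LINT x|lborel. term1 (U x)) = 0" "(LINT x|lborel. term2 (U x)) = 0" using F1 F2 by linarith+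
      qed
      then have "AE x in lborel. term1 (U x) = 0" "AE x in lborel. term2 (U x) = 0"
        using integral_nonneg_eq_0_iff_AE[OF terms_integrable(1)[OF U]] integral_nonneg_eq_0_iff_AE[OF terms_integrable(2)[OF U]] terms_nonneg by auto
      then have "AE x in lborel. U x = 0"
      proof eventually_elim
        fix x assume "term1 (U x) = 0" "term2 (U x) = 0"
        then show "U x = 0" using \<mu> p1 p2 by (auto simp: term1_def term2_def prod_eq_iff)
      qed
      then have "sqn lborel U = 0" by (subst sqn_eq_0_iff) simp_all
      then show ?thesis using pos admissible_masses(3)[OF U] by (simp del: ennreal_plus)
    qed
  qed
  then obtain s where s: "0 < s" "total_energy (dilate s U) < 0" by blast
  then show ?thesis using dilate_admissible(1-3)[OF U s(1)] by blast
qed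

text \<open>Multiplying the components of \<open>w n\<close> by factors tending to \<open>1\<close> restores the masses exactly and raises the energy by at
  most a null sequence.\<close>

lemma asymptotic_lower_bound:
  fixes w :: "nat \<Rightarrow> 'a \<Rightarrow> complex \<times> complex"
  assumes \<tau>: "0 < \<tau>1" "0 < \<tau>2"
    and lb: "\<And>U::'a \<Rightarrow> complex \<times> complex. admissible \<alpha> U \<Longrightarrow> mass1 U = \<tau>1 \<Longrightarrow> mass2 U = \<tau>2 \<Longrightarrow> E \<le> total_energy U"
    and B: "0 \<le> B" "\<And>n. bounded_by \<alpha> B (w n)"
    and lim: "(\<lambda>n. mass1 (w n)) \<longlonglongrightarrow> \<tau>1" "(\<lambda>n. mass2 (w n)) \<longlonglongrightarrow> \<tau>2"
    and X: "\<And>n. total_energy (w n) \<le> X n" "X \<longlonglongrightarrow> L"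
  shows "E \<le> L"
proof -
  define a where "a n = sqrt (\<tau>1 / mass1 (w n))" for n
  define b where "b n = sqrt (\<tau>2 / mass2 (w n))" for n
  have wa: "admissible \<alpha> (w n)" for n by (rule bounded_by_admissible[OF B(2)])
  have q: "(\<lambda>n. \<tau>1 / mass1 (w n)) \<longlonglongrightarrow> \<tau>1 / \<tau>1" "(\<lambda>n. \<tau>2 / mass2 (w n)) \<longlonglongrightarrow> \<tau>2 / \<tau>2"
    by (rule tendsto_divide[OF tendsto_const lim(1)], use \<tau> in simp, rule tendsto_divide[OF tendsto_const lim(2)], use \<tau> in simp)
  have "(\<lambda>n. sqrt (\<tau>1 / mass1 (w n))) \<longlonglongrightarrow> sqrt (\<tau>1 / \<tau>1)" "(\<lambda>n. sqrt (\<tau>2 / mass2 (w n))) \<longlonglongrightarrow> sqrt (\<tau>2 / \<tau>2)"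
    by (rule tendsto_real_sqrt[OF q(1)], rule tendsto_real_sqrt[OF q(2)])
  then have a1: "a \<longlonglongrightarrow> 1" and b1: "b \<longlonglongrightarrow> 1" using \<tau> by (simp_all add: a_def[abs_def] b_def[abs_def])
  define m where "m n = max ((a n)\<^sup>2) ((b n)\<^sup>2)" for n
  have "(\<lambda>n. max ((a n)\<^sup>2) ((b n)\<^sup>2)) \<longlonglongrightarrow> max (1\<^sup>2) (1\<^sup>2)" by (intro tendsto_max tendsto_power a1 b1)
  then have m1: "m \<longlonglongrightarrow> 1" by (simp add: m_def[abs_def])
  define d where "d n = max ((a n - 1)\<^sup>2) ((b n - 1)\<^sup>2)" for n
  have "(\<lambda>n. max ((a n - 1)\<^sup>2) ((b n - 1)\<^sup>2)) \<longlonglongrightarrow> max ((1 - 1)\<^sup>2) ((1 - 1)\<^sup>2)" by (intro tendsto_max tendsto_power tendsto_diff tendsto_const a1 b1)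
  then have d0: "d \<longlonglongrightarrow> 0" by (simp add: d_def[abs_def])
  have dn: "0 \<le> d n" for n by (simp add: d_def max_def)
  obtain D where D: "0 < D" "\<And>n. \<bar>d n\<bar> \<le> D" using convergent_imp_Bseq[OF convergentI[OF d0]] by (auto simp: Bseq_def)
  define z where "z n = rescale (a n) (b n) (w n)" for n
  define Z where "Z n = rescale (a n - 1) (b n - 1) (w n)" for n
  have zZ: "z n = (\<lambda>x. w n x + Z n x)" for n
    by (auto simp: z_def Z_def rescale_def fun_eq_iff prod_eq_iff algebra_simps)
  note rz = rescale_bounds[OF wa, of "a n" "m n" "b n" n for n]
  have az: "admissible \<alpha> (z n)" for n unfolding z_def by (rule rz) (auto simp: m_def)
  note rZ = rescale_bounds[OF wa, of "a n - 1" "d n" "b n - 1" n for n]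
  have aZ: "admissible \<alpha> (Z n)" for n unfolding Z_def by (rule rZ) (auto simp: d_def)
  have massZ: "mass1 (Z n) + mass2 (Z n) \<le> d n * B" for n
  proof -
    have "mass1 (Z n) \<le> d n * mass1 (w n)" "mass2 (Z n) \<le> d n * mass2 (w n)"
      unfolding Z_def using rZ(2,3)[of n] by (auto simp: d_def intro: mult_right_mono)
    then have "mass1 (Z n) + mass2 (Z n) \<le> d n * (mass1 (w n) + mass2 (w n))" by (simp add: distrib_left)
    also have "\<dots> \<le> d n * B" by (intro mult_left_mono bounded_by_le(1)[OF B(2) B(1)] dn)
    finally show ?thesis .
  qed
  have kinZ: "kinetic \<alpha> (Z n) \<le> d n * B" for n
  proof -
    have "kinetic \<alpha> (Z n) \<le> d n * kinetic \<alpha> (w n)" unfolding Z_def by (rule rZ(4)) (auto simp: d_def)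
    also have "\<dots> \<le> d n * B" by (intro mult_left_mono bounded_by_le(2)[OF B(2) B(1)] dn)
    finally show ?thesis .
  qed
  define B' where "B' = (D + 1) * B"
  have B': "0 \<le> B'" "B \<le> B'" "d n * B \<le> B'" for n
  proof -
    have "d n \<le> D + 1" using D(2)[of n] by linarith
    then show "d n * B \<le> B'" unfolding B'_def using B(1) by (rule mult_right_mono)
    show "0 \<le> B'" "B \<le> B'" using B(1) D(1) mult_right_mono[of 1 "D + 1" B] by (simp_all add: B'_def)
  qed
  have "(\<lambda>n. potential (\<lambda>x. w n x + Z n x) - potential (w n)) \<longlonglongrightarrow> 0"
  proof (rule potential_continuous[OF B'(1)])
    show "bounded_by \<alpha> B' (w n)" for n by (rule bounded_by_mono[OF B(2) B'(2)])
    show "bounded_by \<alpha> B' (Z n)" for n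
      by (rule admissible_bounded_by[OF aZ order_trans[OF massZ B'(3)] order_trans[OF kinZ B'(3)]])
    show "admissible \<alpha> (\<lambda>x. w n x + Z n x)" for n using az[of n] by (simp only: zZ)
    have "(\<lambda>n. d n * B) \<longlonglongrightarrow> 0 * B" by (intro tendsto_mult d0 tendsto_const)
    then have "(\<lambda>n. ennreal (d n * B)) \<longlonglongrightarrow> ennreal (0 * B)" by (rule tendsto_ennrealI)
    then have "(\<lambda>n. ennreal (d n * B)) \<longlonglongrightarrow> 0" by simp
    then show "(\<lambda>n. sqn lborel (Z n)) \<longlonglongrightarrow> 0"
      by (rule ennreal_squeeze_0) (intro always_eventually allI, simp add: admissible_masses(3)[OF aZ] ennreal_leI massZ del: ennreal_plus)
  qed
  then have Pz: "(\<lambda>n. potential (z n) - potential (w n)) \<longlonglongrightarrow> 0" by (simp only: zZ)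
  have mk: "(\<lambda>n. 1/2 * ((m n - 1) * kinetic \<alpha> (w n))) \<longlonglongrightarrow> 0"
  proof (rule Lim_null_comparison)
    have "(\<lambda>n. \<bar>m n - 1\<bar> * B) \<longlonglongrightarrow> \<bar>1 - 1\<bar> * B" by (intro tendsto_intros m1)
    then show "(\<lambda>n. \<bar>m n - 1\<bar> * B) \<longlonglongrightarrow> 0" by simp
    have "norm (1/2 * ((m n - 1) * kinetic \<alpha> (w n))) \<le> \<bar>m n - 1\<bar> * B" for n
    proof -
      have "\<bar>m n - 1\<bar> * kinetic \<alpha> (w n) \<le> \<bar>m n - 1\<bar> * B" by (intro mult_left_mono bounded_by_le(2)[OF B(2) B(1)]) simp
      moreover have "0 \<le> \<bar>m n - 1\<bar> * kinetic \<alpha> (w n)" by (intro mult_nonneg_nonneg) simp_all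
      moreover have "norm (1/2 * ((m n - 1) * kinetic \<alpha> (w n))) = 1/2 * (\<bar>m n - 1\<bar> * kinetic \<alpha> (w n))"
        by (simp add: abs_mult)
      ultimately show ?thesis by linarith
    qed
    then show "\<forall>\<^sub>F n in sequentially. norm (1/2 * ((m n - 1) * kinetic \<alpha> (w n))) \<le> \<bar>m n - 1\<bar> * B" by simp
  qed
  have "\<forall>\<^sub>F n in sequentially. 0 < mass1 (w n)" "\<forall>\<^sub>F n in sequentially. 0 < mass2 (w n)"
    using lim \<tau> by (auto intro: order_tendstoD)
  then have ev: "\<forall>\<^sub>F n in sequentially. E \<le> X n + 1/2 * ((m n - 1) * kinetic \<alpha> (w n)) - (potential (z n) - potential (w n))"
  proof eventually_elim
    fix n assume p: "0 < mass1 (w n)" "0 < mass2 (w n)"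
    have "mass1 (z n) = \<tau>1" "mass2 (z n) = \<tau>2"
      unfolding z_def using rz(2,3)[of n] p \<tau> by (simp_all add: m_def) (simp_all add: a_def b_def)
    then have "E \<le> total_energy (z n)" by (intro lb az)
    moreover have "kinetic \<alpha> (z n) \<le> m n * kinetic \<alpha> (w n)" unfolding z_def by (rule rz(4)) (auto simp: m_def)
    ultimately show "E \<le> X n + 1/2 * ((m n - 1) * kinetic \<alpha> (w n)) - (potential (z n) - potential (w n))"
      using X(1)[of n] unfolding total_energy_def by (simp add: algebra_simps)
  qed
  have "(\<lambda>n. X n + 1/2 * ((m n - 1) * kinetic \<alpha> (w n)) - (potential (z n) - potential (w n))) \<longlonglongrightarrow> L + 0 - 0"
    by (intro tendsto_add tendsto_diff X mk Pz)
  from tendsto_lowerbound[OF this ev] show "E \<le> L" by simp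
qed

text \<open>If the potential energy stays away from \<open>0\<close>, the vanishing lemma finds unit balls carrying a fixed amount of
  mass. Translating them to the origin, the local limit keeps this mass and splits off by the Brezis--Lieb
  lemma.\<close>

lemma extraction:
  fixes U :: "nat \<Rightarrow> 'a \<Rightarrow> complex \<times> complex"
  assumes B: "0 \<le> B" and U: "\<And>n. bounded_by \<alpha> B (U n)" and P: "\<not> (\<lambda>n. potential (U n)) \<longlonglongrightarrow> 0"
  shows "\<exists>(r::nat\<Rightarrow>nat) y W. strict_mono r \<and> bounded_by \<alpha> B W \<and> sqn lborel W \<noteq> 0 \<and>
    (\<forall>n. bounded_by \<alpha> (4 * B) (\<lambda>x. U (r n) (x + y n) - W x)) \<and>
    (\<lambda>n. mass1 (U (r n)) - mass1 (\<lambda>x. U (r n) (x + y n) - W x)) \<longlonglongrightarrow> mass1 W \<and>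
    (\<lambda>n. mass2 (U (r n)) - mass2 (\<lambda>x. U (r n) (x + y n) - W x)) \<longlonglongrightarrow> mass2 W \<and>
    (\<lambda>n. total_energy (U (r n)) - total_energy (\<lambda>x. U (r n) (x + y n) - W x)) \<longlonglongrightarrow> total_energy W"
proof -
  obtain e where e: "0 < e" "\<And>N. \<exists>n\<ge>N. e \<le> potential (U n)"
    using P potential_nonneg unfolding LIMSEQ_iff by (auto simp: not_less)
  define S where "S = {n. e \<le> potential (U n)}"
  have S: "infinite S" unfolding infinite_nat_iff_unbounded_le S_def using e(2) by auto
  define r0 where "r0 = enumerate S"
  have r0: "strict_mono r0" "e \<le> potential (U (r0 n))" for n
    using strict_mono_enumerate[OF S] enumerate_in_set[OF S, of n] by (auto simp: r0_def S_def)
  obtain \<delta> where \<delta>: "0 < \<delta>" "\<And>U::'a \<Rightarrow> complex \<times> complex. bounded_by \<alpha> B U \<Longrightarrow>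
    (\<And>x. ball_mass U x 1 \<le> ennreal \<delta>) \<Longrightarrow> potential U \<le> e / 2"
    using potential_vanishing[OF B, of "e / 2"] e(1) by auto
  have "\<exists>x. \<not> ball_mass (U (r0 n)) x 1 \<le> ennreal \<delta>" for n
  proof (rule ccontr)
    assume "\<not> ?thesis"
    then have "potential (U (r0 n)) \<le> e / 2" by (intro \<delta>(2) U) blast
    then show False using r0(2)[of n] e(1) by simp
  qed
  then obtain y0 where y0: "\<And>n. \<not> ball_mass (U (r0 n)) (y0 n) 1 \<le> ennreal \<delta>"
    by metis
  define T where "T n x = U (r0 n) (x + y0 n)" for n x
  have TB: "bounded_by \<alpha> B (T n)" for n unfolding T_def by (rule bounded_by_shift[OF U])
  have Tm[measurable]: "T n \<in> borel_measurable borel" for n using TB by (simp add: bounded_by_def)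
  have Um[measurable]: "U n \<in> borel_measurable borel" for n using U by (simp add: bounded_by_def)
  have cb[measurable]: "cball (z::'a) s \<in> sets borel" for z s by simp
  have Tball: "\<not> ball_mass (T n) 0 1 \<le> ennreal \<delta>" for n
  proof -
    have "ball_mass (T n) 0 1 =
      (\<integral>\<^sup>+x. indicator (cball (y0 n) 1) (x + y0 n) * ennreal ((norm (U (r0 n) (x + y0 n)))\<^sup>2) \<partial>lborel)"
      by (intro nn_integral_cong) (simp add: T_def indicator_def dist_norm)
    also have "\<dots> = ball_mass (U (r0 n)) (y0 n) 1"
      by (rule nn_integral_lborel_shift[of "\<lambda>y. indicator (cball (y0 n) 1) y * ennreal ((norm (U (r0 n) y))\<^sup>2)"]) measurable
    finally show ?thesis using y0[of n] by simp
  qed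
  have TB': "sqn lborel (T n) \<le> ennreal B" "gagliardo \<alpha> (T n) \<le> ennreal B" for n using TB by (simp_all add: bounded_by_def)
  obtain r1 :: "nat \<Rightarrow> nat" and W where r1: "strict_mono r1" and W: "W \<in> borel_measurable borel"
    and conv: "AE x in lborel. (\<lambda>n. T (r1 n) x) \<longlonglongrightarrow> W x"
    and loc: "(\<lambda>n. \<integral>\<^sup>+x. indicator (cball 0 1) x * ennreal ((norm (T (r1 n) x - W x))\<^sup>2) \<partial>lborel) \<longlonglongrightarrow> 0"
    by (rule local_compactness[OF \<alpha>, where u=T and B=B, OF Tm B TB'])
  note [measurable] = W
  have TB1: "bounded_by \<alpha> B (T (r1 n))" for n by (rule TB)
  note sp = splitting[where U="\<lambda>n. T (r1 n)", OF TB1 W conv]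
  have W0: "sqn lborel W \<noteq> 0"
  proof
    assume "sqn lborel W = 0"
    then have W0: "AE x in lborel. W x = 0" by (subst (asm) sqn_eq_0_iff) simp_all
    have "\<forall>\<^sub>F n in sequentially. (\<integral>\<^sup>+x. indicator (cball 0 1) x * ennreal ((norm (T (r1 n) x - W x))\<^sup>2) \<partial>lborel) \<le> ennreal \<delta>"
      by (rule ennreal_tendsto_0D[OF loc \<delta>(1)])
    then obtain n where "(\<integral>\<^sup>+x. indicator (cball 0 1) x * ennreal ((norm (T (r1 n) x - W x))\<^sup>2) \<partial>lborel) \<le> ennreal \<delta>"
      by (auto simp: eventually_sequentially)
    moreover have "(\<integral>\<^sup>+x. indicator (cball 0 1) x * ennreal ((norm (T (r1 n) x - W x))\<^sup>2) \<partial>lborel) = ball_mass (T (r1 n)) 0 1"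
      using W0 by (intro nn_integral_cong_AE) (auto elim!: eventually_mono)
    ultimately show False using Tball[of "r1 n"] by simp
  qed
  define V where "V n x = T (r1 n) x - W x" for n x
  have VB: "bounded_by \<alpha> (4 * B) (V n)" for n unfolding V_def by (rule bounded_by_diff[OF TB1 sp(1) B])
  have Ua: "admissible \<alpha> (U n)" for n by (rule bounded_by_admissible[OF U])
  have mT: "mass1 (T n) = mass1 (U (r0 n))" "mass2 (T n) = mass2 (U (r0 n))" "total_energy (T n) = total_energy (U (r0 n))" for n
    using admissible_shift(2,3)[OF Ua, of "r0 n" "y0 n"] total_energy_shift[OF Ua, of "r0 n" "y0 n"] by (simp_all add: T_def[abs_def])
  have psp: "(\<lambda>n. potential (T (r1 n)) - potential (V n) - potential W) \<longlonglongrightarrow> 0"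
    unfolding V_def by (rule potential_splitting[where U="\<lambda>n. T (r1 n)", OF B TB1 W conv])
  have "(\<lambda>n. (mass1 (T (r1 n)) - mass1 (V n) - mass1 W) + mass1 W) \<longlonglongrightarrow> 0 + mass1 W"
    "(\<lambda>n. (mass2 (T (r1 n)) - mass2 (V n) - mass2 W) + mass2 W) \<longlonglongrightarrow> 0 + mass2 W"
    "(\<lambda>n. (1/2 * (kinetic \<alpha> (T (r1 n)) - kinetic \<alpha> (V n) - kinetic \<alpha> W) - (potential (T (r1 n)) - potential (V n) - potential W)) + total_energy W) \<longlonglongrightarrow> (1/2 * 0 - 0) + total_energy W"
    using sp(2,3,4) psp unfolding V_def by (intro tendsto_add tendsto_diff tendsto_mult tendsto_const; simp)+
  then have L: "(\<lambda>n. mass1 (T (r1 n)) - mass1 (V n)) \<longlonglongrightarrow> mass1 W" "(\<lambda>n. mass2 (T (r1 n)) - mass2 (V n)) \<longlonglongrightarrow> mass2 W"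
    "(\<lambda>n. total_energy (T (r1 n)) - total_energy (V n)) \<longlonglongrightarrow> total_energy W"
    unfolding total_energy_def by (simp_all add: algebra_simps)
  have Veq: "V n = (\<lambda>x. U (r0 (r1 n)) (x + y0 (r1 n)) - W x)" for n by (simp add: V_def T_def fun_eq_iff)
  show ?thesis
    using strict_mono_o[OF r0(1) r1] sp(1) W0 VB L unfolding mT Veq
    by (intro exI[of _ "r0 \<circ> r1"] exI[of _ "\<lambda>n. y0 (r1 n)"] exI[of _ W]) (simp add: o_def)
qed

text \<open>If the first extracted limit \<open>W\<close> leaves mass behind, then
  either the remainder has asymptotically nonnegative energy and a spread-out bump of the missing mass
  added to \<open>W\<close> beats the infimum, or a second limit \<open>W'\<close> splits off and the superposition of \<open>W\<close>
  with an overlapping translate of \<open>W'\<close> and the remainder does.\<close>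

theorem minimizing_sequences_compact:
  fixes U :: "nat \<Rightarrow> 'a \<Rightarrow> complex \<times> complex"
  assumes \<tau>: "0 < \<tau>1" "0 < \<tau>2"
    and lb: "\<And>U::'a \<Rightarrow> complex \<times> complex. admissible \<alpha> U \<Longrightarrow> mass1 U = \<tau>1 \<Longrightarrow> mass2 U = \<tau>2 \<Longrightarrow> E \<le> total_energy U"
    and U0: "admissible \<alpha> (U0 :: 'a \<Rightarrow> complex \<times> complex)" "mass1 U0 = \<tau>1" "mass2 U0 = \<tau>2"
    and B: "0 \<le> B" "\<And>n. bounded_by \<alpha> B (U n)"
    and lim: "(\<lambda>n. mass1 (U n)) \<longlonglongrightarrow> \<tau>1" "(\<lambda>n. mass2 (U n)) \<longlonglongrightarrow> \<tau>2" "(\<lambda>n. total_energy (U n)) \<longlonglongrightarrow> E"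
  shows "\<exists>(r::nat\<Rightarrow>nat) y W. strict_mono r \<and> admissible \<alpha> W \<and> mass1 W = \<tau>1 \<and> mass2 W = \<tau>2 \<and> total_energy W = E \<and>
    (\<forall>n. admissible \<alpha> (\<lambda>x. U (r n) (x + y n) - W x)) \<and>
    (\<lambda>n. H_sqn \<alpha> (\<lambda>x. U (r n) (x + y n) - W x)) \<longlonglongrightarrow> 0"
proof -
  have E_neg: "E < 0"
  proof -
    have "0 < mass1 U0 + mass2 U0" using U0 \<tau> by simp
    from negative_energy[OF U0(1) this] obtain \<phi> :: "'a \<Rightarrow> complex \<times> complex" where "admissible \<alpha> \<phi>" "mass1 \<phi> = mass1 U0" "mass2 \<phi> = mass2 U0" "total_energy \<phi> < 0"
      by blast
    then show ?thesis using lb[of \<phi>] U0 by simp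
  qed
  have pot_le: "- potential V \<le> total_energy V" for V by (simp add: total_energy_def)
  have P: "\<not> (\<lambda>n. potential (U n)) \<longlonglongrightarrow> 0"
  proof
    assume "(\<lambda>n. potential (U n)) \<longlonglongrightarrow> 0"
    then have "(\<lambda>n. - potential (U n)) \<longlonglongrightarrow> - 0" by (rule tendsto_minus)
    from LIMSEQ_le[OF this lim(3)] pot_le have "- 0 \<le> E" by blast
    with E_neg show False by simp
  qed
  from extraction[where U=U, OF B P] obtain r :: "nat \<Rightarrow> nat" and y W where r: "strict_mono r" and WB: "bounded_by \<alpha> B W" and W0: "sqn lborel W \<noteq> 0"
    and VB0: "\<forall>n. bounded_by \<alpha> (4 * B) (\<lambda>x. U (r n) (x + y n) - W x)"
    and l1: "(\<lambda>n. mass1 (U (r n)) - mass1 (\<lambda>x. U (r n) (x + y n) - W x)) \<longlonglongrightarrow> mass1 W"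
    and l2: "(\<lambda>n. mass2 (U (r n)) - mass2 (\<lambda>x. U (r n) (x + y n) - W x)) \<longlonglongrightarrow> mass2 W"
    and l3: "(\<lambda>n. total_energy (U (r n)) - total_energy (\<lambda>x. U (r n) (x + y n) - W x)) \<longlonglongrightarrow> total_energy W"
    by blast
  define V where "V n = (\<lambda>x. U (r n) (x + y n) - W x)" for n
  have VB: "bounded_by \<alpha> (4 * B) (V n)" for n using VB0 by (simp add: V_def)
  have Va: "admissible \<alpha> (V n)" for n by (rule bounded_by_admissible[OF VB])
  have Wa: "admissible \<alpha> W" by (rule bounded_by_admissible[OF WB])
  define b1 where "b1 = \<tau>1 - mass1 W"
  define b2 where "b2 = \<tau>2 - mass2 W"
  have rest: "(\<lambda>n. g (V n)) \<longlonglongrightarrow> c - d" if "(\<lambda>n. g (U n)) \<longlonglongrightarrow> c" "(\<lambda>n. g (U (r n)) - g (V n)) \<longlonglongrightarrow> d" for g :: "('a \<Rightarrow> complex \<times> complex) \<Rightarrow> real" and c d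
    using tendsto_diff[OF LIMSEQ_subseq_LIMSEQ[OF that(1) r] that(2)] by (simp add: o_def)
  have V1: "(\<lambda>n. mass1 (V n)) \<longlonglongrightarrow> b1" unfolding b1_def by (rule rest[OF lim(1) l1[folded V_def]])
  have V2: "(\<lambda>n. mass2 (V n)) \<longlonglongrightarrow> b2" unfolding b2_def by (rule rest[OF lim(2) l2[folded V_def]])
  have V3: "(\<lambda>n. total_energy (V n)) \<longlonglongrightarrow> E - total_energy W" by (rule rest[OF lim(3) l3[folded V_def]])
  have b: "0 \<le> b1" "0 \<le> b2"
    by (rule LIMSEQ_le_const[OF V1], simp, rule LIMSEQ_le_const[OF V2], simp)
  have b0: "b1 = 0 \<and> b2 = 0"
  proof (rule ccontr)
    assume "\<not> ?thesis"
    then have bpos: "0 < b1 + b2" using b by linarith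
    show False
    proof (cases "(\<lambda>n. potential (V n)) \<longlonglongrightarrow> 0")
      case True
      then have "(\<lambda>n. - potential (V n)) \<longlonglongrightarrow> - 0" by (rule tendsto_minus)
      from LIMSEQ_le[OF this V3] pot_le have EW: "total_energy W \<le> E" by auto
      define m where "m = max (b1 / \<tau>1) (b2 / \<tau>2)"
      \<comment> \<open>\<open>\<phi>0\<close> only supplies an admissible function with the missing masses, one of which may be \<open>0\<close>.\<close>
      define \<phi>0 where "\<phi>0 = rescale (sqrt (b1 / \<tau>1)) (sqrt (b2 / \<tau>2)) U0"
      have s: "(sqrt (b1 / \<tau>1))\<^sup>2 = b1 / \<tau>1" "(sqrt (b2 / \<tau>2))\<^sup>2 = b2 / \<tau>2" using b \<tau> by simp_all
      have s': "(sqrt (b1 / \<tau>1))\<^sup>2 \<le> m" "(sqrt (b2 / \<tau>2))\<^sup>2 \<le> m" unfolding s by (simp_all add: m_def)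
      note rs = rescale_bounds[OF U0(1) s', folded \<phi>0_def]
      have \<phi>0: "admissible \<alpha> \<phi>0" "mass1 \<phi>0 = b1" "mass2 \<phi>0 = b2"
        using rs(1) rs(2,3) \<tau> unfolding s U0(2,3) by simp_all
      have "0 < mass1 \<phi>0 + mass2 \<phi>0" using bpos \<phi>0 by simp
      from negative_energy[OF \<phi>0(1) this] obtain \<phi> :: "'a \<Rightarrow> complex \<times> complex" where \<phi>: "admissible \<alpha> \<phi>" "mass1 \<phi> = b1" "mass2 \<phi> = b2" "total_energy \<phi> < 0"
        unfolding \<phi>0(2,3) by blast
      have "E \<le> total_energy (oplus W \<phi>)"
        by (rule lb) (simp_all add: oplus_admissible[OF Wa \<phi>(1)] \<phi> b1_def b2_def)
      also have "\<dots> \<le> total_energy W + total_energy \<phi>" by (rule energy_oplus(1)[OF Wa \<phi>(1)])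
      also have "\<dots> < E" using EW \<phi>(4) by simp
      finally show False by simp
    next
      case False
      have B4: "0 \<le> 4 * B" using B by simp
      from extraction[where U=V, OF B4 VB False] obtain r' :: "nat \<Rightarrow> nat" and y' W' where r': "strict_mono r'" and WB': "bounded_by \<alpha> (4 * B) W'" and W0': "sqn lborel W' \<noteq> 0"
        and VB0': "\<forall>n. bounded_by \<alpha> (4 * (4 * B)) (\<lambda>x. V (r' n) (x + y' n) - W' x)"
        and l1': "(\<lambda>n. mass1 (V (r' n)) - mass1 (\<lambda>x. V (r' n) (x + y' n) - W' x)) \<longlonglongrightarrow> mass1 W'"
        and l2': "(\<lambda>n. mass2 (V (r' n)) - mass2 (\<lambda>x. V (r' n) (x + y' n) - W' x)) \<longlonglongrightarrow> mass2 W'"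
        and l3': "(\<lambda>n. total_energy (V (r' n)) - total_energy (\<lambda>x. V (r' n) (x + y' n) - W' x)) \<longlonglongrightarrow> total_energy W'"
        by blast
      define V' where "V' n = (\<lambda>x. V (r' n) (x + y' n) - W' x)" for n
      have VB': "bounded_by \<alpha> (16 * B) (V' n)" for n using VB0' by (simp add: V'_def)
      have Va': "admissible \<alpha> (V' n)" for n by (rule bounded_by_admissible[OF VB'])
      have Wa': "admissible \<alpha> W'" by (rule bounded_by_admissible[OF WB'])
      have rest': "(\<lambda>n. g (V' n)) \<longlonglongrightarrow> c - d" if "(\<lambda>n. g (V n)) \<longlonglongrightarrow> c" "(\<lambda>n. g (V (r' n)) - g (V' n)) \<longlonglongrightarrow> d" for g :: "('a \<Rightarrow> complex \<times> complex) \<Rightarrow> real" and c d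
        using tendsto_diff[OF LIMSEQ_subseq_LIMSEQ[OF that(1) r'] that(2)] by (simp add: o_def)
      have V1': "(\<lambda>n. mass1 (V' n)) \<longlonglongrightarrow> b1 - mass1 W'" by (rule rest'[OF V1 l1'[folded V'_def]])
      have V2': "(\<lambda>n. mass2 (V' n)) \<longlonglongrightarrow> b2 - mass2 W'" by (rule rest'[OF V2 l2'[folded V'_def]])
      have V3': "(\<lambda>n. total_energy (V' n)) \<longlonglongrightarrow> E - total_energy W - total_energy W'" by (rule rest'[OF V3 l3'[folded V'_def]])
      have Wm: "W \<in> borel_measurable borel" "W' \<in> borel_measurable borel" using Wa Wa' by (simp_all add: admissible_def)
      obtain z where z: "\<not> (AE x in lborel. W x = 0 \<or> W' (x + z) = 0)"
        using overlapping_translate[OF Wm W0 W0'] by blast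
      define Wz where "Wz = (\<lambda>x. W' (x + z))"
      have Wz: "admissible \<alpha> Wz" "mass1 Wz = mass1 W'" "mass2 Wz = mass2 W'" "total_energy Wz = total_energy W'"
        unfolding Wz_def using admissible_shift(1-3)[OF Wa', of z] total_energy_shift[OF Wa', of z] by simp_all
      define G where "G = oplus W Wz"
      note oG = oplus_admissible[OF Wa Wz(1), folded G_def]
      have EG: "total_energy G < total_energy W + total_energy W'"
        unfolding G_def Wz(4)[symmetric] by (rule energy_oplus(2)[OF Wa Wz(1)]) (use z in \<open>simp add: Wz_def\<close>)
      define w where "w n = oplus G (V' n)" for n
      note ow = oplus_admissible[OF oG(1) Va', folded w_def]
      define B'' where "B'' = mass1 G + mass2 G + kinetic \<alpha> G + 16 * B"
      have B'': "0 \<le> B''" using B by (simp add: B''_def)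
      have wB: "bounded_by \<alpha> B'' (w n)" for n
      proof (rule admissible_bounded_by[OF ow(1)])
        have b16: "0 \<le> 16 * B" using B by simp
        note le = bounded_by_le[OF VB'[of n] b16]
        have nn: "0 \<le> mass1 G" "0 \<le> mass2 G" "0 \<le> kinetic \<alpha> G" by simp_all
        show "mass1 (w n) + mass2 (w n) \<le> B''" using ow(2,3)[of n] le(1) nn unfolding B''_def by linarith
        show "kinetic \<alpha> (w n) \<le> B''" using ow(4)[of n] le(2) nn unfolding B''_def by linarith
      qed
      \<comment> \<open>The competitors \<open>w n\<close> have asymptotically the prescribed masses, but their energy falls short of \<open>E\<close> by the strict gain \<open>EG\<close>.\<close>
      have "E \<le> total_energy G + (E - total_energy W - total_energy W')"
      proof (rule asymptotic_lower_bound[where w=w and X="\<lambda>n. total_energy G + total_energy (V' n)", OF \<tau> lb B'' wB])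
        have "(\<lambda>n. mass1 G + mass1 (V' n)) \<longlonglongrightarrow> mass1 G + (b1 - mass1 W')" by (intro tendsto_add tendsto_const V1')
        then show "(\<lambda>n. mass1 (w n)) \<longlonglongrightarrow> \<tau>1" unfolding ow(2) oG(2) Wz(2) b1_def by simp
        have "(\<lambda>n. mass2 G + mass2 (V' n)) \<longlonglongrightarrow> mass2 G + (b2 - mass2 W')" by (intro tendsto_add tendsto_const V2')
        then show "(\<lambda>n. mass2 (w n)) \<longlonglongrightarrow> \<tau>2" unfolding ow(3) oG(3) Wz(3) b2_def by simp
        show "total_energy (w n) \<le> total_energy G + total_energy (V' n)" for n
          unfolding w_def by (rule energy_oplus(1)[OF oG(1) Va'])
        show "(\<lambda>n. total_energy G + total_energy (V' n)) \<longlonglongrightarrow> total_energy G + (E - total_energy W - total_energy W')"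
          by (intro tendsto_add tendsto_const V3')
      qed
      with EG show False by simp
    qed
  qed
  have Wmass: "mass1 W = \<tau>1" "mass2 W = \<tau>2" using b0 by (simp_all add: b1_def b2_def)
  have EW: "E \<le> total_energy W" by (rule lb[OF Wa Wmass])
  have m0: "(\<lambda>n. mass1 (V n) + mass2 (V n)) \<longlonglongrightarrow> 0" using tendsto_add[OF V1 V2] b0 by simp
  then have "(\<lambda>n. ennreal (mass1 (V n) + mass2 (V n))) \<longlonglongrightarrow> ennreal 0" by (rule tendsto_ennrealI)
  then have s0: "(\<lambda>n. sqn lborel (V n)) \<longlonglongrightarrow> 0" unfolding admissible_masses(3)[OF Va] by simp
  have P0: "(\<lambda>n. potential (V n)) \<longlonglongrightarrow> 0"
  proof (rule LIMSEQ_I)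
    fix e :: real assume e: "0 < e"
    have B4: "0 \<le> 4 * B" using B by simp
    obtain \<delta> where \<delta>: "0 < \<delta>" "\<And>U::'a \<Rightarrow> complex \<times> complex. bounded_by \<alpha> (4 * B) U \<Longrightarrow>
      (\<And>x. ball_mass U x 1 \<le> ennreal \<delta>) \<Longrightarrow> potential U \<le> e / 2"
      using potential_vanishing[OF B4, of "e / 2"] e by auto
    obtain N where N: "\<And>n. n \<ge> N \<Longrightarrow> sqn lborel (V n) \<le> ennreal \<delta>"
      using ennreal_tendsto_0D[OF s0 \<delta>(1)] by (auto simp: eventually_sequentially)
    have "norm (potential (V n) - 0) < e" if "n \<ge> N" for n
    proof -
      have "potential (V n) \<le> e / 2" by (rule \<delta>(2)[OF VB]) (rule order_trans[OF ball_mass_le N[OF that]])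
      then show ?thesis using potential_nonneg[of "V n"] e by simp
    qed
    then show "\<exists>no. \<forall>n\<ge>no. norm (potential (V n) - 0) < e" by blast
  qed
  have keq: "kinetic \<alpha> (V n) = 2 * (total_energy (V n) + potential (V n))" for n by (simp add: total_energy_def)
  have "(\<lambda>n. 2 * (total_energy (V n) + potential (V n))) \<longlonglongrightarrow> 2 * ((E - total_energy W) + 0)"
    by (intro tendsto_mult tendsto_add tendsto_const V3 P0)
  \<comment> \<open>The remainder has no mass left, hence no potential energy, so its kinetic energy is twice the energy defect \<open>E - total_energy W\<close>. It is nonnegative, while minimality makes the defect nonpositive.\<close>
  then have k: "(\<lambda>n. kinetic \<alpha> (V n)) \<longlonglongrightarrow> 2 * (E - total_energy W)" unfolding keq by simp
  have "0 \<le> 2 * (E - total_energy W)" by (rule LIMSEQ_le_const[OF k]) simp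
  with EW have EWeq: "total_energy W = E" by simp
  have "(\<lambda>n. (mass1 (V n) + mass2 (V n)) + kinetic \<alpha> (V n)) \<longlonglongrightarrow> 0 + 0"
    using k EWeq by (intro tendsto_add m0) simp
  then show ?thesis
    using r Wa Wmass EWeq Va unfolding V_def by (intro exI[of _ r] exI[of _ y] exI[of _ W]) simp
qed

end

section \<open>Stability\<close>

definition pair_fun :: "'a fpair \<Rightarrow> 'a::euclidean_space \<Rightarrow> complex \<times> complex" where
  "pair_fun u x = (fst u x, snd u x)"

lemma pair_fun_eq: "pair_fun u = (\<lambda>x. (fst u x, snd u x))"
  by (simp add: pair_fun_def fun_eq_iff)

lemma HH_space_iff:
  fixes u :: "'a::euclidean_space fpair"
  assumes \<alpha>: "0 < \<alpha>" "\<alpha> < 1"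
  shows "u \<in> HH_space \<alpha> \<longleftrightarrow> admissible \<alpha> (pair_fun u)"
proof
  assume "u \<in> HH_space \<alpha>"
  then have H: "fst u \<in> H_space \<alpha>" "snd u \<in> H_space \<alpha>" by (auto simp: HH_space_def)
  then have [measurable]: "fst u \<in> borel_measurable borel" "snd u \<in> borel_measurable borel"
    and f: "sqn lborel (fst u) < \<infinity>" "sqn lborel (snd u) < \<infinity>" "gagliardo \<alpha> (fst u) < \<infinity>" "gagliardo \<alpha> (snd u) < \<infinity>"
    using \<alpha> by (simp_all add: H_space_iff)
  have "pair_fun u \<in> borel_measurable borel" unfolding pair_fun_eq by measurable
  then show "admissible \<alpha> (pair_fun u)"
    using f unfolding admissible_def pair_fun_eq by (simp add: sqn_pair gagliardo_pair)
next
  assume A: "admissible \<alpha> (pair_fun u)"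
  then have m: "pair_fun u \<in> borel_measurable borel" by (simp add: admissible_def)
  have [measurable]: "fst u \<in> borel_measurable borel" "snd u \<in> borel_measurable borel"
    using fst_measurable[OF m] snd_measurable[OF m] by (simp_all add: pair_fun_def)
  have "sqn lborel (fst u) + sqn lborel (snd u) < \<infinity>" "gagliardo \<alpha> (fst u) + gagliardo \<alpha> (snd u) < \<infinity>"
    using A unfolding admissible_def pair_fun_eq by (simp_all add: sqn_pair gagliardo_pair)
  then have "fst u \<in> H_space \<alpha>" "snd u \<in> H_space \<alpha>" using \<alpha> by (simp_all add: H_space_iff)
  then show "u \<in> HH_space \<alpha>" by (simp add: HH_space_def mem_Times_iff)
qed

lemma HH_components:
  fixes u :: "'a::euclidean_space fpair"
  assumes u: "u \<in> HH_space \<alpha>" and \<alpha>: "0 < \<alpha>" "\<alpha> < 1"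
  shows "sqn lborel (fst u) + sqn lborel (snd u) = ennreal (mass1 (pair_fun u) + mass2 (pair_fun u))"
    and "gagliardo \<alpha> (fst u) + gagliardo \<alpha> (snd u) = ennreal (kinetic \<alpha> (pair_fun u))"
proof -
  have A: "admissible \<alpha> (pair_fun u)" using u \<alpha> by (simp add: HH_space_iff)
  have [measurable]: "fst u \<in> borel_measurable borel" "snd u \<in> borel_measurable borel"
    using u \<alpha> by (auto simp: HH_space_def H_space_iff)
  show "sqn lborel (fst u) + sqn lborel (snd u) = ennreal (mass1 (pair_fun u) + mass2 (pair_fun u))"
    unfolding admissible_masses(3)[OF A, symmetric] unfolding pair_fun_eq by (simp add: sqn_pair)
  show "gagliardo \<alpha> (fst u) + gagliardo \<alpha> (snd u) = ennreal (kinetic \<alpha> (pair_fun u))"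
    unfolding admissible_masses(4)[OF A, symmetric] unfolding pair_fun_eq by (simp add: gagliardo_pair)
qed

lemma HH_norm_bounds:
  fixes u :: "'a::euclidean_space fpair"
  assumes u: "u \<in> HH_space \<alpha>" and \<alpha>: "0 < \<alpha>" "\<alpha> < 1"
  shows "(HH_norm \<alpha> u)\<^sup>2 \<le> mass1 (pair_fun u) + mass2 (pair_fun u) + kinetic \<alpha> (pair_fun u)"
    and "mass1 (pair_fun u) + mass2 (pair_fun u) \<le> (HH_norm \<alpha> u)\<^sup>2"
    and "kinetic \<alpha> (pair_fun u) \<le> (HH_norm \<alpha> u)\<^sup>2"
proof -
  have H: "fst u \<in> H_space \<alpha>" "snd u \<in> H_space \<alpha>" using u by (auto simp: HH_space_def)
  note b1 = H_norm_bounds[OF H(1) \<alpha>] and b2 = H_norm_bounds[OF H(2) \<alpha>]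
  have n: "(HH_norm \<alpha> u)\<^sup>2 = (H_norm \<alpha> (fst u))\<^sup>2 + (H_norm \<alpha> (snd u))\<^sup>2" by (simp add: HH_norm_def)
  then have en: "ennreal ((HH_norm \<alpha> u)\<^sup>2) = ennreal ((H_norm \<alpha> (fst u))\<^sup>2) + ennreal ((H_norm \<alpha> (snd u))\<^sup>2)" by simp
  let ?m = "mass1 (pair_fun u) + mass2 (pair_fun u)" and ?k = "kinetic \<alpha> (pair_fun u)"
  have m0: "0 \<le> ?m" "0 \<le> ?k" by simp_all
  have "ennreal ((HH_norm \<alpha> u)\<^sup>2) \<le> (sqn lborel (fst u) + gagliardo \<alpha> (fst u)) + (sqn lborel (snd u) + gagliardo \<alpha> (snd u))"
    unfolding en by (intro add_mono b1(1) b2(1))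
  also have "\<dots> = (sqn lborel (fst u) + sqn lborel (snd u)) + (gagliardo \<alpha> (fst u) + gagliardo \<alpha> (snd u))"
    by (simp add: add_ac)
  also have "\<dots> = ennreal (?m + ?k)" unfolding HH_components[OF u \<alpha>] using m0 by (intro ennreal_plus[symmetric])
  finally show "(HH_norm \<alpha> u)\<^sup>2 \<le> ?m + ?k" using m0 by (subst (asm) ennreal_le_iff) simp_all
  have "ennreal ?m \<le> ennreal ((HH_norm \<alpha> u)\<^sup>2)"
    unfolding en HH_components(1)[OF u \<alpha>, symmetric] by (intro add_mono b1(2) b2(2))
  then show "?m \<le> (HH_norm \<alpha> u)\<^sup>2" by (subst (asm) ennreal_le_iff) simp_all
  have "ennreal ?k \<le> ennreal ((HH_norm \<alpha> u)\<^sup>2)"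
    unfolding en HH_components(2)[OF u \<alpha>, symmetric] by (intro add_mono b1(3) b2(3))
  then show "?k \<le> (HH_norm \<alpha> u)\<^sup>2" by (subst (asm) ennreal_le_iff) simp_all
qed

lemma L2_norm_mass: "L2_norm (fst u) = sqrt (mass1 (pair_fun u))" "L2_norm (snd u) = sqrt (mass2 (pair_fun u))"
  by (simp_all add: L2_norm_def mass1_def mass2_def pair_fun_def)

lemma admissible_diff:
  assumes U: "admissible \<alpha> U" and W: "admissible \<alpha> W"
  shows "admissible \<alpha> (\<lambda>x. U x - W x)"
proof -
  define B where "B = max (max (mass1 U + mass2 U) (kinetic \<alpha> U)) (max (mass1 W + mass2 W) (kinetic \<alpha> W))"
  have "bounded_by \<alpha> B U" "bounded_by \<alpha> B W"
    by (rule admissible_bounded_by[OF U], simp_all add: B_def, rule admissible_bounded_by[OF W]) simp_all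
  moreover have "0 \<le> B" using mass_nonneg(3)[of \<alpha> U] by (simp add: B_def le_max_iff_disj)
  ultimately show ?thesis by (intro bounded_by_admissible[OF bounded_by_diff])
qed

context nls_energy begin

lemma energy_eq:
  fixes u :: "'a fpair"
  assumes u: "u \<in> HH_space \<alpha>"
  shows "energy \<alpha> \<mu>1 \<mu>2 p1 p2 \<beta> r1 r2 u = total_energy (pair_fun u)"
proof -
  have H: "fst u \<in> H_space \<alpha>" "snd u \<in> H_space \<alpha>" using u by (auto simp: HH_space_def)
  note f1 = frac_laplacian_sqn[OF H(1) \<alpha>] and f2 = frac_laplacian_sqn[OF H(2) \<alpha>]
  let ?w1 = "frac_laplacian (\<alpha> / 2) (fst u)" and ?w2 = "frac_laplacian (\<alpha> / 2) (snd u)"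
  have i: "integrable lborel (\<lambda>x. (norm (?w1 x))\<^sup>2)" "integrable lborel (\<lambda>x. (norm (?w2 x))\<^sup>2)"
    using f1(1) f2(1) by (simp_all add: L2_def)
  have "ennreal (kinetic \<alpha> (pair_fun u)) = sqn lborel ?w1 + sqn lborel ?w2"
    unfolding f1(2) f2(2) by (rule HH_components(2)[OF u \<alpha>, symmetric])
  also have "\<dots> = ennreal (LINT x|lborel. (norm (?w1 x))\<^sup>2) + ennreal (LINT x|lborel. (norm (?w2 x))\<^sup>2)"
    unfolding sqn_def using i by (simp add: nn_integral_eq_integral)
  also have "\<dots> = ennreal (LINT x|lborel. (norm (?w1 x))\<^sup>2 + (norm (?w2 x))\<^sup>2)"
    using i by (simp add: integral_nonneg_AE ennreal_plus)
  finally have "kinetic \<alpha> (pair_fun u) = (LINT x|lborel. (norm (?w1 x))\<^sup>2 + (norm (?w2 x))\<^sup>2)"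
    by (subst (asm) ennreal_inj) (auto intro!: integral_nonneg_AE)
  then show ?thesis
    unfolding energy_def total_energy_def potential_def term1_def term2_def term3_def by (simp add: pair_fun_def)
qed

lemma mass_set_iff:
  fixes u :: "'a fpair"
  assumes "0 < fst \<tau>" "0 < snd \<tau>"
  shows "u \<in> mass_set \<alpha> \<tau> \<longleftrightarrow> admissible \<alpha> (pair_fun u) \<and> mass1 (pair_fun u) = fst \<tau> \<and> mass2 (pair_fun u) = snd \<tau>"
  unfolding mass_set_def mass_sphere_def mem_Times_iff HH_space_iff[OF \<alpha>, symmetric]
  by (auto simp: HH_space_def mem_Times_iff L2_norm_mass)

end

lemma tendsto_diff_of_sqrt:
  fixes x y d :: "nat \<Rightarrow> real"
  assumes nn: "\<And>n. 0 \<le> x n" "\<And>n. 0 \<le> y n" and B: "\<And>n. x n \<le> B"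
    and d: "\<And>n. \<bar>sqrt (y n) - sqrt (x n)\<bar> \<le> d n" "d \<longlonglongrightarrow> 0"
  shows "(\<lambda>n. y n - x n) \<longlonglongrightarrow> 0"
proof (rule Lim_null_comparison)
  show "\<forall>\<^sub>F n in sequentially. norm (y n - x n) \<le> d n * (d n + 2 * sqrt B)"
  proof (intro always_eventually allI)
    fix n
    have "y n - x n = (sqrt (y n) - sqrt (x n)) * (sqrt (y n) + sqrt (x n))"
      using nn[of n] by (simp add: algebra_simps)
    then have "norm (y n - x n) = \<bar>sqrt (y n) - sqrt (x n)\<bar> * (sqrt (y n) + sqrt (x n))"
      using nn[of n] by (simp add: abs_mult)
    also have "\<dots> \<le> d n * (d n + 2 * sqrt B)"
    proof (rule mult_mono[OF d(1)])
      have "sqrt (x n) \<le> sqrt B" using B[of n] by simp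
      then show "sqrt (y n) + sqrt (x n) \<le> d n + 2 * sqrt B" using d(1)[of n] by linarith
      show "0 \<le> d n" using d(1)[of n] by linarith
      show "0 \<le> sqrt (y n) + sqrt (x n)" using nn[of n] by simp
    qed
    finally show "norm (y n - x n) \<le> d n * (d n + 2 * sqrt B)" .
  qed
  have "(\<lambda>n. d n * (d n + 2 * sqrt B)) \<longlonglongrightarrow> 0 * (0 + 2 * sqrt B)"
    by (intro tendsto_mult tendsto_add tendsto_const d(2))
  then show "(\<lambda>n. d n * (d n + 2 * sqrt B)) \<longlonglongrightarrow> 0" by simp
qed

lemma sqrt_masses_diff:
  fixes U W :: "'a::euclidean_space \<Rightarrow> complex \<times> complex"
  assumes U: "admissible \<alpha> U" and W: "admissible \<alpha> W"
  defines "Z \<equiv> \<lambda>x. U x - W x"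
  shows "\<bar>sqrt (mass1 U) - sqrt (mass1 W)\<bar> \<le> sqrt (mass1 Z)"
    and "\<bar>sqrt (mass2 U) - sqrt (mass2 W)\<bar> \<le> sqrt (mass2 Z)"
    and "\<bar>sqrt (kinetic \<alpha> U) - sqrt (kinetic \<alpha> W)\<bar> \<le> sqrt (kinetic \<alpha> Z)"
proof -
  have Z: "admissible \<alpha> Z" unfolding Z_def by (rule admissible_diff[OF U W])
  have [measurable]: "U \<in> borel_measurable borel" "W \<in> borel_measurable borel" using U W by (simp_all add: admissible_def)
  note mU = admissible_masses(1,2,4)[OF U] and mW = admissible_masses(1,2,4)[OF W] and mZ = admissible_masses(1,2,4)[OF Z]
  have iZ: "(\<lambda>z. increment U z - increment W z) = increment Z"
    by (simp add: Z_def increment_def fun_eq_iff)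
  show "\<bar>sqrt (mass1 U) - sqrt (mass1 W)\<bar> \<le> sqrt (mass1 Z)"
    using sqn_diff_norms[of "\<lambda>x. fst (U x)" lborel "\<lambda>x. fst (W x)"] mU(1) mW(1) mZ(1) by (simp add: Z_def)
  show "\<bar>sqrt (mass2 U) - sqrt (mass2 W)\<bar> \<le> sqrt (mass2 Z)"
    using sqn_diff_norms[of "\<lambda>x. snd (U x)" lborel "\<lambda>x. snd (W x)"] mU(2) mW(2) mZ(2) by (simp add: Z_def)
  show "\<bar>sqrt (kinetic \<alpha> U) - sqrt (kinetic \<alpha> W)\<bar> \<le> sqrt (kinetic \<alpha> Z)"
    using sqn_diff_norms[of "increment U" "pair_measure (gag_kernel \<alpha>)" "increment W"]
      mU(3) mW(3) mZ(3) unfolding iZ gagliardo_def by simp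
qed

context nls_energy begin

text \<open>Square roots of the masses and of the kinetic energy are seminorms, hence Lipschitz; the potential energy is controlled by
  the mass of the difference as long as everything stays bounded.\<close>

lemma energy_uniformly_continuous:
  fixes A Q :: "nat \<Rightarrow> 'a \<Rightarrow> complex \<times> complex"
  assumes B: "0 \<le> B" "\<And>n. bounded_by \<alpha> B (A n)" and Q: "\<And>n. admissible \<alpha> (Q n)"
    and Z0: "(\<lambda>n. H_sqn \<alpha> (\<lambda>x. Q n x - A n x)) \<longlonglongrightarrow> 0"
  shows "(\<lambda>n. mass1 (Q n) - mass1 (A n)) \<longlonglongrightarrow> 0"
    and "(\<lambda>n. mass2 (Q n) - mass2 (A n)) \<longlonglongrightarrow> 0"
    and "(\<lambda>n. total_energy (Q n) - total_energy (A n)) \<longlonglongrightarrow> 0"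
proof -
  define Z where "Z n = (\<lambda>x. Q n x - A n x)" for n
  define s where "s n = mass1 (Z n) + mass2 (Z n) + kinetic \<alpha> (Z n)" for n
  have s: "s \<longlonglongrightarrow> 0" using Z0 unfolding s_def Z_def .
  have s': "(\<lambda>n. sqrt (s n)) \<longlonglongrightarrow> 0" using tendsto_real_sqrt[OF s] by simp
  have A: "admissible \<alpha> (A n)" for n by (rule bounded_by_admissible[OF B(2)])
  have Z: "admissible \<alpha> (Z n)" for n unfolding Z_def by (rule admissible_diff[OF Q A])
  have nn: "0 \<le> mass1 (Z n)" "0 \<le> mass2 (Z n)" "0 \<le> kinetic \<alpha> (Z n)" "0 \<le> mass1 (A n)" "0 \<le> mass2 (A n)" for n by simp_all
  have le: "sqrt (mass1 (Z n)) \<le> sqrt (s n)" "sqrt (mass2 (Z n)) \<le> sqrt (s n)" "sqrt (kinetic \<alpha> (Z n)) \<le> sqrt (s n)" for n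
    using nn[of n] by (simp_all add: s_def)
  have D: "\<bar>sqrt (mass1 (Q n)) - sqrt (mass1 (A n))\<bar> \<le> sqrt (mass1 (Z n))"
    "\<bar>sqrt (mass2 (Q n)) - sqrt (mass2 (A n))\<bar> \<le> sqrt (mass2 (Z n))"
    "\<bar>sqrt (kinetic \<alpha> (Q n)) - sqrt (kinetic \<alpha> (A n))\<bar> \<le> sqrt (kinetic \<alpha> (Z n))" for n
    unfolding Z_def by (rule sqrt_masses_diff[OF Q A])+
  note AB = bounded_by_le[OF B(2,1)]
  show "(\<lambda>n. mass1 (Q n) - mass1 (A n)) \<longlonglongrightarrow> 0"
  proof (rule tendsto_diff_of_sqrt[OF _ _ _ _ s'])
    show "mass1 (A n) \<le> B" for n using AB(1)[of n] nn(5)[of n] by linarith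
    show "\<bar>sqrt (mass1 (Q n)) - sqrt (mass1 (A n))\<bar> \<le> sqrt (s n)" for n by (rule order_trans[OF D(1) le(1)])
  qed simp_all
  show "(\<lambda>n. mass2 (Q n) - mass2 (A n)) \<longlonglongrightarrow> 0"
  proof (rule tendsto_diff_of_sqrt[OF _ _ _ _ s'])
    show "mass2 (A n) \<le> B" for n using AB(1)[of n] nn(4)[of n] by linarith
    show "\<bar>sqrt (mass2 (Q n)) - sqrt (mass2 (A n))\<bar> \<le> sqrt (s n)" for n by (rule order_trans[OF D(2) le(2)])
  qed simp_all
  have k: "(\<lambda>n. kinetic \<alpha> (Q n) - kinetic \<alpha> (A n)) \<longlonglongrightarrow> 0"
  proof (rule tendsto_diff_of_sqrt[OF _ _ _ _ s'])
    show "kinetic \<alpha> (A n) \<le> B" for n by (rule AB(2))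
    show "\<bar>sqrt (kinetic \<alpha> (Q n)) - sqrt (kinetic \<alpha> (A n))\<bar> \<le> sqrt (s n)" for n by (rule order_trans[OF D(3) le(3)])
  qed simp_all
  have "Bseq s" using s by (intro convergent_imp_Bseq convergentI)
  then obtain K where K: "\<And>n. norm (s n) \<le> K" unfolding Bseq_def by blast
  define B' where "B' = max B K"
  have B': "0 \<le> B'" using B by (simp add: B'_def)
  have bA: "bounded_by \<alpha> B' (A n)" for n by (rule bounded_by_mono[OF B(2)]) (simp add: B'_def)
  have bZ: "bounded_by \<alpha> B' (Z n)" for n
  proof (rule admissible_bounded_by[OF Z])
    have "s n \<le> B'" using K[of n] by (simp add: B'_def)
    then show "mass1 (Z n) + mass2 (Z n) \<le> B'" "kinetic \<alpha> (Z n) \<le> B'" using nn[of n] unfolding s_def by linarith+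
  qed
  have AZ: "(\<lambda>x. A n x + Z n x) = Q n" for n by (simp add: Z_def)
  have sq: "(\<lambda>n. sqn lborel (Z n)) \<longlonglongrightarrow> 0"
  proof (rule tendsto_sandwich[OF _ _ tendsto_const])
    show "\<forall>\<^sub>F n in sequentially. sqn lborel (Z n) \<le> ennreal (s n)"
      unfolding admissible_masses(3)[OF Z] s_def using nn by (intro always_eventually allI ennreal_leI) simp
    show "(\<lambda>n. ennreal (s n)) \<longlonglongrightarrow> 0" using tendsto_ennrealI[OF s] by simp
  qed simp
  have "(\<lambda>n. potential (\<lambda>x. A n x + Z n x) - potential (A n)) \<longlonglongrightarrow> 0"
    by (rule potential_continuous[where U=A and Z=Z, OF B' bA bZ _ sq]) (simp add: AZ Q)
  then have p: "(\<lambda>n. potential (Q n) - potential (A n)) \<longlonglongrightarrow> 0" unfolding AZ .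
  have "(\<lambda>n. 1 / 2 * (kinetic \<alpha> (Q n) - kinetic \<alpha> (A n)) - (potential (Q n) - potential (A n))) \<longlonglongrightarrow> 1 / 2 * 0 - 0"
    by (intro tendsto_diff tendsto_mult tendsto_const k p)
  then show "(\<lambda>n. total_energy (Q n) - total_energy (A n)) \<longlonglongrightarrow> 0"
    by (simp add: total_energy_def algebra_simps)
qed

lemma pair_fun_diff: "pair_fun (\<lambda>x. fst u x - fst v x, \<lambda>x. snd u x - snd v x) = (\<lambda>x. pair_fun u x - pair_fun v x)"
  by (simp add: pair_fun_def fun_eq_iff)

lemma HH_dist_bounds:
  fixes u v :: "'a fpair"
  assumes "admissible \<alpha> (pair_fun u)" "admissible \<alpha> (pair_fun v)"
  defines "Z \<equiv> \<lambda>x. pair_fun u x - pair_fun v x"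
  shows "(HH_dist \<alpha> u v)\<^sup>2 \<le> H_sqn \<alpha> Z"
    and "H_sqn \<alpha> Z \<le> 2 * (HH_dist \<alpha> u v)\<^sup>2"
proof -
  have "(\<lambda>x. fst u x - fst v x, \<lambda>x. snd u x - snd v x) \<in> HH_space \<alpha>"
    unfolding HH_space_iff[OF \<alpha>] pair_fun_diff by (rule admissible_diff[OF assms(1,2)])
  note b = HH_norm_bounds[OF this \<alpha>, unfolded pair_fun_diff, folded HH_dist_def Z_def]
  show "(HH_dist \<alpha> u v)\<^sup>2 \<le> H_sqn \<alpha> Z" by (rule b(1))
  show "H_sqn \<alpha> Z \<le> 2 * (HH_dist \<alpha> u v)\<^sup>2" using b(2,3) by linarith
qed

abbreviation ground_states :: "real \<times> real \<Rightarrow> 'a fpair set" where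
  "ground_states \<tau> \<equiv> minimizers \<alpha> \<mu>1 \<mu>2 p1 p2 \<beta> r1 r2 \<tau>"

abbreviation pair_energy :: "'a fpair \<Rightarrow> real" where
  "pair_energy \<equiv> energy \<alpha> \<mu>1 \<mu>2 p1 p2 \<beta> r1 r2"

text \<open>The masses and energies of \<open>\<Psi>0 n\<close> converge to those of the ground states, and \<open>\<Phi> n\<close> inherits them. So \<open>\<Phi>\<close> is a
  minimizing sequence with asymptotically correct masses; undoing the translations
  of the compactness theorem gives ground states \<open>w n\<close> close to it.\<close>

theorem nearly_minimizing_approach_ground_states:
  fixes v \<Psi>0 \<Phi> :: "nat \<Rightarrow> 'a fpair"
  assumes \<tau>: "0 < fst \<tau>" "0 < snd \<tau>"
    and v: "\<And>n. v n \<in> ground_states \<tau>"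
    and \<Psi>0: "\<And>n. \<Psi>0 n \<in> HH_space \<alpha>" and close: "(\<lambda>n. HH_dist \<alpha> (\<Psi>0 n) (v n)) \<longlonglongrightarrow> 0"
    and \<Phi>: "\<And>n. \<Phi> n \<in> HH_space \<alpha>"
    and en: "\<And>n. pair_energy (\<Phi> n) = pair_energy (\<Psi>0 n)"
    and ms: "\<And>n. L2_norm (fst (\<Phi> n)) = L2_norm (fst (\<Psi>0 n))" "\<And>n. L2_norm (snd (\<Phi> n)) = L2_norm (snd (\<Psi>0 n))"
  shows "\<exists>r w. strict_mono r \<and> (\<forall>n. w n \<in> ground_states \<tau>) \<and> (\<lambda>n. HH_dist \<alpha> (\<Phi> (r n)) (w n)) \<longlonglongrightarrow> 0"
proof -
  define E where "E = pair_energy (v 0)"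
  have gs: "u \<in> ground_states \<tau> \<longleftrightarrow> u \<in> mass_set \<alpha> \<tau> \<and> pair_energy u = E" for u :: "'a fpair"
    using v[of 0] unfolding minimizers_def E_def by (auto simp flip: ereal.inject)
  have lb: "E \<le> total_energy U" if U: "admissible \<alpha> U" "mass1 U = fst \<tau>" "mass2 U = snd \<tau>" for U :: "'a \<Rightarrow> complex \<times> complex"
  proof -
    define u :: "'a fpair" where "u = (\<lambda>x. fst (U x), \<lambda>x. snd (U x))"
    have pu: "pair_fun u = U" by (simp add: u_def pair_fun_def fun_eq_iff)
    have um: "u \<in> mass_set \<alpha> \<tau>" unfolding mass_set_iff[OF \<tau>] pu using U by simp
    have "ereal E = min_energy TYPE('a) \<alpha> \<mu>1 \<mu>2 p1 p2 \<beta> r1 r2 \<tau>" using v[of 0] by (simp add: minimizers_def E_def)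
    also have "\<dots> \<le> ereal (pair_energy u)" unfolding min_energy_def by (rule INF_lower[OF um])
    also have "pair_energy u = total_energy U" using energy_eq[of u] HH_space_iff[OF \<alpha>, of u] U(1) by (simp add: pu)
    finally show ?thesis by simp
  qed
  define A Q X where "A n = pair_fun (v n)" and "Q n = pair_fun (\<Psi>0 n)" and "X n = pair_fun (\<Phi> n)" for n
  have Am: "admissible \<alpha> (A n)" "mass1 (A n) = fst \<tau>" "mass2 (A n) = snd \<tau>" for n
    using v[of n] gs mass_set_iff[OF \<tau>] unfolding A_def by blast+
  have AE: "total_energy (A n) = E" for n
    using v[of n] gs energy_eq[of "v n"] HH_space_iff[OF \<alpha>, of "v n"] Am(1)[of n] unfolding A_def by simp
  have Qm: "admissible \<alpha> (Q n)" and Xm: "admissible \<alpha> (X n)" for n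
    using \<Psi>0 \<Phi> HH_space_iff[OF \<alpha>] unfolding Q_def X_def by blast+
  have XQ: "mass1 (X n) = mass1 (Q n)" "mass2 (X n) = mass2 (Q n)" "total_energy (X n) = total_energy (Q n)" for n
    using ms[of n] en[of n] unfolding L2_norm_mass energy_eq[OF \<Phi>] energy_eq[OF \<Psi>0] X_def Q_def by simp_all
  obtain D where D: "0 \<le> D" "\<And>U::'a \<Rightarrow> complex \<times> complex. admissible \<alpha> U \<Longrightarrow> mass1 U + mass2 U \<le> fst \<tau> + snd \<tau> \<Longrightarrow> kinetic \<alpha> U \<le> 4 * total_energy U + D"
    using energy_coercive[of "fst \<tau> + snd \<tau>"] \<tau> by auto
  define B where "B = max (fst \<tau> + snd \<tau>) (4 * E + D)"
  have B: "0 \<le> B" using \<tau> by (simp add: B_def)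
  have BA: "bounded_by \<alpha> B (A n)" for n
    using D(2)[OF Am(1)[of n]] by (intro admissible_bounded_by Am(1)) (simp_all add: Am(2,3) AE B_def)
  have Z0: "(\<lambda>n. H_sqn \<alpha> (\<lambda>x. Q n x - A n x)) \<longlonglongrightarrow> 0"
  proof (rule tendsto_sandwich[OF _ _ tendsto_const])
    show "\<forall>\<^sub>F n in sequentially. H_sqn \<alpha> (\<lambda>x. Q n x - A n x)
        \<le> 2 * (HH_dist \<alpha> (\<Psi>0 n) (v n))\<^sup>2"
      using HH_dist_bounds(2)[OF Qm[unfolded Q_def] Am(1)[unfolded A_def]] unfolding Q_def A_def by simp
    have "(\<lambda>n. 2 * (HH_dist \<alpha> (\<Psi>0 n) (v n))\<^sup>2) \<longlonglongrightarrow> 2 * 0\<^sup>2" by (intro tendsto_mult tendsto_power tendsto_const close)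
    then show "(\<lambda>n. 2 * (HH_dist \<alpha> (\<Psi>0 n) (v n))\<^sup>2) \<longlonglongrightarrow> 0" by simp
  qed simp
  note c = energy_uniformly_continuous[where A=A and Q=Q, OF B BA Qm Z0, unfolded Am(2,3) AE]
  have X1: "(\<lambda>n. mass1 (X n)) \<longlonglongrightarrow> fst \<tau>" and X2: "(\<lambda>n. mass2 (X n)) \<longlonglongrightarrow> snd \<tau>"
    and X3: "(\<lambda>n. total_energy (X n)) \<longlonglongrightarrow> E"
    unfolding XQ using c by (simp_all only: LIM_zero_iff)
  have "Bseq (\<lambda>n. (mass1 (X n) + mass2 (X n), total_energy (X n)))"
    by (rule convergent_imp_Bseq, rule convergentI, rule tendsto_Pair[OF tendsto_add[OF X1 X2] X3])
  then obtain K where K: "0 < K" "\<And>n. norm (mass1 (X n) + mass2 (X n), total_energy (X n)) \<le> K" unfolding Bseq_def by blast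
  have K1: "mass1 (X n) + mass2 (X n) \<le> K" "total_energy (X n) \<le> K" for n
  proof -
    have "norm (mass1 (X n) + mass2 (X n)) \<le> K" "norm (total_energy (X n)) \<le> K"
      using norm_fst_le[of "mass1 (X n) + mass2 (X n)" "total_energy (X n)"]
        norm_snd_le[of "total_energy (X n)" "mass1 (X n) + mass2 (X n)"] K(2)[of n] by linarith+
    then show "mass1 (X n) + mass2 (X n) \<le> K" "total_energy (X n) \<le> K" by simp_all
  qed
  obtain D' where D': "0 \<le> D'" "\<And>U::'a \<Rightarrow> complex \<times> complex. admissible \<alpha> U \<Longrightarrow> mass1 U + mass2 U \<le> K \<Longrightarrow> kinetic \<alpha> U \<le> 4 * total_energy U + D'"
    using energy_coercive[of K] K(1) by auto
  define B' where "B' = 4 * K + D'"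
  have B': "0 \<le> B'" using K D' by (simp add: B'_def)
  have BX: "bounded_by \<alpha> B' (X n)" for n
  proof (rule admissible_bounded_by[OF Xm])
    show "mass1 (X n) + mass2 (X n) \<le> B'" "kinetic \<alpha> (X n) \<le> B'"
      using K1[of n] D'(2)[OF Xm K1(1)[of n]] D'(1) K(1) unfolding B'_def by linarith+
  qed
  obtain r y W where r: "strict_mono (r :: nat \<Rightarrow> nat)" and W: "admissible \<alpha> W" "mass1 W = fst \<tau>" "mass2 W = snd \<tau>" "total_energy W = E"
    and Va: "\<And>n. admissible \<alpha> (\<lambda>x. X (r n) (x + y n) - W x)"
    and V0: "(\<lambda>n. H_sqn \<alpha> (\<lambda>x. X (r n) (x + y n) - W x)) \<longlonglongrightarrow> 0"
    using minimizing_sequences_compact[where U=X and E=E, OF \<tau> lb Am(1-3)[of 0] B' BX X1 X2 X3] by blast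
  define W' where "W' n = (\<lambda>x. W (x + (- y n)))" for n
  define w :: "nat \<Rightarrow> 'a fpair" where "w n = (\<lambda>x. fst (W' n x), \<lambda>x. snd (W' n x))" for n
  have pw: "pair_fun (w n) = W' n" for n by (simp add: w_def pair_fun_def fun_eq_iff)
  have W'm: "admissible \<alpha> (W' n)" "mass1 (W' n) = fst \<tau>" "mass2 (W' n) = snd \<tau>" "total_energy (W' n) = E" for n
    unfolding W'_def using admissible_shift(1-3)[OF W(1), of "- y n"] total_energy_shift[OF W(1), of "- y n"] W by simp_all
  have wg: "w n \<in> ground_states \<tau>" for n
    using W'm[of n] energy_eq[of "w n"] HH_space_iff[OF \<alpha>, of "w n"] unfolding gs mass_set_iff[OF \<tau>] pw by simp
  have sh: "(\<lambda>x. pair_fun (\<Phi> (r n)) x - pair_fun (w n) x) = (\<lambda>x. (\<lambda>x. X (r n) (x + y n) - W x) (x + (- y n)))" for n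
    unfolding pw X_def W'_def by (simp add: fun_eq_iff)
  have "(\<lambda>n. (HH_dist \<alpha> (\<Phi> (r n)) (w n))\<^sup>2) \<longlonglongrightarrow> 0"
  proof (rule tendsto_sandwich[OF _ _ tendsto_const V0])
    show "\<forall>\<^sub>F n in sequentially. (HH_dist \<alpha> (\<Phi> (r n)) (w n))\<^sup>2 \<le> H_sqn \<alpha> (\<lambda>x. X (r n) (x + y n) - W x)"
    proof (intro always_eventually allI)
      fix n
      have "admissible \<alpha> (pair_fun (w n))" unfolding pw by (rule W'm(1))
      note b = HH_dist_bounds(1)[OF Xm[of "r n", unfolded X_def] this, unfolded sh]
      show "(HH_dist \<alpha> (\<Phi> (r n)) (w n))\<^sup>2 \<le> H_sqn \<alpha> (\<lambda>x. X (r n) (x + y n) - W x)"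
        using b unfolding admissible_shift(2-4)[OF Va[of n]] .
    qed
  qed simp
  then have "(\<lambda>n. sqrt ((HH_dist \<alpha> (\<Phi> (r n)) (w n))\<^sup>2)) \<longlonglongrightarrow> sqrt 0" by (rule tendsto_real_sqrt)
  moreover have "0 \<le> HH_dist \<alpha> u v" for u v :: "'a fpair" by (simp add: HH_dist_def HH_norm_def)
  ultimately have "(\<lambda>n. HH_dist \<alpha> (\<Phi> (r n)) (w n)) \<longlonglongrightarrow> 0" by simp
  then show ?thesis using r wg by blast
qed

text \<open>By the conservation laws the states at later times share energy and masses with the data, so a failure
  of stability would contradict the previous theorem along a sequence of data approaching the ground states.\<close>

theorem ground_states_stable:
  assumes \<tau>: "0 < fst \<tau>" "0 < snd \<tau>"
  shows "\<forall>\<epsilon>>0. \<exists>\<delta>>0. \<forall>\<Psi>0 \<in> (HH_space \<alpha> :: 'a fpair set).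
           HH_infdist \<alpha> \<Psi>0 (ground_states \<tau>) < ennreal \<delta> \<longrightarrow>
           (\<forall>\<Psi>. solution \<alpha> \<mu>1 \<mu>2 p1 p2 \<beta> r1 r2 \<Psi>0 \<Psi> \<longrightarrow>
             (SUP t\<in>{0..}. HH_infdist \<alpha> (\<Psi> t) (ground_states \<tau>)) < ennreal \<epsilon>)"
proof (rule ccontr)
  assume "\<not> ?thesis"
  then obtain \<epsilon> :: real where \<epsilon>: "0 < \<epsilon>"
    and bad: "\<And>\<delta>. 0 < \<delta> \<Longrightarrow> \<exists>\<Psi>0 \<Psi>. \<Psi>0 \<in> (HH_space \<alpha> :: 'a fpair set) \<and> HH_infdist \<alpha> \<Psi>0 (ground_states \<tau>) < ennreal \<delta> \<and>
      solution \<alpha> \<mu>1 \<mu>2 p1 p2 \<beta> r1 r2 \<Psi>0 \<Psi> \<and> \<not> (SUP t\<in>{0..}. HH_infdist \<alpha> (\<Psi> t) (ground_states \<tau>)) < ennreal \<epsilon>"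
    by blast
  have "\<exists>\<Psi>0 \<Phi> v. \<Psi>0 \<in> (HH_space \<alpha> :: 'a fpair set) \<and> \<Phi> \<in> HH_space \<alpha> \<and> v \<in> ground_states \<tau> \<and> HH_dist \<alpha> \<Psi>0 v < \<delta> \<and>
      pair_energy \<Phi> = pair_energy \<Psi>0 \<and> L2_norm (fst \<Phi>) = L2_norm (fst \<Psi>0) \<and> L2_norm (snd \<Phi>) = L2_norm (snd \<Psi>0) \<and>
      \<not> HH_infdist \<alpha> \<Phi> (ground_states \<tau>) \<le> ennreal (\<epsilon> / 2)" if \<delta>: "0 < \<delta>" for \<delta> :: real
  proof -
    obtain \<Psi>0 :: "'a fpair" and \<Psi> where P: "\<Psi>0 \<in> HH_space \<alpha>" "HH_infdist \<alpha> \<Psi>0 (ground_states \<tau>) < ennreal \<delta>"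
      and sol: "solution \<alpha> \<mu>1 \<mu>2 p1 p2 \<beta> r1 r2 \<Psi>0 \<Psi>"
      and sup: "\<not> (SUP t\<in>{0..}. HH_infdist \<alpha> (\<Psi> t) (ground_states \<tau>)) < ennreal \<epsilon>"
      using bad[OF \<delta>] by blast
    obtain v where v: "v \<in> ground_states \<tau>" "ennreal (HH_dist \<alpha> \<Psi>0 v) < ennreal \<delta>"
      using P(2) unfolding HH_infdist_def INF_less_iff by blast
    have dv: "HH_dist \<alpha> \<Psi>0 v < \<delta>" using v(2) \<delta> by (simp add: ennreal_less_iff HH_dist_def HH_norm_def)
    have "\<exists>t\<ge>0. \<not> HH_infdist \<alpha> (\<Psi> t) (ground_states \<tau>) \<le> ennreal (\<epsilon> / 2)"
    proof (rule ccontr)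
      assume "\<not> ?thesis"
      then have "(SUP t\<in>{0..}. HH_infdist \<alpha> (\<Psi> t) (ground_states \<tau>)) \<le> ennreal (\<epsilon> / 2)" by (intro SUP_least) auto
      also have "\<dots> < ennreal \<epsilon>" using \<epsilon> by (intro ennreal_lessI) auto
      finally show False using sup by blast
    qed
    then obtain t where t: "0 \<le> t" "\<not> HH_infdist \<alpha> (\<Psi> t) (ground_states \<tau>) \<le> ennreal (\<epsilon> / 2)" by blast
    have "\<Psi> t \<in> HH_space \<alpha>" "pair_energy (\<Psi> t) = pair_energy \<Psi>0" "L2_norm (fst (\<Psi> t)) = L2_norm (fst \<Psi>0)" "L2_norm (snd (\<Psi> t)) = L2_norm (snd \<Psi>0)"
      using sol t(1) unfolding solution_def by blast+
    with P(1) v(1) dv t(2) show ?thesis by blast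
  qed
  then have "\<forall>n. \<exists>\<Psi>0 \<Phi> v. \<Psi>0 \<in> (HH_space \<alpha> :: 'a fpair set) \<and> \<Phi> \<in> HH_space \<alpha> \<and> v \<in> ground_states \<tau> \<and> HH_dist \<alpha> \<Psi>0 v < inverse (real (Suc n)) \<and>
      pair_energy \<Phi> = pair_energy \<Psi>0 \<and> L2_norm (fst \<Phi>) = L2_norm (fst \<Psi>0) \<and> L2_norm (snd \<Phi>) = L2_norm (snd \<Psi>0) \<and>
      \<not> HH_infdist \<alpha> \<Phi> (ground_states \<tau>) \<le> ennreal (\<epsilon> / 2)" by simp
  then obtain \<Psi>0 \<Phi> v :: "nat \<Rightarrow> 'a fpair" where S: "\<And>n. \<Psi>0 n \<in> HH_space \<alpha>" "\<And>n. \<Phi> n \<in> HH_space \<alpha>" "\<And>n. v n \<in> ground_states \<tau>"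
    and dist: "\<And>n. HH_dist \<alpha> (\<Psi>0 n) (v n) < inverse (real (Suc n))"
    and cons: "\<And>n. pair_energy (\<Phi> n) = pair_energy (\<Psi>0 n)" "\<And>n. L2_norm (fst (\<Phi> n)) = L2_norm (fst (\<Psi>0 n))"
      "\<And>n. L2_norm (snd (\<Phi> n)) = L2_norm (snd (\<Psi>0 n))"
    and far: "\<And>n. \<not> HH_infdist \<alpha> (\<Phi> n) (ground_states \<tau>) \<le> ennreal (\<epsilon> / 2)"
    by metis
  have close: "(\<lambda>n. HH_dist \<alpha> (\<Psi>0 n) (v n)) \<longlonglongrightarrow> 0"
  proof (rule tendsto_sandwich[OF _ _ tendsto_const LIMSEQ_inverse_real_of_nat])
    show "\<forall>\<^sub>F n in sequentially. 0 \<le> HH_dist \<alpha> (\<Psi>0 n) (v n)" by (simp add: HH_dist_def HH_norm_def)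
    show "\<forall>\<^sub>F n in sequentially. HH_dist \<alpha> (\<Psi>0 n) (v n) \<le> inverse (real (Suc n))"
      using dist by (intro always_eventually allI less_imp_le)
  qed
  obtain r w where w: "strict_mono (r :: nat \<Rightarrow> nat)" "\<And>n. w n \<in> ground_states \<tau>" "(\<lambda>n. HH_dist \<alpha> (\<Phi> (r n)) (w n)) \<longlonglongrightarrow> 0"
    using nearly_minimizing_approach_ground_states[OF \<tau> S(3,1) close S(2) cons] by blast
  have "\<forall>\<^sub>F n in sequentially. HH_dist \<alpha> (\<Phi> (r n)) (w n) < \<epsilon> / 2" by (rule order_tendstoD(2)[OF w(3)]) (use \<epsilon> in simp)
  then obtain n where n: "HH_dist \<alpha> (\<Phi> (r n)) (w n) < \<epsilon> / 2" by (auto simp: eventually_sequentially)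
  have "HH_infdist \<alpha> (\<Phi> (r n)) (ground_states \<tau>) \<le> ennreal (HH_dist \<alpha> (\<Phi> (r n)) (w n))"
    unfolding HH_infdist_def by (rule INF_lower[OF w(2)])
  also have "\<dots> \<le> ennreal (\<epsilon> / 2)" using n by (intro ennreal_leI) simp
  finally show False using far by blast
qed

end

theorem theorem1p2:
  fixes \<alpha> \<mu>\<^sub>1 \<mu>\<^sub>2 \<beta> r\<^sub>1 r\<^sub>2 p\<^sub>1 p\<^sub>2 :: real
    and \<tau> :: "real \<times> real"
  assumes "CARD('n::finite) \<ge> 2"
    and "0 < \<alpha>" and "\<alpha> < 1"
    and "\<mu>\<^sub>1 > 0" and "\<mu>\<^sub>2 > 0" and "\<beta> > 0"
    and "r\<^sub>1 > 1" and "r\<^sub>2 > 1"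
    and "2 < p\<^sub>1" and "p\<^sub>1 < 2 + 4 * \<alpha> / real CARD('n)"
    and "2 < p\<^sub>2" and "p\<^sub>2 < 2 + 4 * \<alpha> / real CARD('n)"
    and "r\<^sub>1 + r\<^sub>2 < 2 + 4 * \<alpha> / real CARD('n)"
    and "fst \<tau> > 0" and "snd \<tau> > 0"
  shows "\<forall>\<epsilon>>0. \<exists>\<delta>>0. \<forall>\<Psi>0 \<in> (HH_space \<alpha> :: (real ^ 'n) fpair set).
           HH_infdist \<alpha> \<Psi>0 (minimizers \<alpha> \<mu>\<^sub>1 \<mu>\<^sub>2 p\<^sub>1 p\<^sub>2 \<beta> r\<^sub>1 r\<^sub>2 \<tau>) < ennreal \<delta> \<longrightarrow>
           (\<forall>\<Psi>. solution \<alpha> \<mu>\<^sub>1 \<mu>\<^sub>2 p\<^sub>1 p\<^sub>2 \<beta> r\<^sub>1 r\<^sub>2 \<Psi>0 \<Psi> \<longrightarrow>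
             (SUP t\<in>{0..}. HH_infdist \<alpha> (\<Psi> t) (minimizers \<alpha> \<mu>\<^sub>1 \<mu>\<^sub>2 p\<^sub>1 p\<^sub>2 \<beta> r\<^sub>1 r\<^sub>2 \<tau>)) < ennreal \<epsilon>)"
proof -
  interpret nls_energy \<alpha> \<mu>\<^sub>1 \<mu>\<^sub>2 p\<^sub>1 p\<^sub>2 \<beta> r\<^sub>1 r\<^sub>2 "TYPE(real ^ 'n)"
    using assms by unfold_locales simp_all
  show ?thesis by (rule ground_states_stable) (use assms in simp_all)
qed

end
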